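(* Let $X\subset\mathbb{P}^5_{\mathbb{Q}}$ be the cubic fourfold with homogeneous coordinates $(X_0:X_1:X_2:X_{01}:X_{02}:X_{12})$ defined by $$P=X_0X_{12}^2+X_1X_{02}^2+X_2X_{01}^2-X_{01}X_{02}X_{12}-4X_0X_1X_2=0.$$ For $\mathbf{x}=(x_0:x_1:x_2:x_{01}:x_{02}:x_{12})\in\mathbb{P}^5(\mathbb{Q})$ represented by coprime integers, let $H(\mathbf{x})=\max\{|x_0|,|x_1|,|x_2|,|x_{01}|,|x_{02}|,|x_{12}|\}^3$. For $\mathbf{x}\in X(\mathbb{Q})$ and distinct $i,j\in\{0,1,2\}$ let $\Delta_{ij}(\mathbf{x})=x_{ij}^2-4x_ix_j$ (well defined up to multiplication by nonzero rational squares), and define $X_0=\{\mathbf{x}\in X(\mathbb{Q}):$ all $\Delta_{ij}(\mathbf{x})$ are squares in $\mathbb{Q}\}$, $X_+=\{\mathbf{x}\in X(\mathbb{Q}):$ all $\Delta_{ij}(\mathbf{x})\ge 0$, but not all are squares in $\mathbb{Q}\}$, $X_-=\{\mathbf{x}\in X(\mathbb{Q}):$ all $\Delta_{ij}(\mathbf{x})\le 0$, but not all vanish$\}$. For $V\subset X(\mathbb{Q})$ let $N(V,H,B)=\#\{\mathbf{x}\in V: H(\mathbf{x})\le B\}$. Then there are positive real numbers $c_0,c_+,c_-$ such that, as $B\to\infty$, $$N(X_0,H,B)=c_0B\log B+O(B),\quad N(X_+,H,B)=c_+B\log B+O(B(\log B)^{1/2}),\quad N(X_-,H,B)=c_-B\log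 B+O(B(\log B)^{1/2}).$$
   Context: The three sets $X_0,X_+,X_-$ form a disjoint decomposition of $X(\mathbb{Q})$ (the $\Delta_{ij}(\mathbf{x})$ cannot have different signs). *)

theory Defs
  imports "HOL-Analysis.Finite_Cartesian_Product" "HOL-Library.Landau_Symbols"
    "HOL-Computational_Algebra.Nth_Powers"
begin

datatype coord = C0 | C1 | C2 | C01 | C02 | C12

lemma UNIV_coord: "UNIV = {C0, C1, C2, C01, C02, C12}"
  using coord.exhaust by auto

instance coord :: finite
  by standard (simp add: UNIV_coord)

definition proportional :: "((rat ^ coord) \<times> (rat ^ coord)) set" where
  "proportional = {(x, y). x \<noteq> 0 \<and> y \<noteq> 0 \<and> (\<exists>c. c \<noteq> 0 \<and> y = c *s x)}"

lemma equiv_proportional: "equiv {x. x \<noteq> 0} proportional"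
proof (rule equivI)
  show "proportional \<subseteq> {x. x \<noteq> 0} \<times> {x. x \<noteq> 0}"
    by (auto simp: proportional_def)
  show "refl_on {x. x \<noteq> 0} proportional"
    by (auto simp: refl_on_def proportional_def intro!: exI[of _ 1])
  show "sym proportional"
  proof (rule symI)
    fix x y assume "(x, y) \<in> proportional"
    then obtain c where "x \<noteq> 0" "y \<noteq> 0" "c \<noteq> 0" "y = c *s x"
      by (auto simp: proportional_def)
    moreover from this have "x = inverse c *s y"
      by (simp add: vector_smult_assoc)
    ultimately show "(y, x) \<in> proportional"
      unfolding proportional_def
      by (metis (mono_tags, lifting) case_prodI mem_Collect_eq nonzero_imp_inverse_nonzero)
  qed
  show "trans proportional"
  proof (rule transI)
    fix x y z assume "(x, y) \<in> proportional" "(y, z) \<in> proportional"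
    then obtain c d where "x \<noteq> 0" "z \<noteq> 0" "c \<noteq> 0" "d \<noteq> 0" "y = c *s x" "z = d *s y"
      by (auto simp: proportional_def)
    then show "(x, z) \<in> proportional"
      unfolding proportional_def
      by (metis (mono_tags, lifting) case_prodI mem_Collect_eq no_zero_divisors vector_smult_assoc)
  qed
qed

text \<open>Rational points of projective 5-space are classes of nonzero rational vectors.\<close>

definition P5 :: "(rat ^ coord) set set" where
  "P5 = {x. x \<noteq> 0} // proportional"

definition cubic :: "rat ^ coord \<Rightarrow> rat" where
  "cubic x = x $ C0 * (x $ C12)\<^sup>2 + x $ C1 * (x $ C02)\<^sup>2 + x $ C2 * (x $ C01)\<^sup>2
             - x $ C01 * x $ C02 * x $ C12 - 4 * x $ C0 * x $ C1 * x $ C2"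

text \<open>The vanishing of the cubic, and likewise the conditions on the discriminants below, are
  invariant under scaling, so that it does not matter over which representatives of a
  class one quantifies.\<close>

definition XQ :: "(rat ^ coord) set set" where
  "XQ = {p \<in> P5. \<forall>x\<in>p. cubic x = 0}"

text \<open>The values of \<open>x\<^sub>i\<^sub>j\<^sup>2 - 4 x\<^sub>i x\<^sub>j\<close>, which are symmetric in the two indices.\<close>

definition Deltas :: "rat ^ coord \<Rightarrow> rat set" where
  "Deltas x = {(x $ C01)\<^sup>2 - 4 * x $ C0 * x $ C1,
               (x $ C02)\<^sup>2 - 4 * x $ C0 * x $ C2,
               (x $ C12)\<^sup>2 - 4 * x $ C1 * x $ C2}"

definition X_zero :: "(rat ^ coord) set set" where
  "X_zero = {p \<in> XQ. \<forall>x\<in>p. \<forall>d\<in>Deltas x. is_square d}"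

definition X_plus :: "(rat ^ coord) set set" where
  "X_plus = {p \<in> XQ. \<forall>x\<in>p. (\<forall>d\<in>Deltas x. d \<ge> 0) \<and> \<not> (\<forall>d\<in>Deltas x. is_square d)}"

definition X_minus :: "(rat ^ coord) set set" where
  "X_minus = {p \<in> XQ. \<forall>x\<in>p. (\<forall>d\<in>Deltas x. d \<le> 0) \<and> \<not> (\<forall>d\<in>Deltas x. d = 0)}"

text \<open>The coprime integral representative of a point is unique up to sign, so that the choice
  does not affect the height.\<close>

definition coprime_rep :: "(rat ^ coord) set \<Rightarrow> int ^ coord" where
  "coprime_rep p = (SOME a. Gcd (range (($) a)) = 1 \<and> (\<chi> i. of_int (a $ i)) \<in> p)"

definition height :: "(rat ^ coord) set \<Rightarrow> int" where
  "height p = (Max (range (\<lambda>i. \<bar>coprime_rep p $ i\<bar>))) ^ 3"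

definition N :: "(rat ^ coord) set set \<Rightarrow> ((rat ^ coord) set \<Rightarrow> int) \<Rightarrow> real \<Rightarrow> nat" where
  "N V H B = card {p \<in> V. of_int (H p) \<le> B}"

end

theory Submission imports Defs "HOL-Analysis.Analysis" begin

text \<open>The hypersurface parametrizes degenerate ternary quadratic forms: the cubic is, up to a
  constant, the determinant of the Gram matrix, and the \<open>\<Delta>\<^sub>i\<^sub>j\<close> are the negatives of its principal
  minors. Put \<open>T = B\<^sup>1\<^sup>/\<^sup>3\<close> and write \<open>|\<cdot>|\<close> for the maximum norm.

  Forms in \<open>X\<^sub>0\<close> are products of two primitive linear forms \<open>l\<close>, \<open>m\<close>, which are essentially unique, and
  \<open>|l m|\<close> has the order of magnitude of \<open>|l| |m|\<close>. Summing the number of \<open>m\<close> with \<open>|l m| \<le> T\<close>, which is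
  a volume of size \<open>T\<^sup>3 / |l|\<^sup>3\<close> up to a lower order term, over \<open>|l| \<le> T\<^sup>1\<^sup>/\<^sup>2\<close> gives the logarithm.

  A form in \<open>X\<^sub>+\<close> or \<open>X\<^sub>-\<close> has a vertex \<open>v\<close>, a primitive vector that is unique up to sign. If
  \<open>u\<^sub>1\<close>, \<open>u\<^sub>2\<close> is a reduced basis of the lattice orthogonal to \<open>v\<close>, so that \<open>u\<^sub>1 \<times> u\<^sub>2 = v\<close>, then the form is
  \<open>a u\<^sub>1\<^sup>2 + b u\<^sub>1 u\<^sub>2 + c u\<^sub>2\<^sup>2\<close> with integers \<open>a\<close>, \<open>b\<close>, \<open>c\<close>, and \<open>\<Delta>\<^sub>i\<^sub>j = v\<^sub>k\<^sup>2 (b\<^sup>2 - 4 a c)\<close>. A form of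
  norm at most \<open>T\<close> has \<open>a \<lless> T / |u\<^sub>1|\<^sup>2\<close>, \<open>b \<lless> T / |u\<^sub>1| |u\<^sub>2|\<close>, \<open>c \<lless> T / |u\<^sub>2|\<^sup>2\<close>, and as \<open>c \<noteq> 0\<close> for
  forms that do not split, only \<open>|u\<^sub>2|\<^sup>2 \<lless> T\<close> matters. Counting lattice points in the region
  leaves a volume of size \<open>T\<^sup>3 / |v|\<^sup>3\<close> with errors that are summable over the pairs \<open>(u\<^sub>1, u\<^sub>2)\<close>
  because \<open>u\<^sub>2\<close> lies in a slab of width \<open>|u\<^sub>1|\<close>; binary forms with square discriminant are few.
  In both cases the remaining sum is one of a function that is homogeneous of degree -3 over lattice points.\<close>

text \<open>No constant is computed. Of a volume attached to a lattice vector of norm n, only two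
  properties enter: its order of magnitude n^-3, and that moving the vector by a bounded amount
  changes it by a factor 1 + O(1/n). Then the sums over successive dyadic annuli converge
  geometrically, and their limit, positive by the lower bound, gives the coefficient of the
  logarithm.

  For \<open>X_plus\<close> and \<open>X_minus\<close> the obstacle is uniformity in the vertex. The
  region of (a, b, c) has sides of order T/|u1|^2, T/(|u1| |u2|), T/|u2|^2, so it is thin when u2 is
  much longer than u1. The error of a lattice point count is the area of its largest face,
  T^2/(|u1|^3 |u2|), which is not a function of |v|. This forces the error to be summed over reduced
  bases rather than over vertices.

  Multiplicities enter three times: a point has two primitive representatives, a non-split form has
  two primitive vertices, and a split primitive form arises from four ordered pairs of primitive
  linear forms unless its factors agree up to sign.\<close>

type_synonym 'a triple = "'a \<times> 'a \<times> 'a"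

section \<open>The maximum norm on integer triples and the size of its shells\<close>

definition nrm :: "int triple \<Rightarrow> nat" where
  "nrm = (\<lambda>(x, y, z). nat (max \<bar>x\<bar> (max \<bar>y\<bar> \<bar>z\<bar>)))"

definition dot :: "'a::comm_ring_1 triple \<Rightarrow> 'a triple \<Rightarrow> 'a" where
  "dot = (\<lambda>(x, y, z) (x', y', z'). x * x' + y * y' + z * z')"

lemma nrm_le_iff: "nrm (x, y, z) \<le> n \<longleftrightarrow> \<bar>x\<bar> \<le> int n \<and> \<bar>y\<bar> \<le> int n \<and> \<bar>z\<bar> \<le> int n"
  by (auto simp: nrm_def)

lemma nrm_ge: "\<bar>x\<bar> \<le> int (nrm (x, y, z))" "\<bar>y\<bar> \<le> int (nrm (x, y, z))" "\<bar>z\<bar> \<le> int (nrm (x, y, z))"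
  using nrm_le_iff[of x y z "nrm (x, y, z)"] by auto

lemma nrm_attained:
  "\<bar>x\<bar> = int (nrm (x, y, z)) \<or> \<bar>y\<bar> = int (nrm (x, y, z)) \<or> \<bar>z\<bar> = int (nrm (x, y, z))"
  by (simp add: nrm_def max_def)

lemma nrm_eq_0_iff: "nrm v = 0 \<longleftrightarrow> v = 0"
  by (cases v) (auto simp: nrm_def zero_prod_def)

lemma nrm_pos_iff: "0 < nrm v \<longleftrightarrow> v \<noteq> 0"
  using nrm_eq_0_iff[of v] by auto

lemma nrm_ball: "{v. nrm v \<le> n} = {-int n..int n} \<times> {-int n..int n} \<times> {-int n..int n}"
  by (auto simp: nrm_le_iff)

lemma finite_nrm_ball [simp]: "finite {v. nrm v \<le> n}"
  by (simp add: nrm_ball)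

lemma card_nrm_ball: "card {v. nrm v \<le> n} = (2 * n + 1) ^ 3"
proof -
  have "card {-int n..int n} = 2 * n + 1" by simp
  then show ?thesis
    unfolding nrm_ball card_cartesian_product power3_eq_cube by (simp only: mult.assoc)
qed

lemma card_nrm_sphere:
  assumes "n > 0" shows "card {v. nrm v = n} \<le> 26 * n\<^sup>2"
proof -
  obtain m where m: "n = Suc m" using assms gr0_conv_Suc by blast
  have eq: "{v. nrm v = n} = {v. nrm v \<le> n} - {v. nrm v \<le> m}"
    unfolding m by (rule set_eqI) (simp only: mem_Collect_eq Diff_iff, linarith)
  have sub: "{v. nrm v \<le> m} \<subseteq> {v. nrm v \<le> n}"
    by (rule Collect_mono) (simp add: m)
  have "card {v. nrm v = n} = (2 * n + 1) ^ 3 - (2 * m + 1) ^ 3"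
    unfolding eq by (simp only: card_Diff_subset[OF finite_nrm_ball sub] card_nrm_ball)
  \<comment> \<open>The difference is 24 n^2 + 2, and n is at least 1.\<close>
  also have "\<dots> \<le> 26 * n\<^sup>2"
    by (simp add: m power3_eq_cube power2_eq_square algebra_simps)
  finally show ?thesis .
qed

lemma sum_nrm_le:
  fixes g :: "nat \<Rightarrow> real"
  assumes X: "\<And>v. v \<in> X \<Longrightarrow> v \<noteq> 0 \<and> nrm v \<le> R" and g: "\<And>n. g n \<ge> 0"
  shows "(\<Sum>v\<in>X. g (nrm v)) \<le> 26 * (\<Sum>n=1..R. real n ^ 2 * g n)"
proof -
  have "X \<subseteq> {v. nrm v \<le> R}" using X by auto
  then have fin: "finite X" using finite_subset finite_nrm_ball by blast
  have "nrm ` X \<subseteq> {1..R}" using X by (auto simp: Suc_le_eq nrm_pos_iff)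
  then have "(\<Sum>v\<in>X. g (nrm v)) = (\<Sum>n=1..R. \<Sum>v | v \<in> X \<and> nrm v = n. g (nrm v))"
    using sum.group[OF fin, of "{1..R}" nrm "\<lambda>v. g (nrm v)"] by simp
  also have "\<dots> \<le> (\<Sum>n=1..R. 26 * real n ^ 2 * g n)"
  proof (rule sum_mono)
    fix n assume n: "n \<in> {1..R}"
    have "card {v \<in> X. nrm v = n} \<le> card {v. nrm v = n}"
      by (rule card_mono) (auto intro: finite_subset[OF _ finite_nrm_ball[of n]])
    also have "\<dots> \<le> 26 * n\<^sup>2" using n card_nrm_sphere by auto
    finally have "real (card {v \<in> X. nrm v = n}) \<le> real (26 * n\<^sup>2)"
      by (simp only: of_nat_le_iff)
    then have "real (card {v \<in> X. nrm v = n}) \<le> 26 * real n ^ 2" by simp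
    then have "card {v \<in> X. nrm v = n} * g n \<le> 26 * real n ^ 2 * g n"
      using g by (intro mult_right_mono)
    then show "(\<Sum>v | v \<in> X \<and> nrm v = n. g (nrm v)) \<le> 26 * real n ^ 2 * g n"
      by (simp cong: conj_cong)
  qed
  finally show ?thesis by (simp add: sum_distrib_left mult.assoc)
qed

section \<open>Sums over planar slabs\<close>

lemma sum_square_le:
  fixes g :: "nat \<Rightarrow> real"
  assumes g: "\<And>n. g n \<ge> 0" and R: "R \<ge> 1"
  shows "(\<Sum>(y, z)\<in>{-int R..int R} \<times> {-int R..int R}. g (max 1 (nat (max \<bar>y\<bar> \<bar>z\<bar>))))
          \<le> 9 * (\<Sum>n=1..R. real n * g n)"
  using R
proof (induction R rule: dec_induct)
  \<comment> \<open>\<open>max 1\<close> puts the origin into the shell n = 1, which then has 9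
    points; every other shell has 8 n.\<close>
  case base
  have "{-1..1::int} = {-1, 0, 1}" by auto
  then show ?case by (simp add: sum.cartesian_product[symmetric])
next
  case (step R)
  let ?S = "\<lambda>R. {-int R..int R} \<times> {-int R..int R}"
  let ?f = "\<lambda>(y, z). g (max 1 (nat (max \<bar>y\<bar> \<bar>z\<bar>)))"
  have sub: "?S R \<subseteq> ?S (Suc R)" by auto
  have "card (?S (Suc R) - ?S R) = nat (2 * int (Suc R) + 1) ^ 2 - nat (2 * int R + 1) ^ 2"
    using sub by (subst card_Diff_subset) (auto simp: card_cartesian_product power2_eq_square algebra_simps)
  also have "nat (2 * int (Suc R) + 1) = 2 * R + 3" by (simp add: nat_eq_iff)
  also have "nat (2 * int R + 1) = 2 * R + 1" by (simp add: nat_eq_iff)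
  also have "(2 * R + 3)\<^sup>2 - (2 * R + 1)\<^sup>2 = 8 * Suc R"
    by (simp add: power2_eq_square algebra_simps)
  finally have c: "card (?S (Suc R) - ?S R) = 8 * Suc R" .
  have "sum ?f (?S (Suc R) - ?S R) = (\<Sum>p\<in>?S (Suc R) - ?S R. g (Suc R))"
  proof (rule sum.cong, simp)
    fix p assume p: "p \<in> ?S (Suc R) - ?S R"
    obtain y z where [simp]: "p = (y, z)" by (cases p)
    have "\<bar>y\<bar> \<le> int (Suc R)" "\<bar>z\<bar> \<le> int (Suc R)" using p by (simp_all add: abs_le_iff)
    moreover have "\<not> (\<bar>y\<bar> \<le> int R \<and> \<bar>z\<bar> \<le> int R)" using p by simp linarith
    ultimately have "max \<bar>y\<bar> \<bar>z\<bar> = int (Suc R)" by linarith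
    then have "nat (max \<bar>y\<bar> \<bar>z\<bar>) = Suc R" by (simp only: nat_int)
    then show "?f p = g (Suc R)" by simp
  qed
  also have "\<dots> = 8 * real (Suc R) * g (Suc R)" using c by simp
  also have "\<dots> \<le> 9 * (real (Suc R) * g (Suc R))"
    unfolding mult.assoc[symmetric] using g[of "Suc R"] by (intro mult_right_mono) auto
  finally have "sum ?f (?S (Suc R) - ?S R) \<le> 9 * (real (Suc R) * g (Suc R))" .
  moreover have "sum ?f (?S (Suc R)) = sum ?f (?S (Suc R) - ?S R) + sum ?f (?S R)"
    using sub by (intro sum.subset_diff) auto
  ultimately show ?case using step.IH by simp
qed

text \<open>Two solutions differ by at most D / n, hence by at most 3 n, which leaves room for 3 n +
  1 \<le> 4 n integers. This is the width of the slab in the direction of a maximal coordinate of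
  its normal vector.\<close>

lemma card_int_interval_le:
  fixes u s D :: int
  assumes "\<bar>u\<bar> = int n" "n > 0" "D \<le> 3 * int n ^ 2"
  shows "card {x. 2 * \<bar>u * x + s\<bar> \<le> D} \<le> 4 * n \<and> finite {x. 2 * \<bar>u * x + s\<bar> \<le> D}"
proof (cases "{x. 2 * \<bar>u * x + s\<bar> \<le> D} = {}")
  case False
  let ?I = "{x. 2 * \<bar>u * x + s\<bar> \<le> D}"
  have diff: "y - x \<le> 3 * int n" if "x \<in> ?I" "y \<in> ?I" for x y
  proof -
    have "u * (y - x) = (u * y + s) - (u * x + s)" by (simp add: algebra_simps)
    moreover have "\<bar>q - p\<bar> \<le> D" if "2 * \<bar>p\<bar> \<le> D" "2 * \<bar>q\<bar> \<le> D" for p q :: int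
      using that by linarith
    ultimately have "\<bar>u * (y - x)\<bar> \<le> D" using that by (simp only: mem_Collect_eq)
    then have "int n * \<bar>y - x\<bar> \<le> 3 * int n ^ 2"
      using assms(3) unfolding abs_mult assms(1) by (rule order_trans)
    then have "int n * \<bar>y - x\<bar> \<le> int n * (3 * int n)" by (simp add: power2_eq_square)
    then have "\<bar>y - x\<bar> \<le> 3 * int n" using assms(2) by simp
    then show ?thesis by linarith
  qed
  obtain x0 where x0: "x0 \<in> ?I" using False by blast
  have "?I \<subseteq> {x0 - 3 * int n..x0 + 3 * int n}"
  proof
    fix x assume "x \<in> ?I"
    then show "x \<in> {x0 - 3 * int n..x0 + 3 * int n}" using diff[of x x0] diff[of x0 x] x0 by simp
  qed
  then have fin: "finite ?I" by (rule finite_subset) simp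
  define m where "m = Min ?I"
  have "m \<in> ?I" unfolding m_def using fin False by (rule Min_in)
  have "?I \<subseteq> {m..m + 3 * int n}"
  proof
    fix x assume x: "x \<in> ?I"
    have "m \<le> x" unfolding m_def using fin x by (rule Min_le)
    then show "x \<in> {m..m + 3 * int n}" using diff[OF \<open>m \<in> ?I\<close> x] by simp
  qed
  then have "card ?I \<le> card {m..m + 3 * int n}" by (rule card_mono[rotated]) simp
  also have "\<dots> = 3 * n + 1" by simp
  finally show ?thesis using fin assms(2) by simp
qed simp

lemma dot_self_le: "dot v v \<le> 3 * int (nrm v) ^ 2"
proof -
  obtain x y z where v: "v = (x, y, z)" by (cases v)
  have "\<bar>x\<bar> \<le> int (nrm v)" "\<bar>y\<bar> \<le> int (nrm v)" "\<bar>z\<bar> \<le> int (nrm v)"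
    unfolding v by (rule nrm_ge)+
  then have "x\<^sup>2 \<le> int (nrm v) ^ 2" "y\<^sup>2 \<le> int (nrm v) ^ 2" "z\<^sup>2 \<le> int (nrm v) ^ 2"
    by (metis abs_ge_zero power2_abs power_mono)+
  then show ?thesis by (simp add: v dot_def power2_eq_square)
qed

lemma nrm_sq_le_dot: "int (nrm v) ^ 2 \<le> dot v v"
proof -
  obtain x y z where v: "v = (x, y, z)" by (cases v)
  have "int (nrm v) = \<bar>x\<bar> \<or> int (nrm v) = \<bar>y\<bar> \<or> int (nrm v) = \<bar>z\<bar>"
    unfolding v using nrm_attained[of x y z] by metis
  then have "int (nrm v) ^ 2 = x\<^sup>2 \<or> int (nrm v) ^ 2 = y\<^sup>2 \<or> int (nrm v) ^ 2 = z\<^sup>2" by auto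
  moreover have "x\<^sup>2 \<ge> 0" "y\<^sup>2 \<ge> 0" "z\<^sup>2 \<ge> 0" by auto
  ultimately show ?thesis unfolding v dot_def power2_eq_square[symmetric] split by linarith
qed

text \<open>Fixing the last two coordinates leaves at most 4 |u| values for the first, so the slab
  sum is |u| times a planar sum. Since g decreases, the norm of x may be replaced by that of its
  last two coordinates. These may both vanish, and g is monotone only from 1 on, hence
  \<open>max 1\<close>.\<close>

lemma sum_slab_le_aux:
  fixes g :: "nat \<Rightarrow> real"
  assumes u: "u = (u0, u1, u2)" "\<bar>u0\<bar> = int (nrm u)" "u \<noteq> 0"
    and X: "\<And>x. x \<in> X \<Longrightarrow> x \<noteq> 0 \<and> nrm x \<le> R \<and> 2 * \<bar>dot u x\<bar> \<le> dot u u"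
    and g: "\<And>n. g n \<ge> 0" "\<And>m n. 1 \<le> m \<Longrightarrow> m \<le> n \<Longrightarrow> g n \<le> g m"
  shows "(\<Sum>x\<in>X. g (nrm x)) \<le> 36 * real (nrm u) * (\<Sum>n=1..R. real n * g n)"
proof (cases "R \<ge> 1")
  case False
  then have "X = {}" using X nrm_pos_iff by (metis One_nat_def Suc_leI all_not_in_conv le_trans)
  then show ?thesis using g False by simp
next
  case True
  have n0: "nrm u > 0" using u by (simp add: nrm_pos_iff)
  let ?S = "{-int R..int R} \<times> {-int R..int R}"
  let ?I = "\<lambda>(y, z). {x. 2 * \<bar>u0 * x + (u1 * y + u2 * z)\<bar> \<le> dot u u}"
  let ?g = "\<lambda>(y, z). g (max 1 (nat (max \<bar>y\<bar> \<bar>z\<bar>)))"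
  have I: "card (?I p) \<le> 4 * nrm u \<and> finite (?I p)" for p
    using card_int_interval_le[OF u(2) n0 dot_self_le] by (auto split: prod.split)
  let ?\<phi> = "\<lambda>(x, y, z). ((y, z), x)"
  have inj: "inj_on ?\<phi> X" by (auto simp: inj_on_def)
  have sub: "?\<phi> ` X \<subseteq> (SIGMA p:?S. ?I p)"
  proof
    fix w assume "w \<in> ?\<phi> ` X"
    then obtain x y z where w: "w = ((y, z), x)" "(x, y, z) \<in> X" by auto
    have "dot u (x, y, z) = u0 * x + (u1 * y + u2 * z)" by (simp add: u(1) dot_def)
    with X[OF w(2)] show "w \<in> (SIGMA p:?S. ?I p)"
      by (simp add: w nrm_le_iff abs_le_iff)
  qed
  have fin: "finite (SIGMA p:?S. ?I p)" using I by (intro finite_SigmaI) auto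
  have "(\<Sum>x\<in>X. g (nrm x)) \<le> (\<Sum>x\<in>X. ?g (fst (?\<phi> x)))"
  proof (rule sum_mono)
    fix v assume v: "v \<in> X"
    obtain x y z where [simp]: "v = (x, y, z)" by (cases v)
    have "nrm v \<ge> 1" using X[OF v] nrm_pos_iff[of v] by simp
    moreover have "nat (max \<bar>y\<bar> \<bar>z\<bar>) \<le> nrm v" by (simp add: nrm_def nat_mono)
    ultimately have "max 1 (nat (max \<bar>y\<bar> \<bar>z\<bar>)) \<le> nrm v" by simp
    then show "g (nrm v) \<le> ?g (fst (?\<phi> v))" using g(2) by simp
  qed
  also have "\<dots> = (\<Sum>w\<in>?\<phi> ` X. ?g (fst w))" using inj by (simp add: sum.reindex)
  also have "\<dots> \<le> (\<Sum>w\<in>(SIGMA p:?S. ?I p). ?g (fst w))"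
    using fin sub g by (intro sum_mono2) (auto split: prod.split)
  also have "\<dots> = (\<Sum>p\<in>?S. \<Sum>x\<in>?I p. ?g p)"
    using I by (subst sum.Sigma) (auto intro!: sum.cong split: prod.split)
  also have "\<dots> \<le> (\<Sum>p\<in>?S. (4 * real (nrm u)) * ?g p)"
  proof (rule sum_mono)
    fix p
    have "real (card (?I p)) \<le> 4 * real (nrm u)" using I[of p] by linarith
    then show "(\<Sum>x\<in>?I p. ?g p) \<le> 4 * real (nrm u) * ?g p"
      using g(1) by (simp add: mult_right_mono split: prod.split)
  qed
  also have "\<dots> = 4 * real (nrm u) * (\<Sum>p\<in>?S. ?g p)" by (simp only: sum_distrib_left)
  also have "\<dots> \<le> 4 * real (nrm u) * (9 * (\<Sum>n=1..R. real n * g n))"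
    using sum_square_le[OF g(1) True] by (intro mult_left_mono) auto
  finally show ?thesis by simp
qed

text \<open>A cyclic shift, used throughout to bring a coordinate of maximal modulus, or a nonzero
  one, into a fixed position.\<close>

definition rot :: "'a triple \<Rightarrow> 'a triple" where "rot = (\<lambda>(x, y, z). (y, z, x))"

lemma nrm_rot [simp]: "nrm (rot v) = nrm v"
  by (cases v) (simp add: rot_def nrm_def max.commute max.left_commute)

lemma dot_rot [simp]: "dot (rot v) (rot w) = dot v w"
  by (cases v; cases w) (simp add: rot_def dot_def)

lemma rot_eq_0_iff [simp]: "rot v = 0 \<longleftrightarrow> v = 0"
  by (cases v) (auto simp: rot_def zero_prod_def)

lemma inj_rot: "inj_on rot X" by (auto simp: inj_on_def rot_def)

lemma sum_slab_le:
  fixes g :: "nat \<Rightarrow> real"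
  assumes u: "u \<noteq> 0"
    and X: "\<And>x. x \<in> X \<Longrightarrow> x \<noteq> 0 \<and> nrm x \<le> R \<and> 2 * \<bar>dot u x\<bar> \<le> dot u u"
    and g: "\<And>n. g n \<ge> 0" "\<And>m n. 1 \<le> m \<Longrightarrow> m \<le> n \<Longrightarrow> g n \<le> g m"
  shows "(\<Sum>x\<in>X. g (nrm x)) \<le> 36 * real (nrm u) * (\<Sum>n=1..R. real n * g n)"
proof -
  obtain a b c where abc: "u = (a, b, c)" by (cases u)
  have red: "(\<Sum>x\<in>rot ` Y. g (nrm x)) = (\<Sum>x\<in>Y. g (nrm x))" for Y
    by (simp add: sum.reindex inj_rot)
  consider "\<bar>a\<bar> = int (nrm u)" | "\<bar>b\<bar> = int (nrm u)" | "\<bar>c\<bar> = int (nrm u)"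
    using nrm_attained[of a b c] unfolding abc by blast
  then show ?thesis
  proof cases
    case 1
    show ?thesis by (rule sum_slab_le_aux[OF abc 1 u X g])
  next
    case 2
    have ru: "rot u = (b, c, a)" by (simp add: abc rot_def)
    have "(\<Sum>x\<in>rot ` X. g (nrm x)) \<le> 36 * real (nrm (rot u)) * (\<Sum>n=1..R. real n * g n)"
    proof (rule sum_slab_le_aux[OF ru _ _ _ g])
      fix x assume "x \<in> rot ` X"
      then obtain y where "x = rot y" "y \<in> X" by blast
      then show "x \<noteq> 0 \<and> nrm x \<le> R \<and> 2 * \<bar>dot (rot u) x\<bar> \<le> dot (rot u) (rot u)"
        using X by simp
    qed (use 2 u in simp_all)
    then show ?thesis by (simp add: red)
  next
    case 3
    have ru: "rot (rot u) = (c, a, b)" by (simp add: abc rot_def)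
    have "(\<Sum>x\<in>rot ` rot ` X. g (nrm x)) \<le> 36 * real (nrm (rot (rot u))) * (\<Sum>n=1..R. real n * g n)"
    proof (rule sum_slab_le_aux[OF ru _ _ _ g])
      fix x assume "x \<in> rot ` rot ` X"
      then obtain y where "x = rot (rot y)" "y \<in> X" by blast
      then show "x \<noteq> 0 \<and> nrm x \<le> R \<and> 2 * \<bar>dot (rot (rot u)) x\<bar> \<le> dot (rot (rot u)) (rot (rot u))"
        using X by simp
    qed (use 3 u in simp_all)
    then show ?thesis by (simp add: red)
  qed
qed

section \<open>Logarithmic sums of functions of degree -3\<close>

text \<open>Half-open, so that \<open>hbox (2 * R)\<close> is exactly the preimage of
  \<open>hbox R\<close> under \<open>half\<close> and every fibre has 8 elements. With a symmetric
  closed cube this would fail at the boundary.\<close>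

definition hbox :: "nat \<Rightarrow> int triple set" where
  "hbox R = {-int R..<int R} \<times> {-int R..<int R} \<times> {-int R..<int R}"

definition half :: "int triple \<Rightarrow> int triple" where
  "half = (\<lambda>(x, y, z). (x div 2, y div 2, z div 2))"

lemma finite_hbox [simp]: "finite (hbox R)" by (simp add: hbox_def)

lemma card_hbox: "card (hbox R) = (2 * R) ^ 3"
proof -
  have "card {-int R..<int R} = 2 * R" by simp
  then show ?thesis
    unfolding hbox_def card_cartesian_product power3_eq_cube by (simp only: mult.assoc)
qed

lemma hbox_mono: "R \<le> S \<Longrightarrow> hbox R \<subseteq> hbox S"
  unfolding hbox_def by (intro Sigma_mono) auto

lemma hbox_double_iff: "v \<in> hbox (2 * R) \<longleftrightarrow> half v \<in> hbox R"
proof -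
  have *: "x \<in> {-int (2 * R)..<int (2 * R)} \<longleftrightarrow> x div 2 \<in> {-int R..<int R}" for x by auto
  show ?thesis
    by (cases v) (simp only: hbox_def half_def mem_Times_iff fst_conv snd_conv prod.case *)
qed

lemma nrm_less_imp_hbox: "nrm v < R \<Longrightarrow> v \<in> hbox R"
proof (cases v)
  case (fields x y z)
  assume "nrm v < R"
  then show ?thesis
    using nrm_ge(1)[of x y z] nrm_ge(2)[of y x z] nrm_ge(3)[of z x y] by (simp add: fields hbox_def) linarith
qed

lemma hbox_imp_nrm_le: "v \<in> hbox R \<Longrightarrow> nrm v \<le> R"
  by (cases v) (auto simp: hbox_def nrm_le_iff)

lemma half_vimage: "half -` {(x, y, z)} = {2 * x, 2 * x + 1} \<times> {2 * y, 2 * y + 1} \<times> {2 * z, 2 * z + 1}"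
proof -
  have *: "a div 2 = x \<longleftrightarrow> a = 2 * x \<or> a = 2 * x + 1" for a x :: int by auto
  show ?thesis
    by (rule set_eqI) (simp only: half_def vimage_def case_prod_beta mem_Collect_eq singleton_iff
        prod.inject * mem_Times_iff insert_iff empty_iff simp_thms)
qed

lemma card_half_vimage: "card (half -` {v}) = 8"
  by (cases v) (simp add: half_vimage card_cartesian_product)

lemma finite_half_vimage: "finite (half -` {v})"
  by (cases v) (simp add: half_vimage)

text \<open>The limit is the first term plus the series of increments; the tail from j on is
  dominated by a geometric series of ratio 1/2, which accounts for the factor 2.\<close>

lemma geometric_increments_imp_convergent:
  fixes a :: "nat \<Rightarrow> real"
  assumes "\<And>j. j \<ge> 1 \<Longrightarrow> \<bar>a (Suc j) - a j\<bar> \<le> C / 2 ^ j"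
  obtains L where "\<And>j. j \<ge> 1 \<Longrightarrow> \<bar>a j - L\<bar> \<le> 2 * C / 2 ^ j"
proof -
  define b where "b = (\<lambda>j. a (j + 2) - a (j + 1))"
  have bb: "\<bar>b j\<bar> \<le> C / 2 ^ (j + 1)" for j using assms[of "j + 1"] by (simp add: b_def)
  have geo: "(\<lambda>j. C / 2 ^ (j + k)) sums (2 * C / 2 ^ k)" for k
    using sums_mult[OF geometric_sums[of "1 / 2 :: real"], of "C / 2 ^ k"]
    by (simp add: power_add power_divide field_simps)
  have sb: "summable b"
    by (rule summable_comparison_test'[where N = 0 and g = "\<lambda>j. C / 2 ^ (j + 1)"])
       (use geo[of 1] bb in \<open>auto simp: sums_iff\<close>)
  define L where "L = a 1 + suminf b"
  have "\<bar>a j - L\<bar> \<le> 2 * C / 2 ^ j" if j: "j \<ge> 1" for j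
  proof -
    obtain i where i: "j = Suc i" using j by (cases j) auto
    have "(\<Sum>n<i. b n) = a j - a 1"
      using sum_lessThan_telescope[of "\<lambda>n. a (n + 1)" i] by (simp add: b_def i)
    then have "a j - L = - (\<Sum>n. b (n + i))"
      using suminf_split_initial_segment[OF sb, of i] by (simp add: L_def)
    also have "\<bar>\<dots>\<bar> \<le> (\<Sum>n. \<bar>b (n + i)\<bar>)"
    proof -
      have "summable (\<lambda>n. \<bar>b (n + i)\<bar>)"
        by (rule summable_comparison_test'[where N = 0 and g = "\<lambda>n. C / 2 ^ (n + (i + 1))"])
           (use geo[of "i + 1"] bb in \<open>auto simp: sums_iff add.assoc\<close>)
      then show ?thesis unfolding abs_minus_cancel by (rule summable_rabs)
    qed
    also have "\<dots> \<le> (\<Sum>n. C / 2 ^ (n + j))"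
    proof (rule suminf_le)
      show "\<bar>b (n + i)\<bar> \<le> C / 2 ^ (n + j)" for n using bb[of "n + i"] by (simp add: i)
      show sg: "summable (\<lambda>n. C / 2 ^ (n + j))" using geo sums_iff by blast
      show "summable (\<lambda>n. \<bar>b (n + i)\<bar>)"
        by (rule summable_comparison_test'[OF sg, where N = 0]) (use bb[of "_ + i"] in \<open>simp add: i\<close>)
    qed
    also have "\<dots> = 2 * C / 2 ^ j" using geo[of j] by (simp add: sums_iff)
    finally show ?thesis .
  qed
  then show ?thesis using that by blast
qed

text \<open>The hypothesis \<open>doubling\<close> says that k is nearly homogeneous of degree -3.
  Each point of the annulus between R and 2 R is replaced by its 8 preimages under
  \<open>half\<close>, so the sums over the annuli of radius 2^j differ from a limit L by O(2^-j),
  and the sum over J annuli is L J + O(1).\<close>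

lemma log_sum:
  fixes k :: "int triple \<Rightarrow> real"
  assumes c: "c > 0" and lower: "\<And>v. v \<noteq> 0 \<Longrightarrow> c / real (nrm v) ^ 3 \<le> k v"
    and upper: "\<And>v. v \<noteq> 0 \<Longrightarrow> k v \<le> C / real (nrm v) ^ 3"
    and doubling: "\<And>v. nrm (half v) \<ge> 2 \<Longrightarrow> \<bar>8 * k v - k (half v)\<bar> \<le> C / real (nrm (half v)) ^ 4"
  obtains \<kappa> D where "\<kappa> > 0" "\<And>R. R \<ge> 1 \<Longrightarrow> \<bar>(\<Sum>v | v \<noteq> 0 \<and> real (nrm v) \<le> R. k v) - \<kappa> * ln R\<bar> \<le> D"
proof -
  have kpos: "k v > 0" if "v \<noteq> 0" for v
    using lower[OF that] c nrm_pos_iff[of v] that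
    by (smt (verit, best) divide_pos_pos of_nat_0_less_iff zero_less_power)
  \<comment> \<open>Both bounds at a vector of norm 1 give c \<le> C, so C is positive too.\<close>
  have "c / 1 \<le> C / 1" using order_trans[OF lower upper, of "(1, 0, 0)"] by (simp add: nrm_def zero_prod_def)
  then have C: "C > 0" using c by simp
  define ann where "ann = (\<lambda>R. hbox (2 * R) - hbox R)"
  define A where "A = (\<lambda>R. sum k (ann R))"
  have ann: "R \<le> nrm v" "nrm v \<le> 2 * R" if "v \<in> ann R" for v R
    using that nrm_less_imp_hbox[of v R] hbox_imp_nrm_le[of v "2 * R"] by (force simp: ann_def)+
  have finann: "finite (ann R)" for R by (simp add: ann_def)
  have cardann: "card (ann R) = 56 * R ^ 3" for R
    unfolding ann_def using hbox_mono[of R "2 * R"]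
    by (subst card_Diff_subset) (auto simp: card_hbox power_mult_distrib)
  have ann_double: "ann (2 * R) = (\<Union>v\<in>ann R. half -` {v})" for R
  proof (rule set_eqI)
    fix w
    show "w \<in> ann (2 * R) \<longleftrightarrow> w \<in> (\<Union>v\<in>ann R. half -` {v})"
      unfolding ann_def Diff_iff UN_iff vimage_def mem_Collect_eq
      by (simp only: hbox_double_iff[of w] singleton_iff) (auto simp: hbox_double_iff[of "half w"])
  qed
  have step: "\<bar>A (2 * R) - A R\<bar> \<le> 56 * C / R" if R: "R \<ge> 2" for R
  proof -
    have "A (2 * R) = (\<Sum>v\<in>ann R. \<Sum>w\<in>half -` {v}. k w)"
      unfolding A_def ann_double by (rule sum.UNION_disjoint) (auto simp: finite_half_vimage finann)
    then have "A (2 * R) - A R = (\<Sum>v\<in>ann R. (\<Sum>w\<in>half -` {v}. k w) - k v)"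
      by (simp add: A_def sum_subtractf)
    also have "\<bar>\<dots>\<bar> \<le> (\<Sum>v\<in>ann R. C / real R ^ 4)"
    proof (rule order_trans[OF sum_abs sum_mono])
      fix v assume v: "v \<in> ann R"
      have n: "nrm v \<ge> 2" "real R \<le> real (nrm v)" using ann(1)[OF v] R by auto
      have "(\<Sum>w\<in>half -` {v}. k w) - k v = (\<Sum>w\<in>half -` {v}. k w - k v / 8)"
        by (simp add: sum_subtractf card_half_vimage)
      also have "\<bar>\<dots>\<bar> \<le> (\<Sum>w\<in>half -` {v}. C / real (nrm v) ^ 4 / 8)"
      proof (rule order_trans[OF sum_abs sum_mono])
        fix w assume "w \<in> half -` {v}"
        then have "\<bar>8 * k w - k v\<bar> \<le> C / real (nrm v) ^ 4" using doubling[of w] n by auto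
        moreover have "\<bar>p - q / 8\<bar> \<le> e / 8" if "\<bar>8 * p - q\<bar> \<le> e" for p q e :: real
          using that by linarith
        ultimately show "\<bar>k w - k v / 8\<bar> \<le> C / real (nrm v) ^ 4 / 8" by blast
      qed
      also have "\<dots> = C / real (nrm v) ^ 4" by (simp add: card_half_vimage)
      also have "\<dots> \<le> C / real R ^ 4"
        using n R C by (intro divide_left_mono power_mono mult_pos_pos) auto
      finally show "\<bar>(\<Sum>w\<in>half -` {v}. k w) - k v\<bar> \<le> C / real R ^ 4" .
    qed
    \<comment> \<open>There are (4 R)^3 - (2 R)^3 = 56 R^3 points, each with error C / R^4.\<close>
    also have "\<dots> = 56 * C / R" using R by (simp add: cardann field_simps power_numeral_reduce)
    finally show ?thesis .
  qed
  have "\<bar>A (2 ^ Suc j) - A (2 ^ j)\<bar> \<le> 56 * C / 2 ^ j" if "j \<ge> 1" for j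
  proof -
    have "(2::nat) ^ j \<ge> 2 ^ 1" using that by (intro power_increasing) auto
    then show ?thesis using step[of "2 ^ j"] by simp
  qed
  then obtain L where L: "\<And>j. j \<ge> 1 \<Longrightarrow> \<bar>A (2 ^ j) - L\<bar> \<le> 2 * (56 * C) / 2 ^ j"
    using geometric_increments_imp_convergent[of "\<lambda>j. A (2 ^ j)"] by blast
  have Abound: "7 * c \<le> A R" if R: "R \<ge> 1" for R
  proof -
    have "(\<Sum>v\<in>ann R. c / (2 * real R) ^ 3) \<le> A R"
      unfolding A_def
    proof (rule sum_mono)
      fix v assume v: "v \<in> ann R"
      have n: "real R \<le> real (nrm v)" "real (nrm v) \<le> 2 * real R" using ann[OF v] by linarith+
      then have "c / (2 * real R) ^ 3 \<le> c / real (nrm v) ^ 3"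
        using R c by (intro divide_left_mono power_mono mult_pos_pos) auto
      moreover have "v \<noteq> 0" using n R nrm_eq_0_iff[of v] by auto
      ultimately show "c / (2 * real R) ^ 3 \<le> k v" using lower[of v] by linarith
    qed
    \<comment> \<open>Here 56 R^3 points contribute at least c / (2 R)^3 each, in total 7 c. The
      same bound passes to the limit L.\<close>
    then show ?thesis using R by (simp add: cardann power_mult_distrib)
  qed
  have "L \<ge> 7 * c"
  proof (rule ccontr)
    assume "\<not> L \<ge> 7 * c"
    then have e: "7 * c - L > 0" by simp
    obtain n :: nat where n: "2 * (56 * C) / (7 * c - L) < 2 ^ n"
      using real_arch_pow[of 2] by fastforce
    then have "2 * (56 * C) / 2 ^ Suc n < 7 * c - L"
      using e C by (simp add: field_simps)
    moreover have "7 * c \<le> A (2 ^ Suc n)" by (rule Abound) simp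
    ultimately show False using L[of "Suc n"] by linarith
  qed
  then have Lpos: "L > 0" using c by linarith
  define S where "S = (\<lambda>J. \<Sum>v\<in>hbox (2 ^ J) - {0}. k v)"
  have Sstep: "S (Suc J) = S J + A (2 ^ J)" for J
  proof -
    have "hbox (2 ^ Suc J) - {0} = (hbox (2 ^ J) - {0}) \<union> ann (2 ^ J)"
    proof -
      have "0 \<notin> ann (2 ^ J)" using ann(1)[of 0 "2 ^ J"] nrm_eq_0_iff[of 0] by fastforce
      moreover have "hbox (2 ^ Suc J) = hbox (2 ^ J) \<union> ann (2 ^ J)"
        using hbox_mono[of "2 ^ J" "2 * 2 ^ J"] unfolding ann_def power_Suc by auto
      ultimately show ?thesis by blast
    qed
    moreover have "(hbox (2 ^ J) - {0}) \<inter> ann (2 ^ J) = {}" by (auto simp: ann_def)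
    ultimately show ?thesis unfolding S_def A_def by (simp add: sum.union_disjoint finann)
  qed
  define D where "D = \<bar>S 0\<bar> + \<bar>A 1\<bar> + L + 2 * (56 * C)"
  have SJ: "\<bar>S J - L * J\<bar> \<le> D" for J
  proof -
    \<comment> \<open>The factor 1 - 1 / 2^i is the partial sum of the geometric errors; the plain
      bound by their total would not carry the induction.\<close>
    have "\<bar>S (Suc i) - S 1 - L * i\<bar> \<le> 2 * (56 * C) * (1 - 1 / 2 ^ i)" for i
    proof (induction i)
      case (Suc i)
      have "S (Suc (Suc i)) - S 1 - L * Suc i = (S (Suc i) - S 1 - L * i) + (A (2 ^ Suc i) - L)"
        using Sstep[of "Suc i"] by (simp add: algebra_simps)
      then have "\<bar>S (Suc (Suc i)) - S 1 - L * Suc i\<bar>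
          \<le> 2 * (56 * C) * (1 - 1 / 2 ^ i) + 2 * (56 * C) / 2 ^ Suc i"
        using Suc L[of "Suc i"] by linarith
      then show ?case by (simp add: field_simps)
    qed simp
    moreover have "2 * (56 * C) * (1 - 1 / 2 ^ i) \<le> 2 * (56 * C)" for i :: nat using C by simp
    ultimately have *: "\<bar>S (Suc i) - S 1 - L * i\<bar> \<le> 2 * (56 * C)" for i using order_trans by blast
    show ?thesis
    proof (cases J)
      case 0
      then show ?thesis using C Lpos by (simp add: D_def)
    next
      case (Suc i)
      have "S 1 = S 0 + A 1" using Sstep[of 0] by simp
      moreover have "L * J = L * i + L" by (simp add: Suc algebra_simps)
      ultimately have "S J - L * J = (S (Suc i) - S 1 - L * i) + (S 0 + A 1 - L)" by (simp add: Suc)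
      also have "\<bar>\<dots>\<bar> \<le> \<bar>S (Suc i) - S 1 - L * i\<bar> + \<bar>S 0 + A 1 - L\<bar>" by (rule abs_triangle_ineq)
      also have "\<bar>S 0 + A 1 - L\<bar> \<le> \<bar>S 0\<bar> + \<bar>A 1\<bar> + L" using Lpos by linarith
      finally show ?thesis using *[of i] unfolding D_def by linarith
    qed
  qed
  show ?thesis
  \<comment> \<open>Positivity of k squeezes the sum up to R between two consecutive dyadic sums.
    They differ by L up to a bounded error, and J is log R to base 2 up to 1.\<close>
  proof (rule that[of "L / ln 2" "D + 2 * L"])
    show "L / ln 2 > 0" using Lpos by simp
    fix R :: real assume R: "R \<ge> 1"
    define J where "J = nat \<lfloor>log 2 R\<rfloor>"
    have "log 2 R \<ge> 0" using R by simp
    then have J: "real J \<le> log 2 R" "log 2 R < real J + 1" by (simp_all add: J_def)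
    have J1: "2 ^ J \<le> R" using J(1) R by (simp add: le_log_iff powr_realpow)
    have J2: "R < 2 ^ Suc J"
    proof -
      have "log 2 R < real (Suc J)" using J(2) by simp
      then have "R < 2 powr real (Suc J)" using R by (subst (asm) log_less_iff) auto
      then show ?thesis by (simp only: powr_realpow zero_less_numeral)
    qed
    let ?X = "{v. v \<noteq> 0 \<and> real (nrm v) \<le> R}"
    have sub1: "hbox (2 ^ J) - {0} \<subseteq> ?X"
    proof
      fix v assume v: "v \<in> hbox (2 ^ J) - {0}"
      then have "real (nrm v) \<le> real (2 ^ J)" using hbox_imp_nrm_le[of v "2 ^ J"] of_nat_mono by blast
      then have "real (nrm v) \<le> 2 ^ J" by (simp only: of_nat_power of_nat_numeral)
      then have "real (nrm v) \<le> R" using J1 by (rule order_trans)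
      then show "v \<in> ?X" using v by simp
    qed
    have sub2: "?X \<subseteq> hbox (2 ^ Suc J) - {0}"
    proof
      fix v assume v: "v \<in> ?X"
      then have "real (nrm v) < real (2 ^ Suc J)" using J2 by simp
      then show "v \<in> hbox (2 ^ Suc J) - {0}"
        using v nrm_less_imp_hbox[of v "2 ^ Suc J"] by (simp only: of_nat_less_iff) auto
    qed
    have fin: "finite ?X" using sub2 by (rule finite_subset) simp
    have "S J \<le> sum k ?X" unfolding S_def using fin sub1 kpos by (intro sum_mono2) (auto intro: less_imp_le)
    moreover have "sum k ?X \<le> S (Suc J)"
      unfolding S_def using sub2 kpos by (intro sum_mono2) (auto intro: less_imp_le)
    moreover have "L * real J \<le> L * log 2 R" "L * log 2 R \<le> L * real J + L"
      using J Lpos mult_left_mono[of "log 2 R" "real J + 1" L] by (auto simp: algebra_simps)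
    moreover have "L / ln 2 * ln R = L * log 2 R" by (simp add: log_def)
    moreover have "L * real (Suc J) = L * real J + L" by (simp add: algebra_simps)
    ultimately show "\<bar>sum k ?X - L / ln 2 * ln R\<bar> \<le> D + 2 * L"
      using SJ[of J] SJ[of "Suc J"] Lpos by linarith
  qed
qed

section \<open>Restriction to primitive vectors\<close>

text \<open>Comparison with the telescoping terms 1 / (2 n (n + 1)). That the value is at most 1/2
  fixes the constant \<open>K'\<close> of the inversion below.\<close>

lemma sum_inverse_cubes_le: "(\<Sum>d=2..n. 1 / real d ^ 3) \<le> 1 / 2"
proof -
  have "(\<Sum>d=2..n. 1 / real d ^ 3) \<le> (1 - 1 / real n) / 2" if "n \<ge> 1" for n
    using that
  proof (induction n rule: dec_induct)
    case (step n)
    have "1 / real (Suc n) ^ 3 \<le> (1 / real n - 1 / real (Suc n)) / 2"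
    proof -
      have "0 \<le> (real n - 1)\<^sup>2" by simp
      then have "2 * real n \<le> (1 + real n)\<^sup>2" by (simp add: power2_eq_square algebra_simps)
      then have "real (Suc n) * (2 * real n) \<le> real (Suc n) ^ 3"
        by (simp add: power3_eq_cube power2_eq_square mult_left_mono)
      then have "1 / real (Suc n) ^ 3 \<le> 1 / (real (Suc n) * (2 * real n))"
        using step by (intro divide_left_mono) auto
      also have "\<dots> = (1 / real n - 1 / real (Suc n)) / 2" using step by (simp add: field_simps)
      finally show ?thesis .
    qed
    then show ?case using step by (simp add: add_divide_distrib diff_divide_distrib)
  qed simp
  from this[of n] show ?thesis by (cases "n = 0") (auto intro: order_trans)
qed

text \<open>Moebius inversion is replaced by a contraction argument: as the sum of \<open>1 / d\<^sup>3\<close> over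
  \<open>d \<ge> 2\<close> is less than 1, the error terms at \<open>x / d\<close> sum up to less than the one at \<open>x\<close>.\<close>

lemma cubic_log_inversion:
  fixes f F :: "real \<Rightarrow> real"
  assumes F: "\<And>x. x \<ge> 1 \<Longrightarrow> F x = (\<Sum>d=1..nat \<lfloor>x\<rfloor>. f (x / real d))"
    and c: "c > 0" and est: "\<And>x. x \<ge> 1 \<Longrightarrow> \<bar>F x - c * x ^ 3 * ln x\<bar> \<le> K * x ^ 3"
  obtains c' K' where "c' > 0" "\<And>x. x \<ge> 1 \<Longrightarrow> \<bar>f x - c' * x ^ 3 * ln x\<bar> \<le> K' * x ^ 3"
proof -
  define z where "z = (\<lambda>d::nat. 1 / real (Suc d) ^ 3)"
  have sz: "summable z"
    unfolding z_def using summable_Suc_iff[of "\<lambda>n. 1 / real n ^ 3"] inverse_power_summable[of 3, where 'a = real]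
    by (simp add: divide_inverse)
  have s2: "summable (\<lambda>d. 1 / real (Suc d) ^ 2)"
    using summable_Suc_iff[of "\<lambda>n. 1 / real n ^ 2"] inverse_power_summable[of 2, where 'a = real]
    by (simp add: divide_inverse)
  define Z2 where "Z2 = (\<Sum>d. 1 / real (Suc d) ^ 2)"
  have Z2: "Z2 \<ge> 0" unfolding Z2_def by (intro suminf_nonneg s2) auto
  have zeta: "suminf z > 0" using sz by (rule suminf_pos) (simp add: z_def)
  \<comment> \<open>\<open>suminf z\<close> is zeta(3): the main terms at x / d add up to c' zeta(3)
    times the one at x, up to O(x^3).\<close>
  define c' where "c' = c / suminf z"
  have c': "c' > 0" using c zeta by (simp add: c'_def)
  define K1 where "K1 = 2 * c' * Z2"
  \<comment> \<open>Two discrepancies occur: the tail of zeta(3), multiplied by ln x, and the sum of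
    ln d / d^3 from splitting ln (x / d). As ln y \<le> y, each is bounded by zeta(2).\<close>
  have main: "\<bar>c * x ^ 3 * ln x - (\<Sum>d=1..nat \<lfloor>x\<rfloor>. c' * (x / real d) ^ 3 * ln (x / real d))\<bar> \<le> K1 * x ^ 3"
    if x: "x \<ge> 1" for x
  proof -
    define n where "n = nat \<lfloor>x\<rfloor>"
    have n: "real n \<le> x" "x < real n + 1" "n \<ge> 1" using x by (auto simp: n_def le_nat_floor)
    have tail: "suminf z = (\<Sum>d<n. z d) + (\<Sum>d. z (d + n))"
      using suminf_split_initial_segment[OF sz, of n] by simp
    have reidx: "(\<Sum>d=1..n. g d) = (\<Sum>d<n. g (Suc d))" for g :: "nat \<Rightarrow> real"
      by (simp add: sum.atLeast1_atMost_eq)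
    have "(\<Sum>d=1..n. c' * (x / real d) ^ 3 * ln (x / real d))
        = (\<Sum>d<n. c' * x ^ 3 * (z d * ln x - z d * ln (real (Suc d))))"
      unfolding reidx using x
      by (intro sum.cong) (auto simp: z_def ln_div power_divide field_simps)
    also have "\<dots> = c' * x ^ 3 * ((\<Sum>d<n. z d) * ln x - (\<Sum>d<n. z d * ln (real (Suc d))))"
      by (simp add: sum_distrib_left sum_distrib_right sum_subtractf right_diff_distrib)
    finally have "c * x ^ 3 * ln x - (\<Sum>d=1..n. c' * (x / real d) ^ 3 * ln (x / real d))
        = c' * x ^ 3 * ((\<Sum>d. z (d + n)) * ln x + (\<Sum>d<n. z d * ln (real (Suc d))))"
      using zeta tail by (simp add: c'_def field_simps)
    moreover have "(\<Sum>d. z (d + n)) * ln x \<le> Z2"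
    proof -
      have sz': "summable (\<lambda>d. z (d + n))" using sz by (simp add: summable_iff_shift)
      have "(\<Sum>d. z (d + n)) * ln x = (\<Sum>d. z (d + n) * ln x)" using sz' by (rule suminf_mult2)
      also have "\<dots> \<le> Z2" unfolding Z2_def
      proof (rule suminf_le)
        fix d
        \<comment> \<open>In the tail the denominators d + n + 1 exceed x, so the logarithm costs at
          most one power of the denominator.\<close>
        have "ln x \<le> x" using ln_le_minus_one[of x] x by linarith
        then have "ln x \<le> real (Suc (d + n))" using n(2) by simp
        then have "z (d + n) * ln x \<le> z (d + n) * real (Suc (d + n))"
          by (intro mult_left_mono) (auto simp: z_def)
        also have "\<dots> = 1 / real (Suc (d + n)) ^ 2" by (simp add: z_def power3_eq_cube power2_eq_square)
        also have "\<dots> \<le> 1 / real (Suc d) ^ 2" by (intro divide_left_mono power_mono) auto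
        finally show "z (d + n) * ln x \<le> 1 / real (Suc d) ^ 2" .
      qed (use sz' s2 in \<open>auto intro: summable_mult2\<close>)
      finally show ?thesis .
    qed
    moreover have "(\<Sum>d<n. z d * ln (real (Suc d))) \<le> Z2"
    proof -
      have "(\<Sum>d<n. z d * ln (real (Suc d))) \<le> (\<Sum>d<n. 1 / real (Suc d) ^ 2)"
      proof (rule sum_mono)
        fix d
        have "ln (real (Suc d)) \<le> real (Suc d)" using ln_le_minus_one[of "real (Suc d)"] by simp
        then have "z d * ln (real (Suc d)) \<le> z d * real (Suc d)"
          by (intro mult_left_mono) (auto simp: z_def)
        also have "\<dots> = 1 / real (Suc d) ^ 2" by (simp add: z_def power3_eq_cube power2_eq_square)
        finally show "z d * ln (real (Suc d)) \<le> 1 / real (Suc d) ^ 2" .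
      qed
      also have "\<dots> \<le> Z2" unfolding Z2_def by (rule sum_le_suminf[OF s2]) auto
      finally show ?thesis .
    qed
    moreover have "(\<Sum>d. z (d + n)) * ln x \<ge> 0"
      using x sz summable_iff_shift[of z n]
      by (intro mult_nonneg_nonneg suminf_nonneg) (simp_all, simp add: z_def)
    moreover have "(\<Sum>d<n. z d * ln (real (Suc d))) \<ge> 0"
      by (intro sum_nonneg mult_nonneg_nonneg) (auto simp: z_def)
    ultimately have "\<bar>c * x ^ 3 * ln x - (\<Sum>d=1..n. c' * (x / real d) ^ 3 * ln (x / real d))\<bar>
        \<le> c' * x ^ 3 * (2 * Z2)"
      using c' x by (simp add: abs_mult)
    then show ?thesis by (simp add: K1_def n_def algebra_simps)
  qed
  \<comment> \<open>The fixed point of K' = K + K1 + K' / 2, where 1/2 bounds the sum of 1 / d^3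
    over d \<ge> 2.\<close>
  define K' where "K' = 2 * (K + K1)"
  have "K \<ge> 0" using est[of 1] by simp
  then have K': "K' \<ge> 0" using c' Z2 by (simp add: K'_def K1_def)
  have "\<bar>f x - c' * x ^ 3 * ln x\<bar> \<le> K' * x ^ 3" if "x \<ge> 1" for x
    using that
  proof (induction "nat \<lfloor>x\<rfloor>" arbitrary: x rule: less_induct)
    case less
    define E where "E = (\<lambda>x. f x - c' * x ^ 3 * ln x)"
    define n where "n = nat \<lfloor>x\<rfloor>"
    have n: "real n \<le> x" "n \<ge> 1" using less.prems by (auto simp: n_def le_nat_floor)
    have split: "(\<Sum>d=1..n. g d) = g 1 + (\<Sum>d=2..n. g d)" for g :: "nat \<Rightarrow> real"
      using n(2) by (simp add: sum.atLeast_Suc_atMost numeral_2_eq_2)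
    have "E x = (F x - c * x ^ 3 * ln x)
        + (c * x ^ 3 * ln x - (\<Sum>d=1..n. c' * (x / real d) ^ 3 * ln (x / real d))) - (\<Sum>d=2..n. E (x / real d))"
      unfolding F[OF less.prems] n_def[symmetric] split E_def by (simp add: sum_subtractf)
    then have "\<bar>E x\<bar> \<le> K * x ^ 3 + K1 * x ^ 3 + \<bar>\<Sum>d=2..n. E (x / real d)\<bar>"
      using est[OF less.prems] main[OF less.prems] unfolding n_def[symmetric] by linarith
    also have "\<bar>\<Sum>d=2..n. E (x / real d)\<bar> \<le> (\<Sum>d=2..n. K' * x ^ 3 * (1 / real d ^ 3))"
    proof (rule order_trans[OF sum_abs sum_mono])
      fix d assume d: "d \<in> {2..n}"
      have ge: "x / real d \<ge> 1" using d n by (simp add: field_simps)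
      have "x / real d \<le> x / 2" using d less.prems by (intro divide_left_mono) auto
      \<comment> \<open>As d \<ge> 2 and x / d \<ge> 1, passing from x to x / d loses at least x / 2
        \<ge> 1, so the integer part drops and the induction hypothesis applies.\<close>
      have "\<lfloor>x / real d\<rfloor> < \<lfloor>x\<rfloor>"
      proof -
        have "x / 2 + x / 2 = x" by simp
        then have "x / real d + 1 \<le> x" using \<open>x / real d \<le> x / 2\<close> ge by linarith
        then show ?thesis by linarith
      qed
      then have "nat \<lfloor>x / real d\<rfloor> < nat \<lfloor>x\<rfloor>" using ge by linarith
      then have "\<bar>E (x / real d)\<bar> \<le> K' * (x / real d) ^ 3" unfolding E_def using less.hyps ge by blast
      then show "\<bar>E (x / real d)\<bar> \<le> K' * x ^ 3 * (1 / real d ^ 3)" by (simp add: power_divide)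
    qed
    also have "\<dots> = K' * x ^ 3 * (\<Sum>d=2..n. 1 / real d ^ 3)" by (simp only: sum_distrib_left)
    also have "\<dots> \<le> K' * x ^ 3 * (1 / 2)"
      using K' less.prems by (intro mult_left_mono sum_inverse_cubes_le) auto
    also have "K * x ^ 3 + K1 * x ^ 3 + K' * x ^ 3 * (1 / 2) = K' * x ^ 3"
      by (simp add: K'_def algebra_simps)
    finally show ?case by (simp add: E_def)
  qed
  then show ?thesis using that c' by blast
qed

section \<open>Lattice points and volumes\<close>

text \<open>The tolerance is 2 rather than 1 because a section may consist of two intervals: a
  positive discriminant excludes a middle interval of b.\<close>

definition fair :: "real set \<Rightarrow> bool" where
  "fair S \<longleftrightarrow> \<bar>real (card {n::int. real_of_int n \<in> S}) - measure lborel S\<bar> \<le> 2"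

lemma interval_lattice_points:
  fixes S :: "real set"
  assumes "is_interval S" "bounded S"
  shows "\<bar>real (card {n::int. real_of_int n \<in> S}) - measure lborel S\<bar> \<le> 1" (is ?A)
    and "finite {n::int. real_of_int n \<in> S}" (is ?B)
proof -
  have "?A \<and> ?B"
  proof (cases "S = {}")
    case False
    define a b where "a = Inf S" and "b = Sup S"
    have bd: "bdd_below S" "bdd_above S" using assms(2) by (auto intro: bounded_imp_bdd_below bounded_imp_bdd_above)
    have sub: "S \<subseteq> {a..b}" using bd by (auto simp: a_def b_def intro: cInf_lower cSup_upper)
    have ab: "a \<le> b" using sub False by fastforce
    have sup: "{a<..<b} \<subseteq> S"
    proof
      fix x assume x: "x \<in> {a<..<b}"
      obtain s where s: "s \<in> S" "s < x" using x cInf_less_iff[OF False bd(1)] by (auto simp: a_def)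
      obtain t where t: "t \<in> S" "x < t" using x less_cSup_iff[OF False bd(2)] by (auto simp: b_def)
      show "x \<in> S" using assms(1) s t unfolding is_interval_1 by (meson less_imp_le)
    qed
    have "S \<in> sets lborel" using assms(1)
      by (simp add: is_interval_convex_1 real_interval_borel_measurable is_real_interval assms)
    then have "S \<in> fmeasurable lborel"
      using emeasure_bounded_finite[OF assms(2)] by (auto simp: fmeasurable_def)
    then have "measure lborel {a<..<b} \<le> measure lborel S"
      using sup by (intro measure_mono_fmeasurable) auto
    moreover have "measure lborel S \<le> measure lborel {a..b}"
    proof (rule measure_mono_fmeasurable)
      show "{a..b} \<in> fmeasurable lborel" by (rule fmeasurableI) (auto simp: ab)
    qed (use sub \<open>S \<in> sets lborel\<close> in auto)
    ultimately have m: "measure lborel S = b - a" using ab by simp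
    have c1: "{n::int. real_of_int n \<in> S} \<subseteq> {\<lceil>a\<rceil>..\<lfloor>b\<rfloor>}" 
    proof
      fix n assume "n \<in> {n::int. real_of_int n \<in> S}"
      then have "a \<le> real_of_int n" "real_of_int n \<le> b" using sub by auto
      then show "n \<in> {\<lceil>a\<rceil>..\<lfloor>b\<rfloor>}" by (simp add: ceiling_le_iff le_floor_iff)
    qed
    have c2: "{\<lfloor>a\<rfloor> + 1..\<lceil>b\<rceil> - 1} \<subseteq> {n::int. real_of_int n \<in> S}"
    proof
      fix n assume "n \<in> {\<lfloor>a\<rfloor> + 1..\<lceil>b\<rceil> - 1}"
      then have "\<lfloor>a\<rfloor> < n" "n < \<lceil>b\<rceil>" by auto
      then have "a < real_of_int n" "real_of_int n < b" by (simp_all add: floor_less_iff less_ceiling_iff)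
      then show "n \<in> {n::int. real_of_int n \<in> S}" using sup by auto
    qed
    have fin: ?B using c1 by (rule finite_subset) simp
    have nat_le: "real (nat z) \<le> t" if "real_of_int z \<le> t" "0 \<le> t" for z t using that by (cases "z \<ge> 0") auto
    have nat_ge: "real_of_int z \<le> real (nat z)" for z by simp
    have "card {n::int. real_of_int n \<in> S} \<le> nat (\<lfloor>b\<rfloor> + 1 - \<lceil>a\<rceil>)" using card_mono[OF _ c1] by simp
    then have "real (card {n::int. real_of_int n \<in> S}) \<le> real (nat (\<lfloor>b\<rfloor> + 1 - \<lceil>a\<rceil>))" by (simp only: of_nat_le_iff)
    also have "\<dots> \<le> b - a + 1"
      using ab diff_mono[OF of_int_floor_le[of b] le_of_int_ceiling[of a]] by (intro nat_le) (simp_all add: algebra_simps)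
    finally have u: "real (card {n::int. real_of_int n \<in> S}) \<le> b - a + 1" .
    have "b - a - 1 \<le> real_of_int (\<lceil>b\<rceil> - 1 - \<lfloor>a\<rfloor>)"
      using diff_mono[OF le_of_int_ceiling[of b] of_int_floor_le[of a]] by (simp add: algebra_simps)
    also have "\<dots> \<le> real (nat (\<lceil>b\<rceil> - 1 - \<lfloor>a\<rfloor>))" by (rule nat_ge)
    also have "nat (\<lceil>b\<rceil> - 1 - \<lfloor>a\<rfloor>) \<le> card {n::int. real_of_int n \<in> S}" using card_mono[OF fin c2] by simp
    finally have "b - a - 1 \<le> real (card {n::int. real_of_int n \<in> S})" by simp
    then show ?thesis using fin m u by (simp add: abs_le_iff)
  qed simp
  then show ?A ?B by auto
qed

lemma fair_interval:
  assumes "is_interval S" "bounded S" shows "fair S"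
  using interval_lattice_points(1)[OF assms] by (simp add: fair_def)

lemma interval_borel: "is_interval S \<Longrightarrow> S \<in> sets (lborel :: real measure)"
  by (simp add: is_interval_convex_1 real_interval_borel_measurable is_real_interval)

lemma fair_Un:
  assumes "is_interval S" "bounded S" "is_interval T" "bounded T" "S \<inter> T = {}" shows "fair (S \<union> T)"
proof -
  have "{n::int. real_of_int n \<in> S \<union> T} = {n. real_of_int n \<in> S} \<union> {n. real_of_int n \<in> T}" by auto
  then have "card {n::int. real_of_int n \<in> S \<union> T} = card {n::int. real_of_int n \<in> S} + card {n::int. real_of_int n \<in> T}"
    using assms interval_lattice_points(2) by (simp add: card_Un_disjoint disjoint_iff)
  moreover have "measure lborel (S \<union> T) = measure lborel S + measure lborel T"
    using assms emeasure_bounded_finite[of S] emeasure_bounded_finite[of T] interval_borel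
    by (intro measure_Un3[THEN trans]) (auto simp: fmeasurable_def)
  ultimately show ?thesis
    using interval_lattice_points(1)[OF assms(1,2)] interval_lattice_points(1)[OF assms(3,4)]
    by (simp add: fair_def)
qed

text \<open>Interchanging sum and integral, the left side is an integral over y of the number of
  integers in a line section minus the length of that section. The integrand is at most 2 in modulus
  and vanishes outside Y.\<close>

lemma sum_sections_measure:
  fixes K :: "(real \<times> 'a::euclidean_space) set" and Y :: "'a set"
  assumes K: "K \<in> sets borel" and Y: "Y \<in> sets borel" "bounded Y"
    and sub: "\<And>x y. (x, y) \<in> K \<Longrightarrow> \<bar>x\<bar> \<le> real n \<and> y \<in> Y"
    and fair: "\<And>y. fair {x. (x, y) \<in> K}"
  shows "\<bar>(\<Sum>a\<in>{-int n..int n}. measure lborel {y. (real_of_int a, y) \<in> K}) - measure lborel K\<bar> \<le> 2 * measure lborel Y"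
proof -
  have bK: "bounded K"
    by (rule bounded_subset[of "{-real n..real n} \<times> Y"]) (use sub Y in \<open>auto intro!: bounded_Times simp: abs_le_iff\<close>, force)
  have int: "integrable (lborel \<Otimes>\<^sub>M lborel) (\<lambda>(x, y). indicator K (x, y) :: real)"
    using K emeasure_bounded_finite[OF bK] by (simp add: lborel_prod case_prod_eta)
  have secm: "{y. (x, y) \<in> K} \<in> sets borel" for x
  proof -
    have "(\<lambda>y. (x, y)) -` K \<inter> space borel \<in> sets borel"
      by (rule measurable_sets[OF _ K]) (simp add: borel_prod[symmetric])
    then show ?thesis by (simp add: vimage_def)
  qed
  have secb: "emeasure lborel {y. (x, y) \<in> K} < \<infinity>" for x
    by (rule emeasure_bounded_finite, rule bounded_subset[OF Y(2)]) (use sub in auto)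
  have sec: "integrable lborel (\<lambda>y. indicator K (x, y) :: real)"
       "(\<integral>y. indicator K (x, y) \<partial>lborel) = measure lborel {y. (x, y) \<in> K}" for x
  proof -
    have eq: "(\<lambda>y. indicator K (x, y) :: real) = indicator {y. (x, y) \<in> K}" by (auto simp: indicator_def)
    show "integrable lborel (\<lambda>y. indicator K (x, y) :: real)" unfolding eq using secm secb by simp
    show "(\<integral>y. indicator K (x, y) \<partial>lborel) = measure lborel {y. (x, y) \<in> K}" unfolding eq by simp
  qed
  have sec2: "(\<integral>x. indicator K (x, y) \<partial>lborel) = measure lborel {x. (x, y) \<in> K}" for y
  proof -
    have eq: "(\<lambda>x. indicator K (x, y) :: real) = indicator {x. (x, y) \<in> K}" by (auto simp: indicator_def)
    show ?thesis unfolding eq by simp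
  qed
  have cnt: "(\<Sum>a\<in>{-int n..int n}. indicator K (real_of_int a, y)) = real (card {a::int. real_of_int a \<in> {x. (x, y) \<in> K}})" for y
  proof -
    have "(\<Sum>a\<in>{-int n..int n}. indicator K (real_of_int a, y) :: real) = (\<Sum>a\<in>{-int n..int n}. indicator {a. (real_of_int a, y) \<in> K} a)"
      by (simp add: indicator_def)
    also have "\<dots> = real (card ({-int n..int n} \<inter> {a. (real_of_int a, y) \<in> K}))"
      by (simp add: sum.If_cases indicator_def Int_def)
    also have "{-int n..int n} \<inter> {a. (real_of_int a, y) \<in> K} = {a::int. real_of_int a \<in> {x. (x, y) \<in> K}}"
      using sub by fastforce
    finally show ?thesis .
  qed
  have i2: "integrable lborel (\<lambda>y. \<integral>x. indicator K (x, y) \<partial>lborel :: real)"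
    using lborel_pair.integrable_snd[OF int] by simp
  have "measure lborel K = (\<integral>z. indicator K z \<partial>lborel)" by simp
  also have "\<dots> = (\<integral>y. \<integral>x. indicator K (x, y) \<partial>lborel \<partial>lborel)"
    using lborel_pair.integral_snd[OF int] by (simp add: lborel_prod case_prod_eta)
  finally have m: "measure lborel K = (\<integral>y. \<integral>x. indicator K (x, y) \<partial>lborel \<partial>lborel)" .
  have "(\<Sum>a\<in>{-int n..int n}. measure lborel {y. (real_of_int a, y) \<in> K})
      = (\<integral>y. (\<Sum>a\<in>{-int n..int n}. indicator K (real_of_int a, y)) \<partial>lborel)"
    using sec by (subst Bochner_Integration.integral_sum) auto
  then have "(\<Sum>a\<in>{-int n..int n}. measure lborel {y. (real_of_int a, y) \<in> K}) - measure lborel K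
     = (\<integral>y. (\<Sum>a\<in>{-int n..int n}. indicator K (real_of_int a, y)) - (\<integral>x. indicator K (x, y) \<partial>lborel) \<partial>lborel)"
    unfolding m using sec i2 by (subst Bochner_Integration.integral_diff) auto
  also have "\<bar>\<dots>\<bar> \<le> (\<integral>y. 2 * indicator Y y \<partial>lborel)"
  proof (rule integral_abs_bound_integral)
    show "integrable lborel (\<lambda>y. (\<Sum>a\<in>{-int n..int n}. indicator K (real_of_int a, y)) - (\<integral>x. indicator K (x, y) \<partial>lborel) :: real)"
      using sec i2 by auto
    show "integrable lborel (\<lambda>y. 2 * indicator Y y :: real)" using Y emeasure_bounded_finite[OF Y(2)] by simp
    show "\<bar>(\<Sum>a\<in>{-int n..int n}. indicator K (real_of_int a, y)) - (\<integral>x. indicator K (x, y) \<partial>lborel)\<bar> \<le> (2 * indicator Y y :: real)" for y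
    proof (cases "y \<in> Y")
      case True
      then show ?thesis unfolding cnt sec2 using fair[of y] by (simp add: fair_def)
    next
      case False
      then have "{x. (x, y) \<in> K} = {}" using sub by auto
      then show ?thesis unfolding cnt sec2 using False by simp
    qed
  qed
  also have "\<dots> = 2 * measure lborel Y" by simp
  finally show ?thesis .
qed

lemma measure_real_box2: "measure lborel ({-B..B} \<times> {-C..C} :: (real \<times> real) set) = 2 * B * (2 * C)" if "B \<ge> 0" "C \<ge> 0"
proof -
  have "{-B..B} \<times> {-C..C} = cbox (-B, -C) (B, C)" by (auto simp: cbox_Pair_eq)
  then show ?thesis using that by (simp add: measure_lborel_cbox_eq Basis_prod_def prod.union_disjoint prod.reindex inj_on_def)
qed

text \<open>Davenport's principle: the coordinates pass from sums to integrals one at a time. The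
  three terms are the errors for c (2 for each pair a, b), for b (2 times the length 2 C for each
  a), and for a (2 times the area of the b, c rectangle).\<close>

lemma lattice_points_volume:
  fixes K :: "real triple set" and A B C :: nat
  assumes K: "K \<in> sets borel"
    and bd: "\<And>a b c. (a, b, c) \<in> K \<Longrightarrow> \<bar>a\<bar> \<le> real A \<and> \<bar>b\<bar> \<le> real B \<and> \<bar>c\<bar> \<le> real C"
    and fair: "\<And>b c. fair {a. (a, b, c) \<in> K}" "\<And>a c. fair {b. (a, b, c) \<in> K}" "\<And>a b. fair {c. (a, b, c) \<in> K}"
  shows "\<bar>real (card {(a, b, c). (real_of_int a, real_of_int b, real_of_int c) \<in> K}) - measure lborel K\<bar>
          \<le> 2 * ((2 * real A + 1) * (2 * real B + 1) + (2 * real A + 1) * (2 * real C) + 2 * real B * (2 * real C))"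
proof -
  define I where "I = (\<lambda>n::nat. {-int n..int n})"
  have cI: "real (card (I n)) = 2 * real n + 1" for n by (simp add: I_def)
  have secm: "{bc. (a, bc) \<in> K} \<in> sets borel" for a
  proof -
    have "(\<lambda>y. (a, y)) -` K \<inter> space borel \<in> sets borel"
      by (rule measurable_sets[OF _ K]) (simp add: borel_prod[symmetric])
    then show ?thesis by (simp add: vimage_def)
  qed
  let ?n = "\<lambda>a b. card {c::int. real_of_int c \<in> {c. (real_of_int a, real_of_int b, c) \<in> K}}"
  let ?m1 = "\<lambda>a b. measure lborel {c. (real_of_int a, real_of_int b, c) \<in> K}"
  let ?m2 = "\<lambda>a. measure lborel {bc. (real_of_int a, bc) \<in> K}"
  have bdi: "a \<in> I A \<and> b \<in> I B \<and> c \<in> I C" if "(real_of_int a, real_of_int b, real_of_int c) \<in> K" for a b c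
    using bd[OF that] by (auto simp: I_def)
  have "{(a, b, c). (real_of_int a, real_of_int b, real_of_int c) \<in> K}
     = (SIGMA a:I A. SIGMA b:I B. {c::int. real_of_int c \<in> {c. (real_of_int a, real_of_int b, c) \<in> K}})"
    using bdi by auto
  moreover have "finite {c::int. real_of_int c \<in> {c. (real_of_int a, real_of_int b, c) \<in> K}}" for a b
    by (rule finite_subset[of _ "I C"]) (use bdi in \<open>auto simp: I_def\<close>)
  ultimately have "card {(a, b, c). (real_of_int a, real_of_int b, real_of_int c) \<in> K} = (\<Sum>a\<in>I A. \<Sum>b\<in>I B. ?n a b)"
    by (simp add: card_SigmaI I_def)
  then have "real (card {(a, b, c). (real_of_int a, real_of_int b, real_of_int c) \<in> K}) - measure lborel K
     = (\<Sum>a\<in>I A. \<Sum>b\<in>I B. real (?n a b) - ?m1 a b) + (\<Sum>a\<in>I A. (\<Sum>b\<in>I B. ?m1 a b) - ?m2 a)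
       + ((\<Sum>a\<in>I A. ?m2 a) - measure lborel K)"
    by (simp add: sum_subtractf)
  moreover have "\<bar>\<Sum>a\<in>I A. \<Sum>b\<in>I B. real (?n a b) - ?m1 a b\<bar> \<le> (\<Sum>a\<in>I A. \<Sum>b\<in>I B. 2)"
    by (intro order_trans[OF sum_abs sum_mono]) (use fair(3) in \<open>simp add: fair_def\<close>)
  moreover have "\<bar>\<Sum>a\<in>I A. (\<Sum>b\<in>I B. ?m1 a b) - ?m2 a\<bar> \<le> (\<Sum>a\<in>I A. 2 * (2 * real C))"
  proof (intro order_trans[OF sum_abs sum_mono])
    fix a
    have "\<bar>(\<Sum>b\<in>{-int B..int B}. measure lborel {c. (real_of_int b, c) \<in> {bc. (real_of_int a, bc) \<in> K}}) - ?m2 a\<bar>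
       \<le> 2 * measure lborel {-real C..real C}"
      by (rule sum_sections_measure[OF secm]) (use bd fair(2) in \<open>auto simp: abs_le_iff\<close>, force+)
    then show "\<bar>(\<Sum>b\<in>I B. ?m1 a b) - ?m2 a\<bar> \<le> 2 * (2 * real C)" by (simp add: I_def)
  qed
  moreover have "\<bar>(\<Sum>a\<in>I A. ?m2 a) - measure lborel K\<bar> \<le> 2 * (2 * real B * (2 * real C))"
  proof -
    have "\<bar>(\<Sum>a\<in>{-int A..int A}. ?m2 a) - measure lborel K\<bar> \<le> 2 * measure lborel ({-real B..real B} \<times> {-real C..real C})"
    proof (rule sum_sections_measure[OF K])
      show "{-real B..real B} \<times> {-real C..real C} \<in> sets borel" by (intro borel_closed closed_Times) auto
      show "bounded ({-real B..real B} \<times> {-real C..real C})" by (intro bounded_Times) auto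
      show "\<bar>x\<bar> \<le> real A \<and> y \<in> {-real B..real B} \<times> {-real C..real C}" if "(x, y) \<in> K" for x y
        using bd[of x "fst y" "snd y"] that by (cases y) auto
      show "fair {x. (x, y) \<in> K}" for y using fair(1)[of "fst y" "snd y"] by simp
    qed
    then show ?thesis by (simp add: I_def measure_real_box2)
  qed
  ultimately show ?thesis by (simp add: cI algebra_simps)
qed

section \<open>Linear changes of variables\<close>

lemma linear_vec3: "linear (\<lambda>(a, b, c). vector [a, b, c] :: real^3)"
  by (rule linearI) (auto simp: vec_eq_iff forall_3)

lemma borel_measurable_vec3:
  "(\<lambda>(a, b, c). vector [a, b, c] :: real^3) \<in> borel_measurable (lborel :: real triple measure)"
  using linear_vec3
  by (simp add: linear_continuous_on linear_conv_bounded_linear borel_measurable_continuous_onI)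

lemma box_Pair: "box (a, c) (b, d) = box a b \<times> box c d"
  by (auto simp: box_def Basis_prod_def ball_Un)

text \<open>Carries Lebesgue measure from triples, convenient for counting, to
  \<open>real^3\<close>, where linear images are measured by \<open>det\<close>.\<close>

lemma lborel_vec3:
  "(lborel :: (real^3) measure) = distr lborel borel (\<lambda>(a, b, c). vector [a, b, c])"
proof (rule lborel_eqI)
  have m: "(\<lambda>(a, b, c). vector [a, b, c] :: real^3) \<in> borel_measurable (lborel :: real triple measure)"
    by (rule borel_measurable_vec3)
  fix l u :: "real^3"
  assume le: "\<And>b. b \<in> Basis \<Longrightarrow> l \<bullet> b \<le> u \<bullet> b"
  have le': "l $ i \<le> u $ i" for i using le[of "axis i 1"] by (simp add: inner_axis axis_in_Basis_iff)
  have "(\<lambda>(a, b, c). vector [a, b, c] :: real^3) -` box l u \<inter> space lborel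
     = box (l $ 1, l $ 2, l $ 3) (u $ 1, u $ 2, u $ 3)"
    by (auto simp: mem_box_cart forall_3 box_Pair)
  then have "emeasure (distr lborel borel (\<lambda>(a, b, c). vector [a, b, c])) (box l u)
     = emeasure lborel (box (l $ 1, l $ 2, l $ 3) (u $ 1, u $ 2, u $ 3))"
    by (subst emeasure_distr) (use m in auto)
  also have "\<dots> = ennreal ((u $ 1 - l $ 1) * ((u $ 2 - l $ 2) * (u $ 3 - l $ 3)))"
    using le' by (subst emeasure_lborel_box) (auto simp: Basis_prod_def prod.union_disjoint prod.reindex inj_on_def)
  also have "(u $ 1 - l $ 1) * ((u $ 2 - l $ 2) * (u $ 3 - l $ 3)) = (\<Prod>b\<in>Basis. (u - l) \<bullet> b)"
  proof -
    have B: "(Basis :: (real^3) set) = range (\<lambda>i. axis i 1)" by (auto simp: Basis_vec_def)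
    have inj: "inj (\<lambda>i::3. axis i (1::real))" by (auto simp: inj_on_def axis_eq_axis)
    have "(\<Prod>b\<in>Basis. (u - l) \<bullet> b) = (\<Prod>i\<in>UNIV. (u - l) $ i)"
      unfolding B prod.reindex[OF inj] by (simp add: inner_axis)
    then show ?thesis unfolding UNIV_3 by simp
  qed
  finally show "emeasure (distr lborel borel (\<lambda>(a, b, c). vector [a, b, c])) (box l u) = ennreal (\<Prod>b\<in>Basis. (u - l) \<bullet> b)" .
qed simp

text \<open>The preimage under f is the image under the inverse matrix, whose determinant is 1 /
  D.\<close>

lemma measure_linear_vimage:
  fixes S :: "real triple set"
  assumes S: "S \<in> sets borel" "bounded S"
    and f: "f = (\<lambda>(a, b, c). (m11 * a + m12 * b + m13 * c, m21 * a + m22 * b + m23 * c, m31 * a + m32 * b + m33 * c))"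
    and D: "D = m11 * (m22 * m33 - m23 * m32) - m12 * (m21 * m33 - m23 * m31) + m13 * (m21 * m32 - m22 * m31)" "D \<noteq> 0"
  shows "measure lborel (f -` S) = measure lborel S / \<bar>D\<bar>"
proof -
  define \<phi> where "\<phi> = (\<lambda>(a, b, c). vector [a, b, c] :: real^3)"
  define \<psi> where "\<psi> = (\<lambda>x::real^3. (x $ 1, x $ 2, x $ 3))"
  have \<phi>m: "\<phi> \<in> borel_measurable (lborel :: real triple measure)"
    unfolding \<phi>_def by (rule borel_measurable_vec3)
  have \<psi>m: "\<psi> -` U \<in> sets borel" if "U \<in> sets borel" for U
  proof -
    have "\<psi> \<in> borel_measurable borel"
      unfolding \<psi>_def by (intro borel_measurable_continuous_onI) (auto intro!: continuous_intros)
    from measurable_sets[OF this that] show ?thesis by simp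
  qed
  have \<psi>\<phi>: "\<psi> (\<phi> x) = x" for x by (cases x) (simp add: \<phi>_def \<psi>_def)
  have tr: "measure lborel U = measure lebesgue (\<psi> -` U)" if "U \<in> sets borel" for U
  proof -
    have "measure (lborel :: (real^3) measure) (\<psi> -` U) = measure lborel (\<phi> -` (\<psi> -` U) \<inter> space lborel)"
      unfolding lborel_vec3 \<phi>_def[symmetric] by (rule measure_distr) (use \<phi>m \<psi>m[OF that] in auto)
    also have "\<phi> -` (\<psi> -` U) \<inter> space lborel = U" by (auto simp: \<psi>\<phi>)
    finally show ?thesis using \<psi>m[OF that] by simp
  qed
  define M :: "real^3^3" where "M = vector [vector [m11, m12, m13], vector [m21, m22, m23], vector [m31, m32, m33]]"
  have det: "det M = D" by (simp add: det_3 M_def D algebra_simps)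
  obtain M' where inv: "M ** M' = mat 1" "M' ** M = mat 1"
    using D(2) det invertible_det_nz[of M] unfolding invertible_def by blast
  have "det M' = 1 / D" using arg_cong[OF inv(1), of det] det D(2) by (simp add: det_mul field_simps)
  have fM: "\<psi> (M *v x) = f (\<psi> x)" for x
    by (simp add: \<psi>_def f M_def matrix_vector_mult_def sum_3)
  have "f \<in> borel_measurable borel"
    unfolding f case_prod_beta by (intro borel_measurable_continuous_onI) (auto intro!: continuous_intros)
  from measurable_sets[OF this S(1)] have fS: "f -` S \<in> sets borel" by simp
  have "\<psi> -` (f -` S) = (\<lambda>x. M' *v x) ` (\<psi> -` S)"
  proof (intro set_eqI iffI)
    fix x assume "x \<in> \<psi> -` (f -` S)"
    then have "M *v x \<in> \<psi> -` S" by (simp add: fM)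
    moreover have "x = M' *v (M *v x)" by (simp add: matrix_vector_mul_assoc inv)
    ultimately show "x \<in> (\<lambda>x. M' *v x) ` (\<psi> -` S)" by blast
  next
    fix x assume "x \<in> (\<lambda>x. M' *v x) ` (\<psi> -` S)"
    then obtain y where "x = M' *v y" "\<psi> y \<in> S" by auto
    moreover from this have "M *v x = y" by (simp add: matrix_vector_mul_assoc inv)
    ultimately show "x \<in> \<psi> -` (f -` S)" by (simp flip: fM)
  qed
  moreover have "measure lebesgue ((\<lambda>x. M' *v x) ` (\<psi> -` S)) = \<bar>det (matrix (\<lambda>x. M' *v x))\<bar> * measure lebesgue (\<psi> -` S)"
  proof (rule measure_linear_image)
    have "bounded (\<phi> ` S)"
    proof -
      have "linear \<phi>" unfolding \<phi>_def by (rule linear_vec3)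
      then show ?thesis using S(2) bounded_linear_image linear_conv_bounded_linear by blast
    qed
    moreover have "\<psi> -` S \<subseteq> \<phi> ` S"
    proof
      fix x assume "x \<in> \<psi> -` S"
      moreover have "x = \<phi> (\<psi> x)" by (simp add: \<phi>_def \<psi>_def vec_eq_iff forall_3)
      ultimately show "x \<in> \<phi> ` S" by blast
    qed
    ultimately have "bounded (\<psi> -` S)" using bounded_subset by blast
    then show "\<psi> -` S \<in> lmeasurable" using \<psi>m[OF S(1)] by (intro bounded_set_imp_lmeasurable) auto
  qed simp
  ultimately show ?thesis
    using tr[OF S(1)] tr[OF fS] \<open>det M' = 1 / D\<close> by (simp add: abs_divide)
qed

section \<open>The maximum norm on the six coefficients\<close>

definition hgt :: "'a::linordered_idom ^ coord \<Rightarrow> 'a" where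
  "hgt x = Max (range (\<lambda>i. \<bar>x $ i\<bar>))"

lemma hgt_le_iff: "hgt x \<le> t \<longleftrightarrow> (\<forall>i. \<bar>x $ i\<bar> \<le> t)"
  unfolding hgt_def by (subst Max_le_iff) auto

lemma all_coord: "(\<forall>i. P i) \<longleftrightarrow> P C0 \<and> P C1 \<and> P C2 \<and> P C01 \<and> P C02 \<and> P C12"
  by (metis coord.exhaust)

lemma abs_le_hgt: "\<bar>x $ i\<bar> \<le> hgt x"
  using hgt_le_iff[of x "hgt x"] by simp

lemma hgt_nonneg: "0 \<le> hgt x"
  using abs_le_hgt[of x C0] by (rule order_trans[OF abs_ge_zero])

lemma hgt_attained: "\<exists>i. hgt x = \<bar>x $ i\<bar>"
proof -
  have "Max (range (\<lambda>i. \<bar>x $ i\<bar>)) \<in> range (\<lambda>i. \<bar>x $ i\<bar>)" by (rule Max_in) auto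
  then show ?thesis unfolding hgt_def by (rule imageE) blast
qed

lemma hgt_eq_0_iff: "hgt x = 0 \<longleftrightarrow> x = 0"
proof
  assume "hgt x = 0"
  then have "\<forall>i. \<bar>x $ i\<bar> \<le> 0" using abs_le_hgt[of x] by simp
  then show "x = 0" by (simp add: vec_eq_iff)
qed (simp add: hgt_def)

lemma hgt_smult: "hgt (c *s x) = \<bar>c\<bar> * hgt x"
proof (rule antisym)
  show "hgt (c *s x) \<le> \<bar>c\<bar> * hgt x"
    unfolding hgt_le_iff by (auto simp: abs_mult intro: mult_left_mono abs_le_hgt)
  obtain i where "hgt x = \<bar>x $ i\<bar>" using hgt_attained by blast
  then have "\<bar>c\<bar> * hgt x = \<bar>(c *s x) $ i\<bar>" by (simp add: abs_mult)
  then show "\<bar>c\<bar> * hgt x \<le> hgt (c *s x)" using abs_le_hgt by metis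
qed

lemma hgt_add: "hgt (x + y) \<le> hgt x + hgt y"
  unfolding hgt_le_iff
  by (intro allI) (simp add: order_trans[OF abs_triangle_ineq] add_mono abs_le_hgt)

lemma hgt_of_int: "hgt (\<chi> i. (of_int (x $ i) :: real)) = of_int (hgt x)"
proof (rule antisym)
  show "hgt (\<chi> i. (of_int (x $ i) :: real)) \<le> of_int (hgt x)"
    unfolding hgt_le_iff by (simp flip: of_int_abs add: abs_le_hgt)
  obtain i where "hgt x = \<bar>x $ i\<bar>" using hgt_attained by blast
  then show "of_int (hgt x) \<le> hgt (\<chi> i. (of_int (x $ i) :: real))"
    using abs_le_hgt[of "\<chi> i. (of_int (x $ i) :: real)" i] by simp
qed

section \<open>Volumes of linear sections of the unit ball\<close>

definition lin3 :: "'a::comm_ring_1 ^ coord \<Rightarrow> 'a ^ coord \<Rightarrow> 'a ^ coord \<Rightarrow> 'a triple \<Rightarrow> 'a ^ coord" where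
  "lin3 P Q R = (\<lambda>(a, b, c). a *s P + b *s Q + c *s R)"

definition disc :: "'a::comm_ring_1 triple \<Rightarrow> 'a" where
  "disc = (\<lambda>(a, b, c). b\<^sup>2 - 4 * a * c)"

text \<open>One parameter for all three counts: s = 0 imposes nothing and serves the split forms,
  while s = 1 and s = -1 prescribe the sign of the discriminant.\<close>

definition sgn_ok :: "int \<Rightarrow> 'a::linordered_idom triple \<Rightarrow> bool" where
  "sgn_ok s t \<longleftrightarrow> s = 0 \<or> 0 < of_int s * disc t"

text \<open>Boundedness guarantees finite volume; \<open>measure\<close> returns 0 on sets of
  infinite measure, so without it neither monotonicity nor scaling of \<open>vol3\<close> could be
  used.\<close>

definition bounded_lin3 :: "real ^ coord \<Rightarrow> real ^ coord \<Rightarrow> real ^ coord \<Rightarrow> bool" where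
  "bounded_lin3 P Q R \<longleftrightarrow> (\<exists>M. \<forall>a b c. hgt (lin3 P Q R (a, b, c)) \<le> 1 \<longrightarrow> \<bar>a\<bar> \<le> M \<and> \<bar>b\<bar> \<le> M \<and> \<bar>c\<bar> \<le> M)"

definition vol3 :: "int \<Rightarrow> real ^ coord \<Rightarrow> real ^ coord \<Rightarrow> real ^ coord \<Rightarrow> real" where
  "vol3 s P Q R = measure lborel {t. hgt (lin3 P Q R t) \<le> 1 \<and> sgn_ok s t}"

lemma lin3_scale: "lin3 P Q R (k *\<^sub>R t) = k *s lin3 P Q R t"
  by (cases t) (simp add: lin3_def vec_eq_iff algebra_simps)

lemma sgn_ok_scale: "k > 0 \<Longrightarrow> sgn_ok s (k *\<^sub>R t) \<longleftrightarrow> sgn_ok s (t :: real triple)"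
proof (cases t)
  case (fields a b c)
  assume k: "k > 0"
  have "disc (k *\<^sub>R t) = k\<^sup>2 * disc t" by (simp add: fields disc_def algebra_simps power2_eq_square)
  moreover have "of_int s * (k\<^sup>2 * disc t) = k\<^sup>2 * (of_int s * disc t)" by simp
  moreover have "0 < k\<^sup>2 * x \<longleftrightarrow> 0 < x" for x :: real using k by (simp add: zero_less_mult_iff)
  ultimately show ?thesis by (simp only: sgn_ok_def)
qed

lemma closed_lin3: "closed {t. hgt (lin3 P Q R t) \<le> (T::real)}"
proof -
  have "{t. hgt (lin3 P Q R t) \<le> T} = (\<Inter>i. {t. \<bar>lin3 P Q R t $ i\<bar> \<le> T})" by (auto simp: hgt_le_iff)
  moreover have "closed {t. \<bar>lin3 P Q R t $ i\<bar> \<le> T}" for i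
    unfolding lin3_def case_prod_beta by (intro closed_Collect_le) (auto intro!: continuous_intros)
  ultimately show ?thesis by auto
qed

lemma borel_sgn_ok: "{t. sgn_ok s t} \<in> sets (borel :: real triple measure)"
proof (cases "s = 0")
  case False
  have "open {t :: real triple. 0 < of_int s * disc t}"
    unfolding disc_def case_prod_beta by (intro open_Collect_less) (auto intro!: continuous_intros)
  then show ?thesis using False by (simp add: sgn_ok_def)
qed (simp add: sgn_ok_def)

lemma borel_lin3: "{t. hgt (lin3 P Q R t) \<le> T \<and> sgn_ok s t} \<in> sets (borel :: real triple measure)"
proof -
  have "{t. hgt (lin3 P Q R t) \<le> T \<and> sgn_ok s t} = {t. hgt (lin3 P Q R t) \<le> T} \<inter> {t. sgn_ok s t}" by auto
  then show ?thesis using closed_lin3[of P Q R T] borel_sgn_ok[of s] by auto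
qed

lemma bounded_lin3_set:
  assumes "bounded_lin3 P Q R" "T > 0"
  shows "bounded {t. hgt (lin3 P Q R t) \<le> T \<and> sgn_ok s t}"
proof -
  obtain M where M: "\<And>a b c. hgt (lin3 P Q R (a, b, c)) \<le> 1 \<Longrightarrow> \<bar>a\<bar> \<le> M \<and> \<bar>b\<bar> \<le> M \<and> \<bar>c\<bar> \<le> M"
    using assms(1) by (auto simp: bounded_lin3_def)
  have "{t. hgt (lin3 P Q R t) \<le> T \<and> sgn_ok s t} \<subseteq> {-T * M..T * M} \<times> {-T * M..T * M} \<times> {-T * M..T * M}"
  proof
    fix t assume "t \<in> {t. hgt (lin3 P Q R t) \<le> T \<and> sgn_ok s t}"
    then obtain a b c where t: "t = (a, b, c)" "hgt (lin3 P Q R (a, b, c)) \<le> T" by (cases t) auto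
    have "lin3 P Q R (a / T, b / T, c / T) = (1 / T) *s lin3 P Q R t"
      using lin3_scale[of P Q R "1 / T" t] by (simp add: t(1))
    then have "hgt (lin3 P Q R (a / T, b / T, c / T)) \<le> 1"
      using t assms(2) by (simp add: hgt_smult)
    from M[OF this] show "t \<in> {-T * M..T * M} \<times> {-T * M..T * M} \<times> {-T * M..T * M}"
      using assms(2) by (auto simp: t(1) abs_le_iff field_simps)
  qed
  moreover have "bounded ({-T * M..T * M} \<times> {-T * M..T * M} \<times> {-T * M..T * M})"
    by (intro bounded_Times) auto
  ultimately show ?thesis by (rule bounded_subset[rotated])
qed

lemma vol3_scale:
  assumes "bounded_lin3 P Q R" "T > 0"
  shows "measure lborel {t. hgt (lin3 P Q R t) \<le> T \<and> sgn_ok s t} = T ^ 3 * vol3 s P Q R"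
proof -
  let ?S = "{t. hgt (lin3 P Q R t) \<le> 1 \<and> sgn_ok s t}"
  define f where "f = (\<lambda>(a, b, c). (1 / T * a + 0 * b + 0 * c, 0 * a + 1 / T * b + 0 * c, 0 * a + 0 * b + 1 / T * c))"
  have f: "f t = (1 / T) *\<^sub>R t" for t by (cases t) (simp add: f_def)
  have "f -` ?S = {t. hgt (lin3 P Q R t) \<le> T \<and> sgn_ok s t}"
    using assms(2) by (auto simp: f lin3_scale sgn_ok_scale hgt_smult field_simps)
  moreover have "measure lborel (f -` ?S) = measure lborel ?S / \<bar>1 / T ^ 3\<bar>"
    using borel_lin3 bounded_lin3_set[OF assms(1)] assms(2)
    by (intro measure_linear_vimage[OF _ _ f_def]) (auto simp: power3_eq_cube field_simps)
  ultimately show ?thesis using assms(2) by (simp add: vol3_def)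
qed

text \<open>One region lies in the k-fold dilate of the other. The sign condition concerns only the
  parameters and is invariant under dilation.\<close>

lemma vol3_compare:
  assumes "bounded_lin3 P' Q' R'" "k > 0"
    and le: "\<And>t. hgt (lin3 P' Q' R' t) \<le> k * hgt (lin3 P Q R t)"
  shows "vol3 s P Q R \<le> k ^ 3 * vol3 s P' Q' R'"
proof -
  have "vol3 s P Q R \<le> measure lborel {t. hgt (lin3 P' Q' R' t) \<le> k \<and> sgn_ok s t}"
    unfolding vol3_def
  proof (rule measure_mono_fmeasurable)
    show "{t. hgt (lin3 P Q R t) \<le> 1 \<and> sgn_ok s t} \<subseteq> {t. hgt (lin3 P' Q' R' t) \<le> k \<and> sgn_ok s t}"
      using le assms(2) by (smt (verit) Collect_mono mult_left_le)
    show "{t. hgt (lin3 P' Q' R' t) \<le> k \<and> sgn_ok s t} \<in> fmeasurable lborel"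
      using borel_lin3 emeasure_bounded_finite[OF bounded_lin3_set[OF assms(1,2)]] by (intro fmeasurableI) auto
  qed (use borel_lin3 in auto)
  then show ?thesis using vol3_scale[OF assms(1,2)] by simp
qed

lemma is_interval_affine_le: "is_interval {x::real. \<forall>i. \<bar>\<alpha> i + \<beta> i * x\<bar> \<le> T}"
proof -
  have "\<bar>p + q * x\<bar> \<le> T" if "a \<le> x" "x \<le> b" "\<bar>p + q * a\<bar> \<le> T" "\<bar>p + q * b\<bar> \<le> T" for a b x p q :: real
  proof (cases "q \<ge> 0")
    case True
    then have "q * a \<le> q * x" "q * x \<le> q * b" using that by (auto intro: mult_left_mono)
    then show ?thesis using that by linarith
  next
    case False
    then have "q * b \<le> q * x" "q * x \<le> q * a" using that by (auto intro: mult_left_mono_neg)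
    then show ?thesis using that by linarith
  qed
  then show ?thesis unfolding is_interval_1 mem_Collect_eq by blast
qed

lemma is_interval_affine_pos: "is_interval {x::real. 0 < \<alpha> + \<beta> * x}"
proof -
  have "0 < p + q * x" if "a \<le> x" "x \<le> b" "0 < p + q * a" "0 < p + q * b" for a b x p q :: real
  proof (cases "q \<ge> 0")
    case True
    then have "q * a \<le> q * x" using that by (auto intro: mult_left_mono)
    then show ?thesis using that by linarith
  next
    case False
    then have "q * b \<le> q * x" using that by (auto intro: mult_left_mono_neg)
    then show ?thesis using that by linarith
  qed
  then show ?thesis unfolding is_interval_1 mem_Collect_eq by blast
qed

text \<open>The set of b with b^2 > d is a union of two rays, the set with b^2 < d is one interval,
  so at most two intervals meet I.\<close>

lemma fair_quadratic:
  assumes I: "is_interval I" "bounded I" and s: "s \<in> {-1, 1::real}"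
  shows "fair (I \<inter> {b. 0 < s * (b\<^sup>2 - d)})"
proof (cases "d < 0 \<or> s = -1")
  case True
  have "is_interval {b::real. 0 < s * (b\<^sup>2 - d)}"
  proof (cases "s = -1")
    case True
    \<comment> \<open>For negative d this remains true: \<open>sqrt d\<close> is then negative and
      both sides are empty.\<close>
    have "0 < s * (b\<^sup>2 - d) \<longleftrightarrow> b \<in> {-sqrt d<..<sqrt d}" for b
    proof -
      have "0 < s * (b\<^sup>2 - d) \<longleftrightarrow> \<bar>b\<bar> < sqrt d"
        using True real_sqrt_less_iff[of "b\<^sup>2" d] by simp
      then show ?thesis by (simp add: abs_less_iff) linarith
    qed
    then have "{b::real. 0 < s * (b\<^sup>2 - d)} = {-sqrt d<..<sqrt d}" by blast
    then show ?thesis by (simp add: is_interval_oo)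
  next
    case False
    then have "d < 0" "s = 1" using \<open>d < 0 \<or> s = -1\<close> s by auto
    then have "{b::real. 0 < s * (b\<^sup>2 - d)} = UNIV"
      by (auto simp: add_nonneg_pos less_le_trans)
    then show ?thesis by simp
  qed
  then show ?thesis using I by (intro fair_interval is_interval_Int) (auto intro: bounded_subset)
next
  case False
  then have d: "d \<ge> 0" "s = 1" using s by auto
  have "0 < s * (b\<^sup>2 - d) \<longleftrightarrow> b \<in> {..<-sqrt d} \<union> {sqrt d<..}" for b
  proof -
    have "0 < s * (b\<^sup>2 - d) \<longleftrightarrow> sqrt d < \<bar>b\<bar>"
      using d real_sqrt_less_iff[of d "b\<^sup>2"] by (simp add: real_sqrt_abs)
    also have "\<dots> \<longleftrightarrow> b < - sqrt d \<or> sqrt d < b" using real_sqrt_ge_zero[OF d(1)] by linarith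
    finally show ?thesis by auto
  qed
  then have "I \<inter> {b. 0 < s * (b\<^sup>2 - d)} = (I \<inter> {..<-sqrt d}) \<union> (I \<inter> {sqrt d<..})" by auto
  moreover have disj: "\<not> (x < - sqrt d \<and> sqrt d < x)" for x
    using real_sqrt_ge_zero[OF d(1)] by linarith
  have "fair ((I \<inter> {..<-sqrt d}) \<union> (I \<inter> {sqrt d<..}))"
    using I disj
    by (intro fair_Un is_interval_Int) (auto intro: bounded_subset simp: is_interval_ci is_interval_io is_interval_oi)
  ultimately show ?thesis by simp
qed

definition rv :: "int triple \<Rightarrow> real triple" where
  "rv = (\<lambda>(a, b, c). (of_int a, of_int b, of_int c))"

text \<open>The norm condition is convex. The discriminant is affine in a and in c and quadratic in
  b, so every line parallel to an axis meets the region in at most two intervals.\<close>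

lemma lin3_lattice_points:
  fixes A B C :: nat
  assumes bd: "\<And>a b c. hgt (lin3 P Q R (a, b, c)) \<le> T \<Longrightarrow> \<bar>a\<bar> \<le> real A \<and> \<bar>b\<bar> \<le> real B \<and> \<bar>c\<bar> \<le> real C"
    and s: "s \<in> {-1, 0, 1}"
  shows "\<bar>real (card {t. hgt (lin3 P Q R (rv t)) \<le> T \<and> sgn_ok s (rv t)})
      - measure lborel {t. hgt (lin3 P Q R t) \<le> T \<and> sgn_ok s t}\<bar>
    \<le> 2 * ((2 * real A + 1) * (2 * real B + 1) + (2 * real A + 1) * (2 * real C) + 2 * real B * (2 * real C))"
proof -
  let ?K = "{t. hgt (lin3 P Q R t) \<le> T \<and> sgn_ok s t}"
  have lin: "\<bar>lin3 P Q R (a, b, c) $ i\<bar> = \<bar>(a * P $ i + b * Q $ i + c * R $ i)\<bar>" for a b c i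
    by (simp add: lin3_def)
  have s': "s \<noteq> 0 \<Longrightarrow> real_of_int s \<in> {-1, 1}" using s by auto
  have bI: "bounded {a. hgt (lin3 P Q R (a, b, c)) \<le> T}" "bounded {b. hgt (lin3 P Q R (a, b, c)) \<le> T}"
    "bounded {c. hgt (lin3 P Q R (a, b, c)) \<le> T}" for a b c
    by (rule boundedI[of _ "real A"] boundedI[of _ "real B"] boundedI[of _ "real C"], use bd in force)+
  have iI: "is_interval {a. hgt (lin3 P Q R (a, b, c)) \<le> T}" "is_interval {b. hgt (lin3 P Q R (a, b, c)) \<le> T}"
    "is_interval {c. hgt (lin3 P Q R (a, b, c)) \<le> T}" for a b c
  proof -
    have "{a. hgt (lin3 P Q R (a, b, c)) \<le> T} = {x. \<forall>i. \<bar>(b * Q $ i + c * R $ i) + P $ i * x\<bar> \<le> T}"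
      unfolding hgt_le_iff lin by (simp add: algebra_simps)
    then show "is_interval {a. hgt (lin3 P Q R (a, b, c)) \<le> T}" by (simp only: is_interval_affine_le)
    have "{b. hgt (lin3 P Q R (a, b, c)) \<le> T} = {x. \<forall>i. \<bar>(a * P $ i + c * R $ i) + Q $ i * x\<bar> \<le> T}"
      unfolding hgt_le_iff lin by (simp add: algebra_simps)
    then show "is_interval {b. hgt (lin3 P Q R (a, b, c)) \<le> T}" by (simp only: is_interval_affine_le)
    have "{c. hgt (lin3 P Q R (a, b, c)) \<le> T} = {x. \<forall>i. \<bar>(a * P $ i + b * Q $ i) + R $ i * x\<bar> \<le> T}"
      unfolding hgt_le_iff lin by (simp add: algebra_simps)
    then show "is_interval {c. hgt (lin3 P Q R (a, b, c)) \<le> T}" by (simp only: is_interval_affine_le)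
  qed
  have "\<bar>real (card {(a, b, c). (real_of_int a, real_of_int b, real_of_int c) \<in> ?K}) - measure lborel ?K\<bar>
    \<le> 2 * ((2 * real A + 1) * (2 * real B + 1) + (2 * real A + 1) * (2 * real C) + 2 * real B * (2 * real C))"
  proof (rule lattice_points_volume[OF borel_lin3])
    fix a b c assume "(a, b, c) \<in> ?K"
    then show "\<bar>a\<bar> \<le> real A \<and> \<bar>b\<bar> \<le> real B \<and> \<bar>c\<bar> \<le> real C" using bd[of a b c] by simp
  next
    fix b c :: real
    have "fair ({a. hgt (lin3 P Q R (a, b, c)) \<le> T} \<inter> (if s = 0 then UNIV else {a. 0 < s * b\<^sup>2 + (- 4 * s * c) * a}))"
      using bI(1)[of b c] iI(1)[of b c] is_interval_affine_pos[of "s * b\<^sup>2" "- 4 * s * c"]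
      by (intro fair_interval is_interval_Int) (auto intro: bounded_subset simp del: of_int_mult)
    moreover have "{a. (a, b, c) \<in> ?K} = {a. hgt (lin3 P Q R (a, b, c)) \<le> T} \<inter> (if s = 0 then UNIV else {a. 0 < s * b\<^sup>2 + (- 4 * s * c) * a})"
      by (auto simp: sgn_ok_def disc_def algebra_simps)
    ultimately show "fair {a. (a, b, c) \<in> ?K}" by simp
  next
    fix a b :: real
    have "fair ({c. hgt (lin3 P Q R (a, b, c)) \<le> T} \<inter> (if s = 0 then UNIV else {c. 0 < s * b\<^sup>2 + (- 4 * s * a) * c}))"
      using bI(3)[of a b] iI(3)[of a b] is_interval_affine_pos[of "s * b\<^sup>2" "- 4 * s * a"]
      by (intro fair_interval is_interval_Int) (auto intro: bounded_subset simp del: of_int_mult)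
    moreover have "{c. (a, b, c) \<in> ?K} = {c. hgt (lin3 P Q R (a, b, c)) \<le> T} \<inter> (if s = 0 then UNIV else {c. 0 < s * b\<^sup>2 + (- 4 * s * a) * c})"
      by (auto simp: sgn_ok_def disc_def algebra_simps)
    ultimately show "fair {c. (a, b, c) \<in> ?K}" by simp
  next
    fix a c :: real
    show "fair {b. (a, b, c) \<in> ?K}"
    proof (cases "s = 0")
      case True
      then show ?thesis using fair_interval[OF iI(2) bI(2)] by (simp add: sgn_ok_def)
    next
      case False
      have "{b. (a, b, c) \<in> ?K} = {b. hgt (lin3 P Q R (a, b, c)) \<le> T} \<inter> {b. 0 < real_of_int s * (b\<^sup>2 - 4 * a * c)}"
        using False by (auto simp: sgn_ok_def disc_def)
      then show ?thesis using fair_quadratic[OF iI(2) bI(2) s'[OF False]] by simp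
    qed
  qed
  moreover have "{(a, b, c). (real_of_int a, real_of_int b, real_of_int c) \<in> ?K} = {t. hgt (lin3 P Q R (rv t)) \<le> T \<and> sgn_ok s (rv t)}"
    by (auto simp: rv_def)
  ultimately show ?thesis by simp
qed

section \<open>Products of linear forms\<close>

text \<open>A vector indexed by \<open>coord\<close> is read as a ternary quadratic form with square
  coefficients at \<open>C0\<close>, \<open>C1\<close>, \<open>C2\<close> and mixed ones at the
  others; this is the product of the linear forms with coefficient vectors l and m.\<close>

definition lprod :: "'a::comm_ring_1 triple \<Rightarrow> 'a triple \<Rightarrow> 'a ^ coord" where
  "lprod = (\<lambda>(l0, l1, l2) (m0, m1, m2). \<chi> i. case i of
      C0 \<Rightarrow> l0 * m0 | C1 \<Rightarrow> l1 * m1 | C2 \<Rightarrow> l2 * m2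
    | C01 \<Rightarrow> l0 * m1 + l1 * m0 | C02 \<Rightarrow> l0 * m2 + l2 * m0 | C12 \<Rightarrow> l1 * m2 + l2 * m1)"

definition rn :: "real triple \<Rightarrow> real" where
  "rn = (\<lambda>(x, y, z). max \<bar>x\<bar> (max \<bar>y\<bar> \<bar>z\<bar>))"

lemma lprod_component [simp]:
  "lprod (l0, l1, l2) (m0, m1, m2) $ C0 = l0 * m0" "lprod (l0, l1, l2) (m0, m1, m2) $ C1 = l1 * m1"
  "lprod (l0, l1, l2) (m0, m1, m2) $ C2 = l2 * m2" "lprod (l0, l1, l2) (m0, m1, m2) $ C01 = l0 * m1 + l1 * m0"
  "lprod (l0, l1, l2) (m0, m1, m2) $ C02 = l0 * m2 + l2 * m0" "lprod (l0, l1, l2) (m0, m1, m2) $ C12 = l1 * m2 + l2 * m1"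
  by (simp_all add: lprod_def)

lemma rn_le_iff: "rn (x, y, z) \<le> t \<longleftrightarrow> \<bar>x\<bar> \<le> t \<and> \<bar>y\<bar> \<le> t \<and> \<bar>z\<bar> \<le> t"
  by (auto simp: rn_def)

lemma rn_ge: "\<bar>x\<bar> \<le> rn (x, y, z)" "\<bar>y\<bar> \<le> rn (x, y, z)" "\<bar>z\<bar> \<le> rn (x, y, z)"
  using rn_le_iff[of x y z "rn (x, y, z)"] by auto

lemma rn_attained: "\<bar>x\<bar> = rn (x, y, z) \<or> \<bar>y\<bar> = rn (x, y, z) \<or> \<bar>z\<bar> = rn (x, y, z)"
  by (simp add: rn_def max_def)

lemma rn_nonneg: "0 \<le> rn v"
  by (cases v) (simp add: rn_def)

lemma rn_rv: "rn (rv v) = real (nrm v)"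
proof (cases v)
  case (fields x y z)
  have "max \<bar>x\<bar> (max \<bar>y\<bar> \<bar>z\<bar>) \<ge> 0" by simp
  then show ?thesis by (simp add: fields rn_def rv_def nrm_def of_int_max)
qed

lemma lprod_commute: "lprod l m = lprod m l"
  by (cases l; cases m) (simp add: vec_eq_iff all_coord algebra_simps)

lemma lprod_eq_lin3: "lprod l m = lin3 (lprod l (1, 0, 0)) (lprod l (0, 1, 0)) (lprod l (0, 0, 1)) m"
  by (cases l; cases m) (simp add: lin3_def vec_eq_iff all_coord algebra_simps)

lemma lprod_rv: "lprod (rv l) (rv m) = (\<chi> i. of_int (lprod l m $ i))"
  by (cases l; cases m) (simp add: rv_def vec_eq_iff all_coord)

lemma hgt_lprod_rv: "hgt (lprod (rv l) (rv m)) = of_int (hgt (lprod l m))"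
  by (simp add: lprod_rv hgt_of_int)

lemma lprod_add_left: "lprod (l + l') m = lprod l m + lprod l' m"
  by (cases l; cases l'; cases m) (simp add: vec_eq_iff all_coord algebra_simps)

lemma lprod_scaleR_left: "lprod (k *\<^sub>R l) m = k *s lprod l (m :: real triple)"
  by (cases l; cases m) (simp add: vec_eq_iff all_coord algebra_simps)

lemma hgt_lprod_le: "hgt (lprod l m) \<le> 2 * rn l * rn m"
proof -
  obtain l0 l1 l2 m0 m1 m2 where lm: "l = (l0, l1, l2)" "m = (m0, m1, m2)" by (cases l; cases m) auto
  have l: "\<bar>l0\<bar> \<le> rn l" "\<bar>l1\<bar> \<le> rn l" "\<bar>l2\<bar> \<le> rn l" unfolding lm by (rule rn_ge)+
  have m: "\<bar>m0\<bar> \<le> rn m" "\<bar>m1\<bar> \<le> rn m" "\<bar>m2\<bar> \<le> rn m" unfolding lm by (rule rn_ge)+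
  have p: "\<bar>x * y\<bar> \<le> rn l * rn m" if "\<bar>x\<bar> \<le> rn l" "\<bar>y\<bar> \<le> rn m" for x y
    unfolding abs_mult using that by (intro mult_mono) auto
  have q: "\<bar>x * y + z * w\<bar> \<le> 2 * (rn l * rn m)" if "\<bar>x\<bar> \<le> rn l" "\<bar>y\<bar> \<le> rn m" "\<bar>z\<bar> \<le> rn l" "\<bar>w\<bar> \<le> rn m" for x y z w
    using p[OF that(1,2)] p[OF that(3,4)] by linarith
  have nn: "rn l * rn m \<ge> 0" by (simp add: rn_nonneg)
  have p2: "\<bar>x * y\<bar> \<le> 2 * (rn l * rn m)" if "\<bar>x\<bar> \<le> rn l" "\<bar>y\<bar> \<le> rn m" for x y
    using p[OF that] nn by linarith
  have "hgt (lprod l m) \<le> 2 * (rn l * rn m)"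
    unfolding hgt_le_iff all_coord unfolding lm(1,2) lprod_component unfolding lm(1,2)[symmetric]
    using l m by (intro conjI p2 q)
  then show ?thesis by (simp add: mult.assoc)
qed

text \<open>Let x be a coordinate of l of maximal modulus. The square coefficient x z bounds one
  coordinate z of m. In a mixed coefficient x y + w z the second summand is at most |x z|, so
  another coordinate y satisfies |x y| \<le> 2 t.\<close>

lemma rn_lprod_le: "rn l * rn m \<le> 2 * hgt (lprod l m)"
proof -
  obtain l0 l1 l2 m0 m1 m2 where lm: "l = (l0, l1, l2)" "m = (m0, m1, m2)" by (cases l; cases m) auto
  define t where "t = hgt (lprod l m)"
  have "\<bar>lprod l m $ i\<bar> \<le> t" for i by (simp add: t_def abs_le_hgt)
  from this[of C0] this[of C1] this[of C2] this[of C01] this[of C02] this[of C12]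
  have t: "\<bar>l0 * m0\<bar> \<le> t" "\<bar>l1 * m1\<bar> \<le> t" "\<bar>l2 * m2\<bar> \<le> t" "\<bar>l0 * m1 + l1 * m0\<bar> \<le> t"
    "\<bar>l0 * m2 + l2 * m0\<bar> \<le> t" "\<bar>l1 * m2 + l2 * m1\<bar> \<le> t"
    by (simp_all add: lm)
  have l: "\<bar>l0\<bar> \<le> rn l" "\<bar>l1\<bar> \<le> rn l" "\<bar>l2\<bar> \<le> rn l" unfolding lm by (rule rn_ge)+
  have diag: "rn l * \<bar>y\<bar> \<le> 2 * t" if "\<bar>x\<bar> = rn l" "\<bar>x * y\<bar> \<le> t" for x y
  proof -
    have "rn l * \<bar>y\<bar> \<le> t" using that by (simp add: abs_mult)
    moreover have "0 \<le> t" using that(2) abs_ge_zero[of "x * y"] by linarith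
    ultimately show ?thesis by linarith
  qed
  have off: "rn l * \<bar>y\<bar> \<le> 2 * t" if "\<bar>x\<bar> = rn l" "\<bar>x * z\<bar> \<le> t" "\<bar>x * y + w * z\<bar> \<le> t" "\<bar>w\<bar> \<le> rn l" for x y z w
  proof -
    have "\<bar>w * z\<bar> \<le> \<bar>x * z\<bar>" unfolding abs_mult that(1) using that(4) by (intro mult_right_mono) auto
    then have "\<bar>x * y\<bar> \<le> 2 * t" using that by linarith
    then show ?thesis by (simp add: abs_mult that(1))
  qed
  have off': "rn l * \<bar>y\<bar> \<le> 2 * t" if "\<bar>x\<bar> = rn l" "\<bar>x * z\<bar> \<le> t" "\<bar>w * z + x * y\<bar> \<le> t" "\<bar>w\<bar> \<le> rn l" for x y z w
    using off[OF that(1,2) _ that(4), of y] that(3) by (simp add: add.commute)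
  have "rn l * \<bar>m0\<bar> \<le> 2 * t \<and> rn l * \<bar>m1\<bar> \<le> 2 * t \<and> rn l * \<bar>m2\<bar> \<le> 2 * t"
  proof -
    consider "\<bar>l0\<bar> = rn l" | "\<bar>l1\<bar> = rn l" | "\<bar>l2\<bar> = rn l"
      using rn_attained[of l0 l1 l2] unfolding lm(1) by blast
    then show ?thesis
    proof cases
      case 1
      then show ?thesis using diag[OF 1 t(1)] off[OF 1 t(1) t(4) l(2)] off[OF 1 t(1) t(5) l(3)] by blast
    next
      case 2
      then show ?thesis using diag[OF 2 t(2)] off'[OF 2 t(2) t(4) l(1)] off[OF 2 t(2) t(6) l(3)] by blast
    next
      case 3
      then show ?thesis using diag[OF 3 t(3)] off'[OF 3 t(3) t(5) l(1)] off'[OF 3 t(3) t(6) l(2)] by blast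
    qed
  qed
  moreover have "rn m = \<bar>m0\<bar> \<or> rn m = \<bar>m1\<bar> \<or> rn m = \<bar>m2\<bar>"
    unfolding lm using rn_attained[of m0 m1 m2] by argo
  ultimately show ?thesis unfolding t_def[symmetric] by metis
qed

lemma nrm_lprod_le: "real (nrm l) * real (nrm m) \<le> 2 * of_int (hgt (lprod l m))"
  using rn_lprod_le[of "rv l" "rv m"] by (simp add: rn_rv hgt_lprod_rv)

definition pvol :: "real triple \<Rightarrow> real" where
  "pvol l = vol3 0 (lprod l (1, 0, 0)) (lprod l (0, 1, 0)) (lprod l (0, 0, 1))"

lemma pvol_eq: "pvol l = measure lborel {m. hgt (lprod l m) \<le> 1}"
  by (simp add: pvol_def vol3_def lprod_eq_lin3[symmetric] sgn_ok_def)

lemma bounded_lprod: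
  assumes "rn l > 0"
  shows "bounded_lin3 (lprod l (1, 0, 0)) (lprod l (0, 1, 0)) (lprod l (0, 0, 1))"
  unfolding bounded_lin3_def
proof (intro exI allI impI)
  fix a b c assume "hgt (lin3 (lprod l (1, 0, 0)) (lprod l (0, 1, 0)) (lprod l (0, 0, 1)) (a, b, c)) \<le> 1"
  then have "rn l * rn (a, b, c) \<le> 2"
    using rn_lprod_le[of l "(a, b, c)"] unfolding lprod_eq_lin3[symmetric] by simp
  then have "rn (a, b, c) \<le> 2 / rn l" using assms by (simp add: field_simps)
  then show "\<bar>a\<bar> \<le> 2 / rn l \<and> \<bar>b\<bar> \<le> 2 / rn l \<and> \<bar>c\<bar> \<le> 2 / rn l" by (simp add: rn_le_iff)
qed

lemma measure_cube:
  assumes "r \<ge> 0" shows "measure lborel {m. rn m \<le> r} = (2 * r) ^ 3"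
proof -
  have "{m. rn m \<le> r} = cbox (-r, -r, -r) (r, r, r)"
    by (auto simp: rn_le_iff cbox_Pair_eq abs_le_iff)
  then show ?thesis using assms
    by (simp add: measure_lborel_cbox_eq Basis_prod_def prod.union_disjoint prod.reindex inj_on_def power3_eq_cube)
qed

lemma cube_fmeasurable: "{m. rn m \<le> r} \<in> fmeasurable lborel"
proof -
  have "{m. rn m \<le> r} = cbox (-r, -r, -r) (r, r, r)"
    by (auto simp: rn_le_iff cbox_Pair_eq abs_le_iff)
  then show ?thesis by (simp add: fmeasurable_cbox)
qed

text \<open>By the two inequalities between |l m| and |l| |m|, the region lies between the cubes of
  half side 1 / (2 |l|) and 2 / |l|.\<close>

lemma pvol_bounds:
  assumes "rn l > 0" shows "1 / rn l ^ 3 \<le> pvol l" "pvol l \<le> 64 / rn l ^ 3"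
proof -
  have m: "{m. hgt (lprod l m) \<le> 1} \<in> sets lborel"
    using borel_lin3[of "lprod l (1, 0, 0)" "lprod l (0, 1, 0)" "lprod l (0, 0, 1)" 1 0]
    by (simp add: sgn_ok_def lprod_eq_lin3[symmetric])
  have sub: "{m. hgt (lprod l m) \<le> 1} \<subseteq> {m. rn m \<le> 2 / rn l}"
  proof
    fix m assume "m \<in> {m. hgt (lprod l m) \<le> 1}"
    then have "rn l * rn m \<le> 2" using rn_lprod_le[of l m] by simp
    then show "m \<in> {m. rn m \<le> 2 / rn l}" using assms by (simp add: field_simps)
  qed
  have sup: "{m. rn m \<le> 1 / (2 * rn l)} \<subseteq> {m. hgt (lprod l m) \<le> 1}"
  proof
    fix m assume "m \<in> {m. rn m \<le> 1 / (2 * rn l)}"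
    then have "2 * rn l * rn m \<le> 1" using assms by (simp add: field_simps)
    then show "m \<in> {m. hgt (lprod l m) \<le> 1}" using hgt_lprod_le[of l m] by simp
  qed
  have fm: "{m. hgt (lprod l m) \<le> 1} \<in> fmeasurable lborel"
    using fmeasurableI2[OF cube_fmeasurable sub m] .
  have "measure lborel {m. rn m \<le> 1 / (2 * rn l)} \<le> pvol l"
    unfolding pvol_eq using sup fm fmeasurableD[OF cube_fmeasurable[of "1 / (2 * rn l)"]]
    by (intro measure_mono_fmeasurable) auto
  then show "1 / rn l ^ 3 \<le> pvol l" using assms by (simp add: measure_cube power_divide)
  have "pvol l \<le> measure lborel {m. rn m \<le> 2 / rn l}"
    unfolding pvol_eq using sub m cube_fmeasurable by (intro measure_mono_fmeasurable) auto
  then show "pvol l \<le> 64 / rn l ^ 3" using assms by (simp add: measure_cube power_divide)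
qed

lemma pvol_scale:
  assumes "k > 0" "rn l > 0" shows "pvol (k *\<^sub>R l) = pvol l / k ^ 3"
proof -
  have "pvol (k *\<^sub>R l) = measure lborel {m. hgt (lprod l m) \<le> 1 / k}"
    unfolding pvol_eq lprod_scaleR_left hgt_smult using assms by (simp add: field_simps)
  also have "\<dots> = (1 / k) ^ 3 * pvol l"
    unfolding pvol_def using vol3_scale[OF bounded_lprod[OF assms(2)], of "1 / k" 0] assms(1)
    by (simp add: sgn_ok_def lprod_eq_lin3[symmetric])
  finally show ?thesis by (simp add: power_divide)
qed

text \<open>Turns a mutual comparison up to the factor (1 + \<alpha> / n)^3 into the additive
  estimate required by \<open>log_sum\<close>: the factor minus 1 is O(1 / n), and the quantities
  themselves are O(n^-3).\<close>

lemma cube_ratio_bound: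
  fixes x y n \<alpha> M :: real
  assumes n: "n \<ge> 1" and \<alpha>: "\<alpha> \<ge> 0" and x: "x \<le> (1 + \<alpha> / n) ^ 3 * y" and y: "y \<le> (1 + \<alpha> / n) ^ 3 * x"
    and nn: "0 \<le> x" "0 \<le> y" and M: "y \<le> M / n ^ 3"
  shows "\<bar>x - y\<bar> \<le> \<alpha> * (3 + 3 * \<alpha> + \<alpha>\<^sup>2) * (1 + \<alpha>) ^ 3 * M / n ^ 4"
proof -
  define e where "e = \<alpha> / n"
  have e: "0 \<le> e" "e \<le> \<alpha>" using n \<alpha> by (auto simp: e_def field_simps mult_le_cancel_left1)
  have "(1 + e) ^ 3 - 1 = e * (3 + 3 * e + e\<^sup>2)" by (simp add: power3_eq_cube power2_eq_square algebra_simps)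
  also have "\<dots> \<le> e * (3 + 3 * \<alpha> + \<alpha>\<^sup>2)" using e by (intro mult_left_mono add_mono power_mono) auto
  finally have d: "(1 + e) ^ 3 - 1 \<le> e * (3 + 3 * \<alpha> + \<alpha>\<^sup>2)" .
  have d0: "0 \<le> (1 + e) ^ 3 - 1" using e by simp
  have ub: "0 \<le> M / n ^ 3" using M nn by linarith
  have e3: "(1 + e) ^ 3 \<le> (1 + \<alpha>) ^ 3" "1 \<le> (1 + \<alpha>) ^ 3" using e by (auto intro: power_mono)
  have "x \<le> (1 + \<alpha>) ^ 3 * (M / n ^ 3)"
    using x M e3(1) nn unfolding e_def[symmetric]
    by (meson e(1) add_nonneg_nonneg mult_mono' order_trans zero_le_one zero_le_power)
  moreover have "y \<le> (1 + \<alpha>) ^ 3 * (M / n ^ 3)"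
    using M mult_right_mono[OF e3(2) ub] by simp
  ultimately have mx: "max x y \<le> (1 + \<alpha>) ^ 3 * (M / n ^ 3)" by simp
  have "x - y \<le> ((1 + e) ^ 3 - 1) * y" using x by (simp add: e_def algebra_simps)
  moreover have "y - x \<le> ((1 + e) ^ 3 - 1) * x" using y by (simp add: e_def algebra_simps)
  moreover have "((1 + e) ^ 3 - 1) * y \<le> ((1 + e) ^ 3 - 1) * max x y" "((1 + e) ^ 3 - 1) * x \<le> ((1 + e) ^ 3 - 1) * max x y"
    using d0 by (auto intro: mult_left_mono)
  ultimately have "\<bar>x - y\<bar> \<le> ((1 + e) ^ 3 - 1) * max x y" by linarith
  also have "\<dots> \<le> e * (3 + 3 * \<alpha> + \<alpha>\<^sup>2) * ((1 + \<alpha>) ^ 3 * (M / n ^ 3))"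
    using d d0 mx nn by (intro mult_mono) (auto simp: max_def)
  also have "\<dots> = \<alpha> * (3 + 3 * \<alpha> + \<alpha>\<^sup>2) * (1 + \<alpha>) ^ 3 * M / n ^ 4"
    using n by (simp add: e_def power4_eq_xxxx power3_eq_cube mult.assoc)
  finally show ?thesis .
qed

lemma half_decomp:
  obtains e where "rv v = 2 *\<^sub>R rv (half v) + e" "rn e \<le> 1"
proof -
  obtain x y z where v: "v = (x, y, z)" by (cases v)
  have d: "real_of_int x = 2 * real_of_int (x div 2) + real_of_int (x mod 2)" for x :: int
    by (metis mult_div_mod_eq of_int_add of_int_mult of_int_numeral)
  have m: "\<bar>real_of_int (x mod 2)\<bar> \<le> 1" for x :: int by (simp add: mod2_eq_if)
  show ?thesis
  proof (rule that[of "(real_of_int (x mod 2), real_of_int (y mod 2), real_of_int (z mod 2))"])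
    show "rv v = 2 *\<^sub>R rv (half v) + (real_of_int (x mod 2), real_of_int (y mod 2), real_of_int (z mod 2))"
      using d[of x] d[of y] d[of z] by (simp only: v half_def rv_def prod.case scaleR_Pair real_scaleR_def add_Pair)
    show "rn (real_of_int (x mod 2), real_of_int (y mod 2), real_of_int (z mod 2)) \<le> 1"
      using m by (simp only: rn_le_iff simp_thms)
  qed
qed

lemma rn_add_le: "rn (v + w) \<le> rn v + rn w"
proof -
  obtain x y z x' y' z' where vw: "v = (x, y, z)" "w = (x', y', z')" by (cases v; cases w) auto
  have l: "\<bar>x\<bar> \<le> rn v" "\<bar>y\<bar> \<le> rn v" "\<bar>z\<bar> \<le> rn v" unfolding vw by (rule rn_ge)+
  have m: "\<bar>x'\<bar> \<le> rn w" "\<bar>y'\<bar> \<le> rn w" "\<bar>z'\<bar> \<le> rn w" unfolding vw by (rule rn_ge)+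
  have "rn (x + x', y + y', z + z') \<le> rn v + rn w" unfolding rn_le_iff using l m by linarith
  then show ?thesis by (simp add: vw)
qed

lemma rn_scaleR: "rn (k *\<^sub>R v) = \<bar>k\<bar> * rn v"
  by (cases v) (simp add: rn_def abs_mult max_mult_distrib_left)

text \<open>The vector v differs from twice \<open>half v\<close> by some e with |e| \<le> 1. This
  changes |l m| by at most 2 |m|, which is a fraction 4 / n of |l m|. The factor 8 reflects the
  degree -3 of \<open>pvol\<close>.\<close>

lemma pvol_doubling:
  "\<exists>C. \<forall>v. nrm (half v) \<ge> 2 \<longrightarrow> \<bar>8 * pvol (rv v) - pvol (rv (half v))\<bar> \<le> C / real (nrm (half v)) ^ 4"
proof (intro exI allI impI)
  fix v assume n2: "nrm (half v) \<ge> 2"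
  define n where "n = real (nrm (half v))"
  have n: "n \<ge> 2" using n2 by (simp add: n_def)
  obtain e where e: "rv v = 2 *\<^sub>R rv (half v) + e" "rn e \<le> 1" by (rule half_decomp)
  let ?w = "2 *\<^sub>R rv (half v)"
  have rw: "rn ?w = 2 * n" by (simp add: rn_scaleR rn_rv n_def)
  have w_eq: "?w = rv v + (-1) *\<^sub>R e" by (simp add: e(1))
  have "rn ?w \<le> rn (rv v) + rn e" using rn_add_le[of "rv v" "(-1) *\<^sub>R e"] by (simp only: w_eq[symmetric] rn_scaleR)
  then have rvn: "rn (rv v) \<ge> n" using rw e(2) n by linarith
  have ed: "hgt (lprod e m) \<le> 2 * rn m" for m
    using hgt_lprod_le[of e m] mult_right_mono[OF e(2) rn_nonneg[of m]] by linarith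
  have mb1: "2 * rn m \<le> (4 / n) * hgt (lprod ?w m)" for m
  proof -
    have "2 * n * rn m \<le> 2 * hgt (lprod ?w m)" using rn_lprod_le[of ?w m] by (simp add: rw)
    then have "n * rn m \<le> hgt (lprod ?w m)" by simp
    moreover have "0 \<le> hgt (lprod ?w m)" by (rule hgt_nonneg)
    ultimately have "2 * (n * rn m) \<le> 4 * hgt (lprod ?w m)" by linarith
    then show ?thesis using n by (simp add: field_simps)
  qed
  have mb2: "2 * rn m \<le> (4 / n) * hgt (lprod (rv v) m)" for m
  proof -
    have "n * rn m \<le> 2 * hgt (lprod (rv v) m)"
      using rn_lprod_le[of "rv v" m] mult_right_mono[OF rvn rn_nonneg[of m]] by linarith
    then show ?thesis using n by (simp add: field_simps)
  qed
  have c1: "hgt (lprod (rv v) m) \<le> (1 + 4 / n) * hgt (lprod ?w m)" for m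
    using hgt_add[of "lprod ?w m" "lprod e m"] ed[of m] mb1[of m]
    by (simp add: e(1) lprod_add_left algebra_simps)
  have c2: "hgt (lprod ?w m) \<le> (1 + 4 / n) * hgt (lprod (rv v) m)" for m
  proof -
    have "lprod ?w m = lprod (rv v) m + (-1) *s lprod e m"
      unfolding w_eq lprod_add_left lprod_scaleR_left ..
    then have "hgt (lprod ?w m) \<le> hgt (lprod (rv v) m) + \<bar>-1\<bar> * hgt (lprod e m)"
      using hgt_add[of "lprod (rv v) m" "(-1) *s lprod e m"] by (simp only: hgt_smult)
    then show ?thesis using ed[of m] mb2[of m] by (simp add: algebra_simps)
  qed
  have pos: "rn ?w > 0" "rn (rv v) > 0" "rn (rv (half v)) > 0" using rw rvn n by (auto simp: rn_rv n_def)
  have kpos: "0 < 1 + 4 / n" using n by (simp add: add_pos_pos)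
  have "pvol ?w \<le> (1 + 4 / n) ^ 3 * pvol (rv v)"
    unfolding pvol_def using c1 kpos
    by (intro vol3_compare bounded_lprod pos) (auto simp: lprod_eq_lin3[symmetric])
  moreover have "pvol (rv v) \<le> (1 + 4 / n) ^ 3 * pvol ?w"
    unfolding pvol_def using c2 kpos
    by (intro vol3_compare bounded_lprod pos) (auto simp: lprod_eq_lin3[symmetric])
  moreover have "pvol ?w = pvol (rv (half v)) / 8" using pvol_scale[of 2 "rv (half v)"] pos by simp
  ultimately have "8 * pvol (rv v) \<le> (1 + 4 / n) ^ 3 * pvol (rv (half v))"
    "pvol (rv (half v)) \<le> (1 + 4 / n) ^ 3 * (8 * pvol (rv v))" by simp_all
  then have "\<bar>8 * pvol (rv v) - pvol (rv (half v))\<bar> \<le> 4 * (3 + 3 * 4 + 4\<^sup>2) * (1 + 4) ^ 3 * 64 / n ^ 4"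
    using n pvol_bounds(2)[OF pos(3)]
    by (intro cube_ratio_bound) (auto simp: pvol_eq rn_rv n_def)
  then show "\<bar>8 * pvol (rv v) - pvol (rv (half v))\<bar> \<le> (4 * (3 + 3 * 4 + 4\<^sup>2) * (1 + 4) ^ 3 * 64) / real (nrm (half v)) ^ 4"
    by (simp add: n_def)
qed

lemma lprod_lattice_points:
  assumes T: "T \<ge> real (nrm l)" and l: "l \<noteq> 0"
  shows "\<bar>real (card {m. real_of_int (hgt (lprod l m)) \<le> T}) - T ^ 3 * pvol (rv l)\<bar> \<le> 300 * (T / real (nrm l))\<^sup>2"
proof -
  define n where "n = real (nrm l)"
  have n: "n \<ge> 1" using l nrm_pos_iff[of l] by (simp add: n_def)
  have T1: "T \<ge> 1" "T / n \<ge> 1" using T n by (auto simp: n_def[symmetric] field_simps)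
  \<comment> \<open>The coordinates of m are at most 2 T / n. Rounding up adds at most 1, and 1
    \<le> T / n by the hypothesis on T.\<close>
  define A where "A = nat \<lceil>2 * T / n\<rceil>"
  have Au: "real A \<le> 3 * (T / n)" 
  proof -
    have "0 \<le> 2 * T / n" using T1 n by simp
    then have "real A = real_of_int \<lceil>2 * T / n\<rceil>" unfolding A_def by simp
    also have "\<dots> \<le> 2 * T / n + 1" by (rule of_int_ceiling_le_add_one)
    also have "\<dots> = 2 * (T / n) + 1" by simp
    finally show ?thesis using T1 by linarith
  qed
  have Al: "2 * T / n \<le> real A" unfolding A_def by (rule real_nat_ceiling_ge)
  have bd: "\<bar>a\<bar> \<le> real A \<and> \<bar>b\<bar> \<le> real A \<and> \<bar>c\<bar> \<le> real A" if "hgt (lprod (rv l) (a, b, c)) \<le> T" for a b c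
  proof -
    have "n * rn (a, b, c) \<le> 2 * T" using rn_lprod_le[of "rv l" "(a, b, c)"] that by (simp add: rn_rv n_def)
    then have "rn (a, b, c) \<le> 2 * T / n" using n by (simp add: field_simps)
    then show ?thesis using Al rn_le_iff[of a b c "real A"] by linarith
  qed
  have "\<bar>real (card {m. hgt (lprod (rv l) (rv m)) \<le> T}) - measure lborel {m. hgt (lprod (rv l) m) \<le> T}\<bar>
     \<le> 2 * ((2 * real A + 1) * (2 * real A + 1) + (2 * real A + 1) * (2 * real A) + 2 * real A * (2 * real A))"
    using lin3_lattice_points[of "lprod (rv l) (1, 0, 0)" "lprod (rv l) (0, 1, 0)" "lprod (rv l) (0, 0, 1)" T A A A 0] bd
    by (simp add: lprod_eq_lin3[symmetric] sgn_ok_def)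
  also have "measure lborel {m. hgt (lprod (rv l) m) \<le> T} = T ^ 3 * pvol (rv l)"
  proof -
    have "rn (rv l) > 0" "T > 0" using n T1 by (simp_all add: rn_rv n_def)
    from vol3_scale[OF bounded_lprod[OF this(1)] this(2), of 0] show ?thesis
      by (simp only: pvol_def sgn_ok_def lprod_eq_lin3[symmetric] simp_thms)
  qed
  also have "2 * ((2 * real A + 1) * (2 * real A + 1) + (2 * real A + 1) * (2 * real A) + 2 * real A * (2 * real A))
     \<le> 2 * ((7 * (T / n)) * (7 * (T / n)) + (7 * (T / n)) * (6 * (T / n)) + (6 * (T / n)) * (6 * (T / n)))"
  proof -
    have *: "2 * (p * p + p * q + q * q) \<le> 2 * (x * x + x * y + y * y)"
      if "p \<le> x" "q \<le> y" "0 \<le> p" "0 \<le> q" for p q x y :: real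
      using that by (intro mult_left_mono add_mono mult_mono) auto
    show ?thesis by (rule *) (use Au T1 in linarith)+
  qed
  also have "\<dots> = 254 * (T / n)\<^sup>2" by (simp add: power2_eq_square field_simps)
  also have "\<dots> \<le> 300 * (T / n)\<^sup>2" by (rule mult_right_mono) auto
  finally show ?thesis by (simp add: hgt_lprod_rv n_def)
qed

section \<open>Primitive vectors\<close>

definition smul :: "nat \<Rightarrow> int triple \<Rightarrow> int triple" where
  "smul d = (\<lambda>(x, y, z). (int d * x, int d * y, int d * z))"

definition gcd3 :: "int triple \<Rightarrow> int" where
  "gcd3 = (\<lambda>(x, y, z). gcd x (gcd y z))"

definition prim :: "int triple \<Rightarrow> bool" where
  "prim v \<longleftrightarrow> gcd3 v = 1"

lemma gcd3_smul: "gcd3 (smul d v) = int d * gcd3 v"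
  by (cases v) (simp add: gcd3_def smul_def gcd_mult_left)

lemma gcd3_nonneg: "gcd3 v \<ge> 0"
  by (cases v) (simp add: gcd3_def)

lemma gcd3_eq_0_iff: "gcd3 v = 0 \<longleftrightarrow> v = 0"
  by (cases v) (simp add: gcd3_def zero_prod_def)

lemma prim_nonzero: "prim v \<Longrightarrow> v \<noteq> 0"
  using gcd3_eq_0_iff[of v] by (auto simp: prim_def)

lemma nrm_smul: "nrm (smul d v) = d * nrm v"
proof (cases v)
  case (fields x y z)
  have "max \<bar>int d * x\<bar> (max \<bar>int d * y\<bar> \<bar>int d * z\<bar>) = int d * max \<bar>x\<bar> (max \<bar>y\<bar> \<bar>z\<bar>)"
    by (simp add: abs_mult max_mult_distrib_left)
  then show ?thesis
    by (simp only: fields nrm_def smul_def prod.case nat_mult_distrib[OF of_nat_0_le_iff] nat_int)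
qed

lemma smul_eq_0_iff: "smul d v = 0 \<longleftrightarrow> d = 0 \<or> v = 0"
  unfolding nrm_eq_0_iff[symmetric] nrm_smul by simp

lemma prim_decomp:
  assumes "v \<noteq> 0" obtains d y where "d \<ge> 1" "prim y" "v = smul d y"
proof -
  obtain a b c where v: "v = (a, b, c)" by (cases v)
  define d where "d = nat (gcd3 v)"
  have g: "gcd3 v > 0" using assms gcd3_nonneg[of v] gcd3_eq_0_iff[of v] by linarith
  then have d: "int d = gcd3 v" "d \<ge> 1" by (simp_all add: d_def)
  define y where "y = (a div int d, b div int d, c div int d)"
  have "int d dvd a" "int d dvd b" "int d dvd c"
    unfolding d(1) v gcd3_def prod.case by (auto intro: dvd_trans[OF gcd_dvd2])
  then have vy: "v = smul d y" by (simp add: v y_def smul_def)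
  then have "int d * 1 = int d * gcd3 y" using gcd3_smul[of d y] d(1) by simp
  then have "prim y" using d(2) unfolding mult_cancel_left prim_def by simp
  then show ?thesis using that d(2) vy by blast
qed

lemma smul_prim_inj:
  assumes "prim y" "prim y'" "smul d y = smul d' y'" "d \<ge> 1" shows "d = d' \<and> y = y'"
proof -
  have "int d = int d'" using assms gcd3_smul[of d y] gcd3_smul[of d' y'] by (simp add: prim_def)
  then have "d = d'" by simp
  then show ?thesis using assms by (cases y; cases y') (simp add: smul_def)
qed

lemma smul_1 [simp]: "smul 1 v = v" by (cases v) (simp add: smul_def)

lemma nonzero_eq_smul_prim: "{v. v \<noteq> 0} = {smul d y | d y. d \<ge> 1 \<and> y \<in> {y. prim y}}"
proof (intro set_eqI iffI)
  fix v assume "v \<in> {v :: int triple. v \<noteq> 0}"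
  then obtain d y where "d \<ge> 1" "prim y" "v = smul d y" using prim_decomp[of v] by blast
  then show "v \<in> {smul d y | d y. d \<ge> 1 \<and> y \<in> {y. prim y}}" by blast
next
  fix v assume "v \<in> {smul d y | d y. d \<ge> 1 \<and> y \<in> {y. prim y}}"
  then obtain d y where "v = smul d y" "d \<ge> 1" "prim y" by blast
  then show "v \<in> {v. v \<noteq> 0}" using prim_nonzero[of y] by (simp add: smul_eq_0_iff)
qed

text \<open>Sorts X by the content d. Because h is at least 1 on P and is multiplied by d, only d
  \<le> t contribute. The result has the shape to which \<open>cubic_log_inversion\<close>
  applies.\<close>

lemma sum_scaling_decomp:
  fixes h :: "'a \<Rightarrow> real" and act :: "nat \<Rightarrow> 'a \<Rightarrow> 'a" and w :: "'a \<Rightarrow> real"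
  assumes X: "X = {act d y | d y. d \<ge> 1 \<and> y \<in> P}"
    and inj: "\<And>d d' y y'. d \<ge> 1 \<Longrightarrow> d' \<ge> 1 \<Longrightarrow> y \<in> P \<Longrightarrow> y' \<in> P \<Longrightarrow> act d y = act d' y' \<Longrightarrow> d = d' \<and> y = y'"
    and h: "\<And>d y. y \<in> P \<Longrightarrow> h (act d y) = real d * h y"
    and h1: "\<And>y. y \<in> P \<Longrightarrow> h y \<ge> 1"
    and fin: "\<And>t. finite {y \<in> P. h y \<le> t}"
  shows "(\<Sum>x | x \<in> X \<and> h x \<le> t. w x) = (\<Sum>d=1..nat \<lfloor>t\<rfloor>. \<Sum>y | y \<in> P \<and> h y \<le> t / real d. w (act d y))"
proof -
  let ?S = "SIGMA d:{1..nat \<lfloor>t\<rfloor>}. {y \<in> P. h y \<le> t / real d}"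
  have inj': "inj_on (\<lambda>(d, y). act d y) ?S"
  proof (rule inj_onI)
    fix p q assume pq: "p \<in> ?S" "q \<in> ?S" "(\<lambda>(d, y). act d y) p = (\<lambda>(d, y). act d y) q"
    obtain d y d' y' where "p = (d, y)" "q = (d', y')" by (cases p; cases q)
    then show "p = q" using pq inj[of d d' y y'] by auto
  qed
  have img: "(\<lambda>(d, y). act d y) ` ?S = {x. x \<in> X \<and> h x \<le> t}"
  proof (intro set_eqI iffI)
    fix x assume "x \<in> (\<lambda>(d, y). act d y) ` ?S"
    then obtain d y where dy: "x = act d y" "d \<ge> 1" "y \<in> P" "h y \<le> t / real d" by auto
    then have "h x \<le> t" using h[of y d] by (simp add: field_simps)
    then show "x \<in> {x. x \<in> X \<and> h x \<le> t}" using dy X by blast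
  next
    fix x assume "x \<in> {x. x \<in> X \<and> h x \<le> t}"
    then obtain d y where dy: "x = act d y" "d \<ge> 1" "y \<in> P" "h x \<le> t" using X by blast
    have "real d * h y \<le> t" using h[of y d] dy by simp
    moreover from this have "real d \<le> t" using h1[OF dy(3)] mult_left_mono[of 1 "h y" "real d"] by simp
    ultimately have "(d, y) \<in> ?S" using dy by (simp add: le_nat_floor field_simps)
    then show "x \<in> (\<lambda>(d, y). act d y) ` ?S" using dy(1) by force
  qed
  have "(\<Sum>x | x \<in> X \<and> h x \<le> t. w x) = (\<Sum>p\<in>?S. w ((\<lambda>(d, y). act d y) p))"
    unfolding img[symmetric] by (simp only: sum.reindex[OF inj'] o_def)
  also have "\<dots> = (\<Sum>d=1..nat \<lfloor>t\<rfloor>. \<Sum>y | y \<in> P \<and> h y \<le> t / real d. w (act d y))"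
    using fin by (subst sum.Sigma) (auto simp: case_prod_beta)
  finally show ?thesis .
qed

lemma card_scaling_decomp:
  fixes h :: "'a \<Rightarrow> real" and act :: "nat \<Rightarrow> 'a \<Rightarrow> 'a"
  assumes X: "X = {act d y | d y. d \<ge> 1 \<and> y \<in> P}"
    and inj: "\<And>d d' y y'. d \<ge> 1 \<Longrightarrow> d' \<ge> 1 \<Longrightarrow> y \<in> P \<Longrightarrow> y' \<in> P \<Longrightarrow> act d y = act d' y' \<Longrightarrow> d = d' \<and> y = y'"
    and h: "\<And>d y. y \<in> P \<Longrightarrow> h (act d y) = real d * h y"
    and h1: "\<And>y. y \<in> P \<Longrightarrow> h y \<ge> 1"
    and fin: "\<And>t. finite {y \<in> P. h y \<le> t}"
  shows "real (card {x \<in> X. h x \<le> t}) = (\<Sum>d=1..nat \<lfloor>t\<rfloor>. real (card {y \<in> P. h y \<le> t / real d}))"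
  using sum_scaling_decomp[OF assms, where t = t and w = "\<lambda>_. 1"] by (simp only: sum_constant mult_1_right)

section \<open>Counting pairs of linear forms\<close>

lemma lprod_smul: "lprod (smul d l) m = int d *s lprod l m" "lprod l (smul d m) = int d *s lprod l m"
proof -
  show *: "lprod (smul d l) m = int d *s lprod l m" for l m
    by (cases l; cases m) (simp add: smul_def vec_eq_iff all_coord algebra_simps)
  show "lprod l (smul d m) = int d *s lprod l m"
    using *[of m l] by (simp only: lprod_commute[of l])
qed

lemma hgt_lprod_ge_1:
  assumes "l \<noteq> 0" "m \<noteq> 0" shows "hgt (lprod l m) \<ge> (1::int)"
proof -
  have "1 \<le> real (nrm l)" "1 \<le> real (nrm m)" using assms nrm_pos_iff[of l] nrm_pos_iff[of m] by auto
  then have "1 * 1 \<le> real (nrm l) * real (nrm m)" by (intro mult_mono) auto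
  then have "0 < real_of_int (hgt (lprod l m))" using nrm_lprod_le[of l m] by linarith
  then show ?thesis by simp
qed

lemma lprod_nrm_bounds:
  assumes "l \<noteq> 0" "m \<noteq> 0" "real_of_int (hgt (lprod l m)) \<le> t"
  shows "real (nrm l) \<le> 2 * t" "real (nrm m) \<le> 2 * t"
proof -
  have 1: "1 \<le> real (nrm l)" "1 \<le> real (nrm m)" using assms nrm_pos_iff[of l] nrm_pos_iff[of m] by auto
  have le: "real (nrm l) * real (nrm m) \<le> 2 * t" using nrm_lprod_le[of l m] assms(3) by linarith
  have "real (nrm l) * 1 \<le> real (nrm l) * real (nrm m)" using 1 by (intro mult_left_mono) auto
  then show "real (nrm l) \<le> 2 * t" using le by linarith
  have "1 * real (nrm m) \<le> real (nrm l) * real (nrm m)" using 1 by (intro mult_right_mono) auto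
  then show "real (nrm m) \<le> 2 * t" using le by linarith
qed

lemma finite_nrm_real_ball: "finite {v. real (nrm v) \<le> t}"
proof (rule finite_subset[OF _ finite_nrm_ball[of "nat \<lfloor>t\<rfloor>"]])
  show "{v. real (nrm v) \<le> t} \<subseteq> {v. nrm v \<le> nat \<lfloor>t\<rfloor>}" using le_nat_floor by blast
qed

lemma card_nrm_real_ball:
  assumes "t \<ge> 0" shows "real (card {v. real (nrm v) \<le> t}) \<le> (2 * t + 1) ^ 3"
proof -
  have "card {v. real (nrm v) \<le> t} \<le> card {v. nrm v \<le> nat \<lfloor>t\<rfloor>}"
    by (rule card_mono[OF finite_nrm_ball]) (use le_nat_floor in blast)
  then have "real (card {v. real (nrm v) \<le> t}) \<le> real ((2 * nat \<lfloor>t\<rfloor> + 1) ^ 3)"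
    unfolding card_nrm_ball by (simp only: of_nat_le_iff)
  also have "\<dots> = (2 * real (nat \<lfloor>t\<rfloor>) + 1) ^ 3" by (simp add: add.commute)
  also have "\<dots> \<le> (2 * t + 1) ^ 3" using assms of_nat_floor[of t] by (intro power_mono add_mono mult_left_mono) auto
  finally show ?thesis .
qed

definition pairs :: "real \<Rightarrow> (int triple \<times> int triple) set" where
  "pairs t = {(l, m). l \<noteq> 0 \<and> m \<noteq> 0 \<and> real_of_int (hgt (lprod l m)) \<le> t}"

lemma finite_pairs: "finite (pairs t)"
proof (rule finite_subset)
  show "pairs t \<subseteq> {v. real (nrm v) \<le> 2 * t} \<times> {v. real (nrm v) \<le> 2 * t}"
  proof
    fix p assume "p \<in> pairs t"
    then show "p \<in> {v. real (nrm v) \<le> 2 * t} \<times> {v. real (nrm v) \<le> 2 * t}"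
      using lprod_nrm_bounds[of "fst p" "snd p" t] by (simp add: pairs_def case_prod_beta mem_Times_iff)
  qed
qed (simp add: finite_nrm_real_ball)

text \<open>Dirichlet's hyperbola method at r = sqrt T. Pairs with both norms at most r number
  O(r^6) = O(T^3). If both norms exceed r, then |l| |m| \<le> 2 T confines both to 2 r, again O(T^3)
  pairs. The rest is symmetric in l and m, and twice ln r is ln T.\<close>

lemma pairs_asymptotics:
  obtains c K where "c > 0" "\<And>T. T \<ge> 1 \<Longrightarrow> \<bar>real (card (pairs T)) - c * T ^ 3 * ln T\<bar> \<le> K * T ^ 3"
proof -
  obtain C0 where C0: "\<And>v. nrm (half v) \<ge> 2 \<Longrightarrow> \<bar>8 * pvol (rv v) - pvol (rv (half v))\<bar> \<le> C0 / real (nrm (half v)) ^ 4"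
    using pvol_doubling by blast
  define C where "C = max 64 C0"
  have lower: "1 / real (nrm v) ^ 3 \<le> pvol (rv v)" if "v \<noteq> 0" for v
    using pvol_bounds(1)[of "rv v"] that nrm_pos_iff[of v] by (simp add: rn_rv)
  have upper: "pvol (rv v) \<le> C / real (nrm v) ^ 3" if "v \<noteq> 0" for v
  proof -
    have "pvol (rv v) \<le> 64 / real (nrm v) ^ 3" using pvol_bounds(2)[of "rv v"] that nrm_pos_iff[of v] by (simp add: rn_rv)
    also have "\<dots> \<le> C / real (nrm v) ^ 3" by (intro divide_right_mono) (auto simp: C_def)
    finally show ?thesis .
  qed
  have dbl: "\<bar>8 * pvol (rv v) - pvol (rv (half v))\<bar> \<le> C / real (nrm (half v)) ^ 4" if "nrm (half v) \<ge> 2" for v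
  proof -
    have "C0 / real (nrm (half v)) ^ 4 \<le> C / real (nrm (half v)) ^ 4" by (intro divide_right_mono) (auto simp: C_def)
    then show ?thesis using C0[OF that] by linarith
  qed
  obtain \<kappa> D where \<kappa>: "\<kappa> > 0"
    and D: "\<And>R. R \<ge> 1 \<Longrightarrow> \<bar>(\<Sum>v | v \<noteq> 0 \<and> real (nrm v) \<le> R. pvol (rv v)) - \<kappa> * ln R\<bar> \<le> D"
    using log_sum[OF zero_less_one lower upper dbl] by blast
  show ?thesis
  proof (rule that[OF \<kappa>])
    fix T :: real assume T: "T \<ge> 1"
    define r where "r = sqrt T"
    have r: "r \<ge> 1" "r * r = T" "r \<le> T" 
    proof -
      show 1: "r \<ge> 1" and 2: "r * r = T" using T by (simp_all add: r_def)
      show "r \<le> T" using mult_left_mono[OF 1, of r] 1 2 by simp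
    qed
    have "r ^ 6 = (r * r) ^ 3" by (simp add: power_mult_distrib flip: power_add)
    then have T3: "r ^ 6 = T ^ 3" by (simp only: r(2))
    define S1 where "S1 = {(l, m) \<in> pairs T. real (nrm l) \<le> r}"
    define S2 where "S2 = {(l, m) \<in> pairs T. real (nrm m) \<le> r}"
    define S3 where "S3 = {(l, m) \<in> pairs T. \<not> real (nrm l) \<le> r \<and> \<not> real (nrm m) \<le> r}"
    have fin: "finite S1" "finite S2" "finite S3"
      unfolding S1_def S2_def S3_def by (rule finite_subset[OF _ finite_pairs[of T]], blast)+
    have S: "pairs T = S1 \<union> S2 \<union> S3" by (auto simp: S1_def S2_def S3_def)
    have dis: "(S1 \<union> S2) \<inter> S3 = {}" by (auto simp: S1_def S2_def S3_def)
    have swap: "prod.swap p \<in> S2 \<longleftrightarrow> p \<in> S1" "prod.swap p \<in> S1 \<longleftrightarrow> p \<in> S2" for p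
      using lprod_commute[of "fst p" "snd p"] unfolding S1_def S2_def pairs_def by (cases p; auto)+
    have "S2 = prod.swap ` S1"
    proof (intro set_eqI iffI)
      fix p assume "p \<in> S2"
      then have "prod.swap p \<in> S1" by (simp only: swap)
      then have "prod.swap (prod.swap p) \<in> prod.swap ` S1" by (rule imageI)
      then show "p \<in> prod.swap ` S1" by (simp only: swap_swap)
    next
      fix p assume "p \<in> prod.swap ` S1"
      then show "p \<in> S2" using swap(1) by blast
    qed
    then have "card S2 = card S1" by (simp add: card_image)
    then have cardS: "real (card (pairs T)) = 2 * real (card S1) - real (card (S1 \<inter> S2)) + real (card S3)"
      using card_Un_disjoint[of "S1 \<union> S2" S3] card_Un_Int[OF fin(1,2)] fin dis unfolding S by simp
    have prodball: "real (card ({v. real (nrm v) \<le> t} \<times> {v. real (nrm v) \<le> t})) \<le> ((2 * t + 1) ^ 3) ^ 2" if "t \<ge> 0" for t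
      unfolding card_cartesian_product of_nat_mult power2_eq_square
      using card_nrm_real_ball[OF that] that by (intro mult_mono) auto
    have "real (card (S1 \<inter> S2)) \<le> 20000 * T ^ 3"
    proof -
      have "card (S1 \<inter> S2) \<le> card ({v. real (nrm v) \<le> r} \<times> {v. real (nrm v) \<le> r})"
        by (rule card_mono) (auto simp: S1_def S2_def finite_nrm_real_ball)
      then have "real (card (S1 \<inter> S2)) \<le> real (card ({v. real (nrm v) \<le> r} \<times> {v. real (nrm v) \<le> r}))"
        by (simp only: of_nat_le_iff)
      also have "\<dots> \<le> ((2 * r + 1) ^ 3) ^ 2" using r by (intro prodball) auto
      also have "\<dots> \<le> ((3 * r) ^ 3) ^ 2" using r by (intro power_mono) auto
      also have "\<dots> = 729 * r ^ 6" by (simp add: power_mult_distrib flip: power_mult)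
      also have "\<dots> \<le> 20000 * T ^ 3" unfolding T3 using T by (intro mult_right_mono) auto
      finally show ?thesis .
    qed
    moreover have "real (card S3) \<le> 20000 * T ^ 3"
    proof -
      have small: "real x \<le> 2 * r" if "real x * real y \<le> 2 * T" "\<not> real y \<le> r" for x y :: nat
      proof -
        have "real x * r \<le> real x * real y" using that by (intro mult_left_mono) auto
        then have "real x * r \<le> (2 * r) * r" using that(1) r(2) by (simp add: mult.assoc)
        then show ?thesis using r by simp
      qed
      have "S3 \<subseteq> {v. real (nrm v) \<le> 2 * r} \<times> {v. real (nrm v) \<le> 2 * r}"
      proof
        fix p assume p: "p \<in> S3"
        obtain l m where lm: "p = (l, m)" by (cases p)
        have b: "real_of_int (hgt (lprod l m)) \<le> T" "\<not> real (nrm l) \<le> r" "\<not> real (nrm m) \<le> r"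
          using p by (simp_all add: lm S3_def pairs_def)
        have "real (nrm l) * real (nrm m) \<le> 2 * T" using nrm_lprod_le[of l m] b(1) by linarith
        then show "p \<in> {v. real (nrm v) \<le> 2 * r} \<times> {v. real (nrm v) \<le> 2 * r}"
          using small[of "nrm l" "nrm m"] small[of "nrm m" "nrm l"] b by (simp add: lm mult.commute)
      qed
      then have "card S3 \<le> card ({v. real (nrm v) \<le> 2 * r} \<times> {v. real (nrm v) \<le> 2 * r})"
        by (rule card_mono[rotated]) (auto simp: finite_nrm_real_ball)
      then have "real (card S3) \<le> real (card ({v. real (nrm v) \<le> 2 * r} \<times> {v. real (nrm v) \<le> 2 * r}))"
        by (simp only: of_nat_le_iff)
      also have "\<dots> \<le> ((2 * (2 * r) + 1) ^ 3) ^ 2" using r by (intro prodball) auto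
      also have "\<dots> \<le> ((5 * r) ^ 3) ^ 2" using r by (intro power_mono) auto
      also have "\<dots> = 15625 * r ^ 6" by (simp add: power_mult_distrib flip: power_mult)
      also have "\<dots> \<le> 20000 * T ^ 3" unfolding T3 using T by (intro mult_right_mono) auto
      finally show ?thesis .
    qed
    moreover have "\<bar>real (card S1) - T ^ 3 * (\<Sum>v | v \<noteq> 0 \<and> real (nrm v) \<le> r. pvol (rv v))\<bar> \<le> 8000 * T ^ 3"
    proof -
      let ?L = "{v :: int triple. v \<noteq> 0 \<and> real (nrm v) \<le> r}"
      let ?M = "\<lambda>l. {m. m \<noteq> 0 \<and> real_of_int (hgt (lprod l m)) \<le> T}"
      have finL: "finite ?L" by (rule finite_subset[OF _ finite_nrm_real_ball[of r]]) auto
      have finM: "finite (?M l)" if "l \<in> ?L" for l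
      proof (rule finite_subset[OF _ finite_nrm_real_ball[of "2 * T"]], rule subsetI)
        fix m assume "m \<in> ?M l"
        then show "m \<in> {v. real (nrm v) \<le> 2 * T}" using lprod_nrm_bounds(2)[of l m T] that by simp
      qed
      have "S1 = Sigma ?L ?M"
        unfolding S1_def pairs_def by (rule set_eqI) (simp only: mem_Collect_eq mem_Sigma_iff split_paired_all prod.case, blast)
      then have cS1: "real (card S1) = (\<Sum>l\<in>?L. real (card (?M l)))" using finL finM by simp
      have "\<bar>real (card S1) - T ^ 3 * (\<Sum>v\<in>?L. pvol (rv v))\<bar> = \<bar>\<Sum>l\<in>?L. real (card (?M l)) - T ^ 3 * pvol (rv l)\<bar>"
        by (simp add: cS1 sum_subtractf sum_distrib_left)
      also have "\<dots> \<le> (\<Sum>l\<in>?L. 301 * T\<^sup>2 * (1 / real (nrm l) ^ 2))"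
      proof (rule order_trans[OF sum_abs sum_mono])
        fix l assume l: "l \<in> ?L"
        then have nl: "nrm l > 0" "real (nrm l) \<le> T" using nrm_pos_iff[of l] r by auto
        \<comment> \<open>The volume count includes m = 0, which \<open>pairs\<close> excludes; the
          difference 1 is absorbed by (T / |l|)^2 \<ge> 1.\<close>
        have eq: "{m. real_of_int (hgt (lprod l m)) \<le> T} = insert 0 (?M l)"
        proof -
          have "lprod l 0 = 0" by (cases l) (simp add: zero_prod_def vec_eq_iff all_coord)
          then have "real_of_int (hgt (lprod l 0)) \<le> T" using T by (simp add: hgt_eq_0_iff[THEN iffD2])
          then show ?thesis by auto
        qed
        then have "real (card {m. real_of_int (hgt (lprod l m)) \<le> T}) = real (card (?M l)) + 1"
          unfolding eq using finM[OF l] by (subst card_insert_disjoint) auto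
        then have "\<bar>real (card (?M l)) - T ^ 3 * pvol (rv l)\<bar> \<le> 300 * (T / real (nrm l))\<^sup>2 + 1"
          using lprod_lattice_points[of l T] nl l by auto
        also have "1 \<le> (T / real (nrm l))\<^sup>2" using nl by (intro one_le_power) (simp add: field_simps)
        finally show "\<bar>real (card (?M l)) - T ^ 3 * pvol (rv l)\<bar> \<le> 301 * T\<^sup>2 * (1 / real (nrm l) ^ 2)"
          by (simp add: power_divide)
      qed
      also have "\<dots> = 301 * T\<^sup>2 * (\<Sum>l\<in>?L. 1 / real (nrm l) ^ 2)" by (simp only: sum_distrib_left)
      also have "(\<Sum>l\<in>?L. 1 / real (nrm l) ^ 2) \<le> 26 * (\<Sum>n=1..nat \<lfloor>r\<rfloor>. real n ^ 2 * (1 / real n ^ 2))"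
        by (rule sum_nrm_le) (auto simp: le_nat_floor)
      also have "(\<Sum>n=1..nat \<lfloor>r\<rfloor>. real n ^ 2 * (1 / real n ^ 2)) = (\<Sum>n=1..nat \<lfloor>r\<rfloor>. 1)"
        by (rule sum.cong) auto
      also have "\<dots> = real (nat \<lfloor>r\<rfloor>)" by (simp only: sum_constant card_atLeastAtMost mult_1_right diff_Suc_1 Suc_eq_plus1 diff_add_inverse2)
      also have "\<dots> \<le> T" by (rule order_trans[OF of_nat_floor]) (use r in linarith)+
      finally have "\<bar>real (card S1) - T ^ 3 * (\<Sum>v\<in>?L. pvol (rv v))\<bar> \<le> 301 * T\<^sup>2 * (26 * T)"
        using T by (simp add: mult_left_mono)
      also have "\<dots> = 7826 * T ^ 3" by (simp add: power2_eq_square power3_eq_cube)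
      also have "\<dots> \<le> 8000 * T ^ 3" using T by (intro mult_right_mono) auto
      finally show ?thesis .
    qed
    moreover have "\<bar>T ^ 3 * (\<Sum>v | v \<noteq> 0 \<and> real (nrm v) \<le> r. pvol (rv v)) - T ^ 3 * (\<kappa> * ln r)\<bar> \<le> T ^ 3 * D"
      unfolding right_diff_distrib[symmetric] abs_mult using D[OF r(1)] T by (simp add: mult_left_mono)
    moreover have "2 * (T ^ 3 * (\<kappa> * ln r)) = \<kappa> * T ^ 3 * ln T"
    proof -
      have "ln T = 2 * ln r" using T by (simp add: r_def ln_sqrt)
      then show ?thesis by simp
    qed
    moreover have "(56000 + 2 * D) * T ^ 3 = 56000 * T ^ 3 + 2 * (T ^ 3 * D)" by (simp add: algebra_simps)
    ultimately show "\<bar>real (card (pairs T)) - \<kappa> * T ^ 3 * ln T\<bar> \<le> (56000 + 2 * D) * T ^ 3"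
      unfolding cardS by linarith
  qed
qed

text \<open>The content is removed from l and then from m by two applications of the inversion. Each
  divides the constant by zeta(3) and keeps the error O(T^3).\<close>

lemma prim_pairs_asymptotics:
  obtains c K where "c > 0" "\<And>T. T \<ge> 1 \<Longrightarrow>
    \<bar>real (card {(l, m). prim l \<and> prim m \<and> real_of_int (hgt (lprod l m)) \<le> T}) - c * T ^ 3 * ln T\<bar> \<le> K * T ^ 3"
proof -
  let ?h = "\<lambda>p. real_of_int (hgt (lprod (fst p) (snd p)))"
  have finp: "finite {p \<in> P. ?h p \<le> t}" if "\<And>p. p \<in> P \<Longrightarrow> fst p \<noteq> 0 \<and> snd p \<noteq> 0" for P t
  proof (rule finite_subset[OF _ finite_pairs[of t]], rule subsetI)
    fix p assume "p \<in> {p \<in> P. ?h p \<le> t}"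
    then show "p \<in> pairs t" using that[of p] by (simp add: pairs_def case_prod_beta)
  qed
  have ge1: "1 \<le> ?h p" if "fst p \<noteq> 0 \<and> snd p \<noteq> 0" for p
    using hgt_lprod_ge_1[of "fst p" "snd p"] that by simp
  let ?P1 = "{p :: int triple \<times> int triple. prim (fst p) \<and> snd p \<noteq> 0}"
  let ?P2 = "{p. prim (fst p) \<and> prim (snd p)}"
  have d1: "real (card {p \<in> {p. fst p \<noteq> 0 \<and> snd p \<noteq> 0}. ?h p \<le> t}) = (\<Sum>d=1..nat \<lfloor>t\<rfloor>. real (card {p \<in> ?P1. ?h p \<le> t / real d}))" for t
  proof (rule card_scaling_decomp[where act = "\<lambda>d p. (smul d (fst p), snd p)"])
    show "{p. fst p \<noteq> 0 \<and> snd p \<noteq> 0} = {(smul d (fst y), snd y) | d y. 1 \<le> d \<and> y \<in> ?P1}"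
    proof (intro set_eqI iffI)
      fix p :: "int triple \<times> int triple" assume "p \<in> {p. fst p \<noteq> 0 \<and> snd p \<noteq> 0}"
      then obtain l m where p: "p = (l, m)" "l \<noteq> 0" "m \<noteq> 0" by (cases p) simp
      obtain d y where "d \<ge> 1" "prim y" "l = smul d y" using prim_decomp[OF p(2)] .
      then have "p = (smul d (fst (y, m)), snd (y, m)) \<and> 1 \<le> d \<and> (y, m) \<in> ?P1" using p by simp
      then show "p \<in> {(smul d (fst y), snd y) | d y. 1 \<le> d \<and> y \<in> ?P1}" by blast
    next
      fix p assume "p \<in> {(smul d (fst y), snd y) | d y. 1 \<le> d \<and> y \<in> ?P1}"
      then obtain d y where "p = (smul d (fst y), snd y)" "1 \<le> d" "y \<in> ?P1" by blast
      then show "p \<in> {p. fst p \<noteq> 0 \<and> snd p \<noteq> 0}" using prim_nonzero[of "fst y"] by (simp add: smul_eq_0_iff)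
    qed
    show "d = d' \<and> y = y'" if "1 \<le> d" "1 \<le> d'" "y \<in> ?P1" "y' \<in> ?P1" "(smul d (fst y), snd y) = (smul d' (fst y'), snd y')" for d d' y y'
      using smul_prim_inj[of "fst y" "fst y'" d d'] that by (simp add: prod_eq_iff)
    show "finite {y \<in> ?P1. ?h y \<le> t}" for t by (rule finp) (use prim_nonzero in simp)
    show "1 \<le> ?h y" if "y \<in> ?P1" for y by (rule ge1) (use that prim_nonzero in simp)
  qed (simp_all add: lprod_smul hgt_smult)
  have d2: "real (card {p \<in> ?P1. ?h p \<le> t}) = (\<Sum>d=1..nat \<lfloor>t\<rfloor>. real (card {p \<in> ?P2. ?h p \<le> t / real d}))" for t
  proof (rule card_scaling_decomp[where act = "\<lambda>d p. (fst p, smul d (snd p))"])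
    show "?P1 = {(fst y, smul d (snd y)) | d y. 1 \<le> d \<and> y \<in> ?P2}"
    proof (intro set_eqI iffI)
      fix p assume "p \<in> ?P1"
      then obtain l m where p: "p = (l, m)" "prim l" "m \<noteq> 0" by (cases p) simp
      obtain d y where "d \<ge> 1" "prim y" "m = smul d y" using prim_decomp[OF p(3)] .
      then have "p = (fst (l, y), smul d (snd (l, y))) \<and> 1 \<le> d \<and> (l, y) \<in> ?P2" using p by simp
      then show "p \<in> {(fst y, smul d (snd y)) | d y. 1 \<le> d \<and> y \<in> ?P2}" by blast
    next
      fix p assume "p \<in> {(fst y, smul d (snd y)) | d y. 1 \<le> d \<and> y \<in> ?P2}"
      then obtain d y where "p = (fst y, smul d (snd y))" "1 \<le> d" "y \<in> ?P2" by blast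
      then show "p \<in> ?P1" using prim_nonzero[of "snd y"] by (simp add: smul_eq_0_iff)
    qed
    show "d = d' \<and> y = y'" if "1 \<le> d" "1 \<le> d'" "y \<in> ?P2" "y' \<in> ?P2" "(fst y, smul d (snd y)) = (fst y', smul d' (snd y'))" for d d' y y'
      using smul_prim_inj[of "snd y" "snd y'" d d'] that by (simp add: prod_eq_iff)
    show "finite {y \<in> ?P2. ?h y \<le> t}" for t by (rule finp) (use prim_nonzero in simp)
    show "1 \<le> ?h y" if "y \<in> ?P2" for y by (rule ge1) (use that prim_nonzero in simp)
  qed (simp_all add: lprod_smul hgt_smult)
  obtain c K where c: "c > 0" and K: "\<And>T. T \<ge> 1 \<Longrightarrow> \<bar>real (card (pairs T)) - c * T ^ 3 * ln T\<bar> \<le> K * T ^ 3"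
    using pairs_asymptotics by blast
  have pe: "pairs t = {p \<in> {p. fst p \<noteq> 0 \<and> snd p \<noteq> 0}. ?h p \<le> t}" for t
    by (rule set_eqI) (simp add: pairs_def case_prod_beta)
  obtain c1 K1 where c1: "c1 > 0" and K1: "\<And>x. x \<ge> 1 \<Longrightarrow> \<bar>real (card {p \<in> ?P1. ?h p \<le> x}) - c1 * x ^ 3 * ln x\<bar> \<le> K1 * x ^ 3"
    using cubic_log_inversion[OF d1 c K[unfolded pe]] by blast
  obtain c2 K2 where c2: "c2 > 0" and K2: "\<And>x. x \<ge> 1 \<Longrightarrow> \<bar>real (card {p \<in> ?P2. ?h p \<le> x}) - c2 * x ^ 3 * ln x\<bar> \<le> K2 * x ^ 3"
    using cubic_log_inversion[OF d2 c1 K1] by blast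
  have "{(l, m). prim l \<and> prim m \<and> real_of_int (hgt (lprod l m)) \<le> T} = {p \<in> ?P2. ?h p \<le> T}" for T
    by (rule set_eqI) (simp add: case_prod_beta)
  then show ?thesis using K2 by (intro that[OF c2]) (simp only:)
qed

section \<open>Binary quadratic forms in two linear forms\<close>

definition cross :: "'a::comm_ring_1 triple \<Rightarrow> 'a triple \<Rightarrow> 'a triple" where
  "cross = (\<lambda>(x, y, z) (x', y', z'). (y * z' - z * y', z * x' - x * z', x * y' - y * x'))"

text \<open>The ternary form a U^2 + b U V + c V^2, where U and V are the linear forms with
  coefficient vectors u and v.\<close>

definition qf :: "'a::comm_ring_1 triple \<Rightarrow> 'a triple \<Rightarrow> 'a triple \<Rightarrow> 'a ^ coord" where
  "qf u v = lin3 (lprod u u) (lprod u v) (lprod v v)"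

lemma qf_component [simp]:
  "qf (p0, p1, p2) (r0, r1, r2) (a, b, c) $ C0 = a * (p0 * p0) + b * (p0 * r0) + c * (r0 * r0)"
  "qf (p0, p1, p2) (r0, r1, r2) (a, b, c) $ C1 = a * (p1 * p1) + b * (p1 * r1) + c * (r1 * r1)"
  "qf (p0, p1, p2) (r0, r1, r2) (a, b, c) $ C2 = a * (p2 * p2) + b * (p2 * r2) + c * (r2 * r2)"
  "qf (p0, p1, p2) (r0, r1, r2) (a, b, c) $ C01 = a * (p0 * p1 + p1 * p0) + b * (p0 * r1 + p1 * r0) + c * (r0 * r1 + r1 * r0)"
  "qf (p0, p1, p2) (r0, r1, r2) (a, b, c) $ C02 = a * (p0 * p2 + p2 * p0) + b * (p0 * r2 + p2 * r0) + c * (r0 * r2 + r2 * r0)"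
  "qf (p0, p1, p2) (r0, r1, r2) (a, b, c) $ C12 = a * (p1 * p2 + p2 * p1) + b * (p1 * r2 + p2 * r1) + c * (r1 * r2 + r2 * r1)"
  by (simp_all add: qf_def lin3_def)

section \<open>Volumes of regions of binary forms and their dependence on the vertex\<close>

definition qvol :: "int \<Rightarrow> real triple \<Rightarrow> real triple \<Rightarrow> real" where
  "qvol s u v = vol3 s (lprod u u) (lprod u v) (lprod v v)"

text \<open>The two vectors have cross product (x, y, 1). This is the affine chart of vertices with
  nonzero last coordinate, in which a, b, c occur themselves as coefficients of the form.\<close>

definition fvol :: "int \<Rightarrow> real \<Rightarrow> real \<Rightarrow> real" where
  "fvol s x y = qvol s (1, 0, - x) (0, 1, - y)"

lemma qvol_eq: "qvol s u v = measure lborel {t. hgt (qf u v t) \<le> 1 \<and> sgn_ok s t}"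
  by (simp only: qvol_def vol3_def qf_def)

lemma cross_rot: "cross (rot u) (rot v) = rot (cross u v)"
  by (cases u; cases v) (simp add: rot_def cross_def)

lemma hgt_qf_rot: "hgt (qf (rot u) (rot v) t) = hgt (qf u v (t :: real triple))"
proof -
  have "hgt (qf (rot u) (rot v) t) \<le> z \<longleftrightarrow> hgt (qf u v t) \<le> z" for z
    unfolding hgt_le_iff all_coord
    by (cases u; cases v; cases t) (simp add: rot_def add.commute mult.commute conj_ac)
  then show ?thesis by (meson antisym order_refl)
qed

lemma qvol_rot: "qvol s (rot u) (rot v) = qvol s u v"
  by (simp only: qvol_eq hgt_qf_rot)

lemma qf_change:
  "qf (p *\<^sub>R u + q *\<^sub>R v) (r *\<^sub>R u + w *\<^sub>R v) (a, b, c :: real)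
    = qf u v (p\<^sup>2 * a + p * r * b + r\<^sup>2 * c, 2 * p * q * a + (p * w + q * r) * b + 2 * r * w * c,
        q\<^sup>2 * a + q * w * b + w\<^sup>2 * c)"
  by (cases u; cases v) (simp add: vec_eq_iff all_coord power2_eq_square algebra_simps)

text \<open>Binary forms transform under the symmetric square of the matrix of the change of basis.
  Its determinant is the cube of p w - q r, and the discriminant is multiplied by the square of p w
  - q r, so its sign is preserved.\<close>

lemma qvol_change:
  assumes bd: "bounded_lin3 (lprod u u) (lprod u v) (lprod v v)" and D: "p * w - q * r \<noteq> 0"
  shows "qvol s (p *\<^sub>R u + q *\<^sub>R v) (r *\<^sub>R u + w *\<^sub>R v) = qvol s u v / \<bar>p * w - q * r\<bar> ^ 3"
proof -
  let ?S = "{t. hgt (qf u v t) \<le> 1 \<and> sgn_ok s t}"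
  define f where "f = (\<lambda>(a, b, c). (p\<^sup>2 * a + p * r * b + r\<^sup>2 * c,
      2 * p * q * a + (p * w + q * r) * b + 2 * r * w * c, q\<^sup>2 * a + q * w * b + w\<^sup>2 * c))"
  have disc: "disc (f t) = (p * w - q * r)\<^sup>2 * disc t" for t
    by (cases t) (simp add: f_def disc_def power2_eq_square algebra_simps)
  have pos: "(p * w - q * r)\<^sup>2 > 0" using D by simp
  have ok: "sgn_ok s (f t) \<longleftrightarrow> sgn_ok s t" for t
  proof -
    have "of_int s * disc (f t) = (p * w - q * r)\<^sup>2 * (of_int s * disc t)" by (simp add: disc)
    then show ?thesis using pos by (simp only: sgn_ok_def zero_less_mult_iff) auto
  qed
  have "{t. hgt (qf (p *\<^sub>R u + q *\<^sub>R v) (r *\<^sub>R u + w *\<^sub>R v) t) \<le> 1 \<and> sgn_ok s t} = f -` ?S"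
  proof (rule set_eqI)
    fix t :: "real triple"
    obtain a b c where t: "t = (a, b, c)" by (cases t)
    show "t \<in> {t. hgt (qf (p *\<^sub>R u + q *\<^sub>R v) (r *\<^sub>R u + w *\<^sub>R v) t) \<le> 1 \<and> sgn_ok s t} \<longleftrightarrow> t \<in> f -` ?S"
      unfolding t mem_Collect_eq vimage_eq ok qf_change by (simp add: f_def)
  qed
  moreover have "measure lborel (f -` ?S) = measure lborel ?S / \<bar>(p * w - q * r) ^ 3\<bar>"
  proof (rule measure_linear_vimage[OF _ _ f_def])
    show "?S \<in> sets borel" unfolding qf_def by (rule borel_lin3)
    show "bounded ?S" unfolding qf_def by (rule bounded_lin3_set[OF bd]) simp
    show "(p * w - q * r) ^ 3 = p\<^sup>2 * ((p * w + q * r) * w\<^sup>2 - 2 * r * w * (q * w))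
        - p * r * (2 * p * q * w\<^sup>2 - 2 * r * w * q\<^sup>2) + r\<^sup>2 * (2 * p * q * (q * w) - (p * w + q * r) * q\<^sup>2)"
      by (simp add: power2_eq_square power3_eq_cube algebra_simps)
    show "(p * w - q * r) ^ 3 \<noteq> 0" using D by simp
  qed
  ultimately show ?thesis by (simp only: qvol_eq power_abs)
qed

lemma face_component:
  "qf (1, 0, - x) (0, 1, - y) (a, b, c :: real) $ C0 = a" "qf (1, 0, - x) (0, 1, - y) (a, b, c) $ C1 = c"
  "qf (1, 0, - x) (0, 1, - y) (a, b, c) $ C01 = b"
  "qf (1, 0, - x) (0, 1, - y) (a, b, c) $ C2 = a * (x * x) + b * (x * y) + c * (y * y)"
  "qf (1, 0, - x) (0, 1, - y) (a, b, c) $ C02 = - (2 * (a * x) + b * y)"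
  "qf (1, 0, - x) (0, 1, - y) (a, b, c) $ C12 = - (b * x + 2 * (c * y))"
  by simp_all

lemma hgt_face_ge:
  "\<bar>a\<bar> \<le> hgt (qf (1, 0, - x) (0, 1, - y) (a, b, c :: real))"
  "\<bar>b\<bar> \<le> hgt (qf (1, 0, - x) (0, 1, - y) (a, b, c :: real))"
  "\<bar>c\<bar> \<le> hgt (qf (1, 0, - x) (0, 1, - y) (a, b, c :: real))"
  using abs_le_hgt[of "qf (1, 0, - x) (0, 1, - y) (a, b, c)" C0]
    abs_le_hgt[of "qf (1, 0, - x) (0, 1, - y) (a, b, c)" C01]
    abs_le_hgt[of "qf (1, 0, - x) (0, 1, - y) (a, b, c)" C1] by simp_all

lemma bounded_face:
  "bounded_lin3 (lprod (1, 0, - x) (1, 0, - x)) (lprod (1, 0, - x) (0, 1, - y)) (lprod (0, 1, - y) (0, 1, - y))"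
  unfolding bounded_lin3_def qf_def[symmetric] using hgt_face_ge order_trans by blast

text \<open>Orthogonality to the cross product determines the third coordinates of u and v from the
  others. The change from the chart basis to u, v therefore has determinant z.\<close>

lemma qvol_face:
  assumes "cross u v = (x, y, z)" "z \<noteq> 0"
  shows "qvol s u v = fvol s (x / z) (y / z) / \<bar>z\<bar> ^ 3"
proof -
  obtain p q k r w m where uv: "u = (p, q, k)" "v = (r, w, m)" by (cases u; cases v)
  have x: "x = q * m - k * w" and y: "y = k * r - p * m" and z: "z = p * w - q * r"
    using assms(1) by (simp_all add: uv cross_def)
  have "- (p * x + q * y) = k * z" "- (r * x + w * y) = m * z" by (simp_all add: x y z algebra_simps)
  then have "k = - (p * (x / z)) - q * (y / z)" "m = - (r * (x / z)) - w * (y / z)"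
    using assms(2) by (simp_all add: field_simps)
  then have u: "u = p *\<^sub>R (1, 0, - (x / z)) + q *\<^sub>R (0, 1, - (y / z))"
    and v: "v = r *\<^sub>R (1, 0, - (x / z)) + w *\<^sub>R (0, 1, - (y / z))"
    by (simp_all add: uv)
  show ?thesis unfolding fvol_def by (subst u, subst v, subst qvol_change[OF bounded_face]) (use assms(2) z in simp_all)
qed

text \<open>In a chart where some coordinate of the cross product is nonzero,
  \<open>qvol_face\<close> expresses the volume through the cross product alone.\<close>

lemma qvol_unique:
  assumes "cross u v = cross u' v'" "cross u v \<noteq> 0" shows "qvol s u v = qvol s u' v'"
proof -
  obtain x y z where c: "cross u v = (x, y, z)" by (cases "cross u v")
  then have c': "cross u' v' = (x, y, z)" using assms(1) by simp
  have r1: "cross (rot u) (rot v) = (y, z, x)" "cross (rot u') (rot v') = (y, z, x)"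
    unfolding cross_rot c c' by (simp_all add: rot_def)
  have r2: "cross (rot (rot u)) (rot (rot v)) = (z, x, y)" "cross (rot (rot u')) (rot (rot v')) = (z, x, y)"
    unfolding cross_rot c c' by (simp_all add: rot_def)
  consider "z \<noteq> 0" | "x \<noteq> 0" | "y \<noteq> 0" using assms(2) c by (auto simp: zero_prod_def)
  then show ?thesis
  proof cases
    case 1 show ?thesis using qvol_face[OF c 1] qvol_face[OF c' 1] by simp
  next
    case 2
    then have "qvol s (rot u) (rot v) = qvol s (rot u') (rot v')"
      using qvol_face[OF r1(1) 2] qvol_face[OF r1(2) 2] by simp
    then show ?thesis by (simp only: qvol_rot)
  next
    case 3
    then have "qvol s (rot (rot u)) (rot (rot v)) = qvol s (rot (rot u')) (rot (rot v'))"
      using qvol_face[OF r2(1) 3] qvol_face[OF r2(2) 3] by simp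
    then show ?thesis by (simp only: qvol_rot)
  qed
qed

lemma exists_basis:
  assumes "v \<noteq> (0 :: real triple)" shows "\<exists>p. cross (fst p) (snd p) = v"
proof -
  have *: "\<exists>p. cross (fst p) (snd p) = (x, y, z)" if "z \<noteq> 0" for x y z :: real
    using that by (intro exI[of _ "((z, 0, - x), (0, 1, - (y / z)))"]) (simp add: cross_def)
  obtain x y z where v: "v = (x, y, z)" by (cases v)
  consider "z \<noteq> 0" | "x \<noteq> 0" | "y \<noteq> 0" using assms v by (auto simp: zero_prod_def)
  then show ?thesis
  proof cases
    case 1 then show ?thesis using * v by simp
  next
    case 2
    then obtain p where "cross (fst p) (snd p) = (y, z, x)" using * by blast
    then have "cross (rot (rot (fst p))) (rot (rot (snd p))) = v" by (simp only: cross_rot) (simp add: rot_def v)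
    then show ?thesis by (intro exI[of _ "(rot (rot (fst p)), rot (rot (snd p)))"]) simp
  next
    case 3
    then obtain p where "cross (fst p) (snd p) = (z, x, y)" using * by blast
    then have "cross (rot (fst p)) (rot (snd p)) = v" by (simp only: cross_rot) (simp add: rot_def v)
    then show ?thesis by (intro exI[of _ "(rot (fst p), rot (snd p))"]) simp
  qed
qed

text \<open>By the invariance of \<open>qvol\<close> under unimodular changes of the pair of linear forms, the
  choice of the pair is immaterial.\<close>

definition kvol :: "int \<Rightarrow> real triple \<Rightarrow> real" where
  "kvol s v = (let p = SOME p. cross (fst p) (snd p) = v in qvol s (fst p) (snd p))"

lemma kvol_eq:
  assumes "cross u w = v" "v \<noteq> 0" shows "kvol s v = qvol s u w"
proof -
  have "cross (fst (SOME p. cross (fst p) (snd p) = v)) (snd (SOME p. cross (fst p) (snd p) = v)) = v"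
    by (rule someI_ex[OF exists_basis[OF assms(2)]])
  then show ?thesis unfolding kvol_def Let_def by (intro qvol_unique) (use assms in simp_all)
qed

lemma kvol_rot: "v \<noteq> 0 \<Longrightarrow> kvol s (rot v) = kvol s v"
proof -
  assume v: "v \<noteq> 0"
  then obtain p where p: "cross (fst p) (snd p) = v" using exists_basis by blast
  have "kvol s (rot v) = qvol s (rot (fst p)) (rot (snd p))"
    by (rule kvol_eq) (use p v in \<open>simp_all add: cross_rot\<close>)
  then show ?thesis using kvol_eq[OF p v] by (simp only: qvol_rot)
qed

lemma kvol_face:
  assumes "z \<noteq> 0" shows "kvol s (x, y, z) = fvol s (x / z) (y / z) / \<bar>z\<bar> ^ 3"
proof -
  have c: "cross (z, 0, - x) (0, 1, - (y / z)) = (x, y, z)" using assms by (simp add: cross_def)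
  have "(x, y, z) \<noteq> 0" using assms by (simp add: zero_prod_def)
  then show ?thesis using kvol_eq[OF c] qvol_face[OF c assms] by simp
qed

lemma rn_rot: "rn (rot v) = rn v"
  by (cases v) (simp add: rot_def rn_def max.commute max.left_commute)

text \<open>Packs the appropriate cyclic shift as a linear isometry that preserves
  \<open>kvol\<close>, so that only chart points with |x|, |y| \<le> 1 need to be bounded.\<close>

lemma max_coordinate_last:
  obtains f :: "real triple \<Rightarrow> real triple" where "\<bar>snd (snd (f v))\<bar> = rn v"
    "\<And>x. rn (f x) = rn x" "\<And>x y. f (x + y) = f x + f y" "\<And>k x. f (k *\<^sub>R x) = k *\<^sub>R f x"
    "\<And>s x. x \<noteq> 0 \<Longrightarrow> kvol s (f x) = kvol s x"
proof -
  obtain x y z where v: "v = (x, y, z)" by (cases v)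
  have add: "rot (x + y) = rot x + rot y" for x y :: "real triple" by (cases x; cases y) (simp add: rot_def)
  have sc: "rot (k *\<^sub>R x) = k *\<^sub>R rot x" for k and x :: "real triple" by (cases x) (simp add: rot_def)
  consider "\<bar>z\<bar> = rn v" | "\<bar>x\<bar> = rn v" | "\<bar>y\<bar> = rn v" using rn_attained[of x y z] v by auto
  then show ?thesis
  proof cases
    case 1 then show ?thesis by (intro that[of "\<lambda>x. x"]) (simp_all add: v)
  next
    case 2 then show ?thesis
      by (intro that[of rot]) (simp_all add: v rn_rot add sc kvol_rot, simp add: rot_def)
  next
    case 3 then show ?thesis
      by (intro that[of "\<lambda>x. rot (rot x)"]) (simp_all add: v rn_rot add sc kvol_rot, simp add: rot_def)
  qed
qed

lemma rn_eq_0_iff: "rn v = 0 \<longleftrightarrow> v = 0"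
proof (cases v)
  case (fields x y z)
  have "rn v \<le> 0 \<longleftrightarrow> v = 0" unfolding fields rn_le_iff by (simp add: zero_prod_def)
  then show ?thesis using rn_nonneg[of v] by linarith
qed

text \<open>Scaling fixes the chart coordinates x / z and y / z and acts only on the factor
  |z|^-3.\<close>

lemma kvol_scale:
  assumes "v \<noteq> 0" "k > 0" shows "kvol s (k *\<^sub>R v) = kvol s v / k ^ 3"
proof -
  obtain f where f: "\<bar>snd (snd (f v))\<bar> = rn v" "\<And>k x. f (k *\<^sub>R x) = k *\<^sub>R f x" "\<And>s x. x \<noteq> 0 \<Longrightarrow> kvol s (f x) = kvol s x"
    using max_coordinate_last[of v] by metis
  obtain x y z where fv: "f v = (x, y, z)" by (cases "f v")
  have z: "z \<noteq> 0" using f(1) fv assms(1) rn_eq_0_iff[of v] by auto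
  have kv: "k *\<^sub>R v \<noteq> 0" using assms by simp
  have "kvol s (k *\<^sub>R v) = kvol s (k * x, k * y, k * z)"
    using f(3)[OF kv, of s] by (simp add: f(2) fv)
  also have "\<dots> = fvol s (x / z) (y / z) / \<bar>z\<bar> ^ 3 / k ^ 3"
    using assms(2) z by (subst kvol_face) (simp_all add: abs_mult power_mult_distrib)
  also have "fvol s (x / z) (y / z) / \<bar>z\<bar> ^ 3 = kvol s v"
    using f(3)[OF assms(1), of s] kvol_face[OF z, of s x y] by (simp add: fv)
  finally show ?thesis .
qed

lemma abs_mult_le: "\<bar>a :: real\<bar> \<le> A \<Longrightarrow> \<bar>b\<bar> \<le> B \<Longrightarrow> \<bar>a * b\<bar> \<le> A * B"
  unfolding abs_mult by (intro mult_mono) auto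

lemma hgt_face_le:
  assumes x: "\<bar>x\<bar> \<le> 1" "\<bar>y\<bar> \<le> 1" and t: "\<bar>a\<bar> \<le> 1 / 4" "\<bar>b\<bar> \<le> 1 / 4" "\<bar>c\<bar> \<le> 1 / 4"
  shows "hgt (qf (1, 0, - x) (0, 1, - y) (a, b, c :: real)) \<le> 1"
proof -
  note xx = abs_mult_le[OF x(1) x(1)] abs_mult_le[OF x(1) x(2)] abs_mult_le[OF x(2) x(2)]
  note e = abs_mult_le[OF t(1) x(1)] abs_mult_le[OF t(2) x(2)] abs_mult_le[OF t(2) x(1)] abs_mult_le[OF t(3) x(2)]
    abs_mult_le[OF t(1) xx(1)] abs_mult_le[OF t(2) xx(2)] abs_mult_le[OF t(3) xx(3)]
  have "\<bar>a\<bar> \<le> 1" "\<bar>b\<bar> \<le> 1" "\<bar>c\<bar> \<le> 1" using t by linarith+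
  moreover have "\<bar>a * (x * x) + b * (x * y) + c * (y * y)\<bar> \<le> 1" using e(5-7) by linarith
  moreover have "\<bar>- (2 * (a * x) + b * y)\<bar> \<le> 1" using e(1,2) by linarith
  moreover have "\<bar>- (b * x + 2 * (c * y))\<bar> \<le> 1" using e(3,4) by linarith
  ultimately show ?thesis unfolding hgt_le_iff all_coord face_component by blast
qed

lemma fvol_bounds:
  assumes x: "\<bar>x\<bar> \<le> 1" "\<bar>y\<bar> \<le> 1" and s: "s \<in> {-1, 1}"
  shows "1 / 2048 \<le> fvol s x y" "fvol s x y \<le> 8"
proof -
  let ?S = "{t. hgt (qf (1, 0, - x) (0, 1, - y) t) \<le> 1 \<and> sgn_ok s t}"
  have meas: "?S \<in> sets lborel" using borel_lin3 unfolding qf_def by simp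
  have sub: "?S \<subseteq> {t. rn t \<le> 1}"
  proof
    fix t assume t: "t \<in> ?S"
    obtain a b c where abc: "t = (a, b, c)" by (cases t)
    show "t \<in> {t. rn t \<le> 1}" 
      using t hgt_face_ge(1)[of a x y b c] hgt_face_ge(2)[of b x y a c] hgt_face_ge(3)[of c x y a b]
      unfolding abc by (simp add: rn_le_iff)
  qed
  have fm: "?S \<in> fmeasurable lborel" using fmeasurableI2[OF cube_fmeasurable sub meas] .
  have "fvol s x y \<le> measure lborel {t. rn t \<le> 1}"
    unfolding fvol_def qvol_eq using sub meas cube_fmeasurable by (intro measure_mono_fmeasurable) auto
  then show "fvol s x y \<le> 8" by (simp add: measure_cube)
  \<comment> \<open>Boxes inside the region. For s = 1, b^2 \<ge> 1/64 exceeds 4 |a c| \<le> 1/256,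
    and the volume is 1/2048. For s = -1, b^2 \<le> 1/64 is below 4 a c \<ge> 1/16, and the volume
    is 1/256.\<close>
  define l u :: "real triple" where "l = (if s = 1 then (-1/32, 1/8, -1/32) else (1/8, -1/8, 1/8))"
    and "u = (if s = 1 then (1/32, 1/4, 1/32) else (1/4, 1/8, 1/4))"
  have "cbox l u \<subseteq> ?S"
  proof
    fix t assume t: "t \<in> cbox l u"
    obtain a b c where abc: "t = (a, b, c)" by (cases t)
    show "t \<in> ?S"
    proof (cases "s = 1")
      case True
      then have "- 1 / 32 \<le> a" "a \<le> 1 / 32" "1/8 \<le> b" "b \<le> 1/4" "- 1 / 32 \<le> c" "c \<le> 1 / 32"
        using t by (simp_all add: abc l_def u_def cbox_Pair_eq)
      then have b: "\<bar>a\<bar> \<le> 1/32" "1/8 \<le> b" "b \<le> 1/4" "\<bar>c\<bar> \<le> 1/32" by linarith+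
      have "(1/8)\<^sup>2 \<le> b\<^sup>2" using b by (intro power_mono) auto
      moreover have "\<bar>a * c\<bar> \<le> 1/32 * (1/32)" using b by (intro abs_mult_le)
      ultimately have "4 * (a * c) < b\<^sup>2" unfolding power2_eq_square by linarith
      moreover have "hgt (qf (1, 0, - x) (0, 1, - y) (a, b, c)) \<le> 1" 
        using b by (intro hgt_face_le x) linarith+
      ultimately show ?thesis using True by (simp add: abc sgn_ok_def disc_def mult.assoc)
    next
      case False
      then have s1: "s = -1" using s by simp
      have "1/8 \<le> a" "a \<le> 1/4" "- 1 / 8 \<le> b" "b \<le> 1 / 8" "1/8 \<le> c" "c \<le> 1/4"
        using t False by (simp_all add: abc l_def u_def cbox_Pair_eq)
      then have b: "1/8 \<le> a" "a \<le> 1/4" "\<bar>b\<bar> \<le> 1/8" "1/8 \<le> c" "c \<le> 1/4" by linarith+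
      have "\<bar>b\<bar>\<^sup>2 \<le> (1/8)\<^sup>2" using b by (intro power_mono) auto
      moreover have "1/8 * (1/8) \<le> a * c" using b by (intro mult_mono) auto
      ultimately have "b\<^sup>2 < 4 * (a * c)" unfolding power2_abs unfolding power2_eq_square by linarith
      moreover have "hgt (qf (1, 0, - x) (0, 1, - y) (a, b, c)) \<le> 1"
        using b by (intro hgt_face_le x) linarith+
      ultimately show ?thesis using s1 by (simp add: abc sgn_ok_def disc_def mult.assoc)
    qed
  qed
  then have "measure lborel (cbox l u) \<le> fvol s x y"
    unfolding fvol_def qvol_eq using fm by (intro measure_mono_fmeasurable) auto
  moreover have "1 / 2048 \<le> measure lborel (cbox l u)"
    by (simp add: l_def u_def measure_lborel_cbox_eq Basis_prod_def prod.union_disjoint prod.reindex inj_on_def)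
  ultimately show "1 / 2048 \<le> fvol s x y" by linarith
qed

lemma kvol_bounds:
  assumes v: "v \<noteq> 0" and s: "s \<in> {-1, 1}"
  shows "1 / 2048 / rn v ^ 3 \<le> kvol s v" "kvol s v \<le> 8 / rn v ^ 3"
proof -
  obtain f where f: "\<bar>snd (snd (f v))\<bar> = rn v" "\<And>x. rn (f x) = rn x" "\<And>s x. x \<noteq> 0 \<Longrightarrow> kvol s (f x) = kvol s x"
    using max_coordinate_last[of v] by metis
  obtain x y z where fv: "f v = (x, y, z)" by (cases "f v")
  have zr: "\<bar>z\<bar> = rn v" and pos: "rn v > 0" using f(1) fv v rn_eq_0_iff[of v] rn_nonneg[of v] by auto
  have "\<bar>x\<bar> \<le> \<bar>z\<bar>" "\<bar>y\<bar> \<le> \<bar>z\<bar>" using rn_le_iff[of x y z "rn v"] f(2)[of v] zr unfolding fv by auto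
  then have w: "\<bar>x / z\<bar> \<le> 1" "\<bar>y / z\<bar> \<le> 1" using zr pos by (simp_all add: abs_divide)
  have "kvol s v = fvol s (x / z) (y / z) / rn v ^ 3"
    using f(3)[OF v, of s] kvol_face[of z s x y] zr pos unfolding fv by auto
  then show "1 / 2048 / rn v ^ 3 \<le> kvol s v" "kvol s v \<le> 8 / rn v ^ 3"
    using fvol_bounds[OF w s] pos by (auto intro!: divide_right_mono simp del: divide_divide_eq_left)
qed

text \<open>In the chart |a|, |b|, |c| are bounded by the norm h of the form. Moving x and y by
  \<delta> changes the coefficient at \<open>C2\<close> by at most (4 + 4 + 2 + 2) h \<delta>, and
  the other coefficients by less.\<close>

lemma fvol_compare:
  assumes d: "\<bar>x - x'\<bar> \<le> \<delta>" "\<bar>y - y'\<bar> \<le> \<delta>" and b: "\<bar>x\<bar> \<le> 2" "\<bar>y\<bar> \<le> 2" "\<bar>x'\<bar> \<le> 2" "\<bar>y'\<bar> \<le> 2"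
  shows "fvol s x y \<le> (1 + 12 * \<delta>) ^ 3 * fvol s x' y'"
proof -
  have \<delta>: "\<delta> \<ge> 0" using d by linarith
  have "hgt (qf (1, 0, - x') (0, 1, - y') t) \<le> (1 + 12 * \<delta>) * hgt (qf (1, 0, - x) (0, 1, - y) t)" for t
  proof -
    obtain a b' c where t: "t = (a, b', c)" by (cases t)
    define h where "h = hgt (qf (1, 0, - x) (0, 1, - y) t)"
    have abc: "\<bar>a\<bar> \<le> h" "\<bar>b'\<bar> \<le> h" "\<bar>c\<bar> \<le> h" unfolding h_def t by (rule hgt_face_ge)+
    have h0: "h \<ge> 0" using abc by linarith
    have "\<bar>qf (1, 0, - x) (0, 1, - y) t $ i\<bar> \<le> h" for i unfolding h_def by (rule abs_le_hgt)
    from this[of C2] this[of C02] this[of C12]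
    have e: "\<bar>a * (x * x) + b' * (x * y) + c * (y * y)\<bar> \<le> h" "\<bar>2 * (a * x) + b' * y\<bar> \<le> h" "\<bar>b' * x + 2 * (c * y)\<bar> \<le> h"
      unfolding t face_component abs_minus_cancel by blast+
    have d': "\<bar>x' - x\<bar> \<le> \<delta>" "\<bar>y' - y\<bar> \<le> \<delta>" using d by linarith+
    have b4: "\<bar>x' + x\<bar> \<le> 4" "\<bar>y' + y\<bar> \<le> 4" using b by linarith+
    note p = abs_mult_le[OF abc(1) d'(1)] abs_mult_le[OF abc(2) d'(2)] abs_mult_le[OF abc(2) d'(1)] abs_mult_le[OF abc(3) d'(2)]
    note q = abs_mult_le[OF p(1) b4(1)] abs_mult_le[OF p(4) b4(2)] abs_mult_le[OF p(3) b(4)] abs_mult_le[OF p(2) b(1)]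
    have hd: "h * \<delta> \<ge> 0" using h0 \<delta> by simp
    have c2: "a * (x' * x') + b' * (x' * y') + c * (y' * y')
        = (a * (x * x) + b' * (x * y) + c * (y * y)) + a * (x' - x) * (x' + x) + c * (y' - y) * (y' + y)
          + b' * (x' - x) * y' + b' * (y' - y) * x" by (simp add: algebra_simps)
    have c02: "2 * (a * x') + b' * y' = (2 * (a * x) + b' * y) + 2 * (a * (x' - x)) + b' * (y' - y)" by (simp add: algebra_simps)
    have c12: "b' * x' + 2 * (c * y') = (b' * x + 2 * (c * y)) + b' * (x' - x) + 2 * (c * (y' - y))" by (simp add: algebra_simps)
    have hh: "(1 + 12 * \<delta>) * h = h + 12 * (h * \<delta>)" by (simp add: algebra_simps)
    have "\<bar>a * (x' * x') + b' * (x' * y') + c * (y' * y')\<bar> \<le> h + 12 * (h * \<delta>)"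
      unfolding c2 using e(1) q by linarith
    moreover have "\<bar>- (2 * (a * x') + b' * y')\<bar> \<le> h + 12 * (h * \<delta>)" unfolding c02 using e(2) p hd by linarith
    moreover have "\<bar>- (b' * x' + 2 * (c * y'))\<bar> \<le> h + 12 * (h * \<delta>)" unfolding c12 using e(3) p hd by linarith
    moreover have "\<bar>a\<bar> \<le> h + 12 * (h * \<delta>)" "\<bar>b'\<bar> \<le> h + 12 * (h * \<delta>)" "\<bar>c\<bar> \<le> h + 12 * (h * \<delta>)" using abc hd by linarith+
    ultimately show ?thesis unfolding h_def[symmetric] hh unfolding t hgt_le_iff all_coord face_component by blast
  qed
  then show ?thesis unfolding fvol_def qvol_def qf_def using \<delta> by (intro vol3_compare bounded_face) auto
qed

text \<open>Both volumes are compared in the chart of a maximal coordinate of twice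
  \<open>half v\<close>. The chart coordinates move by at most 2 / n, giving the factor (1 + 24 /
  n)^3, and the modulus of the last coordinate changes by a factor at most 1 + 1 / n. The product of
  the two is within (1 + 49 / n)^3.\<close>

lemma kvol_doubling:
  assumes s: "s \<in> {-1, 1}"
  shows "\<exists>C. \<forall>v. nrm (half v) \<ge> 2 \<longrightarrow> \<bar>8 * kvol s (rv v) - kvol s (rv (half v))\<bar> \<le> C / real (nrm (half v)) ^ 4"
proof (intro exI allI impI)
  fix v assume n2: "nrm (half v) \<ge> 2"
  define n where "n = real (nrm (half v))"
  have n: "n \<ge> 2" using n2 by (simp add: n_def)
  obtain e where e: "rv v = 2 *\<^sub>R rv (half v) + e" "rn e \<le> 1" by (rule half_decomp)
  define y where "y = 2 *\<^sub>R rv (half v)"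
  have ry: "rn y = 2 * n" by (simp add: y_def rn_scaleR rn_rv n_def)
  obtain f where f: "\<bar>snd (snd (f y))\<bar> = rn y" "\<And>x. rn (f x) = rn x" "\<And>x y. f (x + y) = f x + f y"
    "\<And>s x. x \<noteq> 0 \<Longrightarrow> kvol s (f x) = kvol s x"
    using max_coordinate_last[of y] by metis
  obtain y0 y1 y2 where fy: "f y = (y0, y1, y2)" by (cases "f y")
  obtain e0 e1 e2 where fe: "f e = (e0, e1, e2)" by (cases "f e")
  have yz: "\<bar>y2\<bar> = 2 * n" using f(1) fy ry by simp
  have yb: "\<bar>y0\<bar> \<le> 2 * n" "\<bar>y1\<bar> \<le> 2 * n" using rn_le_iff[of y0 y1 y2 "2 * n"] f(2)[of y] ry unfolding fy by auto
  have eb: "\<bar>e0\<bar> \<le> 1" "\<bar>e1\<bar> \<le> 1" "\<bar>e2\<bar> \<le> 1" using rn_le_iff[of e0 e1 e2 1] f(2)[of e] e(2) unfolding fe by auto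
  have fx: "f (rv v) = (y0 + e0, y1 + e1, y2 + e2)" using f(3)[of y e] e(1) by (simp add: y_def[symmetric] fy fe)
  have xz: "2 * n - 1 \<le> \<bar>y2 + e2\<bar>" "\<bar>y2 + e2\<bar> \<le> 2 * n + 1" using yz eb by linarith+
  have nz: "y2 \<noteq> 0" "y2 + e2 \<noteq> 0" using yz xz n by auto
  have y_nz: "y \<noteq> 0" using ry n rn_eq_0_iff[of y] by auto
  have x_nz: "rv v \<noteq> 0"
  proof
    assume "rv v = 0"
    then have "rn (f (rv v)) = 0" using f(2)[of "rv v"] rn_eq_0_iff[of "rv v"] by simp
    then show False using rn_ge(3)[of "y2 + e2" "y0 + e0" "y1 + e1"] nz(2) unfolding fx by simp
  qed
  have hy_nz: "rv (half v) \<noteq> 0" using y_nz by (auto simp: y_def)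
  have dist: "\<bar>(p + q) / (y2 + e2) - p / y2\<bar> \<le> 2 / n" if "\<bar>p\<bar> \<le> 2 * n" "\<bar>q\<bar> \<le> 1" for p q
  proof -
    have "(p + q) / (y2 + e2) - p / y2 = (q * y2 - p * e2) / (y2 * (y2 + e2))" using nz by (simp add: field_simps)
    also have "\<bar>\<dots>\<bar> = \<bar>q * y2 - p * e2\<bar> / (2 * n * \<bar>y2 + e2\<bar>)" by (simp add: abs_divide abs_mult yz)
    also have "\<dots> \<le> (4 * n) / (2 * n * n)"
    proof (rule frac_le)
      note abs_mult_le[OF that(2) eq_refl[OF yz]] abs_mult_le[OF that(1) eb(3)]
      then show "\<bar>q * y2 - p * e2\<bar> \<le> 4 * n" by linarith
      show "2 * n * n \<le> 2 * n * \<bar>y2 + e2\<bar>" using xz n by (intro mult_left_mono) auto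
    qed (use n in auto)
    also have "\<dots> = 2 / n" using n by simp
    finally show ?thesis .
  qed
  have small: "\<bar>y0 / y2\<bar> \<le> 1" "\<bar>y1 / y2\<bar> \<le> 1" using yb yz n by (simp_all add: abs_divide)
  have dd: "\<bar>(y0 + e0) / (y2 + e2) - y0 / y2\<bar> \<le> 2 / n" "\<bar>(y1 + e1) / (y2 + e2) - y1 / y2\<bar> \<le> 2 / n"
    using dist yb eb by auto
  have "2 / n \<le> 1" using n by simp
  then have b2: "\<bar>(y0 + e0) / (y2 + e2)\<bar> \<le> 2" "\<bar>(y1 + e1) / (y2 + e2)\<bar> \<le> 2" "\<bar>y0 / y2\<bar> \<le> 2" "\<bar>y1 / y2\<bar> \<le> 2"
    using small dd by linarith+
  let ?X = "fvol s ((y0 + e0) / (y2 + e2)) ((y1 + e1) / (y2 + e2))" and ?Y = "fvol s (y0 / y2) (y1 / y2)"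
  have XY: "?X \<le> (1 + 24 / n) ^ 3 * ?Y" "?Y \<le> (1 + 24 / n) ^ 3 * ?X"
    using fvol_compare[OF dd b2] fvol_compare[OF _ _ b2(3,4,1,2), of "2 / n"] dd by (simp_all add: abs_minus_commute)
  have kx: "kvol s (rv v) = ?X / \<bar>y2 + e2\<bar> ^ 3" using f(4)[OF x_nz, of s] kvol_face[OF nz(2), of s] by (simp add: fx)
  have ky: "kvol s y = ?Y / (2 * n) ^ 3" using f(4)[OF y_nz, of s] kvol_face[OF nz(1), of s] by (simp add: fy yz)
  have kh: "kvol s (rv (half v)) = 8 * kvol s y" using kvol_scale[OF hy_nz, of 2 s] by (simp add: y_def)
  have Y0: "0 \<le> ?Y" "0 \<le> ?X" by (simp_all add: fvol_def qvol_eq)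
  have fac: "(1 + 24 / n) * (1 + 1 / n) \<le> 1 + 49 / n"
  proof -
    have "(1 + 24 / n) * (1 + 1 / n) = 1 + 25 / n + 24 / n * (1 / n)" by (simp add: distrib_left distrib_right add_divide_distrib)
    also have "24 / n * (1 / n) \<le> 24 / n * 1" using n by (intro mult_left_mono) auto
    finally show ?thesis by simp
  qed
  have fac3: "((1 + 24 / n) * (1 + 1 / n)) ^ 3 \<le> (1 + 49 / n) ^ 3" using fac n by (intro power_mono) auto
  have r1: "2 * n \<le> (1 + 1 / n) * \<bar>y2 + e2\<bar>"
  proof -
    have "2 * n \<le> (1 + 1 / n) * (2 * n - 1)" using n by (simp add: field_simps)
    also have "\<dots> \<le> (1 + 1 / n) * \<bar>y2 + e2\<bar>" using xz n by (intro mult_left_mono) auto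
    finally show ?thesis .
  qed
  have r2: "\<bar>y2 + e2\<bar> \<le> (1 + 1 / n) * (2 * n)"
  proof -
    have "(1 + 1 / n) * (2 * n) = 2 * n + 2" using n by (simp add: field_simps)
    then show ?thesis using xz by linarith
  qed
  have gen: "p / a ^ 3 \<le> (1 + 49 / n) ^ 3 * (q / b ^ 3)"
    if "p \<le> (1 + 24 / n) ^ 3 * q" "b \<le> (1 + 1 / n) * a" "a > 0" "b > 0" "0 \<le> q" for p q a b :: real
  proof -
    have "p * b ^ 3 \<le> ((1 + 24 / n) ^ 3 * q) * ((1 + 1 / n) * a) ^ 3"
      using that n by (intro mult_mono power_mono) auto
    also have "\<dots> = ((1 + 24 / n) * (1 + 1 / n)) ^ 3 * (q * a ^ 3)" by (simp add: power_mult_distrib)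
    also have "\<dots> \<le> (1 + 49 / n) ^ 3 * (q * a ^ 3)" using fac3 that by (intro mult_right_mono) auto
    finally show ?thesis using that by (simp add: field_simps)
  qed
  have xp: "\<bar>y2 + e2\<bar> > 0" "2 * n > 0" using nz n by auto
  have "kvol s (rv v) \<le> (1 + 49 / n) ^ 3 * kvol s y" unfolding kx ky by (rule gen[OF XY(1) r1 xp Y0(1)])
  moreover have "kvol s y \<le> (1 + 49 / n) ^ 3 * kvol s (rv v)" unfolding kx ky by (rule gen[OF XY(2) r2 xp(2,1) Y0(2)])
  ultimately have "8 * kvol s (rv v) \<le> (1 + 49 / n) ^ 3 * kvol s (rv (half v))"
    "kvol s (rv (half v)) \<le> (1 + 49 / n) ^ 3 * (8 * kvol s (rv v))" unfolding kh by simp_all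
  moreover have "kvol s (rv (half v)) \<le> 8 / n ^ 3" using kvol_bounds(2)[OF hy_nz s] by (simp add: rn_rv n_def)
  moreover have "0 \<le> 8 * kvol s (rv v)" "0 \<le> kvol s (rv (half v))" using Y0 xp unfolding kh kx ky by simp_all
  ultimately have "\<bar>8 * kvol s (rv v) - kvol s (rv (half v))\<bar> \<le> 49 * (3 + 3 * 49 + 49\<^sup>2) * (1 + 49) ^ 3 * 8 / n ^ 4"
    using n by (intro cube_ratio_bound) auto
  then show "\<bar>8 * kvol s (rv v) - kvol s (rv (half v))\<bar> \<le> (49 * (3 + 3 * 49 + 49\<^sup>2) * (1 + 49) ^ 3 * 8) / real (nrm (half v)) ^ 4"
    by (simp add: n_def)
qed

section \<open>Reduced bases of the plane orthogonal to a primitive vector\<close>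

lemma bezout3:
  assumes "prim u" shows "\<exists>y. dot u y = 1"
proof -
  obtain a b c where u: "u = (a, b, c)" by (cases u)
  have g: "gcd a (gcd b c) = 1" using assms by (simp add: prim_def gcd3_def u)
  obtain r s where rs: "r * b + s * c = gcd b c" using bezout_int by blast
  obtain p q where pq: "p * a + q * gcd b c = gcd a (gcd b c)" using bezout_int by blast
  have "dot u (p, q * r, q * s) = p * a + q * (r * b + s * c)" by (simp add: u dot_def algebra_simps)
  then show ?thesis using rs pq g by metis
qed

lemma cross_cross:
  "cross u (cross v y) = (fst v * dot u y - fst y * dot u v, fst (snd v) * dot u y - fst (snd y) * dot u v,
     snd (snd v) * dot u y - snd (snd y) * dot u v)"
  by (cases u; cases v; cases y) (simp add: cross_def dot_def algebra_simps)

lemma lagrange_identity: "dot u u * dot v v = (dot u v)\<^sup>2 + dot (cross u v) (cross u v)"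
  by (cases u; cases v) (simp add: cross_def dot_def power2_eq_square algebra_simps)

lemma dot_cross [simp]: "dot (cross u v) u = 0" "dot (cross u v) v = 0" "dot u (cross u v) = 0" "dot v (cross u v) = 0"
  by (cases u; cases v; simp add: cross_def dot_def algebra_simps)+

lemma dot_self_pos_iff: "dot u u > 0 \<longleftrightarrow> u \<noteq> (0 :: int triple)"
proof (cases "u = 0")
  case False
  then have "nrm u > 0" by (simp add: nrm_pos_iff)
  then have "int (nrm u) ^ 2 > 0" by simp
  then show ?thesis using nrm_sq_le_dot[of u] False by linarith
qed (simp add: dot_def zero_prod_def)

lemma exists_small_representative:
  fixes p D :: int assumes "D > 0" shows "\<exists>k. 2 * \<bar>p + k * D\<bar> \<le> D"
proof -
  define q where "q = (2 * p + D) div (2 * D)"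
  have "q * (2 * D) + (2 * p + D) mod (2 * D) = 2 * p + D" unfolding q_def by (rule div_mult_mod_eq)
  moreover have "0 \<le> (2 * p + D) mod (2 * D)" "(2 * p + D) mod (2 * D) < 2 * D" using assms by simp_all
  moreover have "2 * \<bar>p - X\<bar> \<le> D" if "2 * X + m = 2 * p + D" "0 \<le> m" "m < 2 * D" for X m :: int
  proof -
    have "2 * (p - X) = m - D" using that(1) by simp
    then have "\<bar>2 * (p - X)\<bar> \<le> D" using that(2,3) by (simp add: abs_le_iff)
    then show ?thesis by (simp only: abs_mult abs_numeral)
  qed
  ultimately have "2 * \<bar>p - q * D\<bar> \<le> D" by (simp add: mult.left_commute)
  then show ?thesis by (intro exI[of _ "- q"]) simp
qed

text \<open>A basis reduced in the sense of Lagrange and Gauss. The condition on the cross product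
  fixes the orientation and, for primitive v, expresses that u and w generate all integral vectors
  orthogonal to v.\<close>

definition reduced :: "int triple \<Rightarrow> int triple \<Rightarrow> int triple \<Rightarrow> bool" where
  "reduced v u w \<longleftrightarrow> cross u w = v \<and> u \<noteq> 0 \<and> w \<noteq> 0 \<and> dot u u \<le> dot w w \<and> 2 * \<bar>dot u w\<bar> \<le> dot u u"

text \<open>Let u be a shortest nonzero integral vector orthogonal to v. It is primitive, so some y
  has dot product 1 with u, and x = v \<times> y satisfies u \<times> x = v (u.y) - y (u.v) = v.
  Adding a multiple of u to x keeps the cross product and makes the dot product small.\<close>

lemma exists_reduced:
  assumes v: "prim v" shows "\<exists>p. reduced v (fst p) (snd p)"
proof -
  have v0: "v \<noteq> 0" using prim_nonzero[OF v] .
  have ex: "\<exists>u. u \<noteq> 0 \<and> dot u v = 0"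
  proof (cases v)
    case (fields a b c)
    show ?thesis
    proof (cases "a = 0 \<and> b = 0")
      case True
      then show ?thesis by (intro exI[of _ "(1, 0, 0)"]) (simp add: fields dot_def zero_prod_def)
    next
      case False
      then show ?thesis by (intro exI[of _ "(b, - a, 0)"]) (auto simp: fields dot_def zero_prod_def)
    qed
  qed
  define P where "P = (\<lambda>n. \<exists>u. u \<noteq> 0 \<and> dot u v = 0 \<and> nat (dot u u) = n)"
  have "\<exists>n. P n" using ex by (auto simp: P_def)
  then have "P (LEAST n. P n)" by (rule LeastI_ex)
  then obtain u where u: "u \<noteq> 0" "dot u v = 0" "nat (dot u u) = (LEAST n. P n)" unfolding P_def by blast
  have min: "dot u u \<le> dot x x" if "x \<noteq> 0" "dot x v = 0" for x
  proof -
    have "P (nat (dot x x))" unfolding P_def using that by blast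
    then have "nat (dot u u) \<le> nat (dot x x)" unfolding u(3) by (rule Least_le)
    then show ?thesis using dot_self_pos_iff[of x] that by linarith
  qed
  have "prim u"
  proof -
    obtain d y where dy: "d \<ge> 1" "prim y" "u = smul d y" using prim_decomp[OF u(1)] .
    have sd: "dot (smul d y) z = int d * dot y z" "dot (smul d y) (smul d y) = int d * (int d * dot y y)" for z
      by (cases y; cases z; simp add: smul_def dot_def algebra_simps)+
    have "dot y v = 0" using u(2) dy(1) unfolding dy(3) sd by simp
    then have "dot u u \<le> dot y y" using min prim_nonzero[OF dy(2)] by blast
    then have le: "int d * (int d * dot y y) \<le> dot y y" by (simp only: dy(3) sd(2))
    have pos: "dot y y > 0" using prim_nonzero[OF dy(2)] by (simp add: dot_self_pos_iff)
    have "d = 1"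
    proof (rule ccontr)
      assume "d \<noteq> 1"
      then have "int d \<ge> 2" using dy(1) by simp
      then have "2 * (2 * dot y y) \<le> int d * (int d * dot y y)" using pos by (intro mult_mono) auto
      then show False using le pos by linarith
    qed
    then have "u = y" using dy(3) by (simp only: smul_1)
    then show ?thesis using dy(2) by simp
  qed
  then obtain y where y: "dot u y = 1" using bezout3 by blast
  define x where "x = cross v y"
  have cx: "cross u x = v" unfolding x_def cross_cross y u(2) by simp
  have D: "dot u u > 0" using u(1) by (simp add: dot_self_pos_iff)
  obtain k where k: "2 * \<bar>dot u x + k * dot u u\<bar> \<le> dot u u" using exists_small_representative[OF D] by blast
  obtain u0 u1 u2 x0 x1 x2 where ux: "u = (u0, u1, u2)" "x = (x0, x1, x2)" by (cases u; cases x)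
  define w where "w = (x0 + k * u0, x1 + k * u1, x2 + k * u2)"
  have cw: "cross u w = v" using cx by (simp add: ux w_def cross_def algebra_simps)
  have dw: "dot u w = dot u x + k * dot u u" by (simp add: ux w_def dot_def algebra_simps)
  have w0: "w \<noteq> 0"
  proof
    assume "w = 0"
    then have "cross u w = 0" by (cases u) (simp add: cross_def zero_prod_def)
    then show False using cw v0 by simp
  qed
  have "dot w v = 0" unfolding cw[symmetric] by simp
  then have "dot u u \<le> dot w w" using min[OF w0] by simp
  then have "reduced v u w" unfolding reduced_def using cw u(1) w0 k dw by simp
  then show ?thesis by (intro exI[of _ "(u, w)"]) simp
qed

definition basis :: "int triple \<Rightarrow> int triple \<times> int triple" where
  "basis v = (SOME p. reduced v (fst p) (snd p))"

abbreviation "bas1 v \<equiv> fst (basis v)"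
abbreviation "bas2 v \<equiv> snd (basis v)"

lemma reduced_basis: "prim v \<Longrightarrow> reduced v (bas1 v) (bas2 v)"
  unfolding basis_def by (rule someI_ex[OF exists_reduced])

text \<open>With Euclidean lengths, Lagrange's identity |u|^2 |w|^2 = (u.w)^2 + |v|^2 gives |v|
  \<le> |u| |w|, while reducedness gives 3 |u|^2 |w|^2 \<le> 4 |v|^2. The constants come from the
  factor 3 between the squares of the maximum and Euclidean norms.\<close>

lemma reduced_norms:
  assumes "reduced v u w"
  shows "real (nrm u) \<le> 2 * real (nrm w)" "real (nrm v) \<le> 3 * (real (nrm u) * real (nrm w))"
    "real (nrm u) * real (nrm w) \<le> 2 * real (nrm v)" "real (nrm u) \<ge> 1" "real (nrm w) \<ge> 1"
proof -
  have r: "cross u w = v" "u \<noteq> 0" "w \<noteq> 0" "dot u u \<le> dot w w" "2 * \<bar>dot u w\<bar> \<le> dot u u"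
    using assms by (auto simp: reduced_def)
  have nn: "dot z z \<ge> 0" for z :: "int triple" using nrm_sq_le_dot[of z] by (smt (verit) zero_le_power2)
  have "int (nrm u) ^ 2 \<le> dot u u" "dot w w \<le> 3 * int (nrm w) ^ 2" by (rule nrm_sq_le_dot dot_self_le)+
  then have "int (nrm u) ^ 2 \<le> 4 * int (nrm w) ^ 2" using r(4) by (smt (verit) zero_le_power2)
  then have "int (nrm u) ^ 2 \<le> (2 * int (nrm w)) ^ 2" by (simp add: power_mult_distrib)
  then have "int (nrm u) \<le> 2 * int (nrm w)" by (rule power2_le_imp_le) simp
  then show "real (nrm u) \<le> 2 * real (nrm w)" by linarith
  have L: "dot u u * dot w w = (dot u w)\<^sup>2 + dot v v" using lagrange_identity[of u w] r(1) by simp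
  have "int (nrm v) ^ 2 \<le> dot u u * dot w w" using L nrm_sq_le_dot[of v] by (smt (verit) zero_le_power2)
  also have "\<dots> \<le> (3 * int (nrm u) ^ 2) * (3 * int (nrm w) ^ 2)"
    by (rule mult_mono[OF dot_self_le dot_self_le _ nn]) simp
  also have "\<dots> = (3 * (int (nrm u) * int (nrm w)))\<^sup>2" by (simp add: power_mult_distrib)
  finally have "int (nrm v) \<le> 3 * (int (nrm u) * int (nrm w))" by (rule power2_le_imp_le) simp
  then have "real_of_int (int (nrm v)) \<le> real_of_int (3 * (int (nrm u) * int (nrm w)))" by (simp only: of_int_le_iff)
  then show "real (nrm v) \<le> 3 * (real (nrm u) * real (nrm w))" by simp
  have "(2 * \<bar>dot u w\<bar>)\<^sup>2 \<le> (dot u u)\<^sup>2" using r(5) by (intro power_mono) auto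
  then have "4 * (dot u w)\<^sup>2 \<le> dot u u * dot u u" by (simp add: power_mult_distrib power2_eq_square)
  also have "\<dots> \<le> dot u u * dot w w" using r(4) nn by (intro mult_left_mono)
  finally have "3 * (dot u u * dot w w) \<le> 4 * dot v v" using L by linarith
  moreover have "int (nrm u) ^ 2 * int (nrm w) ^ 2 \<le> dot u u * dot w w"
    by (rule mult_mono[OF nrm_sq_le_dot nrm_sq_le_dot nn]) simp
  ultimately have "int (nrm u) ^ 2 * int (nrm w) ^ 2 \<le> 4 * int (nrm v) ^ 2" using dot_self_le[of v] by linarith
  then have "(int (nrm u) * int (nrm w))\<^sup>2 \<le> (2 * int (nrm v))\<^sup>2" by (simp add: power_mult_distrib)
  then have "int (nrm u) * int (nrm w) \<le> 2 * int (nrm v)" by (rule power2_le_imp_le) simp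
  then have "real_of_int (int (nrm u) * int (nrm w)) \<le> real_of_int (2 * int (nrm v))" by (simp only: of_int_le_iff)
  then show "real (nrm u) * real (nrm w) \<le> 2 * real (nrm v)" by simp
  show "real (nrm u) \<ge> 1" "real (nrm w) \<ge> 1" using r(2,3) nrm_pos_iff[of u] nrm_pos_iff[of w] by auto
qed

lemma cross_rv: "cross (rv u) (rv w) = rv (cross u w)"
  by (cases u; cases w) (simp add: rv_def cross_def)

lemma dot_rv: "dot (rv u) (rv w) = of_int (dot u w)"
  by (cases u; cases w) (simp add: rv_def dot_def)

lemma qf_rv: "qf (rv u) (rv w) (rv t) = (\<chi> i. of_int (qf u w t $ i))"
  by (cases u; cases w; cases t) (simp add: rv_def vec_eq_iff all_coord)

lemma hgt_qf_rv: "hgt (qf (rv u) (rv w) (rv t)) = of_int (hgt (qf u w t))"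
  by (simp only: qf_rv hgt_of_int)

lemma sgn_ok_rv: "sgn_ok s (rv t) \<longleftrightarrow> sgn_ok s t"
proof (cases t)
  case (fields a b c)
  have "real_of_int s * disc (rv t) = real_of_int (s * disc t)" by (simp add: fields rv_def disc_def)
  then show ?thesis unfolding sgn_ok_def by (simp only: of_int_0_less_iff of_int_eq_id id_apply)
qed

section \<open>Sizes of the coefficients with respect to a reduced basis\<close>

text \<open>The bilinear form of a quadratic form without the factor 1/2, hence integral; on the
  diagonal it is twice the quadratic form.\<close>

definition polar :: "'a::comm_ring_1 ^ coord \<Rightarrow> 'a triple \<Rightarrow> 'a triple \<Rightarrow> 'a" where
  "polar x = (\<lambda>(y0, y1, y2) (z0, z1, z2). x $ C0 * (2 * (y0 * z0)) + x $ C1 * (2 * (y1 * z1)) + x $ C2 * (2 * (y2 * z2))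
     + x $ C01 * (y0 * z1 + y1 * z0) + x $ C02 * (y0 * z2 + y2 * z0) + x $ C12 * (y1 * z2 + y2 * z1))"

lemma polar_qf:
  "polar (qf u w (a, b, c)) y z = 2 * a * (dot u y * dot u z) + b * (dot u y * dot w z + dot u z * dot w y)
     + 2 * c * (dot w y * dot w z)"
  by (cases u; cases w; cases y; cases z) (simp add: polar_def dot_def algebra_simps)

lemma polar_bound: "\<bar>polar x y z\<bar> \<le> 12 * (hgt x * (rn y * rn z))" for x :: "real ^ coord"
proof -
  obtain y0 y1 y2 z0 z1 z2 where yz: "y = (y0, y1, y2)" "z = (z0, z1, z2)" by (cases y; cases z)
  define p where "p = rn y * rn z"
  have Y: "\<bar>y0\<bar> \<le> rn y" "\<bar>y1\<bar> \<le> rn y" "\<bar>y2\<bar> \<le> rn y" unfolding yz by (rule rn_ge)+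
  have Z: "\<bar>z0\<bar> \<le> rn z" "\<bar>z1\<bar> \<le> rn z" "\<bar>z2\<bar> \<le> rn z" unfolding yz by (rule rn_ge)+
  have P: "\<bar>k * l\<bar> \<le> p" if "\<bar>k\<bar> \<le> rn y" "\<bar>l\<bar> \<le> rn z" for k l unfolding p_def by (rule abs_mult_le[OF that])
  have S: "\<bar>2 * (k * l)\<bar> \<le> 2 * p" if "\<bar>k\<bar> \<le> rn y" "\<bar>l\<bar> \<le> rn z" for k l using P[OF that] by linarith
  have M: "\<bar>k * l + k' * l'\<bar> \<le> 2 * p" if "\<bar>k\<bar> \<le> rn y" "\<bar>l\<bar> \<le> rn z" "\<bar>k'\<bar> \<le> rn y" "\<bar>l'\<bar> \<le> rn z" for k l k' l'
    using P[OF that(1,2)] P[OF that(3,4)] by linarith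
  have H: "\<bar>x $ i * q\<bar> \<le> hgt x * (2 * p)" if "\<bar>q\<bar> \<le> 2 * p" for i q by (rule abs_mult_le[OF abs_le_hgt that])
  have tri: "\<bar>a1 + a2 + a3 + a4 + a5 + a6\<bar> \<le> 6 * m" if "\<bar>a1\<bar> \<le> m" "\<bar>a2\<bar> \<le> m" "\<bar>a3\<bar> \<le> m" "\<bar>a4\<bar> \<le> m" "\<bar>a5\<bar> \<le> m" "\<bar>a6\<bar> \<le> m"
    for a1 a2 a3 a4 a5 a6 m :: real using that by linarith
  have "\<bar>polar x y z\<bar> \<le> 6 * (hgt x * (2 * p))"
    unfolding yz polar_def prod.case
    by (rule tri; rule H; (rule S M); (rule Y Z))
  then show ?thesis by (simp add: p_def)
qed

lemma rn_cross_le: "rn (cross u w) \<le> 2 * (rn u * rn w)"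
proof -
  obtain u0 u1 u2 w0 w1 w2 where uw: "u = (u0, u1, u2)" "w = (w0, w1, w2)" by (cases u; cases w)
  have U: "\<bar>u0\<bar> \<le> rn u" "\<bar>u1\<bar> \<le> rn u" "\<bar>u2\<bar> \<le> rn u" unfolding uw by (rule rn_ge)+
  have W: "\<bar>w0\<bar> \<le> rn w" "\<bar>w1\<bar> \<le> rn w" "\<bar>w2\<bar> \<le> rn w" unfolding uw by (rule rn_ge)+
  have M: "\<bar>k * l - k' * l'\<bar> \<le> 2 * (rn u * rn w)" if "\<bar>k\<bar> \<le> rn u" "\<bar>l\<bar> \<le> rn w" "\<bar>k'\<bar> \<le> rn u" "\<bar>l'\<bar> \<le> rn w" for k l k' l'
    using abs_mult_le[OF that(1,2)] abs_mult_le[OF that(3,4)] by linarith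
  have "cross u w = (u1 * w2 - u2 * w1, u2 * w0 - u0 * w2, u0 * w1 - u1 * w0)" by (simp add: uw cross_def)
  then show ?thesis using U W M by (simp only: rn_le_iff simp_thms)
qed

text \<open>The vectors y = w \<times> v and z = v \<times> u are dual to u and w up to the factor W
  = v.v. Evaluating the polar form on them isolates 2 a W^2, b W^2 and 2 c W^2. Their lengths are
  controlled by |w| |v| and |u| |v|, and |u| |w| \<le> 2 |v| converts the result into the stated
  shape.\<close>

lemma reduced_coefficient_bounds:
  assumes red: "reduced v u w" and h: "hgt (qf (rv u) (rv w) (a, b, c)) \<le> T"
  shows "\<bar>a\<bar> * real (nrm u) ^ 2 \<le> 200 * T" "\<bar>b\<bar> * (real (nrm u) * real (nrm w)) \<le> 200 * T"
    "\<bar>c\<bar> * real (nrm w) ^ 2 \<le> 200 * T"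
proof -
  define n n1 n2 where "n = real (nrm v)" and "n1 = real (nrm u)" and "n2 = real (nrm w)"
  note nm = reduced_norms[OF red, folded n_def n1_def n2_def]
  define W where "W = dot (rv v) (rv v)"
  have cv: "cross (rv u) (rv w) = rv v" using red by (simp add: cross_rv reduced_def)
  have T: "T \<ge> 0" using h hgt_nonneg order_trans by blast
  have "n1 * n2 \<ge> 1 * 1" using nm(4,5) by (intro mult_mono) auto
  then have npos: "n > 0" using nm(3) by linarith
  have "real_of_int (int (nrm v) ^ 2) \<le> real_of_int (dot v v)" using nrm_sq_le_dot[of v] by (simp only: of_int_le_iff)
  then have Wn: "W \<ge> n\<^sup>2" by (simp add: W_def dot_rv n_def)
  define y z where "y = cross (rv w) (rv v)" and "z = cross (rv v) (rv u)"
  have triple: "dot x1 (cross x2 x3) = dot (cross x1 x2) x3" "dot x1 (cross x2 x3) = dot x2 (cross x3 x1)" for x1 x2 x3 :: "real triple"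
    by (cases x1; cases x2; cases x3; simp add: cross_def dot_def algebra_simps)+
  have uy: "dot (rv u) y = W" unfolding y_def triple(1) cv W_def ..
  have wy: "dot (rv w) y = 0" unfolding y_def by simp
  have uz: "dot (rv u) z = 0" unfolding z_def by simp
  have wz: "dot (rv w) z = W" unfolding z_def triple(2) triple(1)[of "rv v" "rv u" "rv w"] unfolding W_def cv[symmetric] triple(1) by (simp add: triple)
  have ry: "rn y \<le> 2 * (n2 * n)" unfolding y_def n2_def n_def rn_rv[symmetric] by (rule rn_cross_le)
  have rz: "rn z \<le> 2 * (n * n1)" unfolding z_def n1_def n_def rn_rv[symmetric] by (rule rn_cross_le)
  let ?q = "qf (rv u) (rv w) (a, b, c)"
  have bound: "\<bar>polar ?q p q\<bar> \<le> 12 * (T * (P * Q))" if "rn p \<le> P" "rn q \<le> Q" for p q P Q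
  proof -
    have "rn p * rn q \<le> P * Q" using that rn_nonneg[of p] rn_nonneg[of q] by (intro mult_mono) auto
    then have "hgt ?q * (rn p * rn q) \<le> T * (P * Q)" 
      by (rule mult_mono[OF h _ T]) (simp add: rn_nonneg)
    then show ?thesis using polar_bound[of ?q p q] by linarith
  qed
  have W4: "n ^ 4 \<le> W\<^sup>2"
  proof -
    have "n ^ 4 = (n\<^sup>2)\<^sup>2" by simp
    also have "\<dots> \<le> W\<^sup>2" using Wn by (intro power_mono) auto
    finally show ?thesis .
  qed
  have n12: "(n1 * n2)\<^sup>2 \<le> 4 * n\<^sup>2" using power_mono[OF nm(3), of 2] nm(4,5) by (simp add: power_mult_distrib)
  \<comment> \<open>Here r is the square of |w| or |u|, or their product, and m is the complementary
    quantity, so that r m = (n1 n2)^2 \<le> 4 n^2. The constant becomes 48 * 4 = 192.\<close>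
  have fin: "\<bar>k\<bar> * m \<le> 200 * T" if k: "\<bar>k\<bar> * W\<^sup>2 \<le> 48 * (T * (r * n\<^sup>2))" and rm: "r * m \<le> (n1 * n2)\<^sup>2" and m: "m \<ge> 0" for k m r
  proof -
    have "(\<bar>k\<bar> * m) * n ^ 4 \<le> (\<bar>k\<bar> * m) * W\<^sup>2" using W4 m by (intro mult_left_mono) auto
    also have "\<dots> = (\<bar>k\<bar> * W\<^sup>2) * m" by simp
    also have "\<dots> \<le> 48 * (T * (r * n\<^sup>2)) * m" using k m by (intro mult_right_mono)
    also have "\<dots> = 48 * T * n\<^sup>2 * (r * m)" by simp
    also have "\<dots> \<le> 48 * T * n\<^sup>2 * (4 * n\<^sup>2)" using rm n12 T by (intro mult_left_mono) auto
    also have "\<dots> = 192 * T * n ^ 4" by (simp add: power4_eq_xxxx power2_eq_square)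
    finally have "\<bar>k\<bar> * m \<le> 192 * T" using npos by simp
    then show ?thesis using T by linarith
  qed
  have "\<bar>a\<bar> * W\<^sup>2 \<le> 48 * (T * (n2\<^sup>2 * n\<^sup>2))"
  proof -
    have "polar ?q y y = 2 * (a * W\<^sup>2)" unfolding polar_qf uy wy by (simp add: power2_eq_square)
    then have "2 * (\<bar>a\<bar> * W\<^sup>2) \<le> 12 * (T * (2 * (n2 * n) * (2 * (n2 * n))))" using bound[OF ry ry] by (simp add: abs_mult)
    also have "\<dots> = 48 * (T * (n2\<^sup>2 * n\<^sup>2))" by (simp add: power2_eq_square)
    finally have 1: "2 * (\<bar>a\<bar> * W\<^sup>2) \<le> 48 * (T * (n2\<^sup>2 * n\<^sup>2))" .
    have "0 \<le> \<bar>a\<bar> * W\<^sup>2" by simp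
    then show ?thesis using 1 by linarith
  qed
  then show "\<bar>a\<bar> * real (nrm u) ^ 2 \<le> 200 * T" unfolding n1_def[symmetric] by (rule fin) (simp_all add: power_mult_distrib)
  have "\<bar>c\<bar> * W\<^sup>2 \<le> 48 * (T * (n1\<^sup>2 * n\<^sup>2))"
  proof -
    have "polar ?q z z = 2 * (c * W\<^sup>2)" unfolding polar_qf uz wz by (simp add: power2_eq_square)
    then have "2 * (\<bar>c\<bar> * W\<^sup>2) \<le> 12 * (T * (2 * (n * n1) * (2 * (n * n1))))" using bound[OF rz rz] by (simp add: abs_mult)
    also have "\<dots> = 48 * (T * (n1\<^sup>2 * n\<^sup>2))" by (simp add: power2_eq_square)
    finally have 1: "2 * (\<bar>c\<bar> * W\<^sup>2) \<le> 48 * (T * (n1\<^sup>2 * n\<^sup>2))" .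
    have "0 \<le> \<bar>c\<bar> * W\<^sup>2" by simp
    then show ?thesis using 1 by linarith
  qed
  then show "\<bar>c\<bar> * real (nrm w) ^ 2 \<le> 200 * T" unfolding n2_def[symmetric] by (rule fin) (simp_all add: power_mult_distrib)
  have "\<bar>b\<bar> * W\<^sup>2 \<le> 48 * (T * ((n1 * n2) * n\<^sup>2))"
  proof -
    have "polar ?q y z = b * W\<^sup>2" unfolding polar_qf uy wy uz wz by (simp add: power2_eq_square)
    then have "\<bar>b\<bar> * W\<^sup>2 \<le> 12 * (T * (2 * (n2 * n) * (2 * (n * n1))))" using bound[OF ry rz] by (simp add: abs_mult)
    also have "\<dots> = 48 * (T * ((n1 * n2) * n\<^sup>2))" by (simp add: power2_eq_square)
    finally show ?thesis .
  qed
  then show "\<bar>b\<bar> * (real (nrm u) * real (nrm w)) \<le> 200 * T" unfolding n1_def[symmetric] n2_def[symmetric]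
    by (rule fin) (use nm(4,5) in \<open>simp_all add: power2_eq_square\<close>)
qed

lemma bounded_reduced:
  assumes red: "reduced v u w"
  shows "bounded_lin3 (lprod (rv u) (rv u)) (lprod (rv u) (rv w)) (lprod (rv w) (rv w))"
  unfolding bounded_lin3_def qf_def[symmetric]
proof (intro exI allI impI)
  fix a b c assume h: "hgt (qf (rv u) (rv w) (a, b, c)) \<le> 1"
  note nm = reduced_norms[OF red]
  have *: "x \<le> 200" if "x * m \<le> 200 * 1" "m \<ge> 1" "x \<ge> 0" for x m :: real
    using mult_left_mono[OF that(2,3)] that(1) by simp
  have m: "real (nrm u) ^ 2 \<ge> 1" "real (nrm w) ^ 2 \<ge> 1" "real (nrm u) * real (nrm w) \<ge> 1"
    using nm(4,5) mult_mono[OF nm(4,5)] by (simp_all add: one_le_power)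
  show "\<bar>a\<bar> \<le> 200 \<and> \<bar>b\<bar> \<le> 200 \<and> \<bar>c\<bar> \<le> 200"
    using *[OF reduced_coefficient_bounds(1)[OF red h] m(1)] *[OF reduced_coefficient_bounds(2)[OF red h] m(3)]
      *[OF reduced_coefficient_bounds(3)[OF red h] m(2)] by simp
qed

section \<open>Binary forms of square discriminant\<close>

text \<open>Euler's four number lemma: with p = gcd(a, e), the coprime cofactor s of e divides
  c.\<close>

lemma four_number:
  fixes a c e e' :: int
  assumes "a * c = e * e'" "a \<noteq> 0" "c \<noteq> 0"
  obtains p q r s where "a = p * r" "c = q * s" "e = p * s" "e' = q * r"
proof -
  define p where "p = gcd a e"
  have p0: "p \<noteq> 0" using assms(2) by (simp add: p_def)
  obtain r s where rs: "a = r * p" "e = s * p" "coprime r s"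
    using gcd_coprime_exists[of a e] p0 unfolding p_def by blast
  have "p * (r * c) = p * (s * e')" using assms(1) unfolding rs(1,2) by (simp add: algebra_simps)
  then have eq: "r * c = s * e'" using p0 by simp
  then have "s dvd r * c" by simp
  then have "s dvd c" using rs(3) by (simp add: coprime_commute coprime_dvd_mult_right_iff)
  then obtain q where q: "c = s * q" by (rule dvdE)
  have s0: "s \<noteq> 0" using q assms(3) by auto
  have "s * (r * q) = s * e'" using eq unfolding q by (simp add: algebra_simps)
  then have "e' = q * r" using s0 by (simp add: mult.commute)
  then show ?thesis using that[of p r q s] rs q by (simp add: mult.commute)
qed

text \<open>If d is a root of the discriminant, b and d have the same parity, and e = (b + d) / 2
  satisfies a c = e (b - e). The four numbers are the coefficients of an integral factorization (p X
  + q Y) (r X + s Y).\<close>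

lemma square_disc_factorization:
  fixes a b c :: int
  assumes "is_square (b\<^sup>2 - 4 * a * c)" "a \<noteq> 0" "c \<noteq> 0"
  obtains p q r s where "a = p * r" "c = q * s" "b = p * s + q * r"
proof -
  obtain d where d: "b\<^sup>2 - 4 * a * c = d\<^sup>2" using assms(1) by (auto simp: is_nth_power_def)
  have "even (b\<^sup>2 - 4 * a * c) \<longleftrightarrow> even b" by simp
  then have "even b \<longleftrightarrow> even d" unfolding d by simp
  then have "even (b + d)" by simp
  then obtain e where e: "b + d = 2 * e" by (rule evenE)
  have "4 * (a * c) = (b + d) * (b - d)" using d by (simp add: power2_eq_square algebra_simps)
  also have "b - d = 2 * (b - e)" using e by simp
  also have "(b + d) * (2 * (b - e)) = 4 * (e * (b - e))" unfolding e by (simp add: algebra_simps)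
  finally have "4 * (a * c) = 4 * (e * (b - e))" .
  then have "a * c = e * (b - e)" by (simp only: mult_cancel_left) simp
  then obtain p q r s where "a = p * r" "c = q * s" "e = p * s" "b - e = q * r"
    using four_number assms(2,3) by metis
  then show ?thesis using that[of p r q s] by simp
qed

definition dpairs :: "nat \<Rightarrow> (int \<times> int) set" where
  "dpairs n = {(p, r). p * r \<noteq> 0 \<and> \<bar>p * r\<bar> \<le> int n}"

text \<open>Up to four choices of signs this is the summatory divisor function, the sum of n div i,
  which is at most n times a harmonic number.\<close>

lemma finite_dpairs: "finite (dpairs n)" and card_dpairs: "n \<ge> 1 \<Longrightarrow> real (card (dpairs n)) \<le> 4 * real n * (1 + ln (real n))"
proof -
  let ?S = "SIGMA i:{1..n}. {1..n div i}"
  let ?f = "\<lambda>((\<sigma>, \<tau>), (i, j)). (\<sigma> * int i, \<tau> * int j)"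
  have sub: "dpairs n \<subseteq> ?f ` (({-1, 1} \<times> {-1, 1}) \<times> ?S)"
  proof
    fix z assume z: "z \<in> dpairs n"
    obtain p r where pr: "z = (p, r)" by (cases z)
    have nz: "p \<noteq> 0" "r \<noteq> 0" and le: "\<bar>p * r\<bar> \<le> int n" using z by (auto simp: pr dpairs_def)
    define i j where "i = nat \<bar>p\<bar>" and "j = nat \<bar>r\<bar>"
    have ij: "int i = \<bar>p\<bar>" "int j = \<bar>r\<bar>" "i \<ge> 1" "j \<ge> 1" using nz by (auto simp: i_def j_def)
    have "int (i * j) \<le> int n" using le ij by (simp add: abs_mult)
    then have mul: "i * j \<le> n" by (simp only: of_nat_le_iff)
    then have "j \<le> n div i" using ij(3) by (simp add: less_eq_div_iff_mult_less_eq mult.commute)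
    moreover have "i * 1 \<le> i * j" using ij(4) by (intro mult_le_mono) auto
    then have "i \<le> n" using mul unfolding mult_1_right by (rule order_trans)
    ultimately have "((sgn p, sgn r), (i, j)) \<in> ({-1, 1} \<times> {-1, 1}) \<times> ?S"
      using ij nz by (auto simp: sgn_if)
    moreover have "z = ?f ((sgn p, sgn r), (i, j))" using ij by (simp add: pr sgn_mult_abs mult.commute abs_mult_sgn)
    ultimately show "z \<in> ?f ` (({-1, 1} \<times> {-1, 1}) \<times> ?S)" by (rule rev_image_eqI)
  qed
  have finS: "finite ((({-1, 1 :: int}) \<times> {-1, 1 :: int}) \<times> ?S)" by simp
  show "finite (dpairs n)" using finite_subset[OF sub] by simp
  assume n: "n \<ge> 1"
  have "card (dpairs n) \<le> card (?f ` ((({-1, 1}) \<times> {-1, 1}) \<times> ?S))" by (rule card_mono[OF _ sub]) simp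
  also have "\<dots> \<le> card ((({-1, 1 :: int}) \<times> {-1, 1 :: int}) \<times> ?S)" by (rule card_image_le[OF finS])
  also have "\<dots> = 4 * (\<Sum>i=1..n. n div i)" by (simp add: card_cartesian_product)
  finally have "real (card (dpairs n)) \<le> real (4 * (\<Sum>i=1..n. n div i))" by (simp only: of_nat_le_iff)
  also have "\<dots> = 4 * (\<Sum>i=1..n. real (n div i))" by simp
  also have "(\<Sum>i=1..n. real (n div i)) \<le> (\<Sum>i=1..n. real n * inverse (real i))"
  proof (rule sum_mono)
    fix i assume i: "i \<in> {1..n}"
    have "real (n div i * i) \<le> real n" by (simp only: of_nat_le_iff div_times_less_eq_dividend)
    then show "real (n div i) \<le> real n * inverse (real i)" using i by (simp add: field_simps)
  qed
  also have "\<dots> = real n * harm n" by (simp add: harm_def sum_distrib_left)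
  also have "harm n \<le> 1 + ln (real n)"
  proof -
    obtain m where "n = Suc m" using n by (cases n) auto
    then show ?thesis using decseqD[OF decseq_harm_diff_ln, of 0 m] by (simp add: harm_def)
  qed
  finally show "real (card (dpairs n)) \<le> 4 * real n * (1 + ln (real n))" by (simp add: mult_left_mono)
qed

text \<open>The logarithm is traded for a power 1/4, by ln n = 4 ln (n^(1/4)). Twice the exponent
  5/4 stays below 3, so that (T / |v|)^(5/2) can later be summed over vectors v in space with total
  O(T^3).\<close>

lemma card_dpairs_powr:
  assumes "n \<ge> 1" shows "real (card (dpairs n)) \<le> 16 * real n powr (5 / 4)"
proof -
  define x where "x = real n powr (1 / 4)"
  have n: "real n \<ge> 1" using assms by simp
  have "ln x = ln (real n) / 4" using n by (simp add: x_def ln_powr)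
  moreover have "ln x \<le> x - 1" using n by (intro ln_le_minus_one) (simp add: x_def)
  ultimately have "1 + ln (real n) \<le> 4 * x" by linarith
  then have "4 * real n * (1 + ln (real n)) \<le> 4 * real n * (4 * x)" using n by (intro mult_left_mono) auto
  also have "\<dots> = 16 * real n powr (5 / 4)"
    using n powr_add[of "real n" 1 "1 / 4"] by (simp add: x_def)
  finally show ?thesis using card_dpairs[OF assms] by linarith
qed

text \<open>Forms with a = 0 or c = 0 fill two faces of the box. All others factor, and the outer
  coefficients p r and q s determine the ranges of the two pairs independently.\<close>

lemma card_square_disc:
  fixes A B C :: nat
  defines "X \<equiv> {(a, b, c). \<bar>a\<bar> \<le> int A \<and> \<bar>b\<bar> \<le> int B \<and> \<bar>c\<bar> \<le> int C \<and> is_square (disc (a, b, c))}"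
  shows "real (card X) \<le> (2 * real B + 1) * (2 * real C + 1) + (2 * real A + 1) * (2 * real B + 1)
      + real (card (dpairs A)) * real (card (dpairs C))"
proof -
  let ?I = "\<lambda>n::nat. {-int n..int n}"
  let ?Y1 = "{0::int} \<times> ?I B \<times> ?I C" and ?Y2 = "?I A \<times> ?I B \<times> {0::int}"
  let ?f = "\<lambda>((p, r), (q, s)). (p * r, p * s + q * r, q * s) :: int triple"
  let ?Y3 = "?f ` (dpairs A \<times> dpairs C)"
  have cI: "card (?I n) = 2 * n + 1" for n by simp
  have fin3: "finite ?Y3" using finite_dpairs by blast
  have sub: "X \<subseteq> ?Y1 \<union> ?Y2 \<union> ?Y3"
  proof
    fix t assume t: "t \<in> X"
    obtain a b c where abc: "t = (a, b, c)" by (cases t)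
    have b: "\<bar>a\<bar> \<le> int A" "\<bar>b\<bar> \<le> int B" "\<bar>c\<bar> \<le> int C" and sq: "is_square (b\<^sup>2 - 4 * a * c)"
      using t by (auto simp: abc X_def disc_def)
    consider "a = 0" | "c = 0" | "a \<noteq> 0" "c \<noteq> 0" by blast
    then show "t \<in> ?Y1 \<union> ?Y2 \<union> ?Y3"
    proof cases
      case 1 then show ?thesis using b by (auto simp: abc)
    next
      case 2 then show ?thesis using b by (auto simp: abc)
    next
      case 3
      obtain p q r s where f: "a = p * r" "c = q * s" "b = p * s + q * r"
        using square_disc_factorization[OF sq 3] .
      have "((p, r), (q, s)) \<in> dpairs A \<times> dpairs C" using 3 b f by (simp add: dpairs_def)
      moreover have "t = ?f ((p, r), (q, s))" by (simp add: abc f)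
      ultimately show ?thesis by blast
    qed
  qed
  have "card X \<le> card (?Y1 \<union> ?Y2 \<union> ?Y3)" using sub fin3 by (intro card_mono) auto
  also have "\<dots> \<le> card ?Y1 + card ?Y2 + card ?Y3" by (meson add_le_mono1 card_Un_le order_trans)
  also have "card ?Y3 \<le> card (dpairs A) * card (dpairs C)"
    using card_image_le[of "dpairs A \<times> dpairs C" ?f] finite_dpairs by (simp add: card_cartesian_product)
  also have "card ?Y1 = (2 * B + 1) * (2 * C + 1)" unfolding card_cartesian_product cI by simp
  also have "card ?Y2 = (2 * A + 1) * (2 * B + 1)" unfolding card_cartesian_product cI by simp
  finally have "real (card X) \<le> real ((2 * B + 1) * (2 * C + 1) + (2 * A + 1) * (2 * B + 1) + card (dpairs A) * card (dpairs C))"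
    by (simp only: of_nat_le_iff add_le_mono)
  then show ?thesis by (simp add: algebra_simps)
qed

section \<open>Counting forms with a given vertex\<close>

definition forms :: "int \<Rightarrow> real \<Rightarrow> int triple \<Rightarrow> int triple set" where
  "forms s T v = {t. real_of_int (hgt (qf (bas1 v) (bas2 v) t)) \<le> T \<and> sgn_ok s t \<and> \<not> is_square (disc t)}"

lemma forms_empty:
  assumes v: "prim v" and s: "s \<in> {-1, 1}" and big: "real (nrm (bas2 v)) ^ 2 > 200 * T"
  shows "forms s T v = {}"
proof (rule ccontr)
  assume "forms s T v \<noteq> {}"
  then obtain t where t: "t \<in> forms s T v" by blast
  obtain a b c where abc: "t = (a, b, c)" by (cases t)
  have "hgt (qf (rv (bas1 v)) (rv (bas2 v)) (rv t)) \<le> T" using t unfolding hgt_qf_rv by (simp add: forms_def)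
  then have "hgt (qf (rv (bas1 v)) (rv (bas2 v)) (real_of_int a, real_of_int b, real_of_int c)) \<le> T"
    by (simp add: abc rv_def)
  from reduced_coefficient_bounds(3)[OF reduced_basis[OF v] this]
  have le: "\<bar>real_of_int c\<bar> * real (nrm (bas2 v)) ^ 2 \<le> 200 * T" .
  have "c = 0"
  proof (rule ccontr)
    assume "c \<noteq> 0"
    then have "1 \<le> \<bar>real_of_int c\<bar>" by (simp flip: of_int_abs)
    then have "1 * real (nrm (bas2 v)) ^ 2 \<le> \<bar>real_of_int c\<bar> * real (nrm (bas2 v)) ^ 2" by (intro mult_right_mono) auto
    then show False using le big by linarith
  qed
  then have "disc t = b\<^sup>2" by (simp add: abc disc_def)
  then have "is_square (disc t)" by (auto simp: is_nth_power_def)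
  then show False using t by (simp add: forms_def)
qed

text \<open>The region lies in a box with sides of order a, b, c, decreasing up to constants. The
  boundary error is of the order of its largest face a b, and square discriminants add a multiple of
  (A C)^(5/4), where a c is of order (T / |v|)^2.\<close>

lemma card_forms:
  assumes v: "prim v" and s: "s \<in> {-1, 1}" and T: "T > 0" and small: "real (nrm (bas2 v)) ^ 2 \<le> 200 * T"
  shows "\<bar>real (card (forms s T v)) - T ^ 3 * kvol s (rv v)\<bar>
    \<le> 60000000 * (T\<^sup>2 / (real (nrm (bas1 v)) ^ 3 * real (nrm (bas2 v))))
      + 256 * 3600000 powr (5 / 4) * (T / real (nrm v)) powr (5 / 2)" and "finite (forms s T v)"
proof -
  define u w where "u = bas1 v" and "w = bas2 v"
  define n n1 n2 where "n = real (nrm v)" and "n1 = real (nrm u)" and "n2 = real (nrm w)"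
  have red: "reduced v u w" unfolding u_def w_def by (rule reduced_basis[OF v])
  note nm = reduced_norms[OF red, folded n_def n1_def n2_def]
  have pos: "n1 > 0" "n2 > 0" using nm(4,5) by linarith+
  have npos: "n > 0" using nm(3) mult_pos_pos[OF pos] by linarith
  define a b c where "a = T / n1\<^sup>2" and "b = T / (n1 * n2)" and "c = T / n2\<^sup>2"
  have abc: "a > 0" "b > 0" "c > 0" using T pos by (simp_all add: a_def b_def c_def)
  have ratio: "b \<le> 2 * a" "c \<le> 2 * b" "a * c = b * b"
  proof -
    have "b = a * (n1 / n2)" using pos by (simp add: a_def b_def power2_eq_square)
    also have "\<dots> \<le> a * 2" using nm(1) pos abc by (intro mult_left_mono) (simp_all add: field_simps)
    finally show "b \<le> 2 * a" by simp
    have "c = b * (n1 / n2)" using pos by (simp add: b_def c_def power2_eq_square)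
    also have "\<dots> \<le> b * 2" using nm(1) pos abc by (intro mult_left_mono) (simp_all add: field_simps)
    finally show "c \<le> 2 * b" by simp
    show "a * c = b * b" using pos by (simp add: a_def b_def c_def power2_eq_square)
  qed
  \<comment> \<open>This is where the bound on the second basis vector enters: even the shortest
    side is bounded below, so roundings and summands 1 are absorbed into multiples of a, b and
    c.\<close>
  have one: "1 \<le> 200 * c" using small pos by (simp add: c_def n2_def w_def[symmetric] field_simps)
  define A B C where "A = nat \<lceil>200 * a\<rceil>" and "B = nat \<lceil>200 * b\<rceil>" and "C = nat \<lceil>200 * c\<rceil>"
  have up: "real (nat \<lceil>x\<rceil>) \<le> x + 1" if "x \<ge> 0" for x :: real using that by (simp add: of_int_ceiling_le_add_one)
  have A: "real A \<le> 1000 * a" "200 * a \<le> real A" using up[of "200 * a"] abc ratio one real_nat_ceiling_ge[of "200 * a"] unfolding A_def by linarith+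
  have B: "real B \<le> 600 * b" "200 * b \<le> real B" using up[of "200 * b"] abc ratio one real_nat_ceiling_ge[of "200 * b"] unfolding B_def by linarith+
  have C: "real C \<le> 400 * c" "200 * c \<le> real C" using up[of "200 * c"] abc ratio one real_nat_ceiling_ge[of "200 * c"] unfolding C_def by linarith+
  have A1: "A \<ge> 1" and C1: "C \<ge> 1" using A(2) C(2) abc ratio one by linarith+
  have bd: "\<bar>x\<bar> \<le> real A \<and> \<bar>y\<bar> \<le> real B \<and> \<bar>z\<bar> \<le> real C" if "hgt (qf (rv u) (rv w) (x, y, z)) \<le> T" for x y z
  proof -
    have "\<bar>x\<bar> \<le> 200 * a" "\<bar>y\<bar> \<le> 200 * b" "\<bar>z\<bar> \<le> 200 * c"
      using reduced_coefficient_bounds[OF red that] pos unfolding n1_def[symmetric] n2_def[symmetric] a_def b_def c_def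
      by (simp_all add: field_simps)
    then show ?thesis using A(2) B(2) C(2) by linarith
  qed
  define e where "e = a * b"
  have e_eq: "e = T\<^sup>2 / (n1 ^ 3 * n2)" by (simp add: e_def a_def b_def power2_eq_square power3_eq_cube)
  have prods: "a * b = e" "a * c \<le> 2 * e" "b * c \<le> 4 * e"
  proof -
    show "a * b = e" by (simp add: e_def)
    have bb: "b * b \<le> 2 * e" using mult_right_mono[OF ratio(1), of b] abc by (simp add: e_def)
    then show "a * c \<le> 2 * e" using ratio(3) by simp
    have "b * c \<le> b * (2 * b)" using ratio(2) abc by (intro mult_left_mono) auto
    then show "b * c \<le> 4 * e" using bb by simp
  qed
  have sz: "2 * real A + 1 \<le> 2800 * a" "2 * real B + 1 \<le> 1600 * b" "2 * real C + 1 \<le> 1000 * c"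
    using A B C ratio one by linarith+
  have pAB: "(2 * real A + 1) * (2 * real B + 1) \<le> 4480000 * e"
  proof -
    have "(2 * real A + 1) * (2 * real B + 1) \<le> (2800 * a) * (1600 * b)" using sz abc by (intro mult_mono) auto
    then show ?thesis using prods(1) by simp
  qed
  have pAC: "(2 * real A + 1) * (2 * real C + 1) \<le> 5600000 * e"
  proof -
    have "(2 * real A + 1) * (2 * real C + 1) \<le> (2800 * a) * (1000 * c)" using sz abc by (intro mult_mono) auto
    then show ?thesis using prods(2) by simp
  qed
  have pBC: "(2 * real B + 1) * (2 * real C + 1) \<le> 6400000 * e"
  proof -
    have "(2 * real B + 1) * (2 * real C + 1) \<le> (1600 * b) * (1000 * c)" using sz abc by (intro mult_mono) auto
    then show ?thesis using prods(3) by simp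
  qed
  let ?F = "{t. real_of_int (hgt (qf u w t)) \<le> T \<and> sgn_ok s t}"
  let ?Z = "{t. real_of_int (hgt (qf u w t)) \<le> T \<and> sgn_ok s t \<and> is_square (disc t)}"
  let ?X = "{(a, b, c). \<bar>a\<bar> \<le> int A \<and> \<bar>b\<bar> \<le> int B \<and> \<bar>c\<bar> \<le> int C \<and> is_square (disc (a, b, c))}"
  have bdi: "\<bar>x\<bar> \<le> int A \<and> \<bar>y\<bar> \<le> int B \<and> \<bar>z\<bar> \<le> int C" if "(x, y, z) \<in> ?F" for x y z
  proof -
    have "hgt (qf (rv u) (rv w) (rv (x, y, z))) \<le> T" using that unfolding hgt_qf_rv by simp
    moreover have "rv (x, y, z) = (real_of_int x, real_of_int y, real_of_int z)" by (simp add: rv_def)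
    ultimately have "hgt (qf (rv u) (rv w) (real_of_int x, real_of_int y, real_of_int z)) \<le> T" by (simp only:)
    from bd[OF this] show ?thesis by linarith
  qed
  have finF: "finite ?F"
  proof (rule finite_subset)
    show "?F \<subseteq> {-int A..int A} \<times> {-int B..int B} \<times> {-int C..int C}"
    proof
      fix t assume t: "t \<in> ?F"
      obtain x y z where xyz: "t = (x, y, z)" by (cases t)
      show "t \<in> {-int A..int A} \<times> {-int B..int B} \<times> {-int C..int C}"
        using bdi[OF t[unfolded xyz]] by (simp add: xyz abs_le_iff)
    qed
  qed simp
  have forms_eq: "forms s T v = ?F - ?Z" by (rule set_eqI) (simp add: forms_def u_def w_def, blast)
  show "finite (forms s T v)" unfolding forms_eq using finF by simp
  have ZF: "?Z \<subseteq> ?F" by blast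
  have cf: "real (card (forms s T v)) = real (card ?F) - real (card ?Z)"
    unfolding forms_eq using card_Diff_subset[OF finite_subset[OF ZF finF] ZF] card_mono[OF finF ZF] by simp
  have "measure lborel {t. hgt (qf (rv u) (rv w) t) \<le> T \<and> sgn_ok s t} = T ^ 3 * kvol s (rv v)"
  proof -
    have "cross (rv u) (rv w) = rv v" using red by (simp add: cross_rv reduced_def)
    moreover have "rv v \<noteq> 0" using npos rn_rv[of v] rn_eq_0_iff[of "rv v"] by (auto simp: n_def)
    ultimately have "kvol s (rv v) = qvol s (rv u) (rv w)" by (rule kvol_eq)
    then show ?thesis using vol3_scale[OF bounded_reduced[OF red] T, of s] by (simp only: qf_def qvol_def)
  qed
  moreover have "{t. hgt (qf (rv u) (rv w) (rv t)) \<le> T \<and> sgn_ok s (rv t)} = ?F" by (simp only: hgt_qf_rv sgn_ok_rv)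
  moreover have "\<bar>real (card {t. hgt (qf (rv u) (rv w) (rv t)) \<le> T \<and> sgn_ok s (rv t)})
      - measure lborel {t. hgt (qf (rv u) (rv w) t) \<le> T \<and> sgn_ok s t}\<bar>
     \<le> 2 * ((2 * real A + 1) * (2 * real B + 1) + (2 * real A + 1) * (2 * real C) + 2 * real B * (2 * real C))"
    unfolding qf_def
  proof (rule lin3_lattice_points)
    fix x y z assume "hgt (lin3 (lprod (rv u) (rv u)) (lprod (rv u) (rv w)) (lprod (rv w) (rv w)) (x, y, z)) \<le> T"
    then show "\<bar>x\<bar> \<le> real A \<and> \<bar>y\<bar> \<le> real B \<and> \<bar>z\<bar> \<le> real C" by (rule bd[unfolded qf_def])
  qed (use s in auto)
  ultimately have "\<bar>real (card ?F) - T ^ 3 * kvol s (rv v)\<bar>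
     \<le> 2 * ((2 * real A + 1) * (2 * real B + 1) + (2 * real A + 1) * (2 * real C) + 2 * real B * (2 * real C))"
    by (simp only:)
  also have "\<dots> \<le> 2 * ((2 * real A + 1) * (2 * real B + 1) + (2 * real A + 1) * (2 * real C + 1) + (2 * real B + 1) * (2 * real C + 1))"
    by (intro mult_left_mono add_mono mult_mono) auto
  also have "\<dots> \<le> 2 * (4480000 * e + 5600000 * e + 6400000 * e)"
    using pAB pAC pBC by (intro mult_left_mono add_mono) auto
  finally have main: "\<bar>real (card ?F) - T ^ 3 * kvol s (rv v)\<bar> \<le> 32960000 * e" by simp
  have "real (card ?Z) \<le> 10880000 * e + 256 * 3600000 powr (5 / 4) * (T / n) powr (5 / 2)"
  proof -
    have "?Z \<subseteq> ?X"
    proof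
      fix t assume t: "t \<in> ?Z"
      obtain x y z where xyz: "t = (x, y, z)" by (cases t)
      have "(x, y, z) \<in> ?F" using t ZF xyz by blast
      from bdi[OF this] show "t \<in> ?X" using t by (simp add: xyz)
    qed
    moreover have "finite ?X"
      by (rule finite_subset[of _ "{-int A..int A} \<times> {-int B..int B} \<times> {-int C..int C}"]) auto
    ultimately have "card ?Z \<le> card ?X" by (intro card_mono)
    then have "real (card ?Z) \<le> real (card ?X)" by (simp only: of_nat_le_iff)
    also have "\<dots> \<le> (2 * real B + 1) * (2 * real C + 1) + (2 * real A + 1) * (2 * real B + 1)
      + real (card (dpairs A)) * real (card (dpairs C))" by (rule card_square_disc)
    also have "real (card (dpairs A)) * real (card (dpairs C)) \<le> (16 * real A powr (5 / 4)) * (16 * real C powr (5 / 4))"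
      using card_dpairs_powr[OF A1] card_dpairs_powr[OF C1] by (intro mult_mono) auto
    also have "\<dots> = 256 * (real A * real C) powr (5 / 4)" by (simp add: powr_mult)
    also have "(real A * real C) powr (5 / 4) \<le> (3600000 * (T / n)\<^sup>2) powr (5 / 4)"
    proof (rule powr_mono2)
      have "real A * real C \<le> (1000 * a) * (400 * c)" using A(1) C(1) abc by (intro mult_mono) auto
      also have "\<dots> = 400000 * (b * b)" using ratio(3) by simp
      also have "b * b \<le> (3 * (T / n)) * (3 * (T / n))"
      proof -
        have "b \<le> 3 * (T / n)" using nm(2) T pos npos by (simp add: b_def field_simps)
        then show ?thesis using abc by (intro mult_mono) auto
      qed
      finally show "real A * real C \<le> 3600000 * (T / n)\<^sup>2" by (simp add: power2_eq_square)
    qed simp_all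
    also have "\<dots> = 3600000 powr (5 / 4) * (T / n) powr (5 / 2)"
    proof -
      have "(T / n)\<^sup>2 = (T / n) powr 2" using T npos by simp
      then have "((T / n)\<^sup>2) powr (5 / 4) = (T / n) powr (5 / 2)" by (simp only: powr_powr) simp
      then show ?thesis by (simp add: powr_mult)
    qed
    finally show ?thesis using pAB pBC by simp
  qed
  moreover have "32960000 * e + 10880000 * e \<le> 60000000 * e" using abc by (simp add: e_def)
  moreover have "0 \<le> real (card ?Z)" by simp
  ultimately have "\<bar>real (card (forms s T v)) - T ^ 3 * kvol s (rv v)\<bar>
    \<le> 60000000 * e + 256 * 3600000 powr (5 / 4) * (T / n) powr (5 / 2)" using main unfolding cf by linarith
  then show "\<bar>real (card (forms s T v)) - T ^ 3 * kvol s (rv v)\<bar>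
    \<le> 60000000 * (T\<^sup>2 / (real (nrm (bas1 v)) ^ 3 * real (nrm (bas2 v))))
      + 256 * 3600000 powr (5 / 4) * (T / real (nrm v)) powr (5 / 2)"
    unfolding e_eq n1_def n2_def n_def u_def w_def .
qed

section \<open>Summation over the vertices\<close>

text \<open>The basis determines v by its cross product, so the sum injects into one over pairs (u,
  x) with x in the slab of u. The inner sum costs a factor |u|, which leaves |u|^-2, and this sums
  over |u| \<le> N1 to O(N1). The constant is 36 * 26.\<close>

lemma sum_reduced_pairs:
  fixes g :: "nat \<Rightarrow> real"
  assumes V: "\<And>v. v \<in> V \<Longrightarrow> prim v \<and> nrm (bas1 v) \<le> N1 \<and> nrm (bas2 v) \<le> N2"
    and g: "\<And>n. g n \<ge> 0" "\<And>m n. 1 \<le> m \<Longrightarrow> m \<le> n \<Longrightarrow> g n \<le> g m"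
  shows "(\<Sum>v\<in>V. g (nrm (bas2 v)) / real (nrm (bas1 v)) ^ 3) \<le> 936 * real N1 * (\<Sum>n=1..N2. real n * g n)"
proof -
  let ?U = "{u :: int triple. u \<noteq> 0 \<and> nrm u \<le> N1}"
  let ?S = "\<lambda>u. {x :: int triple. x \<noteq> 0 \<and> nrm x \<le> N2 \<and> 2 * \<bar>dot u x\<bar> \<le> dot u u}"
  let ?f = "\<lambda>p. g (nrm (snd p)) / real (nrm (fst p)) ^ 3"
  define Y where "Y = (\<Sum>n=1..N2. real n * g n)"
  have Y: "Y \<ge> 0" unfolding Y_def using g(1) by (intro sum_nonneg) simp
  have finU: "finite ?U" by (rule finite_subset[OF _ finite_nrm_ball[of N1]]) blast
  have finS: "finite (?S u)" for u by (rule finite_subset[OF _ finite_nrm_ball[of N2]]) blast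
  have red: "reduced v (bas1 v) (bas2 v)" if "v \<in> V" for v using reduced_basis V[OF that] by blast
  have inj: "inj_on basis V"
  proof (rule inj_onI)
    fix v v' assume "v \<in> V" "v' \<in> V" "basis v = basis v'"
    then show "v = v'" using red[of v] red[of v'] by (simp add: reduced_def)
  qed
  have sub: "basis ` V \<subseteq> Sigma ?U ?S"
  proof
    fix p assume "p \<in> basis ` V"
    then obtain v where v: "v \<in> V" "p = basis v" by blast
    show "p \<in> Sigma ?U ?S" using red[OF v(1)] V[OF v(1)] unfolding v(2) mem_Sigma_iff[of "bas1 v" "bas2 v", unfolded prod.collapse]
      by (simp add: reduced_def)
  qed
  have "(\<Sum>v\<in>V. ?f (basis v)) = (\<Sum>p\<in>basis ` V. ?f p)" using inj by (simp add: sum.reindex)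
  also have "\<dots> \<le> (\<Sum>p\<in>Sigma ?U ?S. ?f p)"
    using sub finU finS g(1) by (intro sum_mono2) (auto intro!: finite_SigmaI)
  also have "\<dots> = (\<Sum>u\<in>?U. \<Sum>x\<in>?S u. g (nrm x) / real (nrm u) ^ 3)"
    using finU finS by (subst sum.Sigma) (simp_all add: case_prod_beta)
  also have "\<dots> \<le> (\<Sum>u\<in>?U. 36 * Y * (1 / real (nrm u) ^ 2))"
  proof (rule sum_mono)
    fix u assume u: "u \<in> ?U"
    have n: "real (nrm u) > 0" using u nrm_pos_iff[of u] by simp
    have "(\<Sum>x\<in>?S u. g (nrm x)) \<le> 36 * real (nrm u) * Y"
      unfolding Y_def using u g by (intro sum_slab_le) simp_all
    then have "(\<Sum>x\<in>?S u. g (nrm x)) / real (nrm u) ^ 3 \<le> 36 * real (nrm u) * Y / real (nrm u) ^ 3"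
      using n by (intro divide_right_mono) simp_all
    also have "\<dots> = 36 * Y * (1 / real (nrm u) ^ 2)" using n by (simp add: power2_eq_square power3_eq_cube)
    finally show "(\<Sum>x\<in>?S u. g (nrm x) / real (nrm u) ^ 3) \<le> 36 * Y * (1 / real (nrm u) ^ 2)"
      by (simp only: sum_divide_distrib)
  qed
  also have "\<dots> = 36 * Y * (\<Sum>u\<in>?U. 1 / real (nrm u) ^ 2)" by (simp only: sum_distrib_left)
  also have "(\<Sum>u\<in>?U. 1 / real (nrm u) ^ 2) \<le> 26 * (\<Sum>n=1..N1. real n ^ 2 * (1 / real n ^ 2))"
    by (rule sum_nrm_le) simp_all
  also have "(\<Sum>n=1..N1. real n ^ 2 * (1 / real n ^ 2)) = (\<Sum>n=1..N1. 1)" by (rule sum.cong) auto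
  also have "\<dots> = real N1" by simp
  finally have "(\<Sum>v\<in>V. ?f (basis v)) \<le> 36 * Y * (26 * real N1)" using Y by (simp add: mult_left_mono)
  then show ?thesis by (simp add: Y_def mult_ac)
qed

lemma sum_inverse_sqrt_le: "(\<Sum>n=1..k. 1 / sqrt (real n)) \<le> 2 * sqrt (real k)"
proof (induction k)
  case (Suc k)
  have "1 / sqrt (real (Suc k)) \<le> 2 * (sqrt (real (Suc k)) - sqrt (real k))"
  proof -
    define x y where "x = sqrt (real (Suc k))" and "y = sqrt (real k)"
    have xy: "x > 0" "y \<ge> 0" "y \<le> x" by (simp_all add: x_def y_def)
    have "x\<^sup>2 - y\<^sup>2 = 1" by (simp add: x_def y_def)
    then have "1 = (x - y) * (x + y)" by (simp add: power2_eq_square algebra_simps)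
    also have "\<dots> \<le> (x - y) * (2 * x)" using xy by (intro mult_left_mono) auto
    finally show ?thesis using xy unfolding x_def[symmetric] y_def[symmetric] by (simp add: field_simps)
  qed
  then show ?case using Suc by simp
qed simp

text \<open>The weight 8 / (n + r)^3 majorizes 1 / n^3 for n \<ge> r and is decreasing everywhere.
  It stands in for the cutoff n \<ge> r, which a decreasing weight cannot express, and still sums to
  O(1 / r).\<close>

lemma sum_shifted_cube_le:
  assumes "r > 0" shows "(\<Sum>n=1..k. real n * (8 / (real n + r) ^ 3)) \<le> 8 / r"
proof -
  have "(\<Sum>n=1..k. real n * (8 / (real n + r) ^ 3)) \<le> 8 / r - 8 / (real k + r)"
  proof (induction k)
    case (Suc k)
    define x where "x = real k + r"
    have x: "x > 0" using assms by (simp add: x_def)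
    have "real (Suc k) * (8 / (x + 1) ^ 3) \<le> (x + 1) * (8 / (x + 1) ^ 3)"
      using assms x by (intro mult_right_mono) (simp_all add: x_def)
    also have "\<dots> = 8 / (x + 1)\<^sup>2"
    proof -
      have *: "z * (8 / z ^ 3) = 8 / z\<^sup>2" if "z > 0" for z :: real
        using that by (simp add: power2_eq_square power3_eq_cube)
      show ?thesis by (rule *) (use x in simp)
    qed
    also have "\<dots> \<le> 8 / (x * (x + 1))" using x by (intro divide_left_mono) (simp_all add: power2_eq_square)
    also have "\<dots> = 8 / x - 8 / (x + 1)" using x by (simp add: field_simps)
    finally have "real (Suc k) * (8 / (real (Suc k) + r) ^ 3) \<le> 8 / (real k + r) - 8 / (real (Suc k) + r)"
      by (simp add: x_def algebra_simps)
    then show ?case using Suc by simp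
  qed simp
  moreover have "0 \<le> 8 / (real k + r)" using assms by simp
  ultimately show ?thesis by linarith
qed

text \<open>Since \<open>kvol\<close> has degree -3, grouping by content gives x^3 S(x) as the sum
  of (x / d)^3 P(x / d). Multiplication by x^3 thus brings the sums into the form of
  \<open>cubic_log_inversion\<close>.\<close>

lemma kvol_log_sum:
  assumes s: "s \<in> {-1, 1}"
  obtains c K where "c > 0" "\<And>x. x \<ge> 1 \<Longrightarrow> \<bar>(\<Sum>v | prim v \<and> real (nrm v) \<le> x. kvol s (rv v)) - c * ln x\<bar> \<le> K"
proof -
  obtain C0 where C0: "\<And>v. nrm (half v) \<ge> 2 \<Longrightarrow> \<bar>8 * kvol s (rv v) - kvol s (rv (half v))\<bar> \<le> C0 / real (nrm (half v)) ^ 4"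
    using kvol_doubling[OF s] by blast
  define C where "C = max 8 C0"
  have rv0: "rv v \<noteq> 0" if "v \<noteq> 0" for v
    using that rn_rv[of v] rn_eq_0_iff[of "rv v"] nrm_pos_iff[of v] by auto
  have lower: "1 / 2048 / real (nrm v) ^ 3 \<le> kvol s (rv v)" if "v \<noteq> 0" for v
    using kvol_bounds(1)[OF rv0[OF that] s] by (simp only: rn_rv)
  have upper: "kvol s (rv v) \<le> C / real (nrm v) ^ 3" if "v \<noteq> 0" for v
  proof -
    have "kvol s (rv v) \<le> 8 / real (nrm v) ^ 3" using kvol_bounds(2)[OF rv0[OF that] s] by (simp only: rn_rv)
    also have "\<dots> \<le> C / real (nrm v) ^ 3" by (intro divide_right_mono) (auto simp: C_def)
    finally show ?thesis .
  qed
  have dbl: "\<bar>8 * kvol s (rv v) - kvol s (rv (half v))\<bar> \<le> C / real (nrm (half v)) ^ 4" if "nrm (half v) \<ge> 2" for v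
  proof -
    have "C0 / real (nrm (half v)) ^ 4 \<le> C / real (nrm (half v)) ^ 4" by (intro divide_right_mono) (auto simp: C_def)
    then show ?thesis using C0[OF that] by linarith
  qed
  have c0: "(0::real) < 1 / 2048" by simp
  obtain \<kappa> D where \<kappa>: "\<kappa> > 0"
    and D: "\<And>R. R \<ge> 1 \<Longrightarrow> \<bar>(\<Sum>v | v \<noteq> 0 \<and> real (nrm v) \<le> R. kvol s (rv v)) - \<kappa> * ln R\<bar> \<le> D"
    using log_sum[OF c0 lower upper dbl] by blast
  define S where "S = (\<lambda>x. \<Sum>v | v \<noteq> 0 \<and> real (nrm v) \<le> x. kvol s (rv v))"
  define P where "P = (\<lambda>x. \<Sum>v | prim v \<and> real (nrm v) \<le> x. kvol s (rv v))"
  have dec: "S x = (\<Sum>d=1..nat \<lfloor>x\<rfloor>. \<Sum>y | y \<in> {y. prim y} \<and> real (nrm y) \<le> x / real d. kvol s (rv (smul d y)))" for x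
  proof -
    have "(\<Sum>v | v \<in> {v. v \<noteq> 0} \<and> real (nrm v) \<le> x. kvol s (rv v))
      = (\<Sum>d=1..nat \<lfloor>x\<rfloor>. \<Sum>y | y \<in> {y. prim y} \<and> real (nrm y) \<le> x / real d. kvol s (rv (smul d y)))"
    proof (rule sum_scaling_decomp[OF nonzero_eq_smul_prim])
      show "d = d' \<and> y = y'" if "d \<ge> 1" "y \<in> {y. prim y}" "y' \<in> {y. prim y}" "smul d y = smul d' y'" for d d' y y'
        using smul_prim_inj[of y y' d d'] that by simp
      show "real (nrm (smul d y)) = real d * real (nrm y)" for d y by (simp add: nrm_smul)
      show "1 \<le> real (nrm y)" if "y \<in> {y. prim y}" for y
        using prim_nonzero[of y] nrm_pos_iff[of y] that by simp
      show "finite {y \<in> {y. prim y}. real (nrm y) \<le> t}" for t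
        by (rule finite_subset[OF _ finite_nrm_real_ball[of t]]) blast
    qed
    then show ?thesis by (simp only: S_def mem_Collect_eq)
  qed
  have inv: "x ^ 3 * S x = (\<Sum>d=1..nat \<lfloor>x\<rfloor>. (x / real d) ^ 3 * P (x / real d))" for x
  proof -
    have "x ^ 3 * S x = (\<Sum>d=1..nat \<lfloor>x\<rfloor>. x ^ 3 * (\<Sum>y | prim y \<and> real (nrm y) \<le> x / real d. kvol s (rv (smul d y))))"
      unfolding dec by (simp only: sum_distrib_left mem_Collect_eq)
    also have "\<dots> = (\<Sum>d=1..nat \<lfloor>x\<rfloor>. (x / real d) ^ 3 * P (x / real d))"
    proof (rule sum.cong[OF refl])
      fix d assume "d \<in> {1..nat \<lfloor>x\<rfloor>}"
      then have d: "real d > 0" by simp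
      have "kvol s (rv (smul d y)) = kvol s (rv y) / real d ^ 3" if "prim y" for y
      proof -
        have "rv (smul d y) = real d *\<^sub>R rv y" by (cases y) (simp add: rv_def smul_def)
        then show ?thesis using kvol_scale[OF rv0[OF prim_nonzero[OF that]] d, of s] by simp
      qed
      then have "(\<Sum>y | prim y \<and> real (nrm y) \<le> x / real d. kvol s (rv (smul d y)))
          = (\<Sum>y | prim y \<and> real (nrm y) \<le> x / real d. kvol s (rv y) / real d ^ 3)"
        by (intro sum.cong) simp_all
      also have "\<dots> = P (x / real d) / real d ^ 3" unfolding P_def by (simp only: sum_divide_distrib)
      finally show "x ^ 3 * (\<Sum>y | prim y \<and> real (nrm y) \<le> x / real d. kvol s (rv (smul d y))) = (x / real d) ^ 3 * P (x / real d)"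
        by (simp add: power_divide)
    qed
    finally show ?thesis .
  qed
  have est: "\<bar>x ^ 3 * S x - \<kappa> * x ^ 3 * ln x\<bar> \<le> D * x ^ 3" if x: "x \<ge> 1" for x
  proof -
    have "x ^ 3 * S x - \<kappa> * x ^ 3 * ln x = x ^ 3 * (S x - \<kappa> * ln x)" by (simp add: algebra_simps)
    then have "\<bar>x ^ 3 * S x - \<kappa> * x ^ 3 * ln x\<bar> = x ^ 3 * \<bar>S x - \<kappa> * ln x\<bar>"
      using x by (simp add: abs_mult)
    also have "\<dots> \<le> x ^ 3 * D" unfolding S_def using D[OF x] x by (intro mult_left_mono) auto
    finally show ?thesis by (simp add: mult.commute)
  qed
  obtain c K where c: "c > 0" and K: "\<And>x. x \<ge> 1 \<Longrightarrow> \<bar>x ^ 3 * P x - c * x ^ 3 * ln x\<bar> \<le> K * x ^ 3"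
    using cubic_log_inversion[where F = "\<lambda>x. x ^ 3 * S x" and f = "\<lambda>x. x ^ 3 * P x", OF inv \<kappa> est] by blast
  have "\<bar>P x - c * ln x\<bar> \<le> K" if x: "x \<ge> 1" for x
  proof -
    have "x ^ 3 * P x - c * x ^ 3 * ln x = x ^ 3 * (P x - c * ln x)" by (simp add: algebra_simps)
    then have "x ^ 3 * \<bar>P x - c * ln x\<bar> \<le> x ^ 3 * K" using K[OF x] x by (simp add: abs_mult mult.commute)
    then show ?thesis using x by simp
  qed
  then show ?thesis using that[OF c, of K] unfolding P_def by blast
qed

definition verts :: "real \<Rightarrow> int triple set" where
  "verts T = {v. prim v \<and> real (nrm (bas2 v)) ^ 2 \<le> 200 * T}"

text \<open>Here 15^2 exceeds 200, and |u| \<le> 2 |w| gives 30. With |v| \<le> 3 |u| |w| \<le> 6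
  |w|^2 one obtains 1200.\<close>

lemma verts_bounds:
  assumes "v \<in> verts T" "T \<ge> 1"
  shows "real (nrm (bas2 v)) \<le> 15 * sqrt T" "real (nrm (bas1 v)) \<le> 30 * sqrt T" "real (nrm v) \<le> 1200 * T"
proof -
  note nm = reduced_norms[OF reduced_basis[of v]]
  have v: "prim v" "real (nrm (bas2 v)) ^ 2 \<le> 200 * T" using assms(1) by (simp_all add: verts_def)
  have "(15 * sqrt T)\<^sup>2 = 225 * T" using assms(2) by (simp add: power_mult_distrib)
  then have "real (nrm (bas2 v)) ^ 2 \<le> (15 * sqrt T)\<^sup>2" using v(2) assms(2) by simp
  then show 1: "real (nrm (bas2 v)) \<le> 15 * sqrt T" by (rule power2_le_imp_le) (use assms(2) in simp)
  then show "real (nrm (bas1 v)) \<le> 30 * sqrt T" using nm(1)[OF v(1)] by linarith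
  have "real (nrm (bas1 v)) * real (nrm (bas2 v)) \<le> 2 * real (nrm (bas2 v)) * real (nrm (bas2 v))"
    using nm(1)[OF v(1)] by (intro mult_right_mono) simp_all
  also have "\<dots> = 2 * real (nrm (bas2 v)) ^ 2" by (simp add: power2_eq_square)
  finally show "real (nrm v) \<le> 1200 * T" using nm(2)[OF v(1)] v(2) by linarith
qed

lemma finite_verts: "T \<ge> 1 \<Longrightarrow> finite (verts T)"
  by (rule finite_subset[OF _ finite_nrm_real_ball[of "1200 * T"]]) (use verts_bounds(3) in blast)

text \<open>The admissible vertices are those with |u2|^2 \<le> 200 T, whereas the logarithmic sum
  runs over |v| \<le> T. Besides the two errors of \<open>card_forms\<close>, one needs that the
  volumes over the symmetric difference of these two sets add up to O(1).\<close>

lemma sum_forms: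
  assumes s: "s \<in> {-1, 1}"
  shows "\<exists>E. \<forall>T\<ge>1. \<bar>(\<Sum>v\<in>verts T. real (card (forms s T v))) - T ^ 3 * (\<Sum>v | prim v \<and> real (nrm v) \<le> T. kvol s (rv v))\<bar> \<le> E * T ^ 3"
proof (intro exI allI impI)
  fix T :: real assume T: "T \<ge> 1"
  define E2 where "E2 = (256 * 3600000 powr (5 / 4) :: real)"
  have E2: "E2 \<ge> 0" by (simp add: E2_def)
  have rv0: "rv v \<noteq> 0" if "prim v" for v
    using prim_nonzero[OF that] rn_rv[of v] rn_eq_0_iff[of "rv v"] nrm_pos_iff[of v] by auto
  have kub: "kvol s (rv v) \<le> 8 / real (nrm v) ^ 3" if "prim v" for v
    using kvol_bounds(2)[OF rv0[OF that] s] by (simp only: rn_rv)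
  have k0: "0 \<le> kvol s (rv v)" if "prim v" for v
    using kvol_bounds(1)[OF rv0[OF that] s] rn_nonneg[of "rv v"] by (meson divide_nonneg_nonneg order_trans zero_le_power zero_le_one zero_le_numeral)
  define r where "r = sqrt T"
  have r: "r \<ge> 1" "r * r = T" using T by (simp_all add: r_def)
  let ?V = "verts T" and ?P = "{v. prim v \<and> real (nrm v) \<le> T}"
  have finV: "finite ?V" using finite_verts[OF T] .
  have finP: "finite ?P" by (rule finite_subset[OF _ finite_nrm_real_ball[of T]]) blast
  have Vp: "prim v" "real (nrm (bas2 v)) ^ 2 \<le> 200 * T" if "v \<in> ?V" for v using that by (simp_all add: verts_def)
  \<comment> \<open>With g(n) = 1 / n the slab sum is linear in the bound for |u2|. Both basis
    vectors are O(sqrt T), so the total is T^2 times O(T); the constant is 936 * 30 * 15.\<close>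
  have e1: "(\<Sum>v\<in>?V. T\<^sup>2 / (real (nrm (bas1 v)) ^ 3 * real (nrm (bas2 v)))) \<le> 421200 * T ^ 3"
  proof -
    have "(\<Sum>v\<in>?V. 1 / real (nrm (bas2 v)) / real (nrm (bas1 v)) ^ 3)
        \<le> 936 * real (nat \<lfloor>30 * r\<rfloor>) * (\<Sum>n=1..nat \<lfloor>15 * r\<rfloor>. real n * (1 / real n))"
    proof (rule sum_reduced_pairs)
      fix v assume v: "v \<in> ?V"
      show "prim v \<and> nrm (bas1 v) \<le> nat \<lfloor>30 * r\<rfloor> \<and> nrm (bas2 v) \<le> nat \<lfloor>15 * r\<rfloor>"
        using Vp(1)[OF v] verts_bounds[OF v T] by (simp add: r_def le_nat_floor)
    qed (simp_all add: frac_le)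
    also have "(\<Sum>n=1..nat \<lfloor>15 * r\<rfloor>. real n * (1 / real n)) = (\<Sum>n=1..nat \<lfloor>15 * r\<rfloor>. 1)" by (rule sum.cong) auto
    also have "\<dots> = real (nat \<lfloor>15 * r\<rfloor>)" by simp
    also have "936 * real (nat \<lfloor>30 * r\<rfloor>) * real (nat \<lfloor>15 * r\<rfloor>) \<le> 936 * (30 * r) * (15 * r)"
      using r by (intro mult_mono mult_left_mono of_nat_floor) auto
    also have "\<dots> = 421200 * T" using r(2) by simp
    finally have "(\<Sum>v\<in>?V. 1 / real (nrm (bas2 v)) / real (nrm (bas1 v)) ^ 3) \<le> 421200 * T" .
    then have "T\<^sup>2 * (\<Sum>v\<in>?V. 1 / real (nrm (bas2 v)) / real (nrm (bas1 v)) ^ 3) \<le> T\<^sup>2 * (421200 * T)"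
      by (intro mult_left_mono) auto
    then show ?thesis by (simp add: sum_distrib_left power2_eq_square power3_eq_cube mult_ac)
  qed
  \<comment> \<open>Shells of size O(n^2) turn the sum into T^(5/2) times the sum of n^(-1/2) up to
    1200 T. The constant uses 35^2 \<ge> 1200.\<close>
  have e2: "(\<Sum>v\<in>?V. (T / real (nrm v)) powr (5 / 2)) \<le> 1820 * T ^ 3"
  proof -
    have "(\<Sum>v\<in>?V. (T / real (nrm v)) powr (5 / 2)) \<le> 26 * (\<Sum>n=1..nat \<lfloor>1200 * T\<rfloor>. real n ^ 2 * (T / real n) powr (5 / 2))"
    proof (rule sum_nrm_le)
      fix v assume v: "v \<in> ?V"
      show "v \<noteq> 0 \<and> nrm v \<le> nat \<lfloor>1200 * T\<rfloor>"
        using prim_nonzero[OF Vp(1)[OF v]] verts_bounds(3)[OF v T] by (simp add: le_nat_floor)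
    qed simp
    also have "(\<Sum>n=1..nat \<lfloor>1200 * T\<rfloor>. real n ^ 2 * (T / real n) powr (5 / 2)) = (\<Sum>n=1..nat \<lfloor>1200 * T\<rfloor>. T\<^sup>2 * r * (1 / sqrt (real n)))"
    proof (rule sum.cong[OF refl])
      fix n assume "n \<in> {1..nat \<lfloor>1200 * T\<rfloor>}"
      then have n: "real n > 0" by simp
      have "(T / real n) powr (5 / 2) = (T / real n) powr (2 + 1 / 2)" by simp
      also have "\<dots> = (T / real n)\<^sup>2 * sqrt (T / real n)"
        using T n by (simp only: powr_add powr_half_sqrt powr_numeral divide_pos_pos divide_nonneg_nonneg less_imp_le)
      finally show "real n ^ 2 * (T / real n) powr (5 / 2) = T\<^sup>2 * r * (1 / sqrt (real n))"
        using n by (simp add: power_divide real_sqrt_divide r_def)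
    qed
    also have "\<dots> = T\<^sup>2 * r * (\<Sum>n=1..nat \<lfloor>1200 * T\<rfloor>. 1 / sqrt (real n))" by (simp only: sum_distrib_left)
    also have "\<dots> \<le> T\<^sup>2 * r * (35 * 2 * r)"
    proof (rule mult_left_mono)
      have "sqrt (real (nat \<lfloor>1200 * T\<rfloor>)) \<le> sqrt (1225 * T)"
        using T of_nat_floor[of "1200 * T"] by (intro real_sqrt_le_mono) linarith
      also have "\<dots> = 35 * r" by (simp add: real_sqrt_mult r_def real_sqrt_eq_iff[of 1225 "35\<^sup>2", simplified])
      finally show "(\<Sum>n=1..nat \<lfloor>1200 * T\<rfloor>. 1 / sqrt (real n)) \<le> 35 * 2 * r"
        using sum_inverse_sqrt_le[of "nat \<lfloor>1200 * T\<rfloor>"] by linarith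
    qed (use r in simp)
    also have "\<dots> = 70 * T ^ 3" using r(2) by (simp add: power2_eq_square power3_eq_cube)
    finally show ?thesis by simp
  qed
  \<comment> \<open>These vertices satisfy T < |v| \<le> 1200 T, a range of bounded ratio, over
    which |v|^-3 sums to O(1).\<close>
  have e3: "(\<Sum>v\<in>?V - ?P. kvol s (rv v)) \<le> 249600"
  proof -
    define g where "g = (\<lambda>n::nat. if real n \<le> T then 0 else 8 / real n ^ 3)"
    have "(\<Sum>v\<in>?V - ?P. kvol s (rv v)) \<le> (\<Sum>v\<in>?V - ?P. g (nrm v))"
    proof (rule sum_mono)
      fix v assume v: "v \<in> ?V - ?P"
      then show "kvol s (rv v) \<le> g (nrm v)" using kub[OF Vp(1)] Vp(1)[of v] by (simp add: g_def)
    qed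
    also have "\<dots> \<le> 26 * (\<Sum>n=1..nat \<lfloor>1200 * T\<rfloor>. real n ^ 2 * g n)"
    proof (rule sum_nrm_le)
      fix v assume v: "v \<in> ?V - ?P"
      show "v \<noteq> 0 \<and> nrm v \<le> nat \<lfloor>1200 * T\<rfloor>"
        using prim_nonzero[OF Vp(1)] verts_bounds(3)[OF _ T] v by (simp add: le_nat_floor)
    qed (simp add: g_def)
    also have "(\<Sum>n=1..nat \<lfloor>1200 * T\<rfloor>. real n ^ 2 * g n) \<le> (\<Sum>n=1..nat \<lfloor>1200 * T\<rfloor>. 8 / T)"
    proof (rule sum_mono)
      fix n assume "n \<in> {1..nat \<lfloor>1200 * T\<rfloor>}"
      then have n: "real n > 0" by simp
      show "real n ^ 2 * g n \<le> 8 / T"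
      proof (cases "real n \<le> T")
        case False
        have "real n ^ 2 * (8 / real n ^ 3) = 8 / real n" using n by (simp add: power2_eq_square power3_eq_cube)
        also have "\<dots> \<le> 8 / T" using False T by (intro divide_left_mono) auto
        finally show ?thesis using False by (simp add: g_def)
      qed (use T in \<open>simp add: g_def\<close>)
    qed
    also have "\<dots> = real (nat \<lfloor>1200 * T\<rfloor>) * (8 / T)" by simp
    also have "\<dots> \<le> (1200 * T) * (8 / T)" using T by (intro mult_right_mono of_nat_floor) auto
    also have "\<dots> = 9600" using T by simp
    finally show ?thesis by simp
  qed
  \<comment> \<open>Here |u2| is at least r while |u1| is at most 2 r. As |v| is of order |u1| |u2|,
    the slab sum of |u2|^-3 is O(1 / r) and the sum over u1 contributes O(r).\<close>
  have e4: "(\<Sum>v\<in>?P - ?V. kvol s (rv v)) \<le> 1000000"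
  proof -
    define g where "g = (\<lambda>n::nat. 8 / (real n + r) ^ 3)"
    have nb: "real (nrm (bas1 v)) \<le> 2 * r" "real (nrm (bas2 v)) \<le> 2 * T" "kvol s (rv v) \<le> 64 * (g (nrm (bas2 v)) / real (nrm (bas1 v)) ^ 3)"
      if v: "v \<in> ?P - ?V" for v
    proof -
      have pv: "prim v" "real (nrm v) \<le> T" "real (nrm (bas2 v)) ^ 2 > 200 * T"
        using v by (auto simp: verts_def)
      note nm = reduced_norms[OF reduced_basis[OF pv(1)]]
      define x y where "x = real (nrm (bas1 v))" and "y = real (nrm (bas2 v))"
      have xy: "x \<ge> 1" "y \<ge> 1" "x * y \<le> 2 * real (nrm v)" using nm(3-5) by (simp_all add: x_def y_def)
      have "r\<^sup>2 \<le> y\<^sup>2" using pv(3) T r(2) by (simp add: power2_eq_square y_def)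
      then have ry: "r \<le> y" by (rule power2_le_imp_le) (use xy in simp)
      have "x * r \<le> x * y" using ry xy by (intro mult_left_mono) auto
      also have "\<dots> \<le> (2 * r) * r" using xy(3) pv(2) r(2) by simp
      finally show "real (nrm (bas1 v)) \<le> 2 * r" unfolding x_def[symmetric] using r by simp
      have "1 * y \<le> x * y" using xy by (intro mult_right_mono) auto
      then show "real (nrm (bas2 v)) \<le> 2 * T" using xy(3) pv(2) unfolding y_def[symmetric] by linarith
      have xyp: "x * y > 0" using xy by simp
      have "kvol s (rv v) \<le> 8 / real (nrm v) ^ 3" by (rule kub[OF pv(1)])
      also have "\<dots> \<le> 8 / (x * y / 2) ^ 3"
        using xy(3) xyp by (intro divide_left_mono power_mono mult_pos_pos zero_less_power) auto
      also have "\<dots> = 64 * (1 / y ^ 3 / x ^ 3)" by (simp add: power_divide power_mult_distrib)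
      also have "\<dots> \<le> 64 * (8 / (y + r) ^ 3 / x ^ 3)"
      proof -
        have "(y + r) ^ 3 \<le> (2 * y) ^ 3" using ry r by (intro power_mono) auto
        then have "1 / y ^ 3 \<le> 8 / (y + r) ^ 3" using xy r by (simp add: field_simps power_mult_distrib)
        then show ?thesis using xy by (intro mult_left_mono divide_right_mono) auto
      qed
      finally show "kvol s (rv v) \<le> 64 * (g (nrm (bas2 v)) / real (nrm (bas1 v)) ^ 3)" by (simp add: g_def x_def y_def)
    qed
    have "(\<Sum>v\<in>?P - ?V. kvol s (rv v)) \<le> (\<Sum>v\<in>?P - ?V. 64 * (g (nrm (bas2 v)) / real (nrm (bas1 v)) ^ 3))"
      by (rule sum_mono) (rule nb(3))
    also have "\<dots> = 64 * (\<Sum>v\<in>?P - ?V. g (nrm (bas2 v)) / real (nrm (bas1 v)) ^ 3)" by (simp only: sum_distrib_left)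
    also have "(\<Sum>v\<in>?P - ?V. g (nrm (bas2 v)) / real (nrm (bas1 v)) ^ 3)
        \<le> 936 * real (nat \<lfloor>2 * r\<rfloor>) * (\<Sum>n=1..nat \<lfloor>2 * T\<rfloor>. real n * g n)"
    proof (rule sum_reduced_pairs)
      fix v assume v: "v \<in> ?P - ?V"
      show "prim v \<and> nrm (bas1 v) \<le> nat \<lfloor>2 * r\<rfloor> \<and> nrm (bas2 v) \<le> nat \<lfloor>2 * T\<rfloor>"
        using nb(1,2)[OF v] v by (simp add: le_nat_floor)
    next
      show "g n \<ge> 0" for n using r by (simp add: g_def)
      show "g n \<le> g m" if "m \<le> n" for m n
        unfolding g_def using that r by (intro divide_left_mono power_mono mult_pos_pos zero_less_power) auto
    qed
    also have "\<dots> \<le> 936 * (2 * r) * (8 / r)"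
    proof (rule mult_mono)
      show "936 * real (nat \<lfloor>2 * r\<rfloor>) \<le> 936 * (2 * r)" using r by (intro mult_left_mono of_nat_floor) auto
      show "(\<Sum>n=1..nat \<lfloor>2 * T\<rfloor>. real n * g n) \<le> 8 / r" unfolding g_def using r by (intro sum_shifted_cube_le) auto
      show "0 \<le> (\<Sum>n=1..nat \<lfloor>2 * T\<rfloor>. real n * g n)" using r by (intro sum_nonneg) (simp add: g_def)
    qed (use r in simp)
    also have "\<dots> = 14976" using r by simp
    finally show ?thesis by simp
  qed
  have "\<bar>(\<Sum>v\<in>?V. real (card (forms s T v))) - T ^ 3 * (\<Sum>v\<in>?V. kvol s (rv v))\<bar>
      \<le> (\<Sum>v\<in>?V. 60000000 * (T\<^sup>2 / (real (nrm (bas1 v)) ^ 3 * real (nrm (bas2 v)))) + E2 * (T / real (nrm v)) powr (5 / 2))"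
  proof -
    have "(\<Sum>v\<in>?V. real (card (forms s T v))) - T ^ 3 * (\<Sum>v\<in>?V. kvol s (rv v))
        = (\<Sum>v\<in>?V. real (card (forms s T v)) - T ^ 3 * kvol s (rv v))" by (simp add: sum_subtractf sum_distrib_left)
    also have "\<bar>\<dots>\<bar> \<le> (\<Sum>v\<in>?V. 60000000 * (T\<^sup>2 / (real (nrm (bas1 v)) ^ 3 * real (nrm (bas2 v)))) + E2 * (T / real (nrm v)) powr (5 / 2))"
      unfolding E2_def using T by (intro order_trans[OF sum_abs sum_mono] card_forms(1)[OF Vp(1) s _ Vp(2)]) auto
    finally show ?thesis .
  qed
  also have "\<dots> = 60000000 * (\<Sum>v\<in>?V. T\<^sup>2 / (real (nrm (bas1 v)) ^ 3 * real (nrm (bas2 v)))) + E2 * (\<Sum>v\<in>?V. (T / real (nrm v)) powr (5 / 2))"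
    by (simp only: sum.distrib sum_distrib_left)
  also have "\<dots> \<le> 60000000 * (421200 * T ^ 3) + E2 * (1820 * T ^ 3)"
    using e1 e2 E2 by (intro add_mono mult_left_mono) auto
  finally have m1: "\<bar>(\<Sum>v\<in>?V. real (card (forms s T v))) - T ^ 3 * (\<Sum>v\<in>?V. kvol s (rv v))\<bar>
      \<le> 60000000 * (421200 * T ^ 3) + E2 * (1820 * T ^ 3)" .
  have split: "(\<Sum>v\<in>?V. kvol s (rv v)) - (\<Sum>v\<in>?P. kvol s (rv v)) = (\<Sum>v\<in>?V - ?P. kvol s (rv v)) - (\<Sum>v\<in>?P - ?V. kvol s (rv v))"
    using sum.Int_Diff[OF finV, of "\<lambda>v. kvol s (rv v)" ?P] sum.Int_Diff[OF finP, of "\<lambda>v. kvol s (rv v)" ?V]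
    by (simp add: Int_commute)
  have "0 \<le> (\<Sum>v\<in>?V - ?P. kvol s (rv v))" "0 \<le> (\<Sum>v\<in>?P - ?V. kvol s (rv v))"
    using k0 Vp(1) by (intro sum_nonneg; blast)+
  then have "\<bar>(\<Sum>v\<in>?V. kvol s (rv v)) - (\<Sum>v\<in>?P. kvol s (rv v))\<bar> \<le> 1000000" unfolding split using e3 e4 by linarith
  then have "T ^ 3 * \<bar>(\<Sum>v\<in>?V. kvol s (rv v)) - (\<Sum>v\<in>?P. kvol s (rv v))\<bar> \<le> T ^ 3 * 1000000" using T by (intro mult_left_mono) auto
  then have "\<bar>T ^ 3 * (\<Sum>v\<in>?V. kvol s (rv v)) - T ^ 3 * (\<Sum>v\<in>?P. kvol s (rv v))\<bar> \<le> T ^ 3 * 1000000"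
    using T by (simp only: right_diff_distrib[symmetric] abs_mult) simp
  moreover have "(60000000 * 421200 + E2 * 1820 + 1000000) * T ^ 3 = 60000000 * (421200 * T ^ 3) + E2 * (1820 * T ^ 3) + T ^ 3 * 1000000"
    by (simp add: algebra_simps)
  ultimately show "\<bar>(\<Sum>v\<in>?V. real (card (forms s T v))) - T ^ 3 * (\<Sum>v\<in>?P. kvol s (rv v))\<bar>
      \<le> (60000000 * 421200 + 256 * 3600000 powr (5 / 4) * 1820 + 1000000) * T ^ 3"
    using m1 unfolding E2_def by linarith
qed

lemma forms_asymptotics:
  assumes s: "s \<in> {-1, 1}"
  obtains c K where "c > 0" "\<And>T. T \<ge> 1 \<Longrightarrow> \<bar>(\<Sum>v\<in>verts T. real (card (forms s T v))) - c * T ^ 3 * ln T\<bar> \<le> K * T ^ 3"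
proof -
  obtain E where E: "\<And>T. T \<ge> 1 \<Longrightarrow>
      \<bar>(\<Sum>v\<in>verts T. real (card (forms s T v))) - T ^ 3 * (\<Sum>v | prim v \<and> real (nrm v) \<le> T. kvol s (rv v))\<bar> \<le> E * T ^ 3"
    using sum_forms[OF s] by blast
  obtain c K where c: "c > 0" and K: "\<And>x. x \<ge> 1 \<Longrightarrow> \<bar>(\<Sum>v | prim v \<and> real (nrm v) \<le> x. kvol s (rv v)) - c * ln x\<bar> \<le> K"
    using kvol_log_sum[OF s] by blast
  show ?thesis
  proof (rule that[OF c])
    fix T :: real assume T: "T \<ge> 1"
    let ?P = "\<Sum>v | prim v \<and> real (nrm v) \<le> T. kvol s (rv v)"
    have "T ^ 3 * \<bar>?P - c * ln T\<bar> \<le> T ^ 3 * K" using K[OF T] T by (intro mult_left_mono) auto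
    then have "\<bar>T ^ 3 * (?P - c * ln T)\<bar> \<le> T ^ 3 * K" using T by (simp add: abs_mult)
    moreover have "T ^ 3 * (?P - c * ln T) = T ^ 3 * ?P - c * T ^ 3 * ln T" by (simp add: algebra_simps)
    moreover have "(E + K) * T ^ 3 = E * T ^ 3 + T ^ 3 * K" by (simp add: algebra_simps)
    ultimately show "\<bar>(\<Sum>v\<in>verts T. real (card (forms s T v))) - c * T ^ 3 * ln T\<bar> \<le> (E + K) * T ^ 3"
      using E[OF T] by linarith
  qed
qed

section \<open>Degenerate forms and their vertices\<close>

text \<open>Membership in the kernel of twice the Gram matrix, which has integral entries;
  geometrically, v is a singular point of the conic.\<close>

definition kerv :: "int ^ coord \<Rightarrow> int triple \<Rightarrow> bool" where
  "kerv x = (\<lambda>(p, q, r). 2 * x $ C0 * p + x $ C01 * q + x $ C02 * r = 0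
     \<and> x $ C01 * p + 2 * x $ C1 * q + x $ C12 * r = 0 \<and> x $ C02 * p + x $ C12 * q + 2 * x $ C2 * r = 0)"

definition ri :: "int ^ coord \<Rightarrow> rat ^ coord" where
  "ri a = (\<chi> i. of_int (a $ i))"

definition icubic :: "int ^ coord \<Rightarrow> int" where
  "icubic x = x $ C0 * (x $ C12)\<^sup>2 + x $ C1 * (x $ C02)\<^sup>2 + x $ C2 * (x $ C01)\<^sup>2
             - x $ C01 * x $ C02 * x $ C12 - 4 * x $ C0 * x $ C1 * x $ C2"

definition d01 :: "int ^ coord \<Rightarrow> int" where "d01 x = (x $ C01)\<^sup>2 - 4 * x $ C0 * x $ C1"
definition d02 :: "int ^ coord \<Rightarrow> int" where "d02 x = (x $ C02)\<^sup>2 - 4 * x $ C0 * x $ C2"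
definition d12 :: "int ^ coord \<Rightarrow> int" where "d12 x = (x $ C12)\<^sup>2 - 4 * x $ C1 * x $ C2"

lemma cubic_ri: "cubic (ri a) = of_int (icubic a)"
  by (simp add: cubic_def icubic_def ri_def)

lemma Deltas_ri: "Deltas (ri a) = {of_int (d01 a), of_int (d02 a), of_int (d12 a)}"
  by (simp add: Deltas_def d01_def d02_def d12_def ri_def)

lemma rat_common_denominator:
  fixes x0 x1 x2 :: rat
  obtains q p0 p1 p2 :: int where "q \<noteq> 0" "of_int q * x0 = (of_int p0 :: rat)" "of_int q * x1 = of_int p1" "of_int q * x2 = of_int p2"
proof -
  have *: "\<exists>p q. q \<noteq> 0 \<and> of_int q * x = (of_int p :: rat)" for x
  proof (cases x)
    case (Fract a b)
    then show ?thesis by (intro exI[of _ a] exI[of _ b]) (simp add: Fract_of_int_quotient)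
  qed
  obtain p0 q0 p1 q1 p2 q2 where e: "q0 \<noteq> 0" "of_int q0 * x0 = of_int p0" "q1 \<noteq> 0" "of_int q1 * x1 = of_int p1"
    "q2 \<noteq> 0" "of_int q2 * x2 = of_int p2" using *[of x0] *[of x1] *[of x2] by blast
  show ?thesis
  proof (rule that[of "q0 * q1 * q2" "p0 * q1 * q2" "p1 * q0 * q2" "p2 * q0 * q1"])
    show "of_int (q0 * q1 * q2) * x0 = of_int (p0 * q1 * q2)" unfolding of_int_mult e(2)[symmetric] by simp
    show "of_int (q0 * q1 * q2) * x1 = of_int (p1 * q0 * q2)" unfolding of_int_mult e(4)[symmetric] by simp
    show "of_int (q0 * q1 * q2) * x2 = of_int (p2 * q0 * q1)" unfolding of_int_mult e(6)[symmetric] by simp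
  qed (use e in simp)
qed

text \<open>The matrix has determinant -2 times the cubic. A rational kernel vector is made integral
  by a common denominator and then divided by its content.\<close>

lemma exists_vertex:
  assumes "icubic a = 0" shows "\<exists>v. prim v \<and> kerv a v"
proof -
  let ?x = "ri a"
  define M :: "rat^3^3" where "M = vector [vector [2 * ?x $ C0, ?x $ C01, ?x $ C02], vector [?x $ C01, 2 * ?x $ C1, ?x $ C12],
     vector [?x $ C02, ?x $ C12, 2 * ?x $ C2]]"
  have "det M = - 2 * cubic ?x" by (simp add: det_3 M_def cubic_def power2_eq_square algebra_simps)
  then have "\<not> invertible M" using assms by (simp add: cubic_ri invertible_det_nz)
  then have "\<not> (\<exists>B. B ** M = mat 1)" unfolding invertible_left_inverse .
  then obtain y where y: "M *v y = 0" "y \<noteq> 0" unfolding matrix_left_invertible_ker by blast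
  obtain q p0 p1 p2 where q: "q \<noteq> 0" "of_int q * y $ 1 = of_int p0" "of_int q * y $ 2 = of_int p1" "of_int q * y $ 3 = of_int p2"
    by (rule rat_common_denominator)
  have e: "2 * ?x $ C0 * y $ 1 + ?x $ C01 * y $ 2 + ?x $ C02 * y $ 3 = 0"
    "?x $ C01 * y $ 1 + 2 * ?x $ C1 * y $ 2 + ?x $ C12 * y $ 3 = 0" "?x $ C02 * y $ 1 + ?x $ C12 * y $ 2 + 2 * ?x $ C2 * y $ 3 = 0"
    using y(1) by (simp_all add: vec_eq_iff forall_3 matrix_vector_mult_def sum_3 M_def)
  have ints: "x * p0 + x' * p1 + x'' * p2 = 0" if "of_int x * y $ 1 + of_int x' * y $ 2 + of_int x'' * y $ 3 = (0 :: rat)" for x x' x''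
  proof -
    have "of_int (x * p0 + x' * p1 + x'' * p2) = of_int q * (of_int x * y $ 1 + of_int x' * y $ 2 + of_int x'' * y $ 3)"
      unfolding of_int_add of_int_mult q(2-4)[symmetric] by (simp add: algebra_simps)
    then show ?thesis using that by (simp only: mult_zero_right of_int_eq_0_iff)
  qed
  have k: "kerv a (p0, p1, p2)"
    unfolding kerv_def prod.case using ints[of "2 * a $ C0" "a $ C01" "a $ C02"] ints[of "a $ C01" "2 * a $ C1" "a $ C12"]
      ints[of "a $ C02" "a $ C12" "2 * a $ C2"] e by (simp add: ri_def)
  have "(p0, p1, p2) \<noteq> 0"
  proof
    assume "(p0, p1, p2) = 0"
    then have "y $ 1 = 0" "y $ 2 = 0" "y $ 3 = 0" using q by (simp_all add: zero_prod_def)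
    then show False using y(2) by (simp add: vec_eq_iff forall_3)
  qed
  then obtain d v where dv: "d \<ge> 1" "prim v" "(p0, p1, p2) = smul d v" by (rule prim_decomp)
  obtain v0 v1 v2 where v: "v = (v0, v1, v2)" by (cases v)
  have cancel: "x * v0 + x' * v1 + x'' * v2 = 0" if "x * (int d * v0) + x' * (int d * v1) + x'' * (int d * v2) = 0" for x x' x'' :: int
  proof -
    have "int d * (x * v0 + x' * v1 + x'' * v2) = 0" using that by (simp add: algebra_simps)
    then show ?thesis using dv(1) by simp
  qed
  have "kerv a v" using k unfolding dv(3) v smul_def prod.case kerv_def using cancel by blast
  then show ?thesis using dv(2) by blast
qed

lemma polar_commute: "polar x y z = polar x z y"
  by (cases y; cases z) (simp add: polar_def algebra_simps)

lemma polar_kerv: "kerv x v \<Longrightarrow> polar x v z = 0"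
proof -
  assume k: "kerv x v"
  obtain p q r z0 z1 z2 where v: "v = (p, q, r)" "z = (z0, z1, z2)" by (cases v; cases z)
  have "polar x v z = (2 * x $ C0 * p + x $ C01 * q + x $ C02 * r) * z0 + (x $ C01 * p + 2 * x $ C1 * q + x $ C12 * r) * z1
     + (x $ C02 * p + x $ C12 * q + 2 * x $ C2 * r) * z2" by (simp add: v polar_def algebra_simps)
  also have "\<dots> = 0" using k unfolding kerv_def v prod.case by simp
  finally show ?thesis .
qed

definition comb3 :: "int \<Rightarrow> int triple \<Rightarrow> int \<Rightarrow> int triple \<Rightarrow> int \<Rightarrow> int triple \<Rightarrow> int triple" where
  "comb3 \<alpha> x \<beta> y \<gamma> z = (\<alpha> * fst x + \<beta> * fst y + \<gamma> * fst z,
     \<alpha> * fst (snd x) + \<beta> * fst (snd y) + \<gamma> * fst (snd z), \<alpha> * snd (snd x) + \<beta> * snd (snd y) + \<gamma> * snd (snd z))"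

lemma polar_comb3: "polar a (comb3 \<alpha> x \<beta> y \<gamma> z) t = \<alpha> * polar a x t + \<beta> * polar a y t + \<gamma> * polar a z t"
  by (cases x; cases y; cases z; cases t) (simp add: comb3_def polar_def algebra_simps)

text \<open>If v.z = 1, then w \<times> z, z \<times> u and v form the integral basis dual to u, w,
  z. As v is in the kernel, the form depends only on u.y and w.y. Diagonal values of
  \<open>polar\<close> are even, so all three coefficients are integers.\<close>

lemma exists_qf_coefficients:
  assumes k: "kerv a v" and c: "cross u w = v" and v: "prim v" shows "\<exists>t. a = qf u w t"
proof -
  obtain z where z: "dot v z = 1" using bezout3[OF v] by blast
  define w1 w2 where "w1 = cross w z" and "w2 = cross z u"
  obtain u0 u1 u2 x0 x1 x2 z0 z1 z2 where uwz: "u = (u0, u1, u2)" "w = (x0, x1, x2)" "z = (z0, z1, z2)" by (cases u; cases w; cases z)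
  have det: "(u1 * x2 - u2 * x1) * z0 + (u2 * x0 - u0 * x2) * z1 + (u0 * x1 - u1 * x0) * z2 = 1"
    using z unfolding c[symmetric] by (simp add: uwz cross_def dot_def)
  have e0: "(1, 0, 0) = comb3 u0 w1 x0 w2 z0 v" and e1: "(0, 1, 0) = comb3 u1 w1 x1 w2 z1 v" and e2: "(0, 0, 1) = comb3 u2 w1 x2 w2 z2 v"
    unfolding c[symmetric] w1_def w2_def using det by (simp_all add: uwz comb3_def cross_def algebra_simps)
  define P Q R where "P = polar a w1 w1" and "Q = polar a w1 w2" and "R = polar a w2 w2"
  have half: "\<exists>p. polar a y y = 2 * p" for y
    by (cases y) (simp add: polar_def, intro exI[of _ "a $ C0 * (fst y * fst y) + a $ C1 * (fst (snd y) * fst (snd y)) + a $ C2 * (snd (snd y) * snd (snd y))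
       + a $ C01 * (fst y * fst (snd y)) + a $ C02 * (fst y * snd (snd y)) + a $ C12 * (fst (snd y) * snd (snd y))"], simp add: algebra_simps)
  obtain p where p: "P = 2 * p" using half unfolding P_def by blast
  obtain r where r: "R = 2 * r" using half unfolding R_def by blast
  have expand: "polar a (comb3 \<alpha> w1 \<beta> w2 \<gamma> v) (comb3 \<alpha>' w1 \<beta>' w2 \<gamma>' v)
     = \<alpha> * \<alpha>' * P + (\<alpha> * \<beta>' + \<beta> * \<alpha>') * Q + \<beta> * \<beta>' * R" for \<alpha> \<beta> \<gamma> \<alpha>' \<beta>' \<gamma>'
  proof -
    have "polar a y v = 0" for y using polar_kerv[OF k, of y] polar_commute[of a y v] by simp
    then have "polar a y (comb3 \<alpha>' w1 \<beta>' w2 \<gamma>' v) = \<alpha>' * polar a y w1 + \<beta>' * polar a y w2" for y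
      unfolding polar_commute[of a y] polar_comb3 by (simp add: polar_commute[of a _ y])
    then show ?thesis
      unfolding polar_comb3 polar_kerv[OF k] P_def Q_def R_def using polar_commute[of a w2 w1] by (simp add: algebra_simps)
  qed
  have ev: "polar a (1, 0, 0) (1, 0, 0) = 2 * a $ C0" "polar a (0, 1, 0) (0, 1, 0) = 2 * a $ C1" "polar a (0, 0, 1) (0, 0, 1) = 2 * a $ C2"
    "polar a (1, 0, 0) (0, 1, 0) = a $ C01" "polar a (1, 0, 0) (0, 0, 1) = a $ C02" "polar a (0, 1, 0) (0, 0, 1) = a $ C12"
    by (simp_all add: polar_def)
  note cf = ev[unfolded e0 e1 e2 expand p r]
  have "a = qf u w (p, Q, r)"
    unfolding vec_eq_iff all_coord uwz qf_component using cf by (simp add: algebra_simps)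
  then show ?thesis by blast
qed

text \<open>On the integral dual vectors of u and w, \<open>polar\<close> returns 2 a, b and 2
  c.\<close>

lemma qf_inj:
  assumes v: "prim (cross u w)" and eq: "qf u w t = qf u w (t' :: int triple)" shows "t = t'"
proof -
  obtain z where z: "dot (cross u w) z = 1" using bezout3[OF v] by blast
  define w1 w2 where "w1 = cross w z" and "w2 = cross z u"
  have d: "dot u w1 = 1" "dot w w1 = 0" "dot u w2 = 0" "dot w w2 = 1"
  proof -
    have "dot u w1 = dot (cross u w) z" "dot w w2 = dot (cross u w) z"
      unfolding w1_def w2_def by (cases u; cases w; cases z; simp add: cross_def dot_def algebra_simps)+
    then show "dot u w1 = 1" "dot w w2 = 1" using z by simp_all
  qed (simp_all add: w1_def w2_def)
  obtain a b c a' b' c' where t: "t = (a, b, c)" "t' = (a', b', c')" by (cases t; cases t')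
  have "polar (qf u w t) y y' = polar (qf u w t') y y'" for y y' using eq by simp
  from this[of w1 w1] this[of w1 w2] this[of w2 w2] show ?thesis unfolding t polar_qf d by simp
qed

lemma kerv_qf: "kerv (qf u w t) (cross u w)"
  by (cases u; cases w; cases t) (simp add: kerv_def cross_def algebra_simps)

lemma Delta_qf:
  assumes "cross u w = (v0, v1, v2)"
  shows "d01 (qf u w t) = v2\<^sup>2 * disc t" "d02 (qf u w t) = v1\<^sup>2 * disc t" "d12 (qf u w t) = v0\<^sup>2 * disc t"
proof -
  obtain u0 u1 u2 x0 x1 x2 a b c where uwt: "u = (u0, u1, u2)" "w = (x0, x1, x2)" "t = (a, b, c)" by (cases u; cases w; cases t)
  have v: "v0 = u1 * x2 - u2 * x1" "v1 = u2 * x0 - u0 * x2" "v2 = u0 * x1 - u1 * x0"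
    using assms by (simp_all add: uwt cross_def)
  show "d01 (qf u w t) = v2\<^sup>2 * disc t" "d02 (qf u w t) = v1\<^sup>2 * disc t" "d12 (qf u w t) = v0\<^sup>2 * disc t"
    unfolding d01_def d02_def d12_def disc_def v uwt qf_component prod.case power2_eq_square by algebra+
qed

text \<open>Cramer's rule: the adjugate applied to the kernel equations gives the determinant, -2
  times \<open>icubic\<close>, times each coordinate of v.\<close>

lemma icubic_kerv:
  assumes "kerv a v" "v \<noteq> 0" shows "icubic a = 0"
proof -
  obtain p q r where v: "v = (p, q, r)" by (cases v)
  have e: "2 * a $ C0 * p + a $ C01 * q + a $ C02 * r = 0" "a $ C01 * p + 2 * a $ C1 * q + a $ C12 * r = 0"
    "a $ C02 * p + a $ C12 * q + 2 * a $ C2 * r = 0" using assms(1) by (simp_all add: kerv_def v)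
  have "icubic a * p = 0" "icubic a * q = 0" "icubic a * r = 0"
  proof -
    have "2 * (icubic a * p) = - (4 * a $ C1 * a $ C2 - a $ C12 * a $ C12) * (2 * a $ C0 * p + a $ C01 * q + a $ C02 * r)
       - (a $ C02 * a $ C12 - 2 * a $ C01 * a $ C2) * (a $ C01 * p + 2 * a $ C1 * q + a $ C12 * r)
       - (a $ C01 * a $ C12 - 2 * a $ C1 * a $ C02) * (a $ C02 * p + a $ C12 * q + 2 * a $ C2 * r)"
      by (simp add: icubic_def power2_eq_square algebra_simps)
    then show "icubic a * p = 0" unfolding e by simp
    have "2 * (icubic a * q) = - (a $ C02 * a $ C12 - 2 * a $ C01 * a $ C2) * (2 * a $ C0 * p + a $ C01 * q + a $ C02 * r)
       - (4 * a $ C0 * a $ C2 - a $ C02 * a $ C02) * (a $ C01 * p + 2 * a $ C1 * q + a $ C12 * r)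
       - (a $ C01 * a $ C02 - 2 * a $ C0 * a $ C12) * (a $ C02 * p + a $ C12 * q + 2 * a $ C2 * r)"
      by (simp add: icubic_def power2_eq_square algebra_simps)
    then show "icubic a * q = 0" unfolding e by simp
    have "2 * (icubic a * r) = - (a $ C01 * a $ C12 - 2 * a $ C1 * a $ C02) * (2 * a $ C0 * p + a $ C01 * q + a $ C02 * r)
       - (a $ C01 * a $ C02 - 2 * a $ C0 * a $ C12) * (a $ C01 * p + 2 * a $ C1 * q + a $ C12 * r)
       - (4 * a $ C0 * a $ C1 - a $ C01 * a $ C01) * (a $ C02 * p + a $ C12 * q + 2 * a $ C2 * r)"
      by (simp add: icubic_def power2_eq_square algebra_simps)
    then show "icubic a * r = 0" unfolding e by simp
  qed
  then show ?thesis using assms(2) by (auto simp: v zero_prod_def)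
qed

text \<open>With y.v = 1, expanding y \<times> (v \<times> v') = 0 gives v' = k v for the integer k
  = y.v', and comparing contents gives |k| = 1.\<close>

lemma prim_parallel:
  assumes "cross v v' = 0" "prim v" "prim v'" shows "v' = v \<or> v' = - v"
proof -
  obtain y where y: "dot v y = 1" using bezout3[OF assms(2)] by blast
  obtain a b c a' b' c' where v: "v = (a, b, c)" "v' = (a', b', c')" by (cases v; cases v')
  define k where "k = dot y v'"
  have "dot y v = 1" using y by (cases y; cases v) (simp add: dot_def algebra_simps)
  moreover have "cross y (cross v v') = 0" unfolding assms(1) by (cases y) (simp add: cross_def zero_prod_def)
  ultimately have "a' = k * a" "b' = k * b" "c' = k * c"
    unfolding cross_cross k_def[symmetric] by (simp_all add: v zero_prod_def algebra_simps)
  then have v'_eq: "v' = (k * a, k * b, k * c)" by (simp add: v)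
  have "gcd x (\<bar>k\<bar> * y) = gcd x (k * y)" for x y by (simp add: abs_if)
  then have "gcd3 v' = \<bar>k\<bar> * gcd3 v" by (simp add: gcd3_def v'_eq v(1) gcd_mult_left abs_mult)
  then have "\<bar>k\<bar> = 1" using assms by (simp add: prim_def)
  then have "k = 1 \<or> k = -1" by linarith
  then show ?thesis using v'_eq by (auto simp: v)
qed

text \<open>The discriminants are the principal 2 by 2 minors up to sign. A nonzero one forces rank
  at least 2; concretely, eliminating from the kernel equations shows that each of them annihilates
  v \<times> v'.\<close>

lemma vertex_unique:
  assumes "kerv a v" "kerv a v'" and nz: "\<not> (d01 a = 0 \<and> d02 a = 0 \<and> d12 a = 0)"
  shows "cross v v' = 0"
proof -
  obtain p q r p' q' r' where v: "v = (p, q, r)" "v' = (p', q', r')" by (cases v; cases v')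
  have e: "2 * a $ C0 * p + a $ C01 * q + a $ C02 * r = 0" "a $ C01 * p + 2 * a $ C1 * q + a $ C12 * r = 0"
    "a $ C02 * p + a $ C12 * q + 2 * a $ C2 * r = 0" "2 * a $ C0 * p' + a $ C01 * q' + a $ C02 * r' = 0"
    "a $ C01 * p' + 2 * a $ C1 * q' + a $ C12 * r' = 0" "a $ C02 * p' + a $ C12 * q' + 2 * a $ C2 * r' = 0"
    using assms(1,2) by (simp_all add: kerv_def v)
  have "d * (q * r' - r * q') = 0 \<and> d * (r * p' - p * r') = 0 \<and> d * (p * q' - q * p') = 0"
    if "d = d01 a \<or> d = d02 a \<or> d = d12 a" for d
    using that
  proof (elim disjE)
    assume d: "d = d01 a"
    show ?thesis unfolding d d01_def using e by (intro conjI; algebra)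
  next
    assume d: "d = d02 a"
    show ?thesis unfolding d d02_def using e by (intro conjI; algebra)
  next
    assume d: "d = d12 a"
    show ?thesis unfolding d d12_def using e by (intro conjI; algebra)
  qed
  then show ?thesis using nz by (simp add: v cross_def zero_prod_def) (metis mult_eq_0_iff)
qed

section \<open>Square discriminants\<close>

lemma is_square_rat_of_int_iff: "is_square (of_int n :: rat) \<longleftrightarrow> is_square n"
proof
  assume "is_square (of_int n :: rat)"
  then obtain x :: rat where x: "of_int n = x\<^sup>2" by (auto simp: is_nth_power_def)
  obtain p q where pq: "x = Fract p q" "q > 0" "coprime p q" by (cases x)
  have "of_int n * (of_int q)\<^sup>2 = (of_int p :: rat)\<^sup>2"
    unfolding x pq(1) Fract_of_int_quotient using pq(2) by (simp add: power_divide)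
  then have "of_int (n * q\<^sup>2) = (of_int (p\<^sup>2) :: rat)" by simp
  then have eq: "n * q\<^sup>2 = p\<^sup>2" by (simp only: of_int_eq_iff)
  then have "q\<^sup>2 dvd p\<^sup>2" by (metis dvd_triv_right)
  then have "q dvd p" by simp
  then have "q dvd 1" using pq(3) by (metis coprime_absorb_right)
  then have "q = 1" using pq(2) by simp
  then show "is_square n" using eq by (auto simp: is_nth_power_def)
next
  assume "is_square n"
  then show "is_square (of_int n :: rat)" by (auto simp: is_nth_power_def)
qed

lemma is_square_mult_iff:
  assumes "c \<noteq> (0 :: rat)" shows "is_square (c\<^sup>2 * d) \<longleftrightarrow> is_square d"
proof
  assume "is_square (c\<^sup>2 * d)"
  then obtain x where "c\<^sup>2 * d = x\<^sup>2" by (auto simp: is_nth_power_def)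
  then have "d = (x / c)\<^sup>2" using assms by (simp add: power_divide field_simps)
  then show "is_square d" by (auto simp: is_nth_power_def)
next
  assume "is_square d"
  then obtain x where "d = x\<^sup>2" by (auto simp: is_nth_power_def)
  then have "c\<^sup>2 * d = (c * x)\<^sup>2" by (simp add: power_mult_distrib)
  then show "is_square (c\<^sup>2 * d)" by (auto simp: is_nth_power_def)
qed

definition in_zero :: "rat ^ coord \<Rightarrow> bool" where
  "in_zero x \<longleftrightarrow> cubic x = 0 \<and> (\<forall>d\<in>Deltas x. is_square d)"

definition in_sign :: "int \<Rightarrow> rat ^ coord \<Rightarrow> bool" where
  "in_sign s x \<longleftrightarrow> cubic x = 0 \<and> (if s = 1 then (\<forall>d\<in>Deltas x. d \<ge> 0) \<and> \<not> (\<forall>d\<in>Deltas x. is_square d)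
     else (\<forall>d\<in>Deltas x. d \<le> 0) \<and> \<not> (\<forall>d\<in>Deltas x. d = 0))"

text \<open>Each discriminant is a square times D = \<open>disc t\<close>, and some v_k is nonzero,
  so the conditions on all three become conditions on D; in particular their signs cannot differ. As
  0 is a square and a negative D is not, the two differently phrased conditions for s = 1 and s = -1
  both say that D has the sign s and is not a square.\<close>

lemma qf_conditions:
  assumes v: "cross u w = v" "v \<noteq> 0"
  shows "in_zero (ri (qf u w t)) \<longleftrightarrow> is_square (disc t)"
    and "s \<in> {-1, 1} \<Longrightarrow> in_sign s (ri (qf u w t)) \<longleftrightarrow> sgn_ok s t \<and> \<not> is_square (disc t)"
proof -
  obtain v0 v1 v2 where vv: "v = (v0, v1, v2)" by (cases v)
  define D where "D = disc t"
  have "icubic (qf u w t) = 0" using icubic_kerv[OF kerv_qf[of u w t]] v by simp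
  then have cub: "cubic (ri (qf u w t)) = 0" by (simp add: cubic_ri)
  have Del: "Deltas (ri (qf u w t)) = {of_int (v2\<^sup>2 * D), of_int (v1\<^sup>2 * D), of_int (v0\<^sup>2 * D)}"
    unfolding Deltas_ri D_def using Delta_qf[of u w v0 v1 v2 t] v vv by simp
  obtain m where m: "m \<noteq> 0" "m = v0 \<or> m = v1 \<or> m = v2" using v(2) by (auto simp: vv zero_prod_def)
  have mD: "of_int (m\<^sup>2 * D) \<in> Deltas (ri (qf u w t))" unfolding Del using m(2) by auto
  have sq: "is_square (of_int (k\<^sup>2 * D) :: rat)" if "is_square D" for k :: int
  proof -
    obtain x where "D = x\<^sup>2" using \<open>is_square D\<close> by (auto simp: is_nth_power_def)
    then have "k\<^sup>2 * D = (k * x)\<^sup>2" by (simp add: power_mult_distrib)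
    then have "is_square (k\<^sup>2 * D)" by (auto simp: is_nth_power_def)
    then show ?thesis unfolding is_square_rat_of_int_iff .
  qed
  have sqm: "is_square (of_int (m\<^sup>2 * D) :: rat) \<longleftrightarrow> is_square D"
    using is_square_mult_iff[of "of_int m" "of_int D"] m(1) by (simp add: is_square_rat_of_int_iff)
  have all_sq: "(\<forall>d\<in>Deltas (ri (qf u w t)). is_square d) \<longleftrightarrow> is_square D"
  proof
    assume "\<forall>d\<in>Deltas (ri (qf u w t)). is_square d"
    then show "is_square D" using mD sqm by blast
  next
    assume "is_square D"
    then show "\<forall>d\<in>Deltas (ri (qf u w t)). is_square d" unfolding Del using sq by blast
  qed
  then show "in_zero (ri (qf u w t)) \<longleftrightarrow> is_square (disc t)" by (simp only: in_zero_def cub D_def simp_thms)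
  have m2: "m\<^sup>2 > 0" using m(1) by simp
  have all_pos: "(\<forall>d\<in>Deltas (ri (qf u w t)). d \<ge> 0) \<longleftrightarrow> D \<ge> 0"
  proof
    assume "\<forall>d\<in>Deltas (ri (qf u w t)). d \<ge> 0"
    then have "0 \<le> m\<^sup>2 * D" using mD by (metis of_int_0_le_iff)
    then show "D \<ge> 0" using m2 by (simp add: zero_le_mult_iff)
  next
    assume "D \<ge> 0"
    then have "0 \<le> k\<^sup>2 * D" for k by simp
    then have "(0 :: rat) \<le> of_int (k\<^sup>2 * D)" for k by (simp only: of_int_0_le_iff)
    then show "\<forall>d\<in>Deltas (ri (qf u w t)). d \<ge> 0" unfolding Del by blast
  qed
  have all_neg: "(\<forall>d\<in>Deltas (ri (qf u w t)). d \<le> 0) \<longleftrightarrow> D \<le> 0"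
  proof
    assume "\<forall>d\<in>Deltas (ri (qf u w t)). d \<le> 0"
    then have "m\<^sup>2 * D \<le> 0" using mD by (metis of_int_le_0_iff)
    then show "D \<le> 0" using m2 by (simp add: mult_le_0_iff)
  next
    assume "D \<le> 0"
    then have "k\<^sup>2 * D \<le> 0" for k by (simp add: mult_nonneg_nonpos)
    then have "of_int (k\<^sup>2 * D) \<le> (0 :: rat)" for k by (simp only: of_int_le_0_iff)
    then show "\<forall>d\<in>Deltas (ri (qf u w t)). d \<le> 0" unfolding Del by blast
  qed
  have all_0: "(\<forall>d\<in>Deltas (ri (qf u w t)). d = 0) \<longleftrightarrow> D = 0"
  proof
    assume "\<forall>d\<in>Deltas (ri (qf u w t)). d = 0"
    then have "m\<^sup>2 * D = 0" using mD by (metis of_int_eq_0_iff)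
    then show "D = 0" using m(1) by simp
  qed (simp add: Del)
  have neg_nsq: "\<not> is_square D" if "D < 0"
  proof
    assume "is_square D"
    then obtain x where "D = x\<^sup>2" by (auto simp: is_nth_power_def)
    then show False using that by (simp add: power2_less_0)
  qed
  have sq0: "is_square D" if "D = 0" using that by simp
  assume "s \<in> {-1, 1}"
  then consider "s = 1" | "s = -1" by blast
  then show "in_sign s (ri (qf u w t)) \<longleftrightarrow> sgn_ok s t \<and> \<not> is_square (disc t)"
  proof cases
    case 1
    have "D \<ge> 0 \<and> \<not> is_square D \<longleftrightarrow> 0 < D \<and> \<not> is_square D" using sq0 by (cases "D = 0") auto
    then show ?thesis unfolding in_sign_def cub all_pos all_sq sgn_ok_def D_def[symmetric] using 1 by simp
  next
    case 2
    have "D \<le> 0 \<and> D \<noteq> 0 \<longleftrightarrow> D < 0 \<and> \<not> is_square D" using neg_nsq by auto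
    then show ?thesis unfolding in_sign_def cub all_neg all_0 sgn_ok_def D_def[symmetric] using 2 by simp
  qed
qed

section \<open>Rational points and primitive integral vectors\<close>

definition prim6 :: "int ^ coord \<Rightarrow> bool" where
  "prim6 a \<longleftrightarrow> Gcd (range (($) a)) = 1"

lemma Gcd_smult: "Gcd (range (($) (c *s a))) = \<bar>c\<bar> * Gcd (range (($) a))" for c :: int
proof -
  have "range (($) (c *s a)) = (*) c ` range (($) a)" by (auto simp: image_iff)
  then show ?thesis by (simp add: Gcd_mult abs_mult)
qed

lemma prim6_nonzero: "prim6 a \<Longrightarrow> a \<noteq> 0"
proof
  assume "prim6 a" "a = 0"
  moreover have "range (($) (0 :: int ^ coord)) = {0}" by auto
  ultimately show False by (simp add: prim6_def)
qed

lemma prim6_uminus: "prim6 (- a) \<longleftrightarrow> prim6 a"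
proof -
  have "- a = (-1) *s a" by (simp add: vec_eq_iff)
  then show ?thesis using Gcd_smult[of "-1" a] by (simp add: prim6_def)
qed

lemma prim6_decomp:
  assumes "b \<noteq> 0" obtains d a where "d \<ge> 1" "prim6 a" "b = int d *s a"
proof -
  define g where "g = Gcd (range (($) b))"
  have dv: "g dvd b $ i" for i unfolding g_def by (rule Gcd_dvd) simp
  have "g \<ge> 0" unfolding g_def by simp
  moreover have "g \<noteq> 0"
  proof
    assume "g = 0"
    then have "b $ i = 0" for i using dv[of i] by simp
    then show False using assms by (simp add: vec_eq_iff)
  qed
  ultimately have g: "g > 0" by simp
  define a where "a = (\<chi> i. b $ i div g)"
  have b: "b = g *s a" using dv by (simp add: a_def vec_eq_iff)
  have "g = \<bar>g\<bar> * Gcd (range (($) a))" using Gcd_smult[of g a] unfolding b[symmetric] g_def[symmetric] .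
  then have "g * 1 = g * Gcd (range (($) a))" using g by simp
  then have "prim6 a" using g unfolding mult_cancel_left prim6_def by simp
  then show ?thesis using that[of "nat g" a] b g by simp
qed

lemma prim6_smult_inj:
  assumes "prim6 y" "prim6 y'" "int d *s y = int d' *s y'" "d \<ge> 1" shows "d = d' \<and> y = y'"
proof -
  have "int d = int d'" using Gcd_smult[of "int d" y] Gcd_smult[of "int d'" y'] assms by (simp add: prim6_def)
  then show ?thesis using assms by (simp add: vec_eq_iff)
qed

lemma ri_eq_0_iff: "ri a = 0 \<longleftrightarrow> a = 0"
  by (simp add: ri_def vec_eq_iff)

lemma ri_smult: "ri (c *s a) = of_int c *s ri a"
  by (simp add: ri_def vec_eq_iff)

lemma ri_uminus: "ri (- a) = (-1) *s ri a"
  by (simp add: ri_def vec_eq_iff)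

lemma exists_prim6:
  assumes "x \<noteq> 0" shows "\<exists>a c. c \<noteq> 0 \<and> ri a = c *s x \<and> prim6 a"
proof -
  obtain q p0 p1 p2 where q: "q \<noteq> 0" "of_int q * x $ C0 = of_int p0" "of_int q * x $ C1 = of_int p1" "of_int q * x $ C2 = of_int p2"
    by (rule rat_common_denominator)
  obtain r p3 p4 p5 where r: "r \<noteq> 0" "of_int r * x $ C01 = of_int p3" "of_int r * x $ C02 = of_int p4" "of_int r * x $ C12 = of_int p5"
    by (rule rat_common_denominator)
  define b :: "int ^ coord" where "b = (\<chi> i. case i of C0 \<Rightarrow> r * p0 | C1 \<Rightarrow> r * p1 | C2 \<Rightarrow> r * p2 | C01 \<Rightarrow> q * p3 | C02 \<Rightarrow> q * p4 | C12 \<Rightarrow> q * p5)"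
  have rb: "ri b = of_int (q * r) *s x"
    unfolding vec_eq_iff all_coord using q(2-4)[symmetric] r(2-4)[symmetric] by (simp add: ri_def b_def)
  have qr: "of_int (q * r) \<noteq> (0 :: rat)" using q(1) r(1) by simp
  then have "ri b \<noteq> 0" unfolding rb using assms by (simp add: vec_eq_iff)
  then have "b \<noteq> 0" by (simp add: ri_eq_0_iff)
  then obtain d a where d: "d \<ge> 1" "prim6 a" "b = int d *s a" by (rule prim6_decomp)
  have "ri a = (of_int (q * r) / of_int (int d)) *s x"
  proof -
    have "of_int (int d) *s ri a = of_int (q * r) *s x" using rb unfolding d(3) ri_smult .
    then have "of_int (int d) * ri a $ i = of_int (q * r) * x $ i" for i by (metis vector_smult_component)
    then show ?thesis using d(1) by (simp add: vec_eq_iff field_simps)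
  qed
  then show ?thesis using d(1,2) qr by (intro exI[of _ a] exI[of _ "of_int (q * r) / of_int (int d)"]) simp
qed

text \<open>For c = p / q in lowest terms, q divides every coordinate of a and p every coordinate of
  b, so both are units.\<close>

lemma prim6_unique:
  assumes "prim6 a" "prim6 b" "ri b = c *s ri a" shows "b = a \<or> b = - a"
proof -
  obtain p q where pq: "c = Fract p q" "q > 0" "coprime p q" by (cases c)
  have eq: "q * b $ i = p * a $ i" for i
  proof -
    have "of_int (b $ i) = (of_int p / of_int q) * (of_int (a $ i) :: rat)"
      using assms(3) pq(1) by (simp add: ri_def vec_eq_iff Fract_of_int_quotient)
    then have "of_int (q * b $ i) = (of_int (p * a $ i) :: rat)" using pq(2) by simp
    then show ?thesis by (simp only: of_int_eq_iff)
  qed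
  have "q dvd a $ i" for i
  proof -
    have "q dvd p * a $ i" using eq[of i] by (metis dvd_triv_left)
    then show ?thesis using pq(3) by (simp add: coprime_commute coprime_dvd_mult_right_iff)
  qed
  then have "q dvd Gcd (range (($) a))" by (intro Gcd_greatest) auto
  then have q1: "q = 1" using assms(1) pq(2) by (simp add: prim6_def)
  have "p dvd b $ i" for i using eq[of i] q1 by simp
  then have "p dvd Gcd (range (($) b))" by (intro Gcd_greatest) auto
  then have "p = 1 \<or> p = -1" using assms(2) by (auto simp: prim6_def)
  then show ?thesis using eq q1 by (auto simp: vec_eq_iff)
qed

lemma P5_rep:
  assumes "p \<in> P5"
  shows "prim6 (coprime_rep p)" "ri (coprime_rep p) \<in> p"
    and "\<And>a. prim6 a \<Longrightarrow> ri a \<in> p \<Longrightarrow> a = coprime_rep p \<or> a = - coprime_rep p"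
proof -
  obtain x where x: "x \<noteq> 0" "p = proportional `` {x}" using assms by (auto simp: P5_def quotient_def)
  have mem: "y \<in> p \<longleftrightarrow> y \<noteq> 0 \<and> (\<exists>c. c \<noteq> 0 \<and> y = c *s x)" for y using x by (auto simp: proportional_def)
  obtain a c where a: "c \<noteq> 0" "ri a = c *s x" "prim6 a" using exists_prim6[OF x(1)] by blast
  have "ri a \<in> p" unfolding mem using a ri_eq_0_iff[of a] prim6_nonzero[OF a(3)] by blast
  then have "\<exists>a. Gcd (range (($) a)) = 1 \<and> (\<chi> i. of_int (a $ i)) \<in> p" using a(3) unfolding prim6_def ri_def by blast
  from someI_ex[OF this] show r: "prim6 (coprime_rep p)" "ri (coprime_rep p) \<in> p"
    unfolding coprime_rep_def prim6_def ri_def by blast+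
  fix b assume b: "prim6 b" "ri b \<in> p"
  obtain c1 where c1: "c1 \<noteq> 0" "ri (coprime_rep p) = c1 *s x" using r(2) mem by blast
  obtain c2 where c2: "ri b = c2 *s x" using b(2) mem by blast
  have "ri b = (c2 / c1) *s ri (coprime_rep p)" unfolding c1 c2 using c1(1) by (simp add: vector_smult_assoc)
  then show "b = coprime_rep p \<or> b = - coprime_rep p" using prim6_unique[OF r(1) b(1)] by blast
qed

lemma finite_hgt_ball: "finite {a :: int ^ coord. hgt a \<le> n}"
proof (rule finite_subset)
  show "{a :: int ^ coord. hgt a \<le> n} \<subseteq> vec_lambda ` (PiE UNIV (\<lambda>_. {-n..n}))"
  proof
    fix a :: "int ^ coord" assume "a \<in> {a. hgt a \<le> n}"
    then have "($) a \<in> PiE UNIV (\<lambda>_. {-n..n})" by (auto simp: hgt_le_iff abs_le_iff minus_le_iff)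
    moreover have "a = vec_lambda (($) a)" by simp
    ultimately show "a \<in> vec_lambda ` (PiE UNIV (\<lambda>_. {-n..n}))" by blast
  qed
  show "finite (vec_lambda ` (PiE (UNIV :: coord set) (\<lambda>_. {-n..n})))" by (intro finite_imageI finite_PiE) auto
qed

lemma finite_hgt_real_ball: "finite {a :: int ^ coord. real_of_int (hgt a) \<le> t}"
  by (rule finite_subset[OF _ finite_hgt_ball[of "\<lfloor>t\<rfloor>"]]) (auto simp: le_floor_iff)

lemma hgt_uminus: "hgt (- a) = hgt (a :: int ^ coord)"
  by (simp add: hgt_def)

text \<open>A rational point has exactly two primitive integral representatives, a and -a. By
  invariance of the condition under scaling it may be tested on either of them.\<close>

lemma N_eq_card:
  assumes inv: "\<And>c x. c \<noteq> 0 \<Longrightarrow> \<Phi> (c *s x) \<longleftrightarrow> \<Phi> x"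
  shows "2 * real (N {p \<in> P5. \<forall>x\<in>p. \<Phi> x} height B) = real (card {a. prim6 a \<and> \<Phi> (ri a) \<and> real_of_int (hgt a ^ 3) \<le> B})"
proof -
  define S where "S = {p \<in> {p \<in> P5. \<forall>x\<in>p. \<Phi> x}. real_of_int (height p) \<le> B}"
  define A where "A = {a. prim6 a \<and> \<Phi> (ri a) \<and> real_of_int (hgt a ^ 3) \<le> B}"
  let ?r = coprime_rep
  have ht: "height p = hgt (?r p) ^ 3" for p by (simp add: height_def hgt_def)
  have SP: "p \<in> P5" if "p \<in> S" for p using that by (simp add: S_def)
  have mem: "y \<in> proportional `` {x} \<longleftrightarrow> x \<noteq> 0 \<and> y \<noteq> 0 \<and> (\<exists>c. c \<noteq> 0 \<and> y = c *s x)" for x y by (auto simp: proportional_def)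
  have closed: "c *s x \<in> p" if p: "p \<in> P5" and x: "x \<in> p" and c: "c \<noteq> 0" for p c x
  proof -
    obtain z where z: "z \<noteq> 0" "p = proportional `` {z}" using p unfolding P5_def by (elim quotientE) auto
    obtain k where k: "k \<noteq> 0" "x = k *s z" "x \<noteq> 0" using x unfolding z(2) mem by blast
    have "c *s x = (c * k) *s z" "c *s x \<noteq> 0" using k c by (simp_all add: vector_smult_assoc)
    moreover have "c * k \<noteq> 0" using k(1) c by simp
    ultimately show ?thesis unfolding z(2) mem using z(1) by blast
  qed
  have repA: "?r p \<in> A" if "p \<in> S" for p
    using P5_rep(1,2)[OF SP[OF that]] that ht[of p] by (auto simp: A_def S_def)
  have minus: "- a \<in> A" if "a \<in> A" for a
    using that inv[of "-1" "ri a"] by (simp add: A_def prim6_uminus hgt_uminus ri_uminus)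
  have "A = ?r ` S \<union> uminus ` ?r ` S"
  proof (intro set_eqI iffI)
    fix a assume a: "a \<in> A"
    define p where "p = proportional `` {ri a}"
    have nz: "ri a \<noteq> 0" using a prim6_nonzero[of a] by (simp add: A_def ri_eq_0_iff)
    have pP: "p \<in> P5" unfolding p_def P5_def using nz by (intro quotientI) simp
    have ap: "ri a \<in> p" unfolding p_def mem using nz by (auto intro!: exI[of _ 1])
    have "\<Phi> x" if "x \<in> p" for x using that a inv unfolding p_def mem A_def by auto
    moreover have ra: "a = ?r p \<or> a = - ?r p" using P5_rep(3)[OF pP _ ap] a by (simp add: A_def)
    then have "hgt a = hgt (?r p)" by (auto simp: hgt_uminus)
    ultimately have "p \<in> S" using pP a ht[of p] by (simp add: S_def A_def)
    then show "a \<in> ?r ` S \<union> uminus ` ?r ` S" using ra by blast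
  next
    fix a assume "a \<in> ?r ` S \<union> uminus ` ?r ` S"
    then show "a \<in> A" using repA minus by blast
  qed
  moreover have same: "p = p'" if "p \<in> S" "p' \<in> S" "x \<in> p" "x \<in> p'" for p p' x
    using quotient_disj[OF equiv_proportional, of p p'] SP[OF that(1)] SP[OF that(2)] that(3,4) unfolding P5_def by blast
  have inj: "inj_on ?r S"
  proof (rule inj_onI)
    fix p p' assume p: "p \<in> S" "p' \<in> S" "?r p = ?r p'"
    show "p = p'" using same[OF p(1,2) P5_rep(2)[OF SP[OF p(1)]]] P5_rep(2)[OF SP[OF p(2)]] p(3) by simp
  qed
  have disj: "?r ` S \<inter> uminus ` ?r ` S = {}"
  proof (rule ccontr)
    assume "?r ` S \<inter> uminus ` ?r ` S \<noteq> {}"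
    then obtain p p' where p: "p \<in> S" "p' \<in> S" "?r p = - ?r p'" by blast
    have "ri (?r p) \<in> p'" unfolding p(3) ri_uminus using closed[OF SP[OF p(2)] P5_rep(2)[OF SP[OF p(2)]], of "-1"] by simp
    then have "p = p'" using same[OF p(1,2) P5_rep(2)[OF SP[OF p(1)]]] by blast
    then have "?r p = 0" using p(3) by (simp add: vec_eq_iff)
    then show False using prim6_nonzero[OF P5_rep(1)[OF SP[OF p(1)]]] by simp
  qed
  have finA: "finite A"
  proof (rule finite_subset[OF _ finite_hgt_real_ball[of B]], rule subsetI)
    fix a assume a: "a \<in> A"
    have "hgt a \<noteq> 0" using prim6_nonzero[of a] a by (simp add: A_def hgt_eq_0_iff)
    then have "1 \<le> hgt a" using hgt_nonneg[of a] by linarith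
    then have "hgt a ^ 1 \<le> hgt a ^ 3" by (intro power_increasing) auto
    then have "real_of_int (hgt a) \<le> real_of_int (hgt a ^ 3)" by (simp only: power_one_right of_int_le_iff)
    also have "\<dots> \<le> B" using a unfolding A_def by blast
    finally show "a \<in> {a. real_of_int (hgt a) \<le> B}" by blast
  qed
  ultimately have "card A = card (?r ` S) + card (uminus ` ?r ` S)"
    by (metis card_Un_disjoint disj finite_Un)
  moreover have "card (uminus ` ?r ` S) = card (?r ` S)" by (rule card_image) (simp add: inj_on_def)
  moreover have "card (?r ` S) = card S" by (rule card_image[OF inj])
  ultimately show ?thesis unfolding N_def S_def[symmetric] A_def[symmetric] by simp
qed

lemma cubic_smult: "cubic (c *s x) = c ^ 3 * cubic x"
  by (simp add: cubic_def power2_eq_square power3_eq_cube algebra_simps)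

lemma Deltas_smult: "Deltas (c *s x) = (\<lambda>d. c\<^sup>2 * d) ` Deltas x"
  by (simp add: Deltas_def power2_eq_square algebra_simps)

lemma in_zero_smult: "c \<noteq> 0 \<Longrightarrow> in_zero (c *s x) \<longleftrightarrow> in_zero x"
  by (simp add: in_zero_def cubic_smult Deltas_smult is_square_mult_iff)

lemma in_sign_smult: "c \<noteq> 0 \<Longrightarrow> in_sign s (c *s x) \<longleftrightarrow> in_sign s x"
proof -
  assume c: "c \<noteq> 0"
  then have "c\<^sup>2 > 0" by simp
  then have "0 \<le> c\<^sup>2 * d \<longleftrightarrow> 0 \<le> d" "c\<^sup>2 * d \<le> 0 \<longleftrightarrow> d \<le> 0" "c\<^sup>2 * d = 0 \<longleftrightarrow> d = 0" for d
    by (simp_all add: zero_le_mult_iff mult_le_0_iff)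
  then show ?thesis using c by (simp add: in_sign_def cubic_smult Deltas_smult is_square_mult_iff)
qed

lemma X_zero_eq: "X_zero = {p \<in> P5. \<forall>x\<in>p. in_zero x}"
  by (auto simp: X_zero_def XQ_def in_zero_def)

lemma X_plus_eq: "X_plus = {p \<in> P5. \<forall>x\<in>p. in_sign 1 x}"
  by (auto simp: X_plus_def XQ_def in_sign_def)

lemma X_minus_eq: "X_minus = {p \<in> P5. \<forall>x\<in>p. in_sign (-1) x}"
  by (auto simp: X_minus_def XQ_def in_sign_def)

section \<open>Counting forms that do not split\<close>

lemma in_sign_vertex:
  assumes s: "s \<in> {-1, 1}" and a: "in_sign s (ri a)" "real_of_int (hgt a) \<le> T" and v: "prim v" "kerv a v"
  shows "\<exists>t\<in>forms s T v. a = qf (bas1 v) (bas2 v) t"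
proof -
  have c: "cross (bas1 v) (bas2 v) = v" using reduced_basis[OF v(1)] by (simp add: reduced_def)
  obtain t where t: "a = qf (bas1 v) (bas2 v) t" using exists_qf_coefficients[OF v(2) c v(1)] by blast
  have "sgn_ok s t \<and> \<not> is_square (disc t)" using qf_conditions(2)[OF c prim_nonzero[OF v(1)] s, of t] a(1) t by simp
  then have "t \<in> forms s T v" using a(2) t by (simp add: forms_def)
  then show ?thesis using t by blast
qed

lemma prim_uminus: "prim (- v) \<longleftrightarrow> prim v"
  by (cases v) (simp add: prim_def gcd3_def)

lemma kerv_uminus: "kerv a (- v) \<longleftrightarrow> kerv a v"
proof (cases v)
  case (fields p q r)
  have "x * - p + y * - q + z * - r = 0 \<longleftrightarrow> x * p + y * q + z * r = 0" for x y z :: int by auto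
  then show ?thesis by (simp only: fields kerv_def uminus_prod_def fst_conv snd_conv prod.case)
qed

text \<open>Some discriminant is nonzero, so the primitive vertex is unique up to sign. It lies in
  \<open>verts T\<close> because otherwise \<open>forms_empty\<close> would exclude the form
  itself.\<close>

lemma card_vertices:
  assumes s: "s \<in> {-1, 1}" and a: "in_sign s (ri a)" "real_of_int (hgt a) \<le> T"
  shows "card {v \<in> verts T. kerv a v} = 2"
proof -
  have "icubic a = 0" using a(1) by (simp add: in_sign_def cubic_ri)
  then obtain v where v: "prim v" "kerv a v" using exists_vertex by blast
  have nz: "\<not> (d01 a = 0 \<and> d02 a = 0 \<and> d12 a = 0)"
  proof
    assume "d01 a = 0 \<and> d02 a = 0 \<and> d12 a = 0"
    then show False using a(1) s by (auto simp: in_sign_def Deltas_ri)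
  qed
  have vert: "v' \<in> verts T" if "prim v'" "kerv a v'" for v'
  proof (rule ccontr)
    assume "v' \<notin> verts T"
    then have "real (nrm (bas2 v')) ^ 2 > 200 * T" using that(1) by (simp add: verts_def)
    then have "forms s T v' = {}" using forms_empty[OF that(1) s] by blast
    then show False using in_sign_vertex[OF s a that] by blast
  qed
  have "{v \<in> verts T. kerv a v} = {v, - v}"
  proof (intro set_eqI iffI)
    fix v' assume "v' \<in> {v \<in> verts T. kerv a v}"
    then have v': "prim v'" "kerv a v'" by (simp_all add: verts_def)
    show "v' \<in> {v, - v}" using prim_parallel[OF vertex_unique[OF v(2) v'(2) nz] v(1) v'(1)] by blast
  next
    fix v' assume "v' \<in> {v, - v}"
    then have "prim v'" "kerv a v'" using v by (auto simp: prim_uminus kerv_uminus)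
    then show "v' \<in> {v \<in> verts T. kerv a v}" using vert by simp
  qed
  moreover have "v \<noteq> - v"
  proof
    assume e: "v = - v"
    obtain p q r where "v = (p, q, r)" by (cases v)
    then have "v = 0" using e by (simp add: zero_prod_def)
    then show False using prim_nonzero[OF v(1)] by simp
  qed
  ultimately show ?thesis by simp
qed

text \<open>Double counting of pairs of a form and a primitive vertex of it. For fixed v, the
  coefficients with respect to the chosen basis parametrize the forms with vertex v
  bijectively.\<close>

lemma card_in_sign:
  assumes s: "s \<in> {-1, 1}" and T: "T \<ge> 1"
  shows "2 * real (card {a. in_sign s (ri a) \<and> real_of_int (hgt a) \<le> T}) = (\<Sum>v\<in>verts T. real (card (forms s T v)))"
proof -
  let ?M = "{a. in_sign s (ri a) \<and> real_of_int (hgt a) \<le> T}"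
  have finM: "finite ?M" by (rule finite_subset[OF _ finite_hgt_real_ball[of T]]) blast
  have "card (forms s T v) = card {a \<in> ?M. kerv a v}" if v: "v \<in> verts T" for v
  proof -
    have pv: "prim v" using v by (simp add: verts_def)
    have c: "cross (bas1 v) (bas2 v) = v" using reduced_basis[OF pv] by (simp add: reduced_def)
    have "bij_betw (qf (bas1 v) (bas2 v)) (forms s T v) {a \<in> ?M. kerv a v}"
      unfolding bij_betw_def
    proof
      show "inj_on (qf (bas1 v) (bas2 v)) (forms s T v)"
        by (rule inj_onI) (rule qf_inj[of "bas1 v" "bas2 v"], use c pv in simp_all)
      show "qf (bas1 v) (bas2 v) ` forms s T v = {a \<in> ?M. kerv a v}"
      proof (intro set_eqI iffI)
        fix a assume "a \<in> qf (bas1 v) (bas2 v) ` forms s T v"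
        then obtain t where t: "t \<in> forms s T v" "a = qf (bas1 v) (bas2 v) t" by blast
        have "in_sign s (ri a)" using qf_conditions(2)[OF c prim_nonzero[OF pv] s, of t] t by (simp add: forms_def)
        then show "a \<in> {a \<in> ?M. kerv a v}" using t kerv_qf[of "bas1 v" "bas2 v" t] c by (simp add: forms_def)
      next
        fix a assume "a \<in> {a \<in> ?M. kerv a v}"
        then show "a \<in> qf (bas1 v) (bas2 v) ` forms s T v" using in_sign_vertex[OF s _ _ pv, of a T] by blast
      qed
    qed
    then show ?thesis by (rule bij_betw_same_card)
  qed
  then have "(\<Sum>v\<in>verts T. real (card (forms s T v))) = (\<Sum>v\<in>verts T. \<Sum>a | a \<in> ?M \<and> kerv a v. 1)" by simp
  also have "\<dots> = (\<Sum>a\<in>?M. \<Sum>v | v \<in> verts T \<and> kerv a v. 1)"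
    by (rule sum.swap_restrict[OF finite_verts[OF T] finM])
  also have "\<dots> = (\<Sum>a\<in>?M. 2)"
    by (rule sum.cong[OF refl]) (use card_vertices[OF s] in simp)
  finally show ?thesis by simp
qed

text \<open>Counting by vertices does not see the content of a form, so all forms are counted first
  and the content is removed by inversion. The factor 1/2 accounts for the sign of the
  vertex.\<close>

lemma prim_in_sign_asymptotics:
  assumes s: "s \<in> {-1, 1}"
  obtains c K where "c > 0" "\<And>T. T \<ge> 1 \<Longrightarrow>
    \<bar>real (card {a. prim6 a \<and> in_sign s (ri a) \<and> real_of_int (hgt a) \<le> T}) - c * T ^ 3 * ln T\<bar> \<le> K * T ^ 3"
proof -
  let ?X = "{a. in_sign s (ri a)}" and ?P = "{a. prim6 a \<and> in_sign s (ri a)}"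
  let ?h = "\<lambda>a :: int ^ coord. real_of_int (hgt a)"
  have nz: "a \<noteq> 0" if "in_sign s (ri a)" for a
  proof
    assume "a = 0"
    then have "ri a = 0" by (simp add: ri_eq_0_iff)
    then show False using that s by (auto simp: in_sign_def Deltas_def)
  qed
  have dec: "real (card {a \<in> ?X. ?h a \<le> t}) = (\<Sum>d=1..nat \<lfloor>t\<rfloor>. real (card {a \<in> ?P. ?h a \<le> t / real d}))" for t
  proof (rule card_scaling_decomp[where act = "\<lambda>d a. int d *s a"])
    show "?X = {int d *s y | d y. 1 \<le> d \<and> y \<in> ?P}"
    proof (intro set_eqI iffI)
      fix a assume a: "a \<in> ?X"
      then obtain d y where dy: "d \<ge> 1" "prim6 y" "a = int d *s y" using prim6_decomp[of a] nz[of a] by blast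
      have "in_sign s (ri y)" using a dy(1) in_sign_smult[of "of_int (int d)" s "ri y"] by (simp add: dy(3) ri_smult)
      then show "a \<in> {int d *s y | d y. 1 \<le> d \<and> y \<in> ?P}" using dy by blast
    next
      fix a assume "a \<in> {int d *s y | d y. 1 \<le> d \<and> y \<in> ?P}"
      then obtain d y where dy: "a = int d *s y" "1 \<le> d" "prim6 y" "in_sign s (ri y)" by blast
      then show "a \<in> ?X" using in_sign_smult[of "of_int (int d)" s "ri y"] by (simp add: ri_smult)
    qed
    show "d = d' \<and> y = y'" if "1 \<le> d" "y \<in> ?P" "y' \<in> ?P" "int d *s y = int d' *s y'" for d d' y y'
      using prim6_smult_inj[of y y' d d'] that by simp
    show "?h (int d *s y) = real d * ?h y" for d y by (simp add: hgt_smult)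
    show "1 \<le> ?h y" if "y \<in> ?P" for y
    proof -
      have "hgt y \<noteq> 0" using prim6_nonzero[of y] that by (simp add: hgt_eq_0_iff)
      then have "1 \<le> hgt y" using hgt_nonneg[of y] by linarith
      then show ?thesis by simp
    qed
    show "finite {y \<in> ?P. ?h y \<le> t}" for t by (rule finite_subset[OF _ finite_hgt_real_ball[of t]]) blast
  qed
  obtain c K where c: "c > 0" and K: "\<And>T. T \<ge> 1 \<Longrightarrow> \<bar>(\<Sum>v\<in>verts T. real (card (forms s T v))) - c * T ^ 3 * ln T\<bar> \<le> K * T ^ 3"
    using forms_asymptotics[OF s] by blast
  have half: "\<bar>real (card {a \<in> ?X. ?h a \<le> T}) - c / 2 * T ^ 3 * ln T\<bar> \<le> K / 2 * T ^ 3" if T: "T \<ge> 1" for T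
  proof -
    have "2 * real (card {a \<in> ?X. ?h a \<le> T}) = (\<Sum>v\<in>verts T. real (card (forms s T v)))"
      using card_in_sign[OF s T] by simp
    moreover have "2 * (c / 2 * T ^ 3 * ln T) = c * T ^ 3 * ln T" "2 * (K / 2 * T ^ 3) = K * T ^ 3" by simp_all
    ultimately show ?thesis using K[OF T] by linarith
  qed
  have c2: "c / 2 > 0" using c by simp
  obtain c' K' where c': "c' > 0" and K': "\<And>x. x \<ge> 1 \<Longrightarrow> \<bar>real (card {a \<in> ?P. ?h a \<le> x}) - c' * x ^ 3 * ln x\<bar> \<le> K' * x ^ 3"
    using cubic_log_inversion[OF dec c2 half] by blast
  have "{a. prim6 a \<and> in_sign s (ri a) \<and> real_of_int (hgt a) \<le> T} = {a \<in> ?P. ?h a \<le> T}" for T by auto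
  then show ?thesis using K' by (intro that[OF c']) (simp only:)
qed

section \<open>Counting forms that split\<close>

lemma lprod_eq_0: "lprod l m = 0 \<Longrightarrow> l = 0 \<or> m = (0 :: int triple)"
proof -
  assume "lprod l m = 0"
  then have "hgt (lprod l m) = 0" by (simp add: hgt_eq_0_iff)
  then have "real (nrm l) * real (nrm m) \<le> 0" using nrm_lprod_le[of l m] by simp
  then have "nrm l = 0 \<or> nrm m = 0" by (auto simp: mult_le_0_iff)
  then show ?thesis by (simp add: nrm_eq_0_iff)
qed

lemma lprod_uminus: "lprod (- l) m = - lprod l m" "lprod l (- m) = - lprod l (m :: int triple)"
  by (cases l; cases m; simp add: vec_eq_iff all_coord)+

lemma lprod_cancel:
  assumes "lprod l m = lprod l m'" "l \<noteq> (0 :: int triple)" shows "m = m'"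
proof -
  have "lprod l (m - m') = lprod l m - lprod l m'"
    by (cases l; cases m; cases m') (simp add: vec_eq_iff all_coord algebra_simps)
  then have "m - m' = 0" using lprod_eq_0[of l "m - m'"] assms by simp
  then show ?thesis by simp
qed

lemma polar_lprod: "polar (lprod p q) y z = dot p y * dot q z + dot p z * dot q y"
proof -
  have "lprod p q = qf p q (0, 1, 0)" by (simp add: qf_def lin3_def)
  then show ?thesis by (simp add: polar_qf)
qed

text \<open>The vectors l' \<times> y are zeros of l', hence of l m. As functions of y, the
  restrictions of l and m to them have coefficient vectors l \<times> l' and m \<times> l'. Their
  product vanishes, so one of them does, and l' is parallel to l or m; cancellation determines
  m'.\<close>

lemma lprod_unique:
  assumes eq: "lprod l m = lprod l' m'" and pr: "prim l" "prim m" "prim l'" "prim m'"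
  shows "(l', m') \<in> {(l, m), (- l, - m), (m, l), (- m, - l)}"
proof -
  have t: "dot (cross p l') z = dot p (cross l' z)" for p z :: "int triple"
    by (cases p; cases l'; cases z) (simp add: cross_def dot_def algebra_simps)
  have "polar (lprod (cross l l') (cross m l')) y z = polar (lprod l' m') (cross l' y) (cross l' z)" for y z
    unfolding eq[symmetric] polar_lprod t ..
  then have z: "polar (lprod (cross l l') (cross m l')) y z = 0" for y z unfolding polar_lprod by simp
  have ev: "polar a (1, 0, 0) (1, 0, 0) = 2 * a $ C0" "polar a (0, 1, 0) (0, 1, 0) = 2 * a $ C1" "polar a (0, 0, 1) (0, 0, 1) = 2 * a $ C2"
    "polar a (1, 0, 0) (0, 1, 0) = a $ C01" "polar a (1, 0, 0) (0, 0, 1) = a $ C02" "polar a (0, 1, 0) (0, 0, 1) = a $ C12" for a :: "int ^ coord"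
    by (simp_all add: polar_def)
  have "lprod (cross l l') (cross m l') = 0"
    unfolding vec_eq_iff all_coord using z ev[of "lprod (cross l l') (cross m l')"] by simp
  then have "cross l l' = 0 \<or> cross m l' = 0" by (rule lprod_eq_0)
  then consider "l' = l" | "l' = - l" | "l' = m" | "l' = - m"
    using prim_parallel[of l l'] prim_parallel[of m l'] pr by blast
  then show ?thesis
  proof cases
    case 1
    then have "m = m'" using lprod_cancel[of l m m'] eq prim_nonzero[OF pr(1)] by simp
    then show ?thesis using 1 by simp
  next
    case 2
    then have "m = - m'" using lprod_cancel[of l m "- m'"] eq prim_nonzero[OF pr(1)] by (simp add: lprod_uminus)
    then show ?thesis using 2 by simp
  next
    case 3
    then have "l = m'" using lprod_cancel[of m l m'] eq prim_nonzero[OF pr(2)] by (simp add: lprod_commute[of m l])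
    then show ?thesis using 3 by simp
  next
    case 4
    then have "l = - m'" using lprod_cancel[of m l "- m'"] eq prim_nonzero[OF pr(2)] by (simp add: lprod_uminus lprod_commute[of m l])
    then show ?thesis using 4 by simp
  qed
qed

text \<open>Gauss's lemma. A prime dividing all coefficients misses some coordinate of l. The square
  coefficient there puts it into one coordinate of m, and the mixed coefficients then put it into
  the other two.\<close>

lemma gauss_lemma:
  assumes "prim l" "prim m" shows "prim6 (lprod l m)"
proof (rule ccontr)
  let ?g = "Gcd (range (($) (lprod l m)))"
  assume "\<not> prim6 (lprod l m)"
  then have g1: "?g \<noteq> 1" by (simp add: prim6_def)
  have "lprod l m \<noteq> 0" using lprod_eq_0 prim_nonzero assms by blast
  then obtain i where "lprod l m $ i \<noteq> 0" by (auto simp: vec_eq_iff)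
  then have g0: "?g \<noteq> 0" by (metis Gcd_dvd dvd_0_left_iff rangeI)
  have "\<not> is_unit ?g"
  proof
    assume "is_unit ?g"
    then have "\<bar>?g\<bar> = 1" by simp
    moreover have "?g \<ge> 0" by simp
    ultimately show False using g1 by linarith
  qed
  then obtain p where p: "p dvd ?g" "prime p" using prime_divisor_exists[OF g0] by blast
  have dv: "p dvd lprod l m $ i" for i using p(1) by (meson Gcd_dvd dvd_trans rangeI)
  obtain l0 l1 l2 m0 m1 m2 where lm: "l = (l0, l1, l2)" "m = (m0, m1, m2)" by (cases l; cases m)
  have d: "p dvd l0 * m0" "p dvd l1 * m1" "p dvd l2 * m2" "p dvd l0 * m1 + l1 * m0" "p dvd l0 * m2 + l2 * m0" "p dvd l1 * m2 + l2 * m1"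
    using dv[of C0] dv[of C1] dv[of C2] dv[of C01] dv[of C02] dv[of C12] by (simp_all add: lm)
  have notall: "\<not> (p dvd a \<and> p dvd b \<and> p dvd c)" if "prim (a, b, c)" for a b c
  proof
    assume "p dvd a \<and> p dvd b \<and> p dvd c"
    then have "p dvd 1" using that unfolding prim_def gcd3_def by (metis gcd_greatest prod.case)
    then show False using p(2) not_prime_unit by blast
  qed
  have pm: "p dvd x * y \<Longrightarrow> p dvd x \<or> p dvd y" for x y using p(2) by (simp add: prime_dvd_mult_iff)
  have step: "p dvd y'" if "\<not> p dvd x" "p dvd x * y' + x' * y" "p dvd y" for x x' y y'
  proof -
    have "p dvd x * y'" using that(2,3) by (metis dvd_add_left_iff dvd_mult)
    then show ?thesis using pm that(1) by blast
  qed
  have step': "p dvd y'" if "\<not> p dvd x" "p dvd x' * y + x * y'" "p dvd y" for x x' y y'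
    using step[OF that(1) _ that(3), of y' x'] that(2) by (simp add: add.commute)
  have "\<not> (p dvd m0 \<and> p dvd m1 \<and> p dvd m2)" using notall[of m0 m1 m2] assms(2) by (simp add: lm)
  moreover have "\<not> (p dvd l0 \<and> p dvd l1 \<and> p dvd l2)" using notall[of l0 l1 l2] assms(1) by (simp add: lm)
  ultimately consider "\<not> p dvd l0" | "\<not> p dvd l1" | "\<not> p dvd l2" by blast
  then have "p dvd m0 \<and> p dvd m1 \<and> p dvd m2"
  proof cases
    case 1
    then have "p dvd m0" using pm d(1) by blast
    then show ?thesis using step[OF 1 d(4)] step[OF 1 d(5)] by blast
  next
    case 2
    then have "p dvd m1" using pm d(2) by blast
    then show ?thesis using step'[OF 2 d(4)] step[OF 2 d(6)] by blast
  next
    case 3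
    then have "p dvd m2" using pm d(3) by blast
    then show ?thesis using step'[OF 3 d(5)] step'[OF 3 d(6)] by blast
  qed
  then show False using \<open>\<not> (p dvd m0 \<and> p dvd m1 \<and> p dvd m2)\<close> by blast
qed

lemma square_disc_split:
  assumes "is_square (disc (a, b, c :: int))" shows "\<exists>p q r s. a = p * r \<and> b = p * s + q * r \<and> c = q * s"
proof -
  consider "a = 0" | "c = 0" | "a \<noteq> 0" "c \<noteq> 0" by blast
  then show ?thesis
  proof cases
    case 1 then show ?thesis by (intro exI[of _ 0] exI[of _ 1] exI[of _ b] exI[of _ c]) simp
  next
    case 2 then show ?thesis by (intro exI[of _ 1] exI[of _ 0] exI[of _ a] exI[of _ b]) simp
  next
    case 3
    have "is_square (b\<^sup>2 - 4 * a * c)" using assms by (simp add: disc_def)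
    from square_disc_factorization[OF this 3] obtain p q r s where "a = p * r" "c = q * s" "b = p * s + q * r" .
    then show ?thesis by blast
  qed
qed

lemma lprod_left_factor_prim:
  assumes "prim6 (lprod l m)" shows "prim l"
proof -
  have "l \<noteq> 0"
  proof
    assume "l = 0"
    then have "lprod l m = 0" by (cases m) (simp add: zero_prod_def vec_eq_iff all_coord)
    then show False using prim6_nonzero[OF assms] by simp
  qed
  then obtain d y where d: "d \<ge> 1" "prim y" "l = smul d y" by (rule prim_decomp)
  have "Gcd (range (($) (lprod l m))) = int d * Gcd (range (($) (lprod y m)))"
    unfolding d(3) lprod_smul using Gcd_smult[of "int d" "lprod y m"] by simp
  then have "int d dvd 1" using assms unfolding prim6_def by (metis dvd_triv_left)
  then have "d = 1" using d(1) by simp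
  then have "l = y" using d(3) by (simp only: smul_1)
  then show ?thesis using d(2) by simp
qed

text \<open>A binary form of square discriminant in the basis u, w splits over the integers, which
  gives l = p u + q w and m = r u + s w. Content in either factor would be content of the product.
  Conversely the discriminants of a product are squares of the coordinates of l \<times> m.\<close>

lemma in_zero_iff_lprod:
  assumes "prim6 a" shows "in_zero (ri a) \<longleftrightarrow> (\<exists>l m. prim l \<and> prim m \<and> a = lprod l m)"
proof
  assume z: "in_zero (ri a)"
  then have "icubic a = 0" by (simp add: in_zero_def cubic_ri)
  then obtain v where v: "prim v" "kerv a v" using exists_vertex by blast
  have c: "cross (bas1 v) (bas2 v) = v" using reduced_basis[OF v(1)] by (simp add: reduced_def)
  obtain t where t: "a = qf (bas1 v) (bas2 v) t" using exists_qf_coefficients[OF v(2) c v(1)] by blast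
  obtain x y k where xyk: "t = (x, y, k)" by (cases t)
  have "is_square (disc t)" using qf_conditions(1)[OF c prim_nonzero[OF v(1)], of t] z t by simp
  then obtain p q r s where f: "x = p * r" "y = p * s + q * r" "k = q * s" using square_disc_split unfolding xyk by blast
  obtain u0 u1 u2 w0 w1 w2 where uw: "bas1 v = (u0, u1, u2)" "bas2 v = (w0, w1, w2)" by (cases "bas1 v"; cases "bas2 v")
  define l m where "l = (p * u0 + q * w0, p * u1 + q * w1, p * u2 + q * w2)"
    and "m = (r * u0 + s * w0, r * u1 + s * w1, r * u2 + s * w2)"
  have a: "a = lprod l m"
    unfolding t xyk f uw l_def m_def vec_eq_iff all_coord by (simp add: algebra_simps)
  have "prim l" using lprod_left_factor_prim[of l m] assms a by simp
  moreover have "prim m" using lprod_left_factor_prim[of m l] assms a by (simp add: lprod_commute)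
  ultimately show "\<exists>l m. prim l \<and> prim m \<and> a = lprod l m" using a by blast
next
  assume "\<exists>l m. prim l \<and> prim m \<and> a = lprod l m"
  then obtain l m where a: "a = lprod l m" by blast
  obtain l0 l1 l2 m0 m1 m2 where lm: "l = (l0, l1, l2)" "m = (m0, m1, m2)" by (cases l; cases m)
  have "icubic a = 0" unfolding icubic_def a lm lprod_component power2_eq_square by algebra
  moreover have "d01 a = (l0 * m1 - l1 * m0)\<^sup>2" "d02 a = (l0 * m2 - l2 * m0)\<^sup>2" "d12 a = (l1 * m2 - l2 * m1)\<^sup>2"
    unfolding d01_def d02_def d12_def a lm lprod_component power2_eq_square by algebra+
  then have "is_square (d01 a)" "is_square (d02 a)" "is_square (d12 a)" by simp_all
  ultimately show "in_zero (ri a)" unfolding in_zero_def cubic_ri Deltas_ri by (simp add: is_square_rat_of_int_iff del: of_int_power)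
qed

text \<open>Fibres of the product map have four elements, from the order and a common sign, unless m
  = l or m = -l. These exceptional forms are bounded crudely by all l of norm at most 2 T, which
  gives 4 * 2 * 125 T^3.\<close>

lemma card_prim6_in_zero:
  assumes T: "T \<ge> 1"
  shows "\<bar>4 * real (card {a. prim6 a \<and> in_zero (ri a) \<and> real_of_int (hgt a) \<le> T})
     - real (card {(l, m). prim l \<and> prim m \<and> real_of_int (hgt (lprod l m)) \<le> T})\<bar> \<le> 1000 * T ^ 3"
proof -
  define Z where "Z = {a. prim6 a \<and> in_zero (ri a) \<and> real_of_int (hgt a) \<le> T}"
  define P where "P = {(l, m). prim l \<and> prim m \<and> real_of_int (hgt (lprod l m)) \<le> T}"
  define F where "F = (\<lambda>a. {p \<in> P. lprod (fst p) (snd p) = a})"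
  define L where "L = {l. real (nrm l) \<le> 2 * T}"
  define bad where "bad = (\<lambda>l. lprod l l) ` L \<union> (\<lambda>l. - lprod l l) ` L"
  have finZ: "finite Z" unfolding Z_def by (rule finite_subset[OF _ finite_hgt_real_ball[of T]]) blast
  have memP: "(l, m) \<in> P \<longleftrightarrow> prim l \<and> prim m \<and> real_of_int (hgt (lprod l m)) \<le> T" for l m by (simp add: P_def)
  have finP: "finite P"
  proof (rule finite_subset[OF _ finite_pairs[of T]], rule subsetI)
    fix p assume p: "p \<in> P"
    obtain l m where lm: "p = (l, m)" by (cases p)
    show "p \<in> pairs T" using p prim_nonzero[of l] prim_nonzero[of m] unfolding lm memP pairs_def by simp
  qed
  have finL: "finite L" unfolding L_def by (rule finite_nrm_real_ball)
  have finbad: "finite bad" unfolding bad_def using finL by simp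
  have "(\<lambda>p. lprod (fst p) (snd p)) ` P \<subseteq> Z"
  proof
    fix a assume "a \<in> (\<lambda>p. lprod (fst p) (snd p)) ` P"
    then obtain p where p: "p \<in> P" "a = lprod (fst p) (snd p)" by blast
    have lm: "prim (fst p)" "prim (snd p)" "real_of_int (hgt a) \<le> T" using p memP[of "fst p" "snd p"] by simp_all
    have "prim6 a" unfolding p(2) by (rule gauss_lemma[OF lm(1,2)])
    then show "a \<in> Z" using in_zero_iff_lprod[of a] lm p(2) unfolding Z_def by blast
  qed
  then have cardP: "real (card P) = (\<Sum>a\<in>Z. real (card (F a)))"
    using sum.group[OF finP finZ, of "\<lambda>p. lprod (fst p) (snd p)" "\<lambda>_. 1 :: real"] by (simp add: F_def)
  have fibre: "card (F a) \<le> 4 \<and> (a \<notin> bad \<longrightarrow> card (F a) = 4)" if a: "a \<in> Z" for a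
  proof -
    have "prim6 a" "in_zero (ri a)" "real_of_int (hgt a) \<le> T" using a by (simp_all add: Z_def)
    then obtain l m where lm: "prim l" "prim m" "a = lprod l m" using in_zero_iff_lprod by blast
    have hT: "real_of_int (hgt (lprod l m)) \<le> T" using \<open>real_of_int (hgt a) \<le> T\<close> lm(3) by simp
    have eq: "F a = {(l, m), (- l, - m), (m, l), (- m, - l)}"
    proof (intro set_eqI iffI)
      fix p assume p: "p \<in> F a"
      then have "prim (fst p)" "prim (snd p)" "lprod l m = lprod (fst p) (snd p)"
        using memP[of "fst p" "snd p"] lm(3) by (simp_all add: F_def)
      from lprod_unique[OF this(3) lm(1,2) this(1,2)] show "p \<in> {(l, m), (- l, - m), (m, l), (- m, - l)}" by simp
    next
      fix p assume "p \<in> {(l, m), (- l, - m), (m, l), (- m, - l)}"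
      then have "(prim (fst p) \<and> prim (snd p)) \<and> lprod (fst p) (snd p) = lprod l m"
        using lm(1,2) lprod_commute[of m l] by (elim insertE emptyE) (simp_all add: prim_uminus lprod_uminus)
      then show "p \<in> F a" using memP[of "fst p" "snd p"] lm(3) hT by (simp add: F_def)
    qed
    have n0: "l \<noteq> - l" "m \<noteq> - m"
    proof -
      have "x \<noteq> - x" if "x \<noteq> 0" for x :: "int triple"
        using that by (cases x) (auto simp: zero_prod_def)
      then show "l \<noteq> - l" "m \<noteq> - m" using prim_nonzero lm by blast+
    qed
    have "card (F a) = 4" if "a \<notin> bad"
    proof -
      have lL: "l \<in> L" using lprod_nrm_bounds(1)[OF prim_nonzero[OF lm(1)] prim_nonzero[OF lm(2)] hT] by (simp add: L_def)
      have "m \<noteq> l"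
      proof
        assume "m = l"
        then show False using \<open>a \<notin> bad\<close> lL lm(3) unfolding bad_def by blast
      qed
      moreover have "m \<noteq> - l"
      proof
        assume "m = - l"
        then have "a = - lprod l l" using lm(3) by (simp add: lprod_uminus)
        then show False using \<open>a \<notin> bad\<close> lL unfolding bad_def by blast
      qed
      moreover from this have "l \<noteq> - m" by auto
      ultimately show ?thesis unfolding eq using n0 by auto
    qed
    moreover have "card (F a) \<le> 4"
    proof -
      have "card (set [(l, m), (- l, - m), (m, l), (- m, - l)]) \<le> length [(l, m), (- l, - m), (m, l), (- m, - l)]" by (rule card_length)
      then show ?thesis unfolding eq by simp
    qed
    ultimately show ?thesis by blast
  qed
  have "4 * real (card Z) - real (card P) = (\<Sum>a\<in>Z. 4 - real (card (F a)))" unfolding cardP by (simp add: sum_subtractf)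
  moreover have "0 \<le> (\<Sum>a\<in>Z. 4 - real (card (F a)))"
  proof (rule sum_nonneg)
    fix a assume "a \<in> Z"
    then have "card (F a) \<le> 4" using fibre by blast
    then show "0 \<le> 4 - real (card (F a))" by simp
  qed
  moreover have "(\<Sum>a\<in>Z. 4 - real (card (F a))) \<le> 1000 * T ^ 3"
  proof -
    have "(\<Sum>a\<in>Z. 4 - real (card (F a))) = (\<Sum>a\<in>Z \<inter> bad. 4 - real (card (F a)))"
      using finZ fibre by (intro sum.mono_neutral_right) auto
    also have "\<dots> \<le> (\<Sum>a\<in>Z \<inter> bad. 4)" by (rule sum_mono) simp
    also have "\<dots> = 4 * real (card (Z \<inter> bad))" by simp
    also have "real (card (Z \<inter> bad)) \<le> real (card bad)" using finbad by (simp add: card_mono)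
    also have "card bad \<le> card L + card L"
      unfolding bad_def using card_Un_le[of "(\<lambda>l. lprod l l) ` L" "(\<lambda>l. - lprod l l) ` L"]
        card_image_le[OF finL, of "\<lambda>l. lprod l l"] card_image_le[OF finL, of "\<lambda>l. - lprod l l"] by linarith
    also have "real (card L + card L) = 2 * real (card L)" by simp
    also have "real (card L) \<le> (2 * (2 * T) + 1) ^ 3" unfolding L_def using T by (intro card_nrm_real_ball) simp
    also have "\<dots> \<le> (5 * T) ^ 3" using T by (intro power_mono) auto
    also have "\<dots> = 125 * T ^ 3" by (simp add: power_mult_distrib)
    finally show ?thesis by simp
  qed
  ultimately show ?thesis unfolding Z_def[symmetric] P_def[symmetric] by linarith
qed

lemma prim6_in_zero_asymptotics:
  obtains c K where "c > 0" "\<And>T. T \<ge> 1 \<Longrightarrow>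
    \<bar>real (card {a. prim6 a \<and> in_zero (ri a) \<and> real_of_int (hgt a) \<le> T}) - c * T ^ 3 * ln T\<bar> \<le> K * T ^ 3"
proof -
  obtain c K where c: "c > 0" and K: "\<And>T. T \<ge> 1 \<Longrightarrow>
    \<bar>real (card {(l, m). prim l \<and> prim m \<and> real_of_int (hgt (lprod l m)) \<le> T}) - c * T ^ 3 * ln T\<bar> \<le> K * T ^ 3"
    using prim_pairs_asymptotics by blast
  show ?thesis
  proof (rule that[of "c / 4" "(K + 1000) / 4"])
    show "c / 4 > 0" using c by simp
    fix T :: real assume T: "T \<ge> 1"
    have e: "4 * (c / 4 * T ^ 3 * ln T) = c * T ^ 3 * ln T" "4 * ((K + 1000) / 4 * T ^ 3) = K * T ^ 3 + 1000 * T ^ 3"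
      by (simp_all add: algebra_simps)
    show "\<bar>real (card {a. prim6 a \<and> in_zero (ri a) \<and> real_of_int (hgt a) \<le> T}) - c / 4 * T ^ 3 * ln T\<bar> \<le> (K + 1000) / 4 * T ^ 3"
      using card_prim6_in_zero[OF T] K[OF T] e by linarith
  qed
qed

section \<open>From primitive vectors of norm at most T to points of height at most B\<close>

text \<open>The height is the cube of the norm, so T is the cube root of B and ln B = 3 ln T.
  Together with the two signs of a representative this gives the factor 1/6.\<close>

lemma point_count_asymptotics:
  assumes inv: "\<And>c x. c \<noteq> 0 \<Longrightarrow> \<Phi> (c *s x) \<longleftrightarrow> \<Phi> x" and c: "c > 0"
    and K: "\<And>T. T \<ge> 1 \<Longrightarrow> \<bar>real (card {a. prim6 a \<and> \<Phi> (ri a) \<and> real_of_int (hgt a) \<le> T}) - c * T ^ 3 * ln T\<bar> \<le> K * T ^ 3"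
  shows "(\<lambda>B. real (N {p \<in> P5. \<forall>x\<in>p. \<Phi> x} height B) - c / 6 * B * ln B) \<in> O[at_top](\<lambda>B. B)"
proof (rule bigoI[where c = "K / 2"])
  show "eventually (\<lambda>B. norm (real (N {p \<in> P5. \<forall>x\<in>p. \<Phi> x} height B) - c / 6 * B * ln B) \<le> K / 2 * norm B) at_top"
  proof (rule eventually_mono[OF eventually_ge_at_top[of 1]])
    fix B :: real assume B: "B \<ge> 1"
    define T where "T = root 3 B"
    have T: "T \<ge> 1" "T ^ 3 = B" using B by (simp_all add: T_def)
    have "ln B = 3 * ln T" using T by (simp add: T(2)[symmetric] ln_realpow)
    then have e: "2 * (c / 6 * B * ln B) = c * T ^ 3 * ln T" by (simp add: T(2))
    have "real_of_int (hgt a ^ 3) \<le> B \<longleftrightarrow> real_of_int (hgt a) \<le> T" for a :: "int ^ coord"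
      unfolding T(2)[symmetric] of_int_power using hgt_nonneg[of a] T(1) by (intro power_mono_iff) auto
    then have "2 * real (N {p \<in> P5. \<forall>x\<in>p. \<Phi> x} height B) = real (card {a. prim6 a \<and> \<Phi> (ri a) \<and> real_of_int (hgt a) \<le> T})"
      using N_eq_card[of \<Phi> B, OF inv] by simp
    then show "norm (real (N {p \<in> P5. \<forall>x\<in>p. \<Phi> x} height B) - c / 6 * B * ln B) \<le> K / 2 * norm B"
      using K[OF T(1)] e B unfolding T(2) real_norm_def by linarith
  qed
qed

text \<open>The method yields the error O(B) for \<open>X_plus\<close> and \<open>X_minus\<close> as
  well; it is relaxed here to the error of the theorem.\<close>

lemma bigo_sqrt_log: "(\<lambda>B::real. B) \<in> O[at_top](\<lambda>B. B * (ln B) powr (1 / 2))"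
proof (rule bigoI[where c = 1])
  show "eventually (\<lambda>B::real. norm B \<le> 1 * norm (B * (ln B) powr (1 / 2))) at_top"
  proof (rule eventually_mono[OF eventually_ge_at_top[of "exp 1"]])
    fix B :: real assume B: "B \<ge> exp 1"
    have "0 < B" using B by (rule less_le_trans[OF exp_gt_zero])
    then have "ln B \<ge> 1" using B by (simp add: ln_ge_iff)
    then have "1 \<le> (ln B) powr (1 / 2)" by (simp add: ge_one_powr_ge_zero)
    then have "\<bar>B\<bar> * 1 \<le> \<bar>B\<bar> * \<bar>(ln B) powr (1 / 2)\<bar>" by (intro mult_left_mono) auto
    then show "norm B \<le> 1 * norm (B * (ln B) powr (1 / 2))" by (simp add: abs_mult)
  qed
qed

theorem theorem1p1:
  "\<exists>c0 cp cm :: real. c0 > 0 \<and> cp > 0 \<and> cm > 0 \<and>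
     (\<lambda>B. real (N X_zero height B) - c0 * B * ln B) \<in> O[at_top](\<lambda>B. B) \<and>
     (\<lambda>B. real (N X_plus height B) - cp * B * ln B) \<in> O[at_top](\<lambda>B. B * (ln B) powr (1/2)) \<and>
     (\<lambda>B. real (N X_minus height B) - cm * B * ln B) \<in> O[at_top](\<lambda>B. B * (ln B) powr (1/2))"
proof -
  obtain c0 K0 where 0: "c0 > 0" and K0: "\<And>T. T \<ge> 1 \<Longrightarrow>
    \<bar>real (card {a. prim6 a \<and> in_zero (ri a) \<and> real_of_int (hgt a) \<le> T}) - c0 * T ^ 3 * ln T\<bar> \<le> K0 * T ^ 3"
    using prim6_in_zero_asymptotics by blast
  obtain cp Kp where p: "cp > 0" and Kp: "\<And>T. T \<ge> 1 \<Longrightarrow>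
    \<bar>real (card {a. prim6 a \<and> in_sign 1 (ri a) \<and> real_of_int (hgt a) \<le> T}) - cp * T ^ 3 * ln T\<bar> \<le> Kp * T ^ 3"
    using prim_in_sign_asymptotics[of 1] by blast
  obtain cm Km where m: "cm > 0" and Km: "\<And>T. T \<ge> 1 \<Longrightarrow>
    \<bar>real (card {a. prim6 a \<and> in_sign (-1) (ri a) \<and> real_of_int (hgt a) \<le> T}) - cm * T ^ 3 * ln T\<bar> \<le> Km * T ^ 3"
    using prim_in_sign_asymptotics[of "-1"] by blast
  show ?thesis
  proof (intro exI conjI)
    show "c0 / 6 > 0" "cp / 6 > 0" "cm / 6 > 0" using 0 p m by simp_all
    show "(\<lambda>B. real (N X_zero height B) - c0 / 6 * B * ln B) \<in> O[at_top](\<lambda>B. B)"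
      unfolding X_zero_eq by (rule point_count_asymptotics[OF in_zero_smult 0 K0])
    show "(\<lambda>B. real (N X_plus height B) - cp / 6 * B * ln B) \<in> O[at_top](\<lambda>B. B * (ln B) powr (1/2))"
      unfolding X_plus_eq by (rule landau_o.big_trans[OF point_count_asymptotics[OF in_sign_smult p Kp] bigo_sqrt_log])
    show "(\<lambda>B. real (N X_minus height B) - cm / 6 * B * ln B) \<in> O[at_top](\<lambda>B. B * (ln B) powr (1/2))"
      unfolding X_minus_eq by (rule landau_o.big_trans[OF point_count_asymptotics[OF in_sign_smult m Km] bigo_sqrt_log])
  qed
qed

end
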